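(* Let $d\ge 1$ and let $p,q\in[1,\infty]$ satisfy $q>\max\{p,\tfrac{d+2}{d}p'\}$. Assume that the extension conjecture holds on a neighborhood of $(p,q)$. Then for every $L^p$-normalized extremizing sequence $(f_n)$ for the inequality $\|\mathcal{E}f\|_{L^q(\mathbb{R}^{d+1})}\le S_{p\to q}\|f\|_{L^p(\mathbb{S}^d)}$ there exists a sequence $\{x_n\}\subseteq\mathbb{R}^{d+1}$ such that the sequence $\{e^{ix_n\cdot\omega}f_n(\omega)\}$ is precompact in $L^p(\mathbb{S}^d)$. In particular, extremizers exist for this inequality, i.e. there is a nonzero $f\in L^p(\mathbb{S}^d)$ with $\|\mathcal{E}f\|_{L^q(\mathbb{R}^{d+1})}=S_{p\to q}\|f\|_{L^p(\mathbb{S}^d)}$.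
   Context: $\mathbb{S}^d\subseteq\mathbb{R}^{d+1}$ is the unit sphere, $\sigma$ is $d$-dimensional Hausdorff measure on it, and $L^p(\mathbb{S}^d)=L^p(\mathbb{S}^d;d\sigma)$ (complex-valued functions). The extension operator is $\mathcal{E}f(x)=\int_{\mathbb{S}^d}e^{ix\cdot\omega}f(\omega)\,d\sigma(\omega)$, $x\in\mathbb{R}^{d+1}$. Its operator norm is $S_{p\to q}=\sup\{\|\mathcal{E}f\|_{L^q(\mathbb{R}^{d+1})}: f\in C^\infty(\mathbb{S}^d),\ \|f\|_{L^p(\mathbb{S}^d)}=1\}\in(0,\infty]$. $p'$ denotes the conjugate exponent, $\frac1p+\frac1{p'}=1$. The extension conjecture is said to hold at $(p,q)\in[1,\infty]^2$ if $S_{p\to q}<\infty$, or if $q\le\tfrac{2(d+1)}{d}$, or if $q<\tfrac{d+2}{d}p'$. It holds on a neighborhood of $(p,q)$ if it holds at every pair in some neighborhood of $(p,q)$ in $[1,\infty]^2$. A sequence $(f_n)$ in $L^p(\mathbb{S}^d)$ is $L^p$-normalized if $\|f_n\|_p=1$ for all $n$, and extremizing if $\lim_{n\to\infty}\|\mathcal{E}f_n\|_q/\|f_n\|_p=S_{p\to q}$. *)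

theory Defs
  imports "HOL-Analysis.Analysis" "HOL-Probability.Essential_Supremum"
begin

section \<open>Hausdorff measure\<close>

text \<open>
  The normalising factor is the volume of the \<open>k\<close>-dimensional ball of the given diameter, so that
  the \<open>k\<close>-dimensional Hausdorff measure is the usual \<open>k\<close>-dimensional surface measure.
  Empty sets in a cover count \<open>0\<close>, also for \<open>k = 0\<close>. Boundedness is required separately because
  \<^const>\<open>diameter\<close> is real-valued and unspecified on unbounded sets.
\<close>

definition hausdorff_content :: "nat \<Rightarrow> real \<Rightarrow> 'a::metric_space set \<Rightarrow> ennreal" where
  "hausdorff_content k \<delta> A =
    (INF C \<in> {C :: nat \<Rightarrow> 'a set. A \<subseteq> (\<Union>i. C i) \<and> (\<forall>i. bounded (C i) \<and> diameter (C i) \<le> \<delta>)}.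
       \<Sum>i. if C i = {} then 0 else ennreal (unit_ball_vol (real k) * (diameter (C i) / 2) ^ k))"

definition hausdorff_outer_measure :: "nat \<Rightarrow> 'a::metric_space set \<Rightarrow> ennreal" where
  "hausdorff_outer_measure k A = (SUP \<delta> \<in> {0<..}. hausdorff_content k \<delta> A)"

text \<open>
  \<^const>\<open>measure_of\<close> yields the zero measure when its argument is not countably additive;
  the lemma \<open>emeasure_hausdorff_measure\<close> below shows that this does not happen here.
\<close>

definition hausdorff_measure :: "nat \<Rightarrow> 'a::metric_space measure" where
  "hausdorff_measure k = measure_of UNIV (sets borel) (hausdorff_outer_measure k)"

lemma metric_outer_measure_borel:
  fixes \<mu> :: "'a::metric_space set \<Rightarrow> ennreal"
  assumes om: "outer_measure_space UNIV \<mu>"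
    and sep: "\<And>A B \<epsilon>. 0 < \<epsilon> \<Longrightarrow> (\<And>x y. x \<in> A \<Longrightarrow> y \<in> B \<Longrightarrow> \<epsilon> \<le> dist x y) \<Longrightarrow> \<mu> A + \<mu> B \<le> \<mu> (A \<union> B)"
  shows "sets borel \<subseteq> lambda_system UNIV UNIV \<mu>"
proof -
  interpret P: sigma_algebra "UNIV :: 'a set" UNIV
    using sigma_algebra_Pow[of "UNIV :: 'a set"] by simp
  have pos: "positive UNIV \<mu>" and inc: "increasing UNIV \<mu>" and csa: "countably_subadditive UNIV \<mu>"
    using om by (auto simp: outer_measure_space_def)
  have sa: "subadditive UNIV \<mu>"
    using P.countably_subadditive_subadditive[OF pos csa] .
  have mono: "\<mu> A \<le> \<mu> B" if "A \<subseteq> B" for A B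
    using inc that by (auto simp: increasing_def)
  have sub2: "\<mu> (A \<union> B) \<le> \<mu> A + \<mu> B" for A B
  proof -
    have "\<mu> (A \<union> B) = \<mu> (A \<union> (B - A))" by simp
    also have "\<dots> \<le> \<mu> A + \<mu> (B - A)"
      using sa unfolding subadditive_def by blast
    also have "\<dots> \<le> \<mu> A + \<mu> B" by (intro add_left_mono mono) auto
    finally show ?thesis .
  qed
  have subN: "\<mu> (\<Union>i. A i) \<le> (\<Sum>i. \<mu> (A i))" for A :: "nat \<Rightarrow> 'a set"
  proof -
    have "\<mu> (\<Union>i. disjointed A i) \<le> (\<Sum>i. \<mu> (disjointed A i))"
      using csa disjoint_family_disjointed[of A] unfolding countably_subadditive_def by auto
    also have "\<dots> \<le> (\<Sum>i. \<mu> (A i))"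
      by (intro suminf_le mono disjointed_subset) auto
    finally show ?thesis by (simp add: UN_disjointed_eq)
  qed
  have mu0: "\<mu> {} = 0" using pos by (simp add: positive_def)

  have closed_case: "F \<in> lambda_system UNIV UNIV \<mu>" if F: "closed F" "F \<noteq> {}" for F
  proof -
    have ge: "\<mu> (X \<inter> F) + \<mu> (X - F) \<le> \<mu> X" for X
    proof (cases "\<mu> X = \<infinity>")
      case False
      define B where "B = (\<lambda>n. {x \<in> X. inverse (real (Suc n)) \<le> infdist x F})"
      define R where "R = (\<lambda>n. B (Suc n) - B n)"
      have Rlow: "inverse (real (n + 2)) \<le> infdist x F" if "x \<in> R n" for x n
        using that by (simp add: R_def B_def add.commute)
      have Rup: "infdist x F < inverse (real (n + 1))" if "x \<in> R n" for x n
        using that by (auto simp: R_def B_def add.commute)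
      have RX: "R n \<subseteq> X" for n by (auto simp: R_def B_def)
      have part: "(\<Sum>i<N. \<mu> (R (2 * i + c))) \<le> \<mu> (\<Union>i<N. R (2 * i + c))" for N c
      proof (induction N)
        case 0
        show ?case by simp
      next
        case (Suc N)
        have "\<mu> (\<Union>i<N. R (2 * i + c)) + \<mu> (R (2 * N + c)) \<le>
          \<mu> ((\<Union>i<N. R (2 * i + c)) \<union> R (2 * N + c))"
        proof (cases "N = 0")
          case True
          then show ?thesis by (simp add: mu0)
        next
          case N: False
          define \<epsilon> where "\<epsilon> = inverse (real (2 * N + c)) - inverse (real (2 * N + c + 1))"
          show ?thesis
          proof (rule sep)
            show "0 < \<epsilon>" using N by (simp add: \<epsilon>_def)
          next
            fix x y
            assume "x \<in> (\<Union>i<N. R (2 * i + c))" and y: "y \<in> R (2 * N + c)"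
            then obtain i where i: "i < N" "x \<in> R (2 * i + c)" by auto
            have "inverse (real (2 * N + c)) \<le> inverse (real (2 * i + c + 2))"
              using i(1) by (intro le_imp_inverse_le) auto
            also have "\<dots> \<le> infdist x F" using Rlow[OF i(2)] .
            finally have "inverse (real (2 * N + c)) \<le> infdist x F" .
            moreover have "infdist y F < inverse (real (2 * N + c + 1))" using Rup[OF y] .
            ultimately show "\<epsilon> \<le> dist x y"
              using infdist_triangle[of x F y] by (simp add: \<epsilon>_def)
          qed
        qed
        moreover have "(\<Union>i<N. R (2 * i + c)) \<union> R (2 * N + c) = (\<Union>i<Suc N. R (2 * i + c))"
          by (auto simp: lessThan_Suc)
        ultimately have "\<mu> (\<Union>i<N. R (2 * i + c)) + \<mu> (R (2 * N + c)) \<le> \<mu> (\<Union>i<Suc N. R (2 * i + c))"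
          by (simp only:)
        with add_right_mono[OF Suc.IH, of "\<mu> (R (2 * N + c))"] show ?case
          unfolding sum.lessThan_Suc by (rule order_trans)
      qed
      have part': "(\<Sum>i<N. \<mu> (R (2 * i + c))) \<le> \<mu> X" for N c
        using RX by (intro order.trans[OF part] mono) auto
      have split: "(\<Sum>i<2 * N. \<mu> (R i)) = (\<Sum>i<N. \<mu> (R (2 * i + 0))) + (\<Sum>i<N. \<mu> (R (2 * i + 1)))" for N
        by (induction N) (auto simp: algebra_simps)
      have "(\<Sum>i<N. \<mu> (R i)) \<le> \<mu> X + \<mu> X" for N
      proof -
        have "(\<Sum>i<N. \<mu> (R i)) \<le> (\<Sum>i<2 * N. \<mu> (R i))" by (intro sum_mono2) auto
        also have "\<dots> \<le> \<mu> X + \<mu> X" unfolding split by (intro add_mono part')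
        finally show ?thesis .
      qed
      then have "(\<Sum>i. \<mu> (R i)) \<le> \<mu> X + \<mu> X"
        by (intro suminf_le_const) auto
      also have "\<dots> < top" using False by (simp add: less_top)
      finally have fin: "(\<Sum>i. \<mu> (R i)) \<noteq> top" by simp
      have cover: "X - F \<subseteq> B n \<union> (\<Union>m. R (m + n))" for n
      proof
        fix x assume x: "x \<in> X - F"
        then have "0 < infdist x F" using F by (intro infdist_pos_not_in_closed) auto
        then obtain k where k: "inverse (real (Suc k)) < infdist x F"
          using reals_Archimedean by blast
        show "x \<in> B n \<union> (\<Union>m. R (m + n))"
        proof (cases "x \<in> B n")
          case False
          define j where "j = (LEAST j. x \<in> B j)"
          have "x \<in> B k" using k x by (simp add: B_def)
          then have j: "x \<in> B j" unfolding j_def by (rule LeastI)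
          have min: "x \<notin> B i" if "i < j" for i
            using that not_less_Least unfolding j_def by blast
          have Bmono: "B i \<subseteq> B i'" if "i \<le> i'" for i i'
          proof -
            have "inverse (real (Suc i')) \<le> inverse (real (Suc i))"
              using that by (intro le_imp_inverse_le) auto
            then show ?thesis unfolding B_def by (blast intro: order_trans)
          qed
          have "n < j" using False j Bmono[of j n] by (meson not_less subsetD)
          then obtain i where i: "j = Suc i" "n \<le> i" by (cases j) auto
          then have "x \<in> R i" using j min[of i] by (simp add: R_def)
          then have "x \<in> R ((i - n) + n)" using i by simp
          then show ?thesis by blast
        qed simp
      qed
      have "\<mu> (X \<inter> F) + \<mu> (B n) \<le> \<mu> X" for n
      proof -
        have "\<mu> (X \<inter> F) + \<mu> (B n) \<le> \<mu> (X \<inter> F \<union> B n)"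
        proof (rule sep)
          show "0 < inverse (real (Suc n))" by simp
          fix x y assume "x \<in> X \<inter> F" "y \<in> B n"
          then show "inverse (real (Suc n)) \<le> dist x y"
            using infdist_le[of x F y] by (auto simp: B_def dist_commute)
        qed
        also have "\<dots> \<le> \<mu> X" by (intro mono) (auto simp: B_def)
        finally show ?thesis .
      qed note main = this
      have "(\<Sum>j<n. \<mu> (R j)) + (\<mu> (X \<inter> F) + \<mu> (X - F)) \<le> \<mu> X + (\<Sum>i. \<mu> (R i))" for n
      proof -
        have "\<mu> (X - F) \<le> \<mu> (B n) + \<mu> (\<Union>m. R (m + n))"
          by (rule order.trans[OF mono[OF cover] sub2])
        also have "\<dots> \<le> \<mu> (B n) + (\<Sum>m. \<mu> (R (m + n)))"
          by (intro add_left_mono subN)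
        finally have "(\<Sum>j<n. \<mu> (R j)) + (\<mu> (X \<inter> F) + \<mu> (X - F)) \<le>
          (\<Sum>j<n. \<mu> (R j)) + (\<mu> (X \<inter> F) + (\<mu> (B n) + (\<Sum>m. \<mu> (R (m + n)))))"
          by (intro add_left_mono)
        also have "\<dots> = (\<mu> (X \<inter> F) + \<mu> (B n)) + ((\<Sum>m. \<mu> (R (m + n))) + (\<Sum>j<n. \<mu> (R j)))"
          by (simp add: ac_simps)
        also have "(\<Sum>m. \<mu> (R (m + n))) + (\<Sum>j<n. \<mu> (R j)) = (\<Sum>i. \<mu> (R i))"
          by (rule suminf_offset[symmetric]) simp
        also have "(\<mu> (X \<inter> F) + \<mu> (B n)) + (\<Sum>i. \<mu> (R i)) \<le> \<mu> X + (\<Sum>i. \<mu> (R i))"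
          by (intro add_right_mono main)
        finally show ?thesis .
      qed
      then have "(\<Sum>i. \<mu> (R i)) + (\<mu> (X \<inter> F) + \<mu> (X - F)) \<le> \<mu> X + (\<Sum>i. \<mu> (R i))"
        by (rule ennreal_suminf_bound_add)
      then show ?thesis
        using fin by (simp add: add.commute[of "\<mu> X"] ennreal_add_left_cancel_le)
    qed simp
    have "\<mu> (X \<inter> F) + \<mu> (X - F) = \<mu> X" for X
    proof (rule antisym[OF ge])
      have "X \<inter> F \<union> (X - F) = X" by blast
      then show "\<mu> X \<le> \<mu> (X \<inter> F) + \<mu> (X - F)" using sub2[of "X \<inter> F" "X - F"] by simp
    qed
    then show ?thesis by (simp add: P.lambda_system_eq)
  qed
  have "measure_space UNIV (lambda_system UNIV UNIV \<mu>) \<mu>"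
    by (rule P.caratheodory_lemma[OF om])
  then interpret L: sigma_algebra "UNIV :: 'a set" "lambda_system UNIV UNIV \<mu>"
    by (simp add: measure_space_def)
  have "Collect closed \<subseteq> lambda_system UNIV UNIV \<mu>"
  proof
    fix F :: "'a set" assume "F \<in> Collect closed"
    then show "F \<in> lambda_system UNIV UNIV \<mu>"
      using closed_case[of F] L.empty_sets by (cases "F = {}") auto
  qed
  then have "sigma_sets UNIV (Collect closed) \<subseteq> lambda_system UNIV UNIV \<mu>"
    by (rule L.sigma_sets_subset)
  then show ?thesis by (simp add: borel_eq_closed)
qed

context
  fixes k :: nat
begin

definition hausdorff_gauge :: "real \<Rightarrow> 'a::metric_space set \<Rightarrow> ennreal" where
  "hausdorff_gauge \<delta> C = (if C = {} then 0 else if bounded C \<and> diameter C \<le> \<delta>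
     then ennreal (unit_ball_vol (real k) * (diameter C / 2) ^ k) else \<infinity>)"

lemma hausdorff_gauge_mono: "A \<subseteq> B \<Longrightarrow> hausdorff_gauge \<delta> A \<le> hausdorff_gauge \<delta> B"
proof -
  assume AB: "A \<subseteq> B"
  show ?thesis
  proof (cases "A \<noteq> {} \<and> bounded B \<and> diameter B \<le> \<delta>")
    case True
    then have "bounded A" and d: "diameter A \<le> diameter B"
      using AB bounded_subset diameter_subset by blast+
    moreover have "(diameter A / 2) ^ k \<le> (diameter B / 2) ^ k"
      using d diameter_ge_0[OF \<open>bounded A\<close>] by (intro power_mono) auto
    ultimately show ?thesis
      using True AB by (auto simp: hausdorff_gauge_def intro!: ennreal_leI mult_left_mono)
  qed (use AB in \<open>auto simp: hausdorff_gauge_def\<close>)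
qed

lemma hausdorff_gauge_outer:
  "positive UNIV (hausdorff_gauge \<delta>)" "increasing UNIV (hausdorff_gauge \<delta>)"
  using hausdorff_gauge_mono by (auto simp: positive_def increasing_def) (simp add: hausdorff_gauge_def)

lemma hausdorff_content_eq:
  fixes A :: "'a::metric_space set"
  assumes "\<delta> > 0"
  shows "hausdorff_content k \<delta> A = outer_measure UNIV (hausdorff_gauge \<delta>) A"
proof (rule antisym)
  interpret P: ring_of_sets "UNIV :: 'a set" UNIV
    using ring_of_sets_Pow[of "UNIV :: 'a set"] by simp
  show "outer_measure UNIV (hausdorff_gauge \<delta>) A \<le> hausdorff_content k \<delta> A"
    unfolding hausdorff_content_def
  proof (rule INF_greatest, clarsimp)
    fix C :: "nat \<Rightarrow> 'a set"
    assume C: "A \<subseteq> (\<Union>i. C i)" "\<forall>i. bounded (C i) \<and> diameter (C i) \<le> \<delta>"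
    have "outer_measure UNIV (hausdorff_gauge \<delta>) A \<le> (\<Sum>i. hausdorff_gauge \<delta> (C i))"
      using C by (intro P.outer_measure_le hausdorff_gauge_outer) auto
    then show "outer_measure UNIV (hausdorff_gauge \<delta>) A \<le>
      (\<Sum>i. if C i = {} then 0 else ennreal (unit_ball_vol (real k) * (diameter (C i) / 2) ^ k))"
      using C(2) by (simp add: hausdorff_gauge_def cong: if_cong)
  qed
  show "hausdorff_content k \<delta> A \<le> outer_measure UNIV (hausdorff_gauge \<delta>) A"
    unfolding outer_measure_def
  proof (rule INF_greatest)
    fix C :: "nat \<Rightarrow> 'a set"
    assume C: "C \<in> {C. range C \<subseteq> UNIV \<and> disjoint_family C \<and> A \<subseteq> \<Union> (range C)}"
    show "hausdorff_content k \<delta> A \<le> (\<Sum>i. hausdorff_gauge \<delta> (C i))"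
    proof (cases "\<forall>i. bounded (C i) \<and> diameter (C i) \<le> \<delta>")
      case True
      then have "(\<Sum>i. hausdorff_gauge \<delta> (C i)) =
        (\<Sum>i. if C i = {} then 0 else ennreal (unit_ball_vol (real k) * (diameter (C i) / 2) ^ k))"
        by (simp add: hausdorff_gauge_def cong: if_cong)
      then show ?thesis
        unfolding hausdorff_content_def using C True by (auto intro!: INF_lower)
    next
      case False
      then obtain i where "\<not> (bounded (C i) \<and> diameter (C i) \<le> \<delta>)" by blast
      then have "hausdorff_gauge \<delta> (C i) = \<infinity>"
        using assms by (cases "C i = {}") (auto simp: hausdorff_gauge_def)
      moreover have "hausdorff_gauge \<delta> (C i) \<le> (\<Sum>i. hausdorff_gauge \<delta> (C i))"
        using sum_le_suminf[of "\<lambda>i. hausdorff_gauge \<delta> (C i)" "{i}"] by simp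
      ultimately show ?thesis by (simp add: top_unique)
    qed
  qed
qed

lemma hausdorff_content_antimono: "\<delta> \<le> \<delta>' \<Longrightarrow> hausdorff_content k \<delta>' A \<le> hausdorff_content k \<delta> A"
  unfolding hausdorff_content_def by (intro INF_superset_mono) (auto intro: order_trans)

lemma hausdorff_content_separated:
  fixes A B :: "'a::metric_space set"
  assumes "0 < \<delta>" "\<delta> < \<epsilon>" and sep: "\<And>x y. x \<in> A \<Longrightarrow> y \<in> B \<Longrightarrow> \<epsilon> \<le> dist x y"
  shows "hausdorff_content k \<delta> A + hausdorff_content k \<delta> B \<le> hausdorff_content k \<delta> (A \<union> B)"
  unfolding hausdorff_content_def[of k \<delta> "A \<union> B"]
proof (rule INF_greatest, clarify)
  interpret P: ring_of_sets "UNIV :: 'a set" UNIV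
    using ring_of_sets_Pow[of "UNIV :: 'a set"] by simp
  fix C :: "nat \<Rightarrow> 'a set"
  assume cov: "A \<union> B \<subseteq> (\<Union>i. C i)" and C: "\<forall>i. bounded (C i) \<and> diameter (C i) \<le> \<delta>"
  have le: "hausdorff_content k \<delta> S \<le> (\<Sum>i. hausdorff_gauge \<delta> (C i \<inter> S))" if "S \<subseteq> (\<Union>i. C i)" for S
    unfolding hausdorff_content_eq[OF \<open>0 < \<delta>\<close>]
    using that by (intro P.outer_measure_le hausdorff_gauge_outer) auto
  have each: "hausdorff_gauge \<delta> (C i \<inter> A) + hausdorff_gauge \<delta> (C i \<inter> B) \<le> hausdorff_gauge \<delta> (C i)" for i
  proof -
    have "C i \<inter> A = {} \<or> C i \<inter> B = {}"
    proof (rule ccontr)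
      assume "\<not> ?thesis"
      then obtain x y where xy: "x \<in> C i" "x \<in> A" "y \<in> C i" "y \<in> B" by blast
      then have "dist x y \<le> \<delta>"
        using diameter_bounded_bound[of "C i" x y] C by (meson order_trans)
      with sep[OF xy(2,4)] \<open>\<delta> < \<epsilon>\<close> show False by simp
    qed
    moreover have "hausdorff_gauge \<delta> ({} :: 'a set) = 0" by (simp add: hausdorff_gauge_def)
    ultimately show ?thesis
      using hausdorff_gauge_mono[of "C i \<inter> A" "C i" \<delta>] hausdorff_gauge_mono[of "C i \<inter> B" "C i" \<delta>]
      by (elim disjE) simp_all
  qed
  have "hausdorff_content k \<delta> A + hausdorff_content k \<delta> B \<le>
      (\<Sum>i. hausdorff_gauge \<delta> (C i \<inter> A)) + (\<Sum>i. hausdorff_gauge \<delta> (C i \<inter> B))"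
    using cov by (intro add_mono le) auto
  also have "\<dots> = (\<Sum>i. hausdorff_gauge \<delta> (C i \<inter> A) + hausdorff_gauge \<delta> (C i \<inter> B))"
    by (rule suminf_add) auto
  also have "\<dots> \<le> (\<Sum>i. hausdorff_gauge \<delta> (C i))"
    by (intro suminf_le each) auto
  finally show "hausdorff_content k \<delta> A + hausdorff_content k \<delta> B \<le>
      (\<Sum>i. if C i = {} then 0 else ennreal (unit_ball_vol (real k) * (diameter (C i) / 2) ^ k))"
    using C by (simp add: hausdorff_gauge_def cong: if_cong)
qed

lemma outer_measure_space_hausdorff:
  "outer_measure_space UNIV (hausdorff_outer_measure k :: 'a::metric_space set \<Rightarrow> ennreal)"
proof -
  interpret P: ring_of_sets "UNIV :: 'a set" UNIV
    using ring_of_sets_Pow[of "UNIV :: 'a set"] by simp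
  have om: "outer_measure_space UNIV (hausdorff_content k \<delta> :: 'a set \<Rightarrow> ennreal)" if "\<delta> > 0" for \<delta>
  proof -
    have "(hausdorff_content k \<delta> :: 'a set \<Rightarrow> ennreal) = outer_measure UNIV (hausdorff_gauge \<delta>)"
      using hausdorff_content_eq[OF that] by blast
    then show ?thesis
      using P.outer_measure_space_outer_measure[OF hausdorff_gauge_outer, of \<delta>] by simp
  qed
  have "hausdorff_outer_measure k ({} :: 'a set) = (SUP \<delta> \<in> {0::real<..}. (0::ennreal))"
    unfolding hausdorff_outer_measure_def
    by (intro SUP_cong refl) (use om in \<open>auto simp: outer_measure_space_def positive_def\<close>)
  then have "positive UNIV (hausdorff_outer_measure k :: 'a set \<Rightarrow> ennreal)"
    by (simp add: positive_def bot_ennreal[symmetric] del: bot_ennreal)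
  moreover have "increasing UNIV (hausdorff_outer_measure k :: 'a set \<Rightarrow> ennreal)"
    unfolding increasing_def hausdorff_outer_measure_def
    by (intro ballI impI SUP_mono')
       (auto simp: hausdorff_content_def intro!: INF_superset_mono)
  moreover have "countably_subadditive UNIV (hausdorff_outer_measure k :: 'a set \<Rightarrow> ennreal)"
    unfolding countably_subadditive_def
  proof (intro allI impI)
    fix A :: "nat \<Rightarrow> 'a set"
    assume A: "range A \<subseteq> UNIV" "disjoint_family A" "\<Union> (range A) \<in> UNIV"
    show "hausdorff_outer_measure k (\<Union> (range A)) \<le> (\<Sum>i. hausdorff_outer_measure k (A i))"
      unfolding hausdorff_outer_measure_def[of k "\<Union> (range A)"]
    proof (rule SUP_least)
      fix \<delta> :: real assume d: "\<delta> \<in> {0<..}"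
      have "hausdorff_content k \<delta> (\<Union> (range A)) \<le> (\<Sum>i. hausdorff_content k \<delta> (A i))"
        using om[of \<delta>] d A unfolding outer_measure_space_def countably_subadditive_def by auto
      also have "\<dots> \<le> (\<Sum>i. hausdorff_outer_measure k (A i))"
        unfolding hausdorff_outer_measure_def by (intro suminf_le SUP_upper d) auto
      finally show "hausdorff_content k \<delta> (\<Union> (range A)) \<le> (\<Sum>i. hausdorff_outer_measure k (A i))" .
    qed
  qed
  ultimately show ?thesis by (simp add: outer_measure_space_def)
qed

lemma hausdorff_outer_measure_separated:
  fixes A B :: "'a::metric_space set"
  assumes "0 < \<epsilon>" and sep: "\<And>x y. x \<in> A \<Longrightarrow> y \<in> B \<Longrightarrow> \<epsilon> \<le> dist x y"
  shows "hausdorff_outer_measure k A + hausdorff_outer_measure k B \<le> hausdorff_outer_measure k (A \<union> B)"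
proof -
  have le: "hausdorff_content k a A + hausdorff_content k b B \<le> hausdorff_outer_measure k (A \<union> B)"
    if ab: "a > 0" "b > 0" for a b :: real
  proof -
    define \<delta> where "\<delta> = min (min a b) (\<epsilon> / 2)"
    have d: "0 < \<delta>" "\<delta> < \<epsilon>" "\<delta> \<le> a" "\<delta> \<le> b" using ab \<open>0 < \<epsilon>\<close> by (auto simp: \<delta>_def)
    have "hausdorff_content k a A + hausdorff_content k b B \<le>
        hausdorff_content k \<delta> A + hausdorff_content k \<delta> B"
      using d by (intro add_mono hausdorff_content_antimono)
    also have "\<dots> \<le> hausdorff_content k \<delta> (A \<union> B)"
      by (rule hausdorff_content_separated[OF d(1,2) sep])
    also have "\<dots> \<le> hausdorff_outer_measure k (A \<union> B)"
      unfolding hausdorff_outer_measure_def using d by (intro SUP_upper) auto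
    finally show ?thesis .
  qed
  have ne: "{0::real<..} \<noteq> {}" by auto
  have "hausdorff_outer_measure k A + hausdorff_outer_measure k B =
      (SUP a\<in>{0<..}. SUP b\<in>{0<..}. hausdorff_content k a A + hausdorff_content k b B)"
    unfolding hausdorff_outer_measure_def
    by (simp only: ennreal_SUP_add_right[OF ne, symmetric] ennreal_SUP_add_left[OF ne])
  also have "\<dots> \<le> hausdorff_outer_measure k (A \<union> B)"
    by (intro SUP_least le) auto
  finally show ?thesis .
qed

end

lemma sets_hausdorff_measure [simp, measurable_cong]: "sets (hausdorff_measure k) = sets borel"
  using sets.sigma_sets_eq[of borel] by (simp add: hausdorff_measure_def)

lemma space_hausdorff_measure [simp]: "space (hausdorff_measure k) = UNIV"
  by (simp add: hausdorff_measure_def)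

lemma emeasure_hausdorff_measure:
  fixes A :: "'a::metric_space set"
  assumes "A \<in> sets borel"
  shows "emeasure (hausdorff_measure k) A = hausdorff_outer_measure k A"
proof -
  let ?\<mu> = "hausdorff_outer_measure k :: 'a set \<Rightarrow> ennreal"
  interpret P: sigma_algebra "UNIV :: 'a set" UNIV
    using sigma_algebra_Pow[of "UNIV :: 'a set"] by simp
  have sub: "sets borel \<subseteq> lambda_system UNIV UNIV ?\<mu>"
    by (rule metric_outer_measure_borel[OF outer_measure_space_hausdorff])
       (rule hausdorff_outer_measure_separated)
  have "measure_space UNIV (lambda_system UNIV UNIV ?\<mu>) ?\<mu>"
    by (rule P.caratheodory_lemma[OF outer_measure_space_hausdorff])
  then have "positive (lambda_system UNIV UNIV ?\<mu>) ?\<mu>"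
    and ca: "countably_additive (lambda_system UNIV UNIV ?\<mu>) ?\<mu>"
    by (auto simp: measure_space_def)
  then have "positive (sets borel) ?\<mu>" by (simp add: positive_def)
  moreover have "countably_additive (sets borel) ?\<mu>"
    using ca sub unfolding countably_additive_def by blast
  ultimately show ?thesis
    using emeasure_measure_of[OF hausdorff_measure_def[of k], of A] assms by auto
qed


section \<open>Lebesgue spaces\<close>

text \<open>Exponents range over \<open>[1, \<infinity>]\<close>, as elements of \<^typ>\<open>ennreal\<close>; there
  \<open>inverse 0 = \<infinity>\<close> and \<open>inverse \<infinity> = 0\<close>, so the conjugate of \<open>1\<close> is \<open>\<infinity>\<close> and vice versa.\<close>

definition conj_exponent :: "ennreal \<Rightarrow> ennreal" where
  "conj_exponent p = inverse (1 - inverse p)"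

definition eLp_norm :: "'b measure \<Rightarrow> ennreal \<Rightarrow> ('b \<Rightarrow> 'c::real_normed_vector) \<Rightarrow> ennreal" where
  "eLp_norm M p f =
    (if p = \<infinity> then esssup M (\<lambda>x. ennreal (norm (f x)))
     else let I = \<integral>\<^sup>+ x. ennreal (norm (f x) powr enn2real p) \<partial>M
          in if I = \<infinity> then \<infinity> else ennreal (enn2real I powr (1 / enn2real p)))"

definition Lp :: "'b measure \<Rightarrow> ennreal \<Rightarrow> ('b \<Rightarrow> 'c::real_normed_vector) set" where
  "Lp M p = {f \<in> borel_measurable M. eLp_norm M p f < \<infinity>}"

text \<open>
  The topology of the \<open>L\<^sup>p\<close> seminorm on functions. Functions that agree almost everywhere are
  topologically indistinguishable, so a set of functions has compact closure here if and only if
  the corresponding set of classes has compact closure in the quotient.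
\<close>

definition Lp_topology :: "'b measure \<Rightarrow> ennreal \<Rightarrow> ('b \<Rightarrow> 'c::real_normed_vector) topology" where
  "Lp_topology M p = topology (\<lambda>U. U \<subseteq> Lp M p \<and>
     (\<forall>f\<in>U. \<exists>\<epsilon>>0. \<forall>g\<in>Lp M p. eLp_norm M p (\<lambda>x. g x - f x) < \<epsilon> \<longrightarrow> g \<in> U))"

lemma openin_Lp_topology:
  fixes U :: "('b \<Rightarrow> 'c::real_normed_vector) set"
  shows "openin (Lp_topology M p) U \<longleftrightarrow> U \<subseteq> Lp M p \<and>
     (\<forall>f\<in>U. \<exists>\<epsilon>>0. \<forall>g\<in>Lp M p. eLp_norm M p (\<lambda>x. g x - f x) < \<epsilon> \<longrightarrow> g \<in> U)"
proof -
  define P where "P = (\<lambda>U :: ('b \<Rightarrow> 'c) set. U \<subseteq> Lp M p \<and>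
     (\<forall>f\<in>U. \<exists>\<epsilon>>0. \<forall>g\<in>Lp M p. eLp_norm M p (\<lambda>x. g x - f x) < \<epsilon> \<longrightarrow> g \<in> U))"
  have "istopology P"
    unfolding istopology_def
  proof (intro conjI allI impI)
    fix S T assume S: "P S" and T: "P T"
    have "\<exists>\<epsilon>>0. \<forall>g\<in>Lp M p. eLp_norm M p (\<lambda>x. g x - f x) < \<epsilon> \<longrightarrow> g \<in> S \<inter> T"
      if "f \<in> S \<inter> T" for f
    proof -
      from S that obtain a where a: "a > 0"
        "\<forall>g\<in>Lp M p. eLp_norm M p (\<lambda>x. g x - f x) < a \<longrightarrow> g \<in> S" by (auto simp: P_def)
      from T that obtain b where b: "b > 0"
        "\<forall>g\<in>Lp M p. eLp_norm M p (\<lambda>x. g x - f x) < b \<longrightarrow> g \<in> T" by (auto simp: P_def)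
      show ?thesis using a b by (intro exI[of _ "min a b"]) auto
    qed
    with S T show "P (S \<inter> T)" by (auto simp: P_def)
  next
    fix K assume K: "\<forall>S\<in>K. P S"
    show "P (\<Union>K)"
      unfolding P_def
    proof (intro conjI ballI)
      show "\<Union>K \<subseteq> Lp M p" using K by (auto simp: P_def)
      fix f assume "f \<in> \<Union>K"
      then obtain S where S: "S \<in> K" "f \<in> S" by auto
      then obtain \<epsilon> where "\<epsilon> > 0" "\<forall>g\<in>Lp M p. eLp_norm M p (\<lambda>x. g x - f x) < \<epsilon> \<longrightarrow> g \<in> S"
        using K unfolding P_def by blast
      then show "\<exists>\<epsilon>>0. \<forall>g\<in>Lp M p. eLp_norm M p (\<lambda>x. g x - f x) < \<epsilon> \<longrightarrow> g \<in> \<Union>K"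
        using S by blast
    qed
  qed
  then have "openin (topology P) U = P U"
    by (simp add: topology_inverse')
  then show ?thesis
    unfolding Lp_topology_def P_def .
qed

lemma topspace_Lp_topology [simp]: "topspace (Lp_topology M p) = Lp M p"
proof
  show "topspace (Lp_topology M p) \<subseteq> Lp M p"
    using openin_Lp_topology[of M p "topspace (Lp_topology M p)"] by auto
  have "openin (Lp_topology M p) (Lp M p)"
    unfolding openin_Lp_topology by (auto intro!: exI[of _ 1])
  then show "Lp M p \<subseteq> topspace (Lp_topology M p)" by (rule openin_subset)
qed

definition precompactin :: "'b topology \<Rightarrow> 'b set \<Rightarrow> bool" where
  "precompactin X A \<longleftrightarrow> A \<subseteq> topspace X \<and> compactin X (X closure_of A)"


section \<open>Fourier extension from the unit sphere\<close>

text \<open>The unit sphere of a Euclidean space of dimension \<open>d + 1\<close>; all functions on the sphere below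
  are functions on the whole space whose values outside the sphere are irrelevant.\<close>

definition sphere_measure :: "'a::euclidean_space measure" where
  "sphere_measure = restrict_space (hausdorff_measure (DIM('a) - 1)) (sphere 0 1)"

primrec Ck_on ::
  "nat \<Rightarrow> 'a::real_normed_vector set \<Rightarrow> ('a \<Rightarrow> 'b::real_normed_vector) \<Rightarrow> bool" where
  "Ck_on 0 U g \<longleftrightarrow> continuous_on U g"
| "Ck_on (Suc k) U g \<longleftrightarrow> (\<forall>x\<in>U. g differentiable (at x)) \<and>
     (\<forall>v. Ck_on k U (\<lambda>x. frechet_derivative g (at x) v))"

text \<open>Smoothness on the sphere as an embedded submanifold: \<open>f\<close> is the restriction of a smooth
  function on an open neighbourhood.\<close>

definition smooth_on_sphere :: "('a::euclidean_space \<Rightarrow> complex) \<Rightarrow> bool" where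
  "smooth_on_sphere f \<longleftrightarrow>
    (\<exists>U g. open U \<and> sphere 0 1 \<subseteq> U \<and> (\<forall>k. Ck_on k U g) \<and> (\<forall>\<omega>\<in>sphere 0 1. f \<omega> = g \<omega>))"

definition extension_op :: "('a::euclidean_space \<Rightarrow> complex) \<Rightarrow> 'a \<Rightarrow> complex" where
  "extension_op f x = (LINT \<omega>|sphere_measure. cis (x \<bullet> \<omega>) * f \<omega>)"

definition extension_norm :: "'a::euclidean_space itself \<Rightarrow> ennreal \<Rightarrow> ennreal \<Rightarrow> ennreal" where
  "extension_norm _ p q =
    (SUP f \<in> {f :: 'a \<Rightarrow> complex. smooth_on_sphere f \<and> eLp_norm sphere_measure p f = 1}.
       eLp_norm lborel q (extension_op f))"

definition extension_conjecture_at :: "'a::euclidean_space itself \<Rightarrow> ennreal \<Rightarrow> ennreal \<Rightarrow> bool" where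
  "extension_conjecture_at T p q \<longleftrightarrow> (let d = real DIM('a) - 1 in
     extension_norm T p q < \<infinity> \<or> q \<le> ennreal (2 * (d + 1) / d) \<or>
     q < ennreal ((d + 2) / d) * conj_exponent p)"

definition extension_conjecture_near :: "'a::euclidean_space itself \<Rightarrow> ennreal \<Rightarrow> ennreal \<Rightarrow> bool" where
  "extension_conjecture_near T p q \<longleftrightarrow>
    (\<exists>U. open U \<and> (p, q) \<in> U \<and>
      (\<forall>r s. (r, s) \<in> U \<longrightarrow> 1 \<le> r \<longrightarrow> 1 \<le> s \<longrightarrow> extension_conjecture_at T r s))"

definition extremizing_sequence ::
  "ennreal \<Rightarrow> ennreal \<Rightarrow> (nat \<Rightarrow> 'a::euclidean_space \<Rightarrow> complex) \<Rightarrow> bool" where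
  "extremizing_sequence p q f \<longleftrightarrow>
    (\<lambda>n. eLp_norm lborel q (extension_op (f n)) / eLp_norm sphere_measure p (f n))
      \<longlonglongrightarrow> extension_norm TYPE('a) p q"

end

theory Submission
  imports Defs "HOL-Complex_Analysis.Complex_Analysis"
begin

text \<open>
  Since \<open>q > (d + 2) p' / d\<close> and \<open>p < q\<close> put \<open>q\<close> above the endpoint \<open>2 (d + 1) / d\<close>, the hypothesis
  provides an extension estimate into \<open>L\<close> with an exponent \<open>q1 < q\<close>. Let \<open>f n\<close> be extremizing. As
  \<open>\<E> (f n)\<close> is uniformly Lipschitz and bounded in \<open>L\<close> with exponent \<open>q1\<close>, the set where
  \<open>\<bar>\<E> (f n)\<bar> \<ge> \<delta>\<close> is covered by a number of unit balls independent of \<open>n\<close>, and outside this set the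
  contribution to the \<open>L\<^sup>q\<close> norm is \<open>O(\<delta> powr (q - q1))\<close>. Sort the balls into finitely many clusters
  whose mutual distances tend to infinity, and let \<open>\<phi> j\<close> be the weak limit of the \<open>f n\<close> modulated to
  the \<open>j\<close>-th cluster. Extensions converge locally uniformly, so the sum of \<open>\<parallel>\<E> (\<phi> j)\<parallel>\<close> to the power
  \<open>q\<close> is almost \<open>S\<close> to the power \<open>q\<close>, whereas asymptotic orthogonality of the modulations gives
  \<open>\<Sum> \<parallel>\<phi> j\<parallel> powr max p p' \<le> 1\<close>. Because \<open>q > max p p'\<close>, some \<open>\<phi> j\<close> has almost full norm, and
  uniform convexity turns weak into almost strong convergence. This holds along every subsequence, so
  the sequence, modulated to points where \<open>\<bar>\<E> (f n)\<bar>\<close> is bounded below, is totally bounded.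
  For \<open>q = \<infinity>\<close> the weak limit along near maximum points of \<open>\<bar>\<E> (f n)\<bar>\<close> has full norm at once.
\<close>

section \<open>The three lines theorem\<close>

text \<open>The hypotheses on \<open>q\<close> confine the exponents: an infinite p' rules out p =
  1, q > p rules out p = \<infinity>, and (d + 2)/d > 1 yields q > p'. The neighbourhood enters by
  lowering q at fixed p. Each threshold 1 - \<eta> comes with its own subsequence, centres and weak
  limit, so concentration yields no single limit; hence total boundedness. The obstacle is that
  these centres depend on the subsequence, while one sequence x_n is wanted. Points where the
  extension stays above a fixed c serve all subsequences at once: relative to any concentration
  centres they stay in a bounded superlevel set of the extension of the weak limit, and a convergent
  relative shift is only one more modulation. The exponent max p p' comes from duality. Pairing f_n
  with modulated dual functions of the weak limits needs the sum of these bounded in L^p' by an l^t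
  sum with t = min p p', the conjugate of max p p'. For p <= 2 this is an interpolation, for p > 2 a
  weighted L^2 estimate.\<close>

lemma three_lines:
  fixes f :: "complex \<Rightarrow> complex"
  assumes hol: "f holomorphic_on {z. a < Re z \<and> Re z < b}"
    and cont: "continuous_on {z. a \<le> Re z \<and> Re z \<le> b} f"
    and bdd: "bounded (f ` {z. a \<le> Re z \<and> Re z \<le> b})"
    and left: "\<And>z. Re z = a \<Longrightarrow> norm (f z) \<le> 1"
    and right: "\<And>z. Re z = b \<Longrightarrow> norm (f z) \<le> 1"
    and t: "a \<le> t" "t \<le> b"
  shows "norm (f (of_real t)) \<le> 1"
proof -
  obtain B where B: "B > 0" "\<And>z. a \<le> Re z \<Longrightarrow> Re z \<le> b \<Longrightarrow> norm (f z) \<le> B"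
    using bdd unfolding bounded_pos by auto
  have est: "norm (f (of_real t)) \<le> exp (\<epsilon> * (b - a)\<^sup>2)" if \<epsilon>: "\<epsilon> > 0" for \<epsilon>
  proof -
    \<comment> \<open>The Gaussian factor equals 1 at z = t, costs at most exp (\<epsilon> (b -
      a)^2) on the vertical sides and decays along the strip.\<close>
    define g where "g = (\<lambda>z. f z * exp (of_real \<epsilon> * (z - of_real t)\<^sup>2))"
    \<comment> \<open>On the horizontal sides the decay exp (- \<epsilon> T^2) has to absorb the
      bound B, so \<epsilon> T^2 must reach ln B; adding 1 keeps T positive.\<close>
    define T where "T = sqrt (\<bar>ln B\<bar> / \<epsilon>) + 1"
    have T: "T > 0" "B \<le> exp (\<epsilon> * T\<^sup>2)"
    proof -
      show "T > 0" unfolding T_def using \<epsilon> by (simp add: add_nonneg_pos)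
      have "(sqrt (\<bar>ln B\<bar> / \<epsilon>))\<^sup>2 \<le> T\<^sup>2"
        unfolding T_def using \<epsilon> by (intro power_mono) auto
      then have "\<bar>ln B\<bar> / \<epsilon> \<le> T\<^sup>2" using \<epsilon> by simp
      then have "ln B \<le> \<epsilon> * T\<^sup>2" using \<epsilon> by (simp add: field_simps)
      then show "B \<le> exp (\<epsilon> * T\<^sup>2)" using \<open>B > 0\<close> by (metis exp_le_cancel_iff exp_ln)
    qed
    have ng: "norm (g z) = norm (f z) * exp (\<epsilon> * ((Re z - t)\<^sup>2 - (Im z)\<^sup>2))" for z
      by (simp add: g_def norm_mult power2_eq_square)
    let ?S = "cbox (Complex a (- T)) (Complex b T)"
    have "norm (g (of_real t)) \<le> exp (\<epsilon> * (b - a)\<^sup>2)"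
    proof (rule maximum_modulus_frontier[where S = ?S and f = g and \<xi> = "of_real t"])
      have "box (Complex a (- T)) (Complex b T) \<subseteq> {z. a < Re z \<and> Re z < b}"
        by (auto simp: in_box_complex_iff)
      then show "g holomorphic_on interior ?S"
        unfolding g_def interior_cbox by (intro holomorphic_intros holomorphic_on_subset[OF hol])
      have "?S \<subseteq> {z. a \<le> Re z \<and> Re z \<le> b}"
        by (auto simp: in_cbox_complex_iff)
      then show "continuous_on (closure ?S) g"
        unfolding g_def by (simp, intro continuous_intros continuous_on_subset[OF cont])
      show "bounded ?S" by (rule bounded_cbox)
      show "of_real t \<in> ?S" using t T by (auto simp: in_cbox_complex_iff)
      fix z assume "z \<in> frontier ?S"
      then have z: "z \<in> ?S" "z \<notin> box (Complex a (- T)) (Complex b T)"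
        by (auto simp: frontier_def)
      then have zz: "a \<le> Re z" "Re z \<le> b" "- T \<le> Im z" "Im z \<le> T"
        by (auto simp: in_cbox_complex_iff)
      have sq: "(Re z - t)\<^sup>2 \<le> (b - a)\<^sup>2"
        using zz t by (intro power2_le_iff_abs_le[THEN iffD2]) auto
      have "Re z = a \<or> Re z = b \<or> Im z = T \<or> Im z = - T"
        using z(2) zz by (auto simp: in_box_complex_iff)
      then consider "Re z = a \<or> Re z = b" | "(Im z)\<^sup>2 = T\<^sup>2"
        by auto
      then show "norm (g z) \<le> exp (\<epsilon> * (b - a)\<^sup>2)"
      proof cases
        case 1
        then have "norm (f z) \<le> 1" using left right by blast
        moreover have "exp (\<epsilon> * ((Re z - t)\<^sup>2 - (Im z)\<^sup>2)) \<le> exp (\<epsilon> * (b - a)\<^sup>2)"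
          using sq \<epsilon> by (auto intro!: mult_left_mono) (smt (verit) zero_le_power2)
        ultimately show ?thesis
          unfolding ng using mult_mono[of "norm (f z)" 1 "exp (\<epsilon> * ((Re z - t)\<^sup>2 - (Im z)\<^sup>2))"] by simp
      next
        case 2
        have "norm (g z) \<le> exp (\<epsilon> * T\<^sup>2) * exp (\<epsilon> * ((b - a)\<^sup>2 - T\<^sup>2))"
          unfolding ng 2
          by (rule mult_mono) (use B(2)[of z] zz T sq \<epsilon> in \<open>auto intro!: mult_left_mono\<close>)
        also have "\<dots> = exp (\<epsilon> * (b - a)\<^sup>2)"
          by (simp add: exp_add[symmetric] algebra_simps)
        finally show ?thesis .
      qed
    qed
    then show ?thesis by (simp add: g_def)
  qed
  have "((\<lambda>\<epsilon>. exp (\<epsilon> * (b - a)\<^sup>2)) \<longlongrightarrow> exp (0 * (b - a)\<^sup>2)) (at_right 0)"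
    by (intro tendsto_intros)
  then show ?thesis
    using est by (intro tendsto_lowerbound[of "\<lambda>\<epsilon>. exp (\<epsilon> * (b - a)\<^sup>2)" 1 "at_right 0"])
      (auto simp: eventually_at_filter)
qed

section \<open>Lebesgue spaces and uniform convexity\<close>

text \<open>The mean value theorem on the two halves of [u, v] produces slopes p z1^(p-1) < p
  z2^(p-1). At u = 0 only continuity enters, since the derivative is taken at interior
  points.\<close>

lemma powr_avg_le:
  fixes u v p :: real
  assumes "1 < p" "0 \<le> u" "0 \<le> v"
  shows "((u + v) / 2) powr p \<le> (u powr p + v powr p) / 2"
    and "u \<noteq> v \<Longrightarrow> ((u + v) / 2) powr p < (u powr p + v powr p) / 2"
proof -
  have strict: "((u + v) / 2) powr p < (u powr p + v powr p) / 2" if "0 \<le> u" "u < v" for u v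
  proof -
    define m where "m = (u + v) / 2"
    have m: "u < m" "m < v" "0 < m" using that by (auto simp: m_def)
    have d: "((\<lambda>x. x powr p) has_real_derivative p * x powr (p - 1)) (at x)" if "x > 0" for x
      using that by (auto intro!: derivative_eq_intros simp: powr_diff)
    have c: "continuous_on {u..v} (\<lambda>x. x powr p)"
      by (rule continuous_on_powr') (use \<open>0 \<le> u\<close> assms(1) in \<open>auto intro!: continuous_intros\<close>)
    have mvt: "\<exists>z. x < z \<and> z < y \<and> y powr p - x powr p = (y - x) * (p * z powr (p - 1))"
      if "u \<le> x" "x < y" "y \<le> v" for x y
    proof -
      have "\<exists>l z. x < z \<and> z < y \<and> ((\<lambda>x. x powr p) has_real_derivative l) (at z) \<and>
          y powr p - x powr p = (y - x) * l"
      proof (rule MVT[OF \<open>x < y\<close>])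
        show "continuous_on {x..y} (\<lambda>x. x powr p)"
          using that by (intro continuous_on_subset[OF c]) auto
        show "(\<lambda>x. x powr p) differentiable (at z)" if "x < z" "z < y" for z
          using d[of z] that \<open>0 \<le> u\<close> \<open>u \<le> x\<close> real_differentiable_def by force
      qed
      then obtain l z where z: "x < z" "z < y" "((\<lambda>x. x powr p) has_real_derivative l) (at z)"
          "y powr p - x powr p = (y - x) * l" by blast
      moreover have "l = p * z powr (p - 1)"
        using z that \<open>0 \<le> u\<close> by (intro DERIV_unique[OF z(3) d]) auto
      ultimately show ?thesis by blast
    qed
    obtain z1 where z1: "u < z1" "z1 < m" "m powr p - u powr p = (m - u) * (p * z1 powr (p - 1))"
      using mvt[of u m] m by auto
    obtain z2 where z2: "m < z2" "z2 < v" "v powr p - m powr p = (v - m) * (p * z2 powr (p - 1))"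
      using mvt[of m v] m by auto
    have "z1 powr (p - 1) < z2 powr (p - 1)"
      using z1 z2 \<open>0 \<le> u\<close> assms(1) by (intro powr_less_mono2) auto
    then have "(m - u) * (p * z1 powr (p - 1)) < (m - u) * (p * z2 powr (p - 1))"
      using m assms(1) by simp
    moreover have "m - u = v - m" by (simp add: m_def field_simps)
    ultimately have "m powr p - u powr p < v powr p - m powr p"
      using z1(3) z2(3) by metis
    then show ?thesis unfolding m_def[symmetric] by simp
  qed
  show "((u + v) / 2) powr p \<le> (u powr p + v powr p) / 2"
    using strict[of u v] strict[of v u] assms by (cases u v rule: linorder_cases) (auto simp: add.commute)
  show "u \<noteq> v \<Longrightarrow> ((u + v) / 2) powr p < (u powr p + v powr p) / 2"
    using strict[of u v] strict[of v u] assms by (cases u v rule: linorder_cases) (auto simp: add.commute)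
qed

text \<open>Strictness has two sources: if the norms differ, the strict convexity of the power; if
  they agree, the strict triangle inequality, because equality there would make two vectors of equal
  norm parallel and hence equal.\<close>

lemma norm_avg_powr_le:
  fixes a b :: "'a::euclidean_space" and p :: real
  assumes "1 < p"
  shows "norm ((1/2) *\<^sub>R (a + b)) powr p \<le> (norm a powr p + norm b powr p) / 2"
    and "a \<noteq> b \<Longrightarrow> norm ((1/2) *\<^sub>R (a + b)) powr p < (norm a powr p + norm b powr p) / 2"
proof -
  have 1: "norm ((1/2) *\<^sub>R (a + b)) powr p \<le> ((norm a + norm b) / 2) powr p"
    using assms norm_triangle_ineq[of a b] by (intro powr_mono2) auto
  with powr_avg_le(1)[OF assms, of "norm a" "norm b"]
  show "norm ((1/2) *\<^sub>R (a + b)) powr p \<le> (norm a powr p + norm b powr p) / 2" by simp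
  show "norm ((1/2) *\<^sub>R (a + b)) powr p < (norm a powr p + norm b powr p) / 2" if "a \<noteq> b"
  proof (cases "norm a = norm b")
    case False
    with powr_avg_le(2)[OF assms, of "norm a" "norm b"] 1 show ?thesis by simp
  next
    case True
    have "norm (a + b) < norm a + norm b"
    proof (rule ccontr)
      assume "\<not> ?thesis"
      then have "norm (a + b) = norm a + norm b" using norm_triangle_ineq[of a b] by simp
      then have "norm a *\<^sub>R b = norm b *\<^sub>R a" by (simp add: norm_triangle_eq)
      with True have "norm a *\<^sub>R b = norm a *\<^sub>R a" by simp
      then show False using True \<open>a \<noteq> b\<close> by auto
    qed
    then have "norm ((1/2) *\<^sub>R (a + b)) powr p < norm a powr p"
      using assms True by (intro powr_less_mono2) auto
    with True show ?thesis by simp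
  qed
qed

text \<open>Pointwise form of the uniform convexity of \<open>L\<^sup>p\<close>, valid for all \<open>1 < p < \<infinity>\<close> at once: by
  homogeneity it suffices to bound the convexity defect from below on a compact set.\<close>

lemma norm_diff_powr_le_defect:
  fixes p \<epsilon> :: real
  assumes "1 < p" "0 < \<epsilon>"
  obtains C where "C > 0" "\<And>a b :: 'a::euclidean_space. norm (a - b) powr p \<le>
    \<epsilon> * (norm a powr p + norm b powr p) +
    C * ((norm a powr p + norm b powr p) / 2 - norm ((1/2) *\<^sub>R (a + b)) powr p)"
proof -
  define N where "N = (\<lambda>(a::'a, b::'a). norm a powr p + norm b powr p)"
  define D where "D = (\<lambda>(a::'a, b::'a). (norm a powr p + norm b powr p) / 2 - norm ((1/2) *\<^sub>R (a + b)) powr p)"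
  \<comment> \<open>Normalised pairs whose difference is not already absorbed by the \<epsilon>
    term. The diagonal is excluded, so \<open>D\<close> is positive on this compact set.\<close>
  define K where "K = {x. N x = 1 \<and> \<epsilon> \<le> norm (fst x - snd x) powr p}"
  have contN: "continuous_on UNIV N" and contD: "continuous_on UNIV D"
    unfolding N_def D_def split_beta
    by (intro continuous_intros continuous_on_powr'; use assms in force)+
  have contd: "continuous_on UNIV (\<lambda>x::'a \<times> 'a. norm (fst x - snd x) powr p)"
    by (intro continuous_intros continuous_on_powr'; use assms in force)
  have "compact K"
    unfolding compact_eq_bounded_closed
  proof
    have "closed ({x. N x = 1} \<inter> {x. \<epsilon> \<le> norm (fst x - snd x) powr p})"
      by (intro closed_Int closed_Collect_eq closed_Collect_le contN contd continuous_intros)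
    then show "closed K" by (simp add: K_def Collect_conj_eq)
    have "norm x \<le> 2" if "x \<in> K" for x
    proof -
      obtain a b where x: "x = (a, b)" by (cases x)
      have "norm a powr p + norm b powr p = 1" using that by (simp add: K_def N_def x)
      then have "norm a powr p \<le> 1" "norm b powr p \<le> 1"
        using powr_ge_zero[of "norm a" p] powr_ge_zero[of "norm b" p] by linarith+
      then have "norm a \<le> 1" "norm b \<le> 1"
        using assms by (metis gr_one_powr less_trans not_less zero_less_one)+
      then show ?thesis using norm_Pair_le[of a b] by (simp add: x)
    qed
    then show "bounded K" unfolding bounded_iff by blast
  qed
  have Dpos: "D x > 0" if "fst x \<noteq> snd x" for x
    using norm_avg_powr_le(2)[OF assms(1), of "fst x" "snd x"] that by (simp add: D_def split_beta)
  have "\<exists>m>0. \<forall>x\<in>K. m \<le> D x"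
  proof (cases "K = {}")
    case False
    then obtain x where x: "x \<in> K" "\<And>y. y \<in> K \<Longrightarrow> D x \<le> D y"
      using continuous_attains_inf[OF \<open>compact K\<close> False continuous_on_subset[OF contD]] by auto
    have "fst x \<noteq> snd x" using x(1) assms by (auto simp: K_def)
    with Dpos x show ?thesis by blast
  qed (auto intro: exI[of _ 1])
  then obtain m where m: "m > 0" "\<And>x. x \<in> K \<Longrightarrow> m \<le> D x" by blast
  \<comment> \<open>On the level \<open>N = 1\<close> both norms are at most 1, so |a - b|^p <= 2^p
    = C m, where m bounds \<open>D\<close> from below on \<open>K\<close>.\<close>
  define C where "C = 2 powr p / m"
  have C: "C > 0" using m by (simp add: C_def)
  have unit: "norm (a - b) powr p \<le> \<epsilon> + C * D (a, b)" if "N (a, b) = 1" for a b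
  proof (cases "(a, b) \<in> K")
    case True
    have "norm a powr p + norm b powr p = 1" using that by (simp add: N_def)
    then have "norm a powr p \<le> 1" "norm b powr p \<le> 1"
      using powr_ge_zero[of "norm a" p] powr_ge_zero[of "norm b" p] by linarith+
    then have "norm a \<le> 1" "norm b \<le> 1"
      using assms by (metis gr_one_powr less_trans not_less zero_less_one)+
    then have "norm (a - b) powr p \<le> 2 powr p"
      using norm_triangle_ineq4[of a b] assms by (intro powr_mono2) auto
    also have "\<dots> = C * m" using m by (simp add: C_def)
    also have "\<dots> \<le> C * D (a, b)" using C m(2)[OF True] by simp
    finally show ?thesis using assms by simp
  next
    case False
    then have "norm (a - b) powr p < \<epsilon>" using that by (auto simp: K_def)
    moreover have "0 \<le> C * D (a, b)"
      using C norm_avg_powr_le(1)[OF assms(1), of a b] by (simp add: D_def)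
    ultimately show ?thesis by simp
  qed
  have "norm (a - b) powr p \<le> \<epsilon> * N (a, b) + C * D (a, b)" for a b
  proof (cases "N (a, b) = 0")
    case True
    have "norm a powr p = 0 \<and> norm b powr p = 0"
      using True powr_ge_zero[of "norm a" p] powr_ge_zero[of "norm b" p]
      unfolding N_def by (simp only: split_conv) linarith
    then have "a = 0" "b = 0" by auto
    then show ?thesis by (simp add: N_def D_def)
  next
    case False
    then have Np: "N (a, b) > 0" by (simp add: N_def less_le add_nonneg_nonneg)
    \<comment> \<open>\<open>N\<close> and \<open>D\<close> are homogeneous of degree p; this factor
      brings the pair to the level \<open>N = 1\<close>.\<close>
    define t where "t = (1 / N (a, b)) powr (1 / p)"
    have t: "t > 0" using Np by (simp add: t_def)
    have "t powr p = (1 / N (a, b)) powr 1"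
      unfolding t_def powr_powr using assms by simp
    then have tp: "t powr p = 1 / N (a, b)" using Np by simp
    have sc: "norm (t *\<^sub>R x) powr p = norm x powr p / N (a, b)" for x :: 'a
      using t by (simp add: powr_mult tp)
    have "N (t *\<^sub>R a, t *\<^sub>R b) = 1"
      using Np sc[of a] sc[of b] unfolding N_def by (simp only: split_conv add_divide_distrib[symmetric]) simp
    from unit[OF this] have "norm (t *\<^sub>R (a - b)) powr p \<le> \<epsilon> + C * D (t *\<^sub>R a, t *\<^sub>R b)"
      by (simp add: scaleR_diff_right)
    moreover have "D (t *\<^sub>R a, t *\<^sub>R b) = D (a, b) / N (a, b)"
    proof -
      have "(1/2) *\<^sub>R (t *\<^sub>R a + t *\<^sub>R b) = t *\<^sub>R ((1/2) *\<^sub>R (a + b))"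
        by (simp add: scaleR_add_right)
      then show ?thesis
        unfolding D_def by (simp only: split_conv sc) (simp add: diff_divide_distrib add_divide_distrib)
    qed
    ultimately have "norm (a - b) powr p / N (a, b) \<le> \<epsilon> + C * (D (a, b) / N (a, b))"
      by (simp only: sc)
    then show ?thesis using Np by (simp add: field_simps)
  qed
  then show ?thesis using that[OF C] by (simp add: N_def D_def)
qed

section \<open>The classes L^p of complex functions for a real exponent\<close>

definition lpow :: "'b measure \<Rightarrow> real \<Rightarrow> ('b \<Rightarrow> complex) set" where
  "lpow M p = {f \<in> borel_measurable M. integrable M (\<lambda>x. norm (f x) powr p)}"

text \<open>Real-valued counterpart of \<open>eLp_norm\<close>, so that estimates stay within the
  reals; \<open>Lp_eq_lpow\<close> and \<open>eLp_norm_eq_lnorm\<close> translate back. If the p-th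
  power is not integrable the value defaults to 0, hence the membership hypotheses in the
  estimates.\<close>

definition lnorm :: "'b measure \<Rightarrow> real \<Rightarrow> ('b \<Rightarrow> complex) \<Rightarrow> real" where
  "lnorm M p f = (\<integral>x. norm (f x) powr p \<partial>M) powr (1 / p)"

lemma lpowI: "f \<in> borel_measurable M \<Longrightarrow> integrable M (\<lambda>x. norm (f x) powr p) \<Longrightarrow> f \<in> lpow M p"
  by (simp add: lpow_def)

lemma lpow_measurable [measurable_dest]: "f \<in> lpow M p \<Longrightarrow> f \<in> borel_measurable M"
  by (simp add: lpow_def)

lemma lpow_integrable: "f \<in> lpow M p \<Longrightarrow> integrable M (\<lambda>x. norm (f x) powr p)"
  by (simp add: lpow_def)

lemma lnorm_nonneg [simp]: "0 \<le> lnorm M p f"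
  by (simp add: lnorm_def)

lemma integral_powr_nonneg [simp]: "0 \<le> (\<integral>x. norm (f x) powr p \<partial>M)"
  by (intro integral_nonneg_AE) auto

lemma lnorm_powr: "0 < p \<Longrightarrow> lnorm M p f powr p = (\<integral>x. norm (f x) powr p \<partial>M)"
  by (simp add: lnorm_def powr_powr)

lemma lnorm_le_iff:
  assumes "0 < p" "0 \<le> A"
  shows "lnorm M p f \<le> A \<longleftrightarrow> (\<integral>x. norm (f x) powr p \<partial>M) \<le> A powr p"
proof -
  have "lnorm M p f powr p \<le> A powr p \<longleftrightarrow> lnorm M p f \<le> A"
    using assms by (metis lnorm_nonneg not_less powr_less_mono2 powr_mono2 less_imp_le)
  then show ?thesis using lnorm_powr[OF assms(1)] by metis
qed

lemma lnorm_cong_norm: "(\<And>x. x \<in> space M \<Longrightarrow> norm (f x) = norm (g x)) \<Longrightarrow> lnorm M p f = lnorm M p g"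
  by (simp add: lnorm_def cong: Bochner_Integration.integral_cong)

lemma lpow_bound:
  assumes "g \<in> lpow M p" "0 < p" "f \<in> borel_measurable M"
    and "\<And>x. x \<in> space M \<Longrightarrow> norm (f x) \<le> C * norm (g x)"
  shows "f \<in> lpow M p"
proof (rule lpowI)
  show "integrable M (\<lambda>x. norm (f x) powr p)"
  proof (rule Bochner_Integration.integrable_bound)
    show "integrable M (\<lambda>x. (C * norm (g x)) powr p)"
    proof (cases "0 \<le> C")
      case True
      then show ?thesis using lpow_integrable[OF assms(1)] by (simp add: powr_mult)
    next
      case False
      have "(C * norm (g x)) powr p = 0" if "x \<in> space M" for x
      proof -
        have "0 \<le> C * norm (g x)" using assms(4)[OF that] norm_ge_zero order_trans by blast
        then have "norm (g x) = 0" using False by (smt (verit) mult_neg_pos norm_ge_zero)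
        then show ?thesis by simp
      qed
      then have "integrable M (\<lambda>x. (C * norm (g x)) powr p) \<longleftrightarrow> integrable M (\<lambda>x. 0 :: real)"
        by (intro Bochner_Integration.integrable_cong) auto
      then show ?thesis by simp
    qed
    show "AE x in M. norm (norm (f x) powr p) \<le> norm ((C * norm (g x)) powr p)"
      using assms(2,4) by (auto intro!: powr_mono2)
  qed (use assms in measurable)
qed (rule assms)

lemma lpow_cong_norm:
  assumes "g \<in> lpow M p" "0 < p" "f \<in> borel_measurable M"
    and "\<And>x. x \<in> space M \<Longrightarrow> norm (f x) = norm (g x)"
  shows "f \<in> lpow M p"
  using lpow_bound[OF assms(1-3), of 1] assms(4) by simp

lemma lpow_scale:
  assumes "f \<in> lpow M p" "0 < p"
  shows "(\<lambda>x. c * f x) \<in> lpow M p"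
  using lpow_bound[OF assms, of "\<lambda>x. c * f x" "norm c"] assms(1)
  by (auto simp: norm_mult lpow_def)

lemma lnorm_scale:
  assumes "0 < p"
  shows "lnorm M p (\<lambda>x. c * f x) = norm c * lnorm M p f"
  using assms by (simp add: lnorm_def norm_mult powr_mult powr_powr)

lemma powr_convex_comb_le:
  fixes u v l p :: real
  assumes "1 < p" "0 \<le> u" "0 \<le> v" "0 \<le> l" "l \<le> 1"
  shows "(l * u + (1 - l) * v) powr p \<le> l * u powr p + (1 - l) * v powr p"
proof -
  \<comment> \<open>\<open>powr_convex\<close> is applied on the open half-line; a zero argument is
    covered by l^p <= l for l in [0, 1].\<close>
  have small: "(l * u) powr p \<le> l * u powr p" if "0 \<le> l" "l \<le> 1" "0 \<le> u" for l u
  proof -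
    have "l powr p \<le> l powr 1 \<or> l = 0" using that assms by (intro disjI1 powr_mono') auto
    then have "l powr p \<le> l" using that by auto
    then show ?thesis using that by (simp add: powr_mult mult_right_mono)
  qed
  consider "u = 0" | "v = 0" | "u > 0" "v > 0" using assms by linarith
  then show ?thesis
  proof cases
    case 3
    have "convex_on {0<..} (\<lambda>x. x powr p)" using assms by (intro powr_convex) auto
    from convex_onD[OF this, of "1 - l" u v] 3 assms show ?thesis by simp
  qed (use small[of l u] small[of "1 - l" v] assms in auto)
qed

text \<open>Minkowski from the convexity of t^p, applied to |f|/A and |g|/B with weights A/(A+B) and
  B/(A+B). Taking A and B strictly above the norms keeps them positive, so vanishing norms need no
  separate case; at the end they are lowered to the norms.\<close>

lemma
  assumes "1 < p" and f: "f \<in> lpow M p" and g: "g \<in> lpow M p"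
  shows lpow_add: "(\<lambda>x. f x + g x) \<in> lpow M p"
    and lnorm_triangle: "lnorm M p (\<lambda>x. f x + g x) \<le> lnorm M p f + lnorm M p g"
proof -
  have [measurable]: "f \<in> borel_measurable M" "g \<in> borel_measurable M"
    using f g by (auto simp: lpow_def)
  note fi = lpow_integrable[OF f] and gi = lpow_integrable[OF g]
  have pt: "norm (f x + g x) powr p \<le> (A + B) powr p * (A / (A + B) * (norm (f x) powr p / A powr p) +
      B / (A + B) * (norm (g x) powr p / B powr p))" if AB: "A > 0" "B > 0" for A B x
  proof -
    have 1: "1 - A / (A + B) = B / (A + B)" using AB by (simp add: field_simps)
    have "norm (f x + g x) \<le> norm (f x) + norm (g x)" by (rule norm_triangle_ineq)
    also have "\<dots> = (A + B) * (A / (A + B) * (norm (f x) / A) + B / (A + B) * (norm (g x) / B))"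
    proof -
      have "(A + B) * (A / (A + B) * (norm (f x) / A)) = norm (f x)"
        "(A + B) * (B / (A + B) * (norm (g x) / B)) = norm (g x)" using AB by auto
      then show ?thesis unfolding distrib_left by simp
    qed
    finally have "norm (f x + g x) powr p \<le>
        ((A + B) * (A / (A + B) * (norm (f x) / A) + B / (A + B) * (norm (g x) / B))) powr p"
      using assms(1) by (intro powr_mono2) auto
    also have "\<dots> = (A + B) powr p * (A / (A + B) * (norm (f x) / A) + B / (A + B) * (norm (g x) / B)) powr p"
      by (rule powr_mult)
    also have "\<dots> \<le> (A + B) powr p * (A / (A + B) * (norm (f x) / A) powr p + B / (A + B) * (norm (g x) / B) powr p)"
      using powr_convex_comb_le[OF assms(1), of "norm (f x) / A" "norm (g x) / B" "A / (A + B)"] AB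
      unfolding 1 by (intro mult_left_mono) auto
    finally show ?thesis using AB by (simp add: powr_divide)
  qed
  have int: "integrable M (\<lambda>x. norm (f x + g x) powr p)"
  proof (rule Bochner_Integration.integrable_bound)
    show "AE x in M. norm (norm (f x + g x) powr p) \<le>
      norm (2 powr p * (1 / 2 * norm (f x) powr p + 1 / 2 * norm (g x) powr p))"
      using pt[of 1 1] by (auto simp: powr_one_eq_one abs_of_nonneg add_nonneg_nonneg)
    show "integrable M (\<lambda>x. 2 powr p * (1 / 2 * norm (f x) powr p + 1 / 2 * norm (g x) powr p))"
      using fi gi by auto
  qed measurable
  then show "(\<lambda>x. f x + g x) \<in> lpow M p" by (intro lpowI) auto
  have *: "lnorm M p (\<lambda>x. f x + g x) \<le> A + B" if A: "lnorm M p f < A" and B: "lnorm M p g < B" for A B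
  proof -
    have AB: "A > 0" "B > 0"
      using A B lnorm_nonneg[of M p f] lnorm_nonneg[of M p g] by linarith+
    have "(\<integral>x. norm (f x + g x) powr p \<partial>M) \<le> (\<integral>x. (A + B) powr p * (A / (A + B) * (norm (f x) powr p / A powr p) +
      B / (A + B) * (norm (g x) powr p / B powr p)) \<partial>M)"
      using fi gi by (intro integral_mono int pt AB) auto
    also have "\<dots> = (A + B) powr p * (A / (A + B) * ((\<integral>x. norm (f x) powr p \<partial>M) / A powr p) +
      B / (A + B) * ((\<integral>x. norm (g x) powr p \<partial>M) / B powr p))"
      using fi gi by simp
    also have "\<dots> \<le> (A + B) powr p * (A / (A + B) * 1 + B / (A + B) * 1)"
    proof -
      have "(\<integral>x. norm (f x) powr p \<partial>M) \<le> A powr p" "(\<integral>x. norm (g x) powr p \<partial>M) \<le> B powr p"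
        using lnorm_le_iff[of p A M f] lnorm_le_iff[of p B M g] assms(1) A B AB by auto
      then show ?thesis using AB by (intro mult_left_mono add_mono) (auto simp: divide_le_eq_1)
    qed
    also have "\<dots> = (A + B) powr p" using AB by (simp add: add_divide_distrib[symmetric])
    finally show ?thesis using AB assms(1) by (subst lnorm_le_iff) auto
  qed
  show "lnorm M p (\<lambda>x. f x + g x) \<le> lnorm M p f + lnorm M p g"
  proof (rule field_le_epsilon)
    fix e :: real assume "e > 0"
    then show "lnorm M p (\<lambda>x. f x + g x) \<le> lnorm M p f + lnorm M p g + e"
      using *[of "lnorm M p f + e / 2" "lnorm M p g + e / 2"] by simp
  qed
qed

lemma
  assumes "1 < p" and f: "f \<in> lpow M p" and g: "g \<in> lpow M p"
  shows lpow_diff: "(\<lambda>x. f x - g x) \<in> lpow M p"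
    and lnorm_diff_triangle: "lnorm M p f \<le> lnorm M p g + lnorm M p (\<lambda>x. f x - g x)"
proof -
  show d: "(\<lambda>x. f x - g x) \<in> lpow M p"
    using lpow_add[OF assms(1) f lpow_scale[OF g, of "- 1"]] assms(1) by simp
  show "lnorm M p f \<le> lnorm M p g + lnorm M p (\<lambda>x. f x - g x)"
    using lnorm_triangle[OF assms(1) g d] by simp
qed

lemma lnorm_minus_commute: "lnorm M p (\<lambda>x. f x - g x) = lnorm M p (\<lambda>x. g x - f x)"
  by (intro lnorm_cong_norm norm_minus_commute)

lemma lnorm_triangle3:
  assumes "1 < p" "f \<in> lpow M p" "g \<in> lpow M p" "h \<in> lpow M p"
  shows "lnorm M p (\<lambda>x. f x - h x) \<le> lnorm M p (\<lambda>x. f x - g x) + lnorm M p (\<lambda>x. g x - h x)"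
  using lnorm_triangle[OF assms(1) lpow_diff[OF assms(1,2,3)] lpow_diff[OF assms(1,3,4)]] by simp

lemma lpow_zero [simp]: "(\<lambda>x. 0) \<in> lpow M p"
  by (simp add: lpow_def)

lemma lnorm_zero [simp]: "lnorm M p (\<lambda>x. 0) = 0"
  by (simp add: lnorm_def)

lemma
  assumes "1 < p" "finite J" "\<And>j. j \<in> J \<Longrightarrow> f j \<in> lpow M p"
  shows lpow_sum: "(\<lambda>x. \<Sum>j\<in>J. f j x) \<in> lpow M p"
    and lnorm_sum_le: "lnorm M p (\<lambda>x. \<Sum>j\<in>J. f j x) \<le> (\<Sum>j\<in>J. lnorm M p (f j))"
proof -
  have "(\<lambda>x. \<Sum>j\<in>J. f j x) \<in> lpow M p \<and> lnorm M p (\<lambda>x. \<Sum>j\<in>J. f j x) \<le> (\<Sum>j\<in>J. lnorm M p (f j))"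
    using assms(2,3)
  proof (induction J)
    case (insert j J)
    then have 1: "(\<lambda>x. \<Sum>j\<in>J. f j x) \<in> lpow M p" "f j \<in> lpow M p"
      "lnorm M p (\<lambda>x. \<Sum>j\<in>J. f j x) \<le> (\<Sum>j\<in>J. lnorm M p (f j))" by auto
    show ?case
      using lpow_add[OF assms(1) 1(2,1)] lnorm_triangle[OF assms(1) 1(2,1)] 1(3) insert(1,2)
      by auto
  qed simp
  then show "(\<lambda>x. \<Sum>j\<in>J. f j x) \<in> lpow M p"
    and "lnorm M p (\<lambda>x. \<Sum>j\<in>J. f j x) \<le> (\<Sum>j\<in>J. lnorm M p (f j))" by auto
qed

text \<open>Young's inequality for |f|/A and |g|/B, again with A and B strictly above the norms and
  then let down to them.\<close>

lemma
  assumes pq: "1 < p" "1 < q" "1 / p + 1 / q = 1" and f: "f \<in> lpow M p" and g: "g \<in> lpow M q"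
  shows lpow_mult_integrable: "integrable M (\<lambda>x. f x * g x)"
    and Holder_norm: "(\<integral>x. norm (f x * g x) \<partial>M) \<le> lnorm M p f * lnorm M q g"
    and Holder: "norm (\<integral>x. f x * g x \<partial>M) \<le> lnorm M p f * lnorm M q g"
proof -
  have [measurable]: "f \<in> borel_measurable M" "g \<in> borel_measurable M"
    using f g by (auto simp: lpow_def)
  note fi = lpow_integrable[OF f] and gi = lpow_integrable[OF g]
  have pt: "norm (f x * g x) \<le> A * B * (norm (f x) powr p / A powr p / p + norm (g x) powr q / B powr q / q)"
    if AB: "A > 0" "B > 0" for A B x
  proof -
    have "norm (f x) / A * (norm (g x) / B) \<le> (norm (f x) / A) powr p / p + (norm (g x) / B) powr q / q"
      using AB by (intro Youngs_inequality pq) auto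
    then have "A * B * (norm (f x) / A * (norm (g x) / B)) \<le>
      A * B * ((norm (f x) / A) powr p / p + (norm (g x) / B) powr q / q)"
      using AB by (intro mult_left_mono) auto
    then show ?thesis using AB by (simp add: norm_mult powr_divide)
  qed
  show int: "integrable M (\<lambda>x. f x * g x)"
  proof (rule Bochner_Integration.integrable_bound)
    show "integrable M (\<lambda>x. norm (f x) powr p / p + norm (g x) powr q / q)" using fi gi by auto
    show "AE x in M. norm (f x * g x) \<le> norm (norm (f x) powr p / p + norm (g x) powr q / q)"
      using pt[of 1 1] pq by (auto simp: abs_of_nonneg add_nonneg_nonneg)
  qed measurable
  have *: "(\<integral>x. norm (f x * g x) \<partial>M) \<le> A * B" if A: "lnorm M p f < A" and B: "lnorm M q g < B" for A B
  proof -
    have AB: "A > 0" "B > 0"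
      using A B lnorm_nonneg[of M p f] lnorm_nonneg[of M q g] by linarith+
    have "(\<integral>x. norm (f x * g x) \<partial>M) \<le>
        (\<integral>x. A * B * (norm (f x) powr p / A powr p / p + norm (g x) powr q / B powr q / q) \<partial>M)"
      using fi gi int by (intro integral_mono pt AB) auto
    also have "\<dots> = A * B * ((\<integral>x. norm (f x) powr p \<partial>M) / A powr p / p + (\<integral>x. norm (g x) powr q \<partial>M) / B powr q / q)"
      using fi gi by simp
    also have "\<dots> \<le> A * B * (1 / p + 1 / q)"
    proof -
      have "(\<integral>x. norm (f x) powr p \<partial>M) \<le> A powr p" "(\<integral>x. norm (g x) powr q \<partial>M) \<le> B powr q"
        using lnorm_le_iff[of p A M f] lnorm_le_iff[of q B M g] pq A B AB by auto
      then show ?thesis using AB pq by (intro mult_left_mono add_mono divide_right_mono) (auto simp: divide_le_eq_1)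
    qed
    finally show ?thesis using pq by simp
  qed
  show norm: "(\<integral>x. norm (f x * g x) \<partial>M) \<le> lnorm M p f * lnorm M q g"
  proof (rule tendsto_lowerbound)
    show "((\<lambda>e. (lnorm M p f + e) * (lnorm M q g + e)) \<longlongrightarrow> lnorm M p f * lnorm M q g) (at_right 0)"
      by (rule tendsto_eq_intros | simp)+
    show "\<forall>\<^sub>F e in at_right 0. (\<integral>x. norm (f x * g x) \<partial>M) \<le> (lnorm M p f + e) * (lnorm M q g + e)"
      using * by (auto simp: eventually_at_filter)
  qed simp
  show "norm (\<integral>x. f x * g x \<partial>M) \<le> lnorm M p f * lnorm M q g"
    using integral_norm_bound[of M "\<lambda>x. f x * g x"] norm by linarith
qed

lemma (in finite_measure) lpow_const [simp]: "(\<lambda>x. c) \<in> lpow M p"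
  by (simp add: lpow_def)

lemma (in finite_measure) lpow_bounded:
  assumes "f \<in> borel_measurable M" "\<And>x. x \<in> space M \<Longrightarrow> norm (f x) \<le> C" "0 < p"
  shows "f \<in> lpow M p"
  using assms lpow_bound[OF lpow_const[of 1] assms(3,1), of C] by simp

lemma (in finite_measure)
  assumes pq: "1 < p" "1 < q" "1 / p + 1 / q = 1" and f: "f \<in> lpow M p"
  shows lpow_imp_integrable: "integrable M f"
    and L1_le_lnorm: "(\<integral>x. norm (f x) \<partial>M) \<le> lnorm M p f * lnorm M q (\<lambda>x. 1)"
  using lpow_mult_integrable[OF pq f, of "\<lambda>x. 1"] Holder_norm[OF pq f, of "\<lambda>x. 1"] by auto

section \<open>Completeness, convexity defect, duality and approximation by simple functions\<close>

lemma lpow_Fatou: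
  assumes "0 < p" and u: "\<And>k. u k \<in> lpow M p" and A: "0 \<le> A" "\<And>k. lnorm M p (u k) \<le> A"
    and [measurable]: "v \<in> borel_measurable M" and lim: "AE x in M. (\<lambda>k. u k x) \<longlonglongrightarrow> v x"
  shows "v \<in> lpow M p" and "lnorm M p v \<le> A"
proof -
  have [measurable]: "u k \<in> borel_measurable M" for k using u[of k] by (auto simp: lpow_def)
  have "(\<integral>\<^sup>+x. ennreal (norm (v x) powr p) \<partial>M) = (\<integral>\<^sup>+x. liminf (\<lambda>k. ennreal (norm (u k x) powr p)) \<partial>M)"
  proof (rule nn_integral_cong_AE, use lim in eventually_elim)
    fix x assume "(\<lambda>k. u k x) \<longlonglongrightarrow> v x"
    then have "(\<lambda>k. ennreal (norm (u k x) powr p)) \<longlonglongrightarrow> ennreal (norm (v x) powr p)"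
      using assms(1) by (intro tendsto_ennrealI tendsto_powr' tendsto_norm tendsto_const) auto
    then show "ennreal (norm (v x) powr p) = liminf (\<lambda>k. ennreal (norm (u k x) powr p))"
      by (intro lim_imp_Liminf[symmetric]) auto
  qed
  also have "\<dots> \<le> liminf (\<lambda>k. \<integral>\<^sup>+x. ennreal (norm (u k x) powr p) \<partial>M)"
    by (intro nn_integral_liminf) measurable
  also have "\<dots> \<le> liminf (\<lambda>k::nat. ennreal (A powr p))"
  proof (intro Liminf_mono always_eventually allI)
    fix k
    have "(\<integral>\<^sup>+x. ennreal (norm (u k x) powr p) \<partial>M) = ennreal (\<integral>x. norm (u k x) powr p \<partial>M)"
      using lpow_integrable[OF u] by (intro nn_integral_eq_integral) auto
    also have "\<dots> \<le> ennreal (A powr p)"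
      using A lnorm_le_iff[of p A M "u k"] assms(1) by (intro ennreal_leI) auto
    finally show "(\<integral>\<^sup>+x. ennreal (norm (u k x) powr p) \<partial>M) \<le> ennreal (A powr p)" .
  qed
  finally have *: "(\<integral>\<^sup>+x. ennreal (norm (v x) powr p) \<partial>M) \<le> ennreal (A powr p)"
    by (simp add: Liminf_const)
  have int: "integrable M (\<lambda>x. norm (v x) powr p)"
    by (rule integrableI_nonneg) (use * in \<open>auto simp: less_top[symmetric] top_unique intro: le_less_trans\<close>)
  then show "v \<in> lpow M p" by (intro lpowI) auto
  have "ennreal (\<integral>x. norm (v x) powr p \<partial>M) \<le> ennreal (A powr p)"
    using * nn_integral_eq_integral[OF int] by simp
  then show "lnorm M p v \<le> A"
    using A assms(1) by (subst lnorm_le_iff) auto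
qed

text \<open>Along a subsequence with geometric steps the increments are summable in L^1, by Hoelder
  on the finite measure, hence summable at almost every point. Fatou turns this pointwise
  convergence into norm convergence of the whole sequence.\<close>

lemma (in finite_measure) lpow_complete:
  fixes f :: "nat \<Rightarrow> 'a \<Rightarrow> complex"
  assumes p: "1 < p" and f: "\<And>n. f n \<in> lpow M p"
    and cauchy: "\<And>e. e > 0 \<Longrightarrow> \<exists>N. \<forall>m\<ge>N. \<forall>n\<ge>N. lnorm M p (\<lambda>x. f m x - f n x) < e"
  obtains g where "g \<in> lpow M p" "(\<lambda>n. lnorm M p (\<lambda>x. f n x - g x)) \<longlonglongrightarrow> 0"
proof -
  define q where "q = p / (p - 1)"
  have q: "1 < q" "1 / p + 1 / q = 1" using p by (auto simp: q_def field_simps)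
  have [measurable]: "f n \<in> borel_measurable M" for n using f[of n] by (auto simp: lpow_def)
  obtain N where N: "\<And>k m n. N k \<le> m \<Longrightarrow> N k \<le> n \<Longrightarrow> lnorm M p (\<lambda>x. f m x - f n x) < (1/2) ^ k"
    using cauchy[of "(1/2) ^ k" for k] by (metis half_gt_zero zero_less_one zero_less_power)
  \<comment> \<open>Partial sums of the thresholds are nondecreasing in k and dominate each
    \<open>N k\<close>.\<close>
  define r where "r = (\<lambda>k. \<Sum>i\<le>k. N i)"
  have rN: "N k \<le> r k" "r k \<le> r (Suc k)" for k
    by (auto simp: r_def member_le_sum)
  define h where "h = (\<lambda>k x. norm (f (r (Suc k)) x - f (r k) x))"
  have [measurable]: "h k \<in> borel_measurable M" for k unfolding h_def by measurable
  define C where "C = lnorm M q (\<lambda>x. 1)"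
  have hint: "integrable M (h k)" and hle: "(\<integral>x. h k x \<partial>M) \<le> (1/2) ^ k * C" for k
  proof -
    have d: "(\<lambda>x. f (r (Suc k)) x - f (r k) x) \<in> lpow M p" by (intro lpow_diff p f)
    show "integrable M (h k)"
      unfolding h_def using lpow_imp_integrable[OF p q d] by simp
    have "(\<integral>x. h k x \<partial>M) \<le> lnorm M p (\<lambda>x. f (r (Suc k)) x - f (r k) x) * C"
      unfolding h_def C_def by (rule L1_le_lnorm[OF p q d])
    also have "\<dots> \<le> (1/2) ^ k * C"
      using N[of k "r (Suc k)" "r k"] rN[of k] by (intro mult_right_mono) (auto simp: C_def)
    finally show "(\<integral>x. h k x \<partial>M) \<le> (1/2) ^ k * C" .
  qed
  have "(\<integral>\<^sup>+x. (\<Sum>k. ennreal (h k x)) \<partial>M) = (\<Sum>k. \<integral>\<^sup>+x. ennreal (h k x) \<partial>M)"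
    by (intro nn_integral_suminf) measurable
  also have "\<dots> \<le> (\<Sum>k. ennreal ((1/2) ^ k * C))"
  proof (intro suminf_le)
    fix k
    have "(\<integral>\<^sup>+x. ennreal (h k x) \<partial>M) = ennreal (\<integral>x. h k x \<partial>M)"
      by (intro nn_integral_eq_integral hint) (auto simp: h_def)
    with hle[of k] show "(\<integral>\<^sup>+x. ennreal (h k x) \<partial>M) \<le> ennreal ((1/2) ^ k * C)"
      by (simp add: ennreal_leI)
  qed auto
  also have "\<dots> = ennreal (\<Sum>k. (1/2) ^ k * C)"
    by (intro suminf_ennreal2) (auto simp: C_def intro!: summable_mult2 summable_geometric)
  finally have "(\<integral>\<^sup>+x. (\<Sum>k. ennreal (h k x)) \<partial>M) \<noteq> \<infinity>" by (auto simp: top_unique)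
  then have "AE x in M. (\<Sum>k. ennreal (h k x)) \<noteq> \<infinity>"
    by (intro nn_integral_PInf_AE) auto
  then have lim: "AE x in M. (\<lambda>k. f (r k) x) \<longlonglongrightarrow> lim (\<lambda>k. f (r k) x)"
  proof eventually_elim
    fix x assume "(\<Sum>k. ennreal (h k x)) \<noteq> \<infinity>"
    then have "summable (\<lambda>k. h k x)"
      by (intro summable_suminf_not_top) (auto simp: h_def)
    then have "summable (\<lambda>k. f (r (Suc k)) x - f (r k) x)"
      unfolding h_def by (rule summable_norm_cancel)
    then have "convergent (\<lambda>n. \<Sum>k<n. f (r (Suc k)) x - f (r k) x)"
      by (simp add: summable_iff_convergent)
    then have "convergent (\<lambda>n. f (r n) x - f (r 0) x)"
      unfolding sum_lessThan_telescope[of "\<lambda>k. f (r k) x"] .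
    then have "convergent (\<lambda>n. f (r n) x - f (r 0) x + f (r 0) x)"
      by (intro convergent_add convergent_const)
    then show "(\<lambda>k. f (r k) x) \<longlonglongrightarrow> lim (\<lambda>k. f (r k) x)"
      by (simp add: convergent_LIMSEQ_iff)
  qed
  define g where "g = (\<lambda>x. lim (\<lambda>k. f (r k) x))"
  have [measurable]: "g \<in> borel_measurable M" unfolding g_def by measurable
  have fg: "(\<lambda>x. f n x - g x) \<in> lpow M p \<and> lnorm M p (\<lambda>x. f n x - g x) \<le> (1/2) ^ k" if n: "N k \<le> n" for n k
  proof -
    have ge: "N k \<le> r (j + k)" for j
      unfolding r_def by (intro member_le_sum) auto
    have le: "lnorm M p (\<lambda>x. f n x - f (r (j + k)) x) \<le> (1/2) ^ k" for j
      using N[OF n ge] less_imp_le by blast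
    have l: "AE x in M. (\<lambda>j. f n x - f (r (j + k)) x) \<longlonglongrightarrow> f n x - g x"
      using lim
    proof eventually_elim
      case (elim x)
      then have "(\<lambda>j. f (r (j + k)) x) \<longlonglongrightarrow> lim (\<lambda>k. f (r k) x)" by (rule LIMSEQ_ignore_initial_segment)
      then show ?case unfolding g_def by (intro tendsto_intros)
    qed
    show ?thesis
      using lpow_Fatou[of p "\<lambda>j x. f n x - f (r (j + k)) x" M "(1/2) ^ k" "\<lambda>x. f n x - g x"] le l p
        lpow_diff[OF p f f] by auto
  qed
  have "(\<lambda>x. f (N 0) x - (f (N 0) x - g x)) \<in> lpow M p"
    by (rule lpow_diff[OF p f]) (use fg[of 0 "N 0"] in simp)
  then have "g \<in> lpow M p" by simp
  moreover have "(\<lambda>n. lnorm M p (\<lambda>x. f n x - g x)) \<longlonglongrightarrow> 0"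
  proof (rule LIMSEQ_I)
    fix e :: real assume "e > 0"
    then obtain k where "(1/2) ^ k < e" using real_arch_pow_inv[of e "1/2"] by auto
    then show "\<exists>n0. \<forall>n\<ge>n0. norm (lnorm M p (\<lambda>x. f n x - g x) - 0) < e"
      using fg[of k] by (intro exI[of _ "N k"]) (auto intro: le_less_trans)
  qed
  ultimately show ?thesis using that by blast
qed

text \<open>The pointwise defect inequality, integrated. \<open>C\<close> is fixed before the
  measure and the functions, so one constant serves a whole sequence.\<close>

lemma lpow_defect:
  fixes p \<epsilon> :: real
  assumes "1 < p" "0 < \<epsilon>"
  obtains C where "C > 0" "\<And>(M :: 'b measure) f g. f \<in> lpow M p \<Longrightarrow> g \<in> lpow M p \<Longrightarrow>
    (\<integral>x. norm (f x - g x) powr p \<partial>M) \<le>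
      \<epsilon> * ((\<integral>x. norm (f x) powr p \<partial>M) + (\<integral>x. norm (g x) powr p \<partial>M)) +
      C * (((\<integral>x. norm (f x) powr p \<partial>M) + (\<integral>x. norm (g x) powr p \<partial>M)) / 2 -
           (\<integral>x. norm ((1/2) * (f x + g x)) powr p \<partial>M))"
proof -
  obtain C where C: "C > 0" "\<And>a b :: complex. norm (a - b) powr p \<le>
    \<epsilon> * (norm a powr p + norm b powr p) +
    C * ((norm a powr p + norm b powr p) / 2 - norm ((1/2) *\<^sub>R (a + b)) powr p)"
    using norm_diff_powr_le_defect[OF assms] by blast
  show ?thesis
  proof (rule that[OF C(1)])
    fix M :: "'b measure" and f g assume f: "f \<in> lpow M p" and g: "g \<in> lpow M p"
    note fi = lpow_integrable[OF f] and gi = lpow_integrable[OF g]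
    have "(\<lambda>x. (1/2) * (f x + g x)) \<in> lpow M p"
      using assms by (intro lpow_scale lpow_add f g) auto
    note hi = lpow_integrable[OF this]
    have di: "integrable M (\<lambda>x. norm (f x - g x) powr p)"
      by (intro lpow_integrable lpow_diff assms f g)
    have "(\<integral>x. norm (f x - g x) powr p \<partial>M) \<le> (\<integral>x. \<epsilon> * (norm (f x) powr p + norm (g x) powr p) +
      C * ((norm (f x) powr p + norm (g x) powr p) / 2 - norm ((1/2) * (f x + g x)) powr p) \<partial>M)"
    proof (rule integral_mono[OF di])
      show "integrable M (\<lambda>x. \<epsilon> * (norm (f x) powr p + norm (g x) powr p) +
        C * ((norm (f x) powr p + norm (g x) powr p) / 2 - norm ((1/2) * (f x + g x)) powr p))"
        using fi gi hi by (intro Bochner_Integration.integrable_add integrable_mult_right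
            Bochner_Integration.integrable_diff integrable_divide) auto
      show "norm (f x - g x) powr p \<le> \<epsilon> * (norm (f x) powr p + norm (g x) powr p) +
        C * ((norm (f x) powr p + norm (g x) powr p) / 2 - norm ((1/2) * (f x + g x)) powr p)" for x
        using C(2)[of "f x" "g x"] by (simp add: scaleR_conv_of_real)
    qed
    also have "\<dots> = \<epsilon> * ((\<integral>x. norm (f x) powr p \<partial>M) + (\<integral>x. norm (g x) powr p \<partial>M)) +
      C * (((\<integral>x. norm (f x) powr p \<partial>M) + (\<integral>x. norm (g x) powr p \<partial>M)) / 2 -
           (\<integral>x. norm ((1/2) * (f x + g x)) powr p \<partial>M))"
      using fi gi hi by (simp del: norm_mult norm_divide norm_divide_numeral)
    finally show "(\<integral>x. norm (f x - g x) powr p \<partial>M) \<le>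
      \<epsilon> * ((\<integral>x. norm (f x) powr p \<partial>M) + (\<integral>x. norm (g x) powr p \<partial>M)) +
      C * (((\<integral>x. norm (f x) powr p \<partial>M) + (\<integral>x. norm (g x) powr p \<partial>M)) / 2 -
           (\<integral>x. norm ((1/2) * (f x + g x)) powr p \<partial>M))" .
  qed
qed

text \<open>\<open>g\<close> is the extremal function for Hoelder's inequality: f g = |f|^p = |g|^q.
  At zeros of f the factor \<open>cnj (f x)\<close> makes it vanish, whatever the sign of p -
  2.\<close>

lemma lpow_dual:
  assumes pq: "1 < p" "1 < q" "1 / p + 1 / q = 1" and f: "f \<in> lpow M p"
  defines "g \<equiv> \<lambda>x. cnj (f x) * of_real (norm (f x) powr (p - 2))"
  shows "g \<in> lpow M q" "(\<integral>x. norm (g x) powr q \<partial>M) = (\<integral>x. norm (f x) powr p \<partial>M)"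
    "(\<integral>x. f x * g x \<partial>M) = of_real (\<integral>x. norm (f x) powr p \<partial>M)"
    "\<And>x. norm (g x) = norm (f x) powr (p - 1)"
proof -
  have [measurable]: "f \<in> borel_measurable M" using f by (auto simp: lpow_def)
  have ng: "norm (g x) = norm (f x) powr (p - 1)" for x
  proof (cases "f x = 0")
    case False
    then have "norm (f x) * norm (f x) powr (p - 2) = norm (f x) powr (1 + (p - 2))"
      by (subst powr_add) simp
    then show ?thesis by (simp add: g_def norm_mult)
  qed (simp add: g_def)
  have "(p - 1) * q = p" using pq by (simp add: field_simps)
  then have gq: "norm (g x) powr q = norm (f x) powr p" for x by (simp add: ng powr_powr)
  show "g \<in> lpow M q"
  proof (rule lpowI)
    have "(\<lambda>x. cnj (f x)) \<in> borel_measurable M"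
      by (rule measurable_compose[of f M borel])
         (auto intro!: borel_measurable_continuous_onI continuous_intros)
    then show "g \<in> borel_measurable M" unfolding g_def by measurable
    show "integrable M (\<lambda>x. norm (g x) powr q)"
      using lpow_integrable[OF f] by (simp add: gq)
  qed
  show "(\<integral>x. norm (g x) powr q \<partial>M) = (\<integral>x. norm (f x) powr p \<partial>M)" by (simp add: gq)
  have "f x * g x = of_real (norm (f x) powr p)" for x
  proof (cases "f x = 0")
    case False
    have "f x * g x = of_real ((norm (f x))\<^sup>2 * norm (f x) powr (p - 2))"
      by (simp only: g_def of_real_mult complex_norm_square mult.assoc)
    also have "(norm (f x))\<^sup>2 * norm (f x) powr (p - 2) = norm (f x) powr (2 + (p - 2))"
      using False by (subst powr_add) simp
    finally show ?thesis by simp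
  qed simp
  then show "(\<integral>x. f x * g x \<partial>M) = of_real (\<integral>x. norm (f x) powr p \<partial>M)" by simp
  show "norm (g x) = norm (f x) powr (p - 1)" for x by (rule ng)
qed

lemma lpow_simple_approx:
  assumes "1 < p" and f: "f \<in> lpow M p" and "e > 0"
  obtains g where "simple_function M g" "g \<in> lpow M p" "lnorm M p (\<lambda>x. f x - g x) < e"
proof -
  have [measurable]: "f \<in> borel_measurable M" using f by (auto simp: lpow_def)
  have "f \<in> borel_measurable M" by measurable
  from borel_measurable_implies_sequence_metric[OF this, of 0]
  obtain s where s': "\<forall>i. simple_function M (s i)" "\<forall>x\<in>space M. (\<lambda>i. s i x) \<longlonglongrightarrow> f x"
      "\<forall>i. \<forall>x\<in>space M. dist (s i x) 0 \<le> 2 * dist (f x) 0" by (elim exE conjE)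
  note s = s'(1)[rule_format] s'(2)[rule_format] s'(3)[rule_format]
  have [measurable]: "s i \<in> borel_measurable M" for i using s(1) by (rule borel_measurable_simple_function)
  have sl: "s i \<in> lpow M p" for i
    using s(3) assms(1) by (intro lpow_bound[OF f, of _ 2]) auto
  have "(\<lambda>i. \<integral>x. norm (f x - s i x) powr p \<partial>M) \<longlonglongrightarrow> (\<integral>x. 0 \<partial>M)"
  proof (rule integral_dominated_convergence)
    \<comment> \<open>The approximants satisfy |s_i| <= 2 |f|, so |f - s_i| <= 3 |f|.\<close>
    show "integrable M (\<lambda>x. 3 powr p * norm (f x) powr p)" using lpow_integrable[OF f] by auto
    show "AE x in M. (\<lambda>i. norm (f x - s i x) powr p) \<longlonglongrightarrow> 0"
    proof (rule AE_I2)
      fix x assume "x \<in> space M"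
      then have "(\<lambda>i. norm (f x - s i x) powr p) \<longlonglongrightarrow> norm (f x - f x) powr p"
        using s(2) assms(1) by (intro tendsto_powr' tendsto_norm tendsto_diff tendsto_const) auto
      then show "(\<lambda>i. norm (f x - s i x) powr p) \<longlonglongrightarrow> 0" by simp
    qed
    show "AE x in M. norm (norm (f x - s i x) powr p) \<le> 3 powr p * norm (f x) powr p" for i
    proof (rule AE_I2)
      fix x assume "x \<in> space M"
      then have "norm (f x - s i x) \<le> 3 * norm (f x)"
        using s(3)[of x i] norm_triangle_ineq4[of "f x" "s i x"] by simp
      then have "norm (f x - s i x) powr p \<le> (3 * norm (f x)) powr p"
        using assms(1) by (intro powr_mono2) auto
      then show "norm (norm (f x - s i x) powr p) \<le> 3 powr p * norm (f x) powr p"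
        by (simp add: powr_mult)
    qed
  qed auto
  then have "(\<lambda>i. \<integral>x. norm (f x - s i x) powr p \<partial>M) \<longlonglongrightarrow> 0" by simp
  then have "\<forall>\<^sub>F i in sequentially. (\<integral>x. norm (f x - s i x) powr p \<partial>M) < (e/2) powr p"
    using \<open>e > 0\<close> by (intro order_tendstoD(2)) auto
  then obtain i where "(\<integral>x. norm (f x - s i x) powr p \<partial>M) < (e/2) powr p"
    by (auto simp: eventually_sequentially)
  then have "lnorm M p (\<lambda>x. f x - s i x) \<le> e/2"
    using \<open>e > 0\<close> assms(1) by (subst lnorm_le_iff) auto
  then show ?thesis using that[OF s(1) sl, of i] \<open>e > 0\<close> by auto
qed

section \<open>The surface measure of the sphere\<close>

text \<open>A separated subset of maximal cardinality is a net, since an uncovered point could be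
  added to it; the uniform bound \<open>N\<close> makes the maximum exist.\<close>

lemma separated_net:
  fixes S :: "'a::metric_space set"
  assumes "0 < r" and bound: "\<And>X. X \<subseteq> S \<Longrightarrow> finite X \<Longrightarrow>
      (\<And>x y. x \<in> X \<Longrightarrow> y \<in> X \<Longrightarrow> x \<noteq> y \<Longrightarrow> r \<le> dist x y) \<Longrightarrow> card X \<le> N"
  obtains X where "X \<subseteq> S" "finite X" "card X \<le> N" "S \<subseteq> (\<Union>x\<in>X. ball x r)"
    "\<And>x y. x \<in> X \<Longrightarrow> y \<in> X \<Longrightarrow> x \<noteq> y \<Longrightarrow> r \<le> dist x y"
proof -
  define F where "F = {X. X \<subseteq> S \<and> finite X \<and> (\<forall>x\<in>X. \<forall>y\<in>X. x \<noteq> y \<longrightarrow> r \<le> dist x y)}"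
  have "{} \<in> F" by (simp add: F_def)
  moreover have "card X < Suc N" if "X \<in> F" for X
    using bound[of X] that unfolding F_def by (simp add: less_Suc_eq_le)
  ultimately obtain X where X: "X \<in> F" "\<And>Y. Y \<in> F \<Longrightarrow> card Y \<le> card X"
    using ex_has_greatest_nat[of "\<lambda>X. X \<in> F" "{}" card "Suc N"] by (auto simp: less_imp_le)
  have "S \<subseteq> (\<Union>x\<in>X. ball x r)"
  proof (rule ccontr)
    assume "\<not> ?thesis"
    then obtain s where s: "s \<in> S" "\<And>x. x \<in> X \<Longrightarrow> r \<le> dist x s" by force
    then have "s \<notin> X" using \<open>0 < r\<close> by force
    have "insert s X \<in> F" using X(1) s by (auto simp: F_def dist_commute)
    from X(2)[OF this] show False using X(1) \<open>s \<notin> X\<close> by (simp add: F_def)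
  qed
  moreover have "X \<subseteq> S" "finite X" "\<And>x y. x \<in> X \<Longrightarrow> y \<in> X \<Longrightarrow> x \<noteq> y \<Longrightarrow> r \<le> dist x y"
    using X(1) by (auto simp: F_def)
  moreover from this have "card X \<le> N" by (intro bound) auto
  ultimately show ?thesis by (intro that)
qed

lemma lborel_fmeasurable_bounded:
  fixes A :: "'a::euclidean_space set"
  assumes "bounded A" "A \<in> sets borel"
  shows "A \<in> fmeasurable lborel"
  using emeasure_bounded_finite[OF assms(1)] assms(2) by (intro fmeasurableI) auto

text \<open>Volume count: the disjoint balls of radius e/2 about X lie in a shell of thickness e
  around the sphere. Its volume is O(e), which turns the exponent DIM of a count in the full space
  into DIM - 1.\<close>

lemma sphere_separated_card:
  fixes X :: "'a::euclidean_space set"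
  assumes e: "0 < e" "e \<le> 1" and X: "X \<subseteq> sphere 0 1" "finite X"
    and sep: "\<And>x y. x \<in> X \<Longrightarrow> y \<in> X \<Longrightarrow> x \<noteq> y \<Longrightarrow> e \<le> dist x y"
  shows "real (card X) * e ^ (DIM('a) - 1) \<le> real DIM('a) * 2 ^ (2 * DIM('a))"
proof -
  define n where "n = DIM('a)"
  have n: "n \<ge> 1" by (simp add: n_def DIM_positive Suc_leI)
  define v where "v = unit_ball_vol (real n)"
  have v: "v > 0" by (simp add: v_def)
  have U: "(\<Union>x\<in>X. ball x (e/2)) \<subseteq> ball 0 (1 + e/2) - ball 0 (1 - e/2)"
  proof (intro UN_least subsetI)
    fix x y assume "x \<in> X" "y \<in> ball x (e/2)"
    then have "norm x = 1" "norm (x - y) < e/2" using X by (auto simp: dist_norm)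
    then show "y \<in> ball 0 (1 + e/2) - ball 0 (1 - e/2)"
      using norm_triangle_ineq2[of x y] norm_triangle_ineq2[of y x] by (auto simp: norm_minus_commute)
  qed
  have "measure lborel (\<Union>x\<in>X. ball x (e/2)) = (\<Sum>x\<in>X. measure lborel (ball x (e/2)))"
  proof (rule measure_finite_Union)
    show "disjoint_family_on (\<lambda>x. ball x (e/2)) X"
      unfolding disjoint_family_on_def
    proof (intro ballI impI)
      fix x y assume "x \<in> X" "y \<in> X" "x \<noteq> y"
      from sep[OF this] show "ball x (e/2) \<inter> ball y (e/2) = {}"
        using disjoint_ballI[of "e/2" "e/2" x y] by simp
    qed
  qed (use X e in \<open>auto simp: emeasure_ball\<close>)
  also have "\<dots> = real (card X) * (v * (e/2) ^ n)"
    using e by (simp add: content_ball v_def n_def)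
  finally have "real (card X) * (v * (e/2) ^ n) = measure lborel (\<Union>x\<in>X. ball x (e/2))" by simp
  also have "\<dots> \<le> measure lborel (ball (0::'a) (1 + e/2) - ball 0 (1 - e/2))"
    by (rule measure_mono_fmeasurable[OF U]) (use X in \<open>auto intro!: lborel_fmeasurable_bounded sets.finite_UN\<close>)
  also have "\<dots> = measure lborel (ball (0::'a) (1 + e/2)) - measure lborel (ball (0::'a) (1 - e/2))"
    using e by (intro measure_Diff) (auto simp: emeasure_ball)
  also have "\<dots> = v * ((1 + e/2) ^ n - (1 - e/2) ^ n)"
    using e by (simp add: content_ball v_def n_def algebra_simps)
  \<comment> \<open>Factoring the difference of powers isolates the thickness e; each of the n
    remaining terms is at most 2^n because e <= 1.\<close>
  also have "(1 + e/2) ^ n - (1 - e/2) ^ n \<le> e * (real n * 2 ^ n)"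
  proof -
    have "(1 + e/2) ^ n - (1 - e/2) ^ n =
        ((1 + e/2) - (1 - e/2)) * (\<Sum>i<n. (1 - e/2) ^ (n - Suc i) * (1 + e/2) ^ i)"
      by (rule power_diff_sumr2)
    also have "\<dots> \<le> e * (\<Sum>i<n. 1 * 2 ^ n)"
    proof -
      have "(1 - e/2) ^ (n - Suc i) * (1 + e/2) ^ i \<le> 1 * 2 ^ n" if "i < n" for i
      proof (rule mult_mono)
        show "(1 - e/2) ^ (n - Suc i) \<le> 1" using e by (intro power_le_one) auto
        have "(1 + e/2) ^ i \<le> 2 ^ i" using e by (intro power_mono) auto
        also have "\<dots> \<le> (2::real) ^ n" using that by (intro power_increasing) auto
        finally show "(1 + e/2) ^ i \<le> 2 ^ n" .
      qed (use e in auto)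
      then have "(\<Sum>i<n. (1 - e/2) ^ (n - Suc i) * (1 + e/2) ^ i) \<le> (\<Sum>i<n. 1 * 2 ^ n)"
        by (intro sum_mono) auto
      then show ?thesis using e by simp
    qed
    finally show ?thesis by simp
  qed
  finally have "real (card X) * (v * (e/2) ^ n) \<le> v * (e * (real n * 2 ^ n))" using v by simp
  then have "v * (real (card X) * (e/2) ^ n) \<le> v * (e * (real n * 2 ^ n))" by (simp add: mult_ac)
  then have "real (card X) * (e/2) ^ n \<le> e * (real n * 2 ^ n)" using v by simp
  then have "real (card X) * e ^ n \<le> e * (real n * 2 ^ n * 2 ^ n)"
    by (simp add: power_divide field_simps)
  moreover have "n = Suc (n - 1)" using n by simp
  then have "e ^ n = e * e ^ (n - 1)" by (metis power_Suc)
  ultimately have "e * (real (card X) * e ^ (n - 1)) \<le> e * (real n * 2 ^ n * 2 ^ n)"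
    by (simp add: mult_ac)
  then show ?thesis using e by (simp add: n_def power_add[symmetric] mult_2 mult.assoc)
qed

text \<open>Closed balls of radius \<delta>/2 about a separated net have diameter \<delta>, and
  their number times (\<delta>/2)^d is bounded independently of \<delta>. Scales above 1 follow
  because the content decreases in \<delta>.\<close>

lemma hausdorff_outer_measure_sphere_finite:
  "hausdorff_outer_measure (DIM('a) - 1) (sphere (0::'a::euclidean_space) 1) < \<infinity>"
proof -
  define d where "d = DIM('a) - 1"
  define B where "B = real DIM('a) * 2 ^ (2 * DIM('a))"
  define v where "v = unit_ball_vol (real d)"
  have v: "v > 0" by (simp add: v_def)
  have le1: "hausdorff_content d \<delta> (sphere (0::'a) 1) \<le> ennreal (v * B)" if \<delta>: "0 < \<delta>" "\<delta> \<le> 1" for \<delta>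
  proof -
    define e where "e = \<delta> / 2"
    have e: "0 < e" "e \<le> 1" using \<delta> by (auto simp: e_def)
    have card: "card X \<le> nat \<lfloor>B / e ^ d\<rfloor>" if "X \<subseteq> sphere (0::'a) 1" "finite X"
      "\<And>x y. x \<in> X \<Longrightarrow> y \<in> X \<Longrightarrow> x \<noteq> y \<Longrightarrow> e \<le> dist x y" for X
    proof -
      have "real (card X) \<le> B / e ^ d"
        using sphere_separated_card[OF e that] e by (simp add: B_def d_def field_simps)
      then show ?thesis by linarith
    qed
    obtain X where X: "X \<subseteq> sphere (0::'a) 1" "finite X" "sphere 0 1 \<subseteq> (\<Union>x\<in>X. ball x e)"
      and sep: "\<And>x y. x \<in> X \<Longrightarrow> y \<in> X \<Longrightarrow> x \<noteq> y \<Longrightarrow> e \<le> dist x y"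
      by (rule separated_net[of e "sphere (0::'a) 1" "nat \<lfloor>B / e ^ d\<rfloor>"]) (use e card in auto)
    have bX: "real (card X) * e ^ d \<le> B"
      using sphere_separated_card[OF e X(1,2) sep] by (simp add: B_def d_def)
    obtain h where h: "bij_betw h {..<card X} X" using X(2)
      by (metis bij_betw_from_nat_into_finite)
    \<comment> \<open>Covers are indexed by all naturals; padding with empty sets is free because
      these count 0.\<close>
    define C where "C = (\<lambda>i. if i < card X then cball (h i) e else {})"
    have diam: "diameter (C i) \<le> \<delta>" "bounded (C i)" for i
      using e by (auto simp: C_def diameter_cball e_def)
    have "sphere 0 1 \<subseteq> (\<Union>i. C i)"
    proof
      fix s assume "s \<in> sphere (0::'a) 1"
      then obtain x where x: "x \<in> X" "dist x s < e" using X(3) by auto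
      have "x \<in> h ` {..<card X}" using bij_betw_imp_surj_on[OF h] x(1) by simp
      then obtain i where "i < card X" "h i = x" by auto
      then show "s \<in> (\<Union>i. C i)" using x by (auto simp: C_def intro!: exI[of _ i])
    qed
    then have "hausdorff_content d \<delta> (sphere (0::'a) 1) \<le>
      (\<Sum>i. if C i = {} then 0 else ennreal (unit_ball_vol (real d) * (diameter (C i) / 2) ^ d))"
      unfolding hausdorff_content_def using diam by (intro INF_lower) auto
    also have "\<dots> = (\<Sum>i<card X. if C i = {} then 0 else ennreal (unit_ball_vol (real d) * (diameter (C i) / 2) ^ d))"
      by (intro suminf_finite) (auto simp: C_def)
    also have "\<dots> \<le> (\<Sum>i<card X. ennreal (v * e ^ d))"
    proof (intro sum_mono)
      fix i
      have "(diameter (C i) / 2) ^ d \<le> e ^ d"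
        using diam[of i] diameter_ge_0[of "C i"] by (intro power_mono) (auto simp: e_def)
      then show "(if C i = {} then 0 else ennreal (unit_ball_vol (real d) * (diameter (C i) / 2) ^ d)) \<le> ennreal (v * e ^ d)"
        using v by (auto simp: v_def intro!: ennreal_leI mult_left_mono)
    qed
    also have "\<dots> = ennreal (real (card X) * (v * e ^ d))"
      using v e by (simp add: ennreal_mult ennreal_of_nat_eq_real_of_nat)
    also have "\<dots> \<le> ennreal (v * B)"
      using bX v by (intro ennreal_leI) (simp add: mult.left_commute)
    finally show ?thesis .
  qed
  have "hausdorff_outer_measure d (sphere (0::'a) 1) \<le> ennreal (v * B)"
    unfolding hausdorff_outer_measure_def
  proof (rule SUP_least)
    fix \<delta> :: real assume "\<delta> \<in> {0<..}"
    then have "hausdorff_content d \<delta> (sphere (0::'a) 1) \<le> hausdorff_content d (min \<delta> 1) (sphere (0::'a) 1)"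
      by (intro hausdorff_content_antimono) auto
    also have "\<dots> \<le> ennreal (v * B)" using \<open>\<delta> \<in> {0<..}\<close> by (intro le1) auto
    finally show "hausdorff_content d \<delta> (sphere (0::'a) 1) \<le> ennreal (v * B)" .
  qed
  then show ?thesis unfolding d_def using le_less_trans by force
qed

text \<open>Cones turn a covering of the sphere into a covering of an annulus, whose volume bounds the
  Hausdorff measure from below. Each cone is covered by about \<open>1/e\<close> balls centred on its axis.\<close>

lemma cone_cover:
  fixes w0 :: "'a::euclidean_space"
  assumes e: "0 < e" "e \<le> 1" and w0: "norm w0 = 1"
  obtains U where "U \<in> sets borel"
    "\<And>t w. 1 \<le> t \<Longrightarrow> t \<le> 2 \<Longrightarrow> norm w = 1 \<Longrightarrow> dist w w0 \<le> e \<Longrightarrow> t *\<^sub>R w \<in> U"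
    "emeasure lborel U \<le> ennreal (2 * 3 ^ DIM('a) * unit_ball_vol (real DIM('a)) * e ^ (DIM('a) - 1))"
proof -
  define n where "n = DIM('a)"
  have n: "n \<ge> 1" by (simp add: n_def DIM_positive Suc_leI)
  define m where "m = nat \<lfloor>1 / e\<rfloor>"
  \<comment> \<open>The centres 1 + k e run along the axis from 1 to at most 2. The radius 3 e
    consists of 2 e for turning \<open>w\<close> into \<open>w0\<close> at a distance t <= 2 from
    the origin, and e for rounding t down to a centre.\<close>
  define U where "U = (\<Union>k\<le>m. cball ((1 + real k * e) *\<^sub>R w0) (3 * e))"
  show ?thesis
  proof
    show "U \<in> sets borel" unfolding U_def by auto
    fix t :: real and w :: 'a assume t: "1 \<le> t" "t \<le> 2" and w: "norm w = 1" "dist w w0 \<le> e"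
    define k where "k = nat \<lfloor>(t - 1) / e\<rfloor>"
    have "(t - 1) / e \<ge> 0" "(t - 1) / e \<le> 1 / e" using t e by (auto intro!: divide_right_mono)
    then have k: "real k \<le> (t - 1) / e" "(t - 1) / e < real k + 1" "k \<le> m"
      unfolding k_def m_def by (auto simp: nat_mono floor_mono)
    have "real k * e \<le> t - 1" "t - 1 < real k * e + e"
      using k e by (auto simp: field_simps)
    then have tk: "\<bar>t - (1 + real k * e)\<bar> \<le> e" by auto
    have "t *\<^sub>R w - (1 + real k * e) *\<^sub>R w0 = t *\<^sub>R (w - w0) + (t - (1 + real k * e)) *\<^sub>R w0"
      by (simp add: algebra_simps)
    then have "norm (t *\<^sub>R w - (1 + real k * e) *\<^sub>R w0) \<le> \<bar>t\<bar> * dist w w0 + \<bar>t - (1 + real k * e)\<bar> * 1"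
      using norm_triangle_ineq[of "t *\<^sub>R (w - w0)" "(t - (1 + real k * e)) *\<^sub>R w0"] w0
      by (simp add: dist_norm)
    also have "\<dots> \<le> 2 * e + e"
      using t w tk e by (intro add_mono mult_mono) auto
    finally have "t *\<^sub>R w \<in> cball ((1 + real k * e) *\<^sub>R w0) (3 * e)"
      by (simp add: dist_norm norm_minus_commute)
    then show "t *\<^sub>R w \<in> U" unfolding U_def using k(3) by blast
  next
    have "emeasure lborel U \<le> (\<Sum>k\<le>m. emeasure lborel (cball ((1 + real k * e) *\<^sub>R w0) (3 * e)))"
      unfolding U_def by (intro emeasure_subadditive_finite) auto
    also have "\<dots> = (\<Sum>k\<le>m. ennreal (unit_ball_vol (real n) * (3 * e) ^ n))"
      using e by (simp add: emeasure_cball n_def)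
    also have "\<dots> = ennreal (real (Suc m) * (unit_ball_vol (real n) * (3 * e) ^ n))"
      using e by (subst ennreal_mult) (auto simp: ennreal_of_nat_eq_real_of_nat)
    also have "\<dots> \<le> ennreal (2 * 3 ^ n * unit_ball_vol (real n) * e ^ (n - 1))"
    proof (rule ennreal_leI)
      have "real m \<le> 1 / e" using e by (simp add: m_def)
      then have "real (Suc m) * e \<le> 2" using e by (simp add: field_simps)
      then have "(real (Suc m) * e) * (3 ^ n * unit_ball_vol (real n) * e ^ (n - 1)) \<le>
        2 * (3 ^ n * unit_ball_vol (real n) * e ^ (n - 1))"
        using e by (intro mult_right_mono) auto
      moreover have "n = Suc (n - 1)" using n by simp
      then have "e ^ n = e * e ^ (n - 1)" by (metis power_Suc)
      then have "(3 * e) ^ n = 3 ^ n * (e * e ^ (n - 1))"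
        by (simp add: power_mult_distrib)
      ultimately show "real (Suc m) * (unit_ball_vol (real n) * (3 * e) ^ n) \<le>
        2 * 3 ^ n * unit_ball_vol (real n) * e ^ (n - 1)" by (simp add: mult_ac)
    qed
    finally show "emeasure lborel U \<le> ennreal (2 * 3 ^ DIM('a) * unit_ball_vol (real DIM('a)) * e ^ (DIM('a) - 1))"
      by (simp add: n_def)
  qed
qed

lemma hausdorff_outer_measure_sphere_pos:
  assumes dim: "DIM('a::euclidean_space) \<ge> 2"
  shows "0 < hausdorff_outer_measure (DIM('a) - 1) (sphere (0::'a) 1)"
proof -
  define n where "n = DIM('a)"
  define d where "d = n - 1"
  have d: "d \<ge> 1" using dim by (simp add: d_def n_def)
  define v where "v = unit_ball_vol (real d)"
  define K where "K = 2 * 3 ^ n * unit_ball_vol (real n)"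
  \<comment> \<open>v (diam/2)^d = c diam^d, so K/c converts the Hausdorff weight of a set into the
    volume bound for its cone.\<close>
  define c where "c = v / 2 ^ d"
  have pos: "v > 0" "K > 0" "c > 0" by (auto simp: v_def K_def c_def)
  define A where "A = cball (0::'a) 2 - ball 0 1"
  define a where "a = measure lborel A"
  have "a = measure lborel (cball (0::'a) 2) - measure lborel (ball (0::'a) 1)"
    unfolding a_def A_def by (intro measure_Diff) (auto simp: emeasure_cball emeasure_ball)
  also have "\<dots> = unit_ball_vol (real n) * (2 ^ n - 1)"
    by (simp add: content_ball content_cball n_def algebra_simps)
  finally have a: "a > 0" using dim by (simp add: n_def)
  have eA: "emeasure lborel A = ennreal a"
    unfolding a_def by (rule emeasure_eq_measure2) (auto simp: A_def intro!: lborel_fmeasurable_bounded)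
  \<comment> \<open>The padding of the radii below costs a total volume 2 K e; this is kept to at
    most half of the annulus.\<close>
  define e where "e = min 1 (a / (4 * K))"
  have e: "0 < e" "e \<le> 1" "2 * K * e \<le> a / 2" using a pos by (auto simp: e_def min_def field_simps)
  \<comment> \<open>The outer measure is a supremum over scales, so one scale suffices; scale 1 also
    keeps the radii within the range of \<open>cone_cover\<close>.\<close>
  have low: "ennreal (a * c / (2 * K)) \<le> hausdorff_content d 1 (sphere (0::'a) 1)"
    unfolding hausdorff_content_def
  proof (rule INF_greatest, clarsimp)
    fix C :: "nat \<Rightarrow> 'a set"
    assume cov: "sphere 0 1 \<subseteq> (\<Union>i. C i)" and C: "\<forall>i. bounded (C i) \<and> diameter (C i) \<le> 1"
    define g where "g = (\<lambda>i. if C i = {} then 0 else ennreal (v * (diameter (C i) / 2) ^ d))"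
    have "\<exists>U. U \<in> sets borel \<and> (\<forall>t w. 1 \<le> t \<longrightarrow> t \<le> 2 \<longrightarrow> norm w = 1 \<longrightarrow> w \<in> C i \<longrightarrow> t *\<^sub>R w \<in> U) \<and>
        emeasure lborel U \<le> ennreal (K / c) * g i + ennreal (K * e * (1/2) ^ i)" for i
    proof (cases "C i \<inter> sphere 0 1 = {}")
      case True
      then show ?thesis by (intro exI[of _ "{}"]) auto
    next
      case False
      then obtain w0 where w0: "w0 \<in> C i" "norm w0 = 1" by auto
      \<comment> \<open>A covering set may be a single point, whereas the cone needs a positive
        radius: each radius is raised to at least the geometrically small \<theta>. As d >= 1 and
        \<theta> <= 1, the d-th power of \<theta> is at most \<theta>.\<close>
      define \<theta> where "\<theta> = e * (1/2) ^ i"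
      have \<theta>: "0 < \<theta>" "\<theta> \<le> 1"
        using e by (auto simp: \<theta>_def intro!: mult_le_one power_le_one)
      define \<eta> where "\<eta> = max (diameter (C i)) \<theta>"
      have \<eta>: "0 < \<eta>" "\<eta> \<le> 1" using \<theta> C by (auto simp: \<eta>_def)
      have dg: "0 \<le> diameter (C i)" using C by (simp add: diameter_ge_0)
      obtain U where U: "U \<in> sets borel"
        "\<And>t w. 1 \<le> t \<Longrightarrow> t \<le> 2 \<Longrightarrow> norm w = 1 \<Longrightarrow> dist w w0 \<le> \<eta> \<Longrightarrow> t *\<^sub>R w \<in> U"
        "emeasure lborel U \<le> ennreal (K * \<eta> ^ d)"
        using cone_cover[OF \<eta> w0(2)] unfolding K_def n_def d_def by metis
      have "\<theta> ^ d \<le> \<theta> ^ 1" using \<theta> d by (intro power_decreasing) auto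
      then have "\<eta> ^ d \<le> diameter (C i) ^ d + \<theta>"
        using \<theta> zero_le_power[OF dg, of d] by (auto simp: \<eta>_def max_def)
      then have "K * \<eta> ^ d \<le> K * (diameter (C i) ^ d + \<theta>)" using pos by simp
      also have "\<dots> = (K / c) * (v * (diameter (C i) / 2) ^ d) + K * \<theta>"
        using pos by (simp add: c_def power_divide field_simps)
      finally have "ennreal (K * \<eta> ^ d) \<le> ennreal ((K / c) * (v * (diameter (C i) / 2) ^ d) + K * \<theta>)"
        by (rule ennreal_leI)
      also have "\<dots> = ennreal (K / c) * g i + ennreal (K * e * (1/2) ^ i)"
      proof -
        have "g i = ennreal (v * (diameter (C i) / 2) ^ d)" using w0 by (auto simp: g_def)
        then have "ennreal (K / c) * g i = ennreal ((K / c) * (v * (diameter (C i) / 2) ^ d))"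
          using pos dg by (metis divide_nonneg_pos ennreal_mult' less_imp_le)
        moreover have "K * \<theta> = K * e * (1/2) ^ i" by (simp add: \<theta>_def)
        ultimately show ?thesis
          using pos dg \<theta> by (subst ennreal_plus) (auto simp: mult.assoc)
      qed
      finally have "emeasure lborel U \<le> ennreal (K / c) * g i + ennreal (K * e * (1/2) ^ i)"
        using U(3) by simp
      moreover have "t *\<^sub>R w \<in> U" if "1 \<le> t" "t \<le> 2" "norm w = 1" "w \<in> C i" for t w
      proof (rule U(2)[OF that(1-3)])
        have "dist w w0 \<le> diameter (C i)" using diameter_bounded_bound[of "C i" w w0] C that w0 by auto
        then show "dist w w0 \<le> \<eta>" by (simp add: \<eta>_def)
      qed
      ultimately show ?thesis using U(1) by blast
    qed
    then obtain U where U: "\<And>i. U i \<in> sets borel"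
        "\<And>i t w. 1 \<le> t \<Longrightarrow> t \<le> 2 \<Longrightarrow> norm w = 1 \<Longrightarrow> w \<in> C i \<Longrightarrow> t *\<^sub>R w \<in> U i"
        "\<And>i. emeasure lborel (U i) \<le> ennreal (K / c) * g i + ennreal (K * e * (1/2) ^ i)"
      by metis
    have "A \<subseteq> (\<Union>i. U i)"
    proof
      fix x assume "x \<in> A"
      then have x: "1 \<le> norm x" "norm x \<le> 2" by (auto simp: A_def)
      define w where "w = x /\<^sub>R norm x"
      have "norm x \<noteq> 0" using x by linarith
      then have w: "norm w = 1" "x = norm x *\<^sub>R w" by (auto simp: w_def)
      then obtain i where "w \<in> C i" using cov by auto
      then have "norm x *\<^sub>R w \<in> U i" using U(2) x w by blast
      then show "x \<in> (\<Union>i. U i)" using w(2) by auto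
    qed
    then have "emeasure lborel A \<le> emeasure lborel (\<Union>i. U i)"
      using U(1) by (intro emeasure_mono) auto
    also have "\<dots> \<le> (\<Sum>i. emeasure lborel (U i))"
      using U(1) by (intro emeasure_subadditive_countably) auto
    also have "\<dots> \<le> (\<Sum>i. ennreal (K / c) * g i + ennreal (K * e * (1/2) ^ i))"
      by (intro suminf_le U(3)) auto
    also have "\<dots> = ennreal (K / c) * (\<Sum>i. g i) + (\<Sum>i. ennreal (K * e * (1/2) ^ i))"
      by (simp add: suminf_add[symmetric])
    also have "(\<Sum>i. ennreal (K * e * (1/2) ^ i)) = ennreal (\<Sum>i. K * e * (1/2) ^ i)"
      using pos e by (intro suminf_ennreal2) (auto intro!: summable_mult summable_geometric)
    also have "(\<Sum>i. K * e * (1/2) ^ i) = 2 * K * e"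
      by (subst suminf_mult) (auto simp: suminf_geometric intro!: summable_geometric)
    finally have main: "ennreal a \<le> ennreal (K / c) * (\<Sum>i. g i) + ennreal (2 * K * e)"
      by (simp add: eA)
    show "ennreal (a * c / (2 * K)) \<le> (\<Sum>i. if C i = {} then 0 else ennreal (unit_ball_vol (real d) * (diameter (C i) / 2) ^ d))"
    proof (cases "(\<Sum>i. g i) = top")
      case True
      then show ?thesis unfolding g_def v_def by simp
    next
      case False
      then obtain s where s: "s \<ge> 0" "(\<Sum>i. g i) = ennreal s" by (metis ennreal_cases)
      have "ennreal (K / c * s + 2 * K * e) = ennreal (K / c * s) + ennreal (2 * K * e)"
        using s pos e by (intro ennreal_plus) auto
      also have "ennreal (K / c * s) = ennreal (K / c) * ennreal s"
        using s pos by (intro ennreal_mult) auto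
      finally have "ennreal a \<le> ennreal (K / c * s + 2 * K * e)"
        using main s(2) by simp
      then have "a \<le> K / c * s + 2 * K * e"
        using s pos e by (subst (asm) ennreal_le_iff) auto
      then have "a / 2 \<le> K / c * s" using e by linarith
      then have "a * c / (2 * K) \<le> s" using pos by (simp add: field_simps)
      then have "ennreal (a * c / (2 * K)) \<le> (\<Sum>i. g i)"
        unfolding s(2) by (rule ennreal_leI)
      then show ?thesis unfolding g_def v_def by simp
    qed
  qed
  have "0 < ennreal (a * c / (2 * K))" using a pos by simp
  also have "\<dots> \<le> hausdorff_content d 1 (sphere (0::'a) 1)" by (rule low)
  also have "\<dots> \<le> hausdorff_outer_measure d (sphere (0::'a) 1)"
    unfolding hausdorff_outer_measure_def by (intro SUP_upper) auto
  finally show ?thesis by (simp add: d_def n_def)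
qed

section \<open>The surface measure as a finite, nonzero Borel measure\<close>

lemma space_sphere_measure [simp]: "space (sphere_measure :: 'a::euclidean_space measure) = sphere 0 1"
  by (simp add: sphere_measure_def space_restrict_space)

lemma emeasure_sphere_measure_space:
  "emeasure (sphere_measure :: 'a::euclidean_space measure) (sphere 0 1) =
    hausdorff_outer_measure (DIM('a) - 1) (sphere (0::'a) 1)"
  unfolding sphere_measure_def
  by (subst emeasure_restrict_space) (auto simp: emeasure_hausdorff_measure)

lemma finite_sphere_measure: "finite_measure (sphere_measure :: 'a::euclidean_space measure)"
  using hausdorff_outer_measure_sphere_finite[where 'a = 'a]
  by (intro finite_measureI) (simp add: emeasure_sphere_measure_space less_top)

lemma measure_sphere_measure_pos:
  assumes "DIM('a::euclidean_space) \<ge> 2"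
  shows "0 < measure (sphere_measure :: 'a measure) (sphere 0 1)"
proof -
  interpret finite_measure "sphere_measure :: 'a measure" by (rule finite_sphere_measure)
  have "0 < emeasure (sphere_measure :: 'a measure) (sphere 0 1)"
    unfolding emeasure_sphere_measure_space by (rule hausdorff_outer_measure_sphere_pos[OF assms])
  then show ?thesis by (simp add: emeasure_eq_measure)
qed

lemma sets_sphere_measure: "sets (sphere_measure :: 'a::euclidean_space measure) = sets (restrict_space borel (sphere 0 1))"
  unfolding sphere_measure_def by (intro sets_restrict_space_cong) simp

lemma continuous_on_sphere_measurable:
  fixes f :: "'a::euclidean_space \<Rightarrow> 'b::topological_space"
  assumes "continuous_on (sphere 0 1) f"
  shows "f \<in> borel_measurable sphere_measure"
  using borel_measurable_continuous_on_restrict[OF assms]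
  by (simp add: measurable_cong_sets[OF sets_sphere_measure refl])

section \<open>Weak limits\<close>

text \<open>Dyadic convex combinations of the tail from m. Midpoints are enough because the
  convexity defect compares two functions with their midpoint.\<close>

inductive_set midpoint_hull :: "(nat \<Rightarrow> 'b \<Rightarrow> complex) \<Rightarrow> nat \<Rightarrow> ('b \<Rightarrow> complex) set"
  for f m where
  base: "m \<le> n \<Longrightarrow> f n \<in> midpoint_hull f m"
| mid: "g \<in> midpoint_hull f m \<Longrightarrow> h \<in> midpoint_hull f m \<Longrightarrow>
    (\<lambda>x. (1/2) * (g x + h x)) \<in> midpoint_hull f m"

lemma midpoint_hull_antimono: "m \<le> m' \<Longrightarrow> midpoint_hull f m' \<subseteq> midpoint_hull f m"
proof
  fix g assume "m \<le> m'" "g \<in> midpoint_hull f m'"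
  from this(2,1) show "g \<in> midpoint_hull f m"
  proof (induction rule: midpoint_hull.induct)
    case (base n)
    then show ?case by (intro midpoint_hull.base) simp
  next
    case (mid g h)
    then show ?case by (intro midpoint_hull.mid)
  qed
qed

lemma midpoint_hull_lnorm:
  assumes "1 < p" "\<And>n. f n \<in> lpow M p" "\<And>n. lnorm M p (f n) \<le> K" "g \<in> midpoint_hull f m"
  shows "g \<in> lpow M p \<and> lnorm M p g \<le> K"
  using assms(4)
proof (induction rule: midpoint_hull.induct)
  case (mid g h)
  have "lnorm M p (\<lambda>x. (1/2) * (g x + h x)) = (1/2) * lnorm M p (\<lambda>x. g x + h x)"
    using lnorm_scale[of p M "1/2" "\<lambda>x. g x + h x"] assms(1) by simp
  also have "\<dots> \<le> (1/2) * (K + K)"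
    using lnorm_triangle[OF assms(1), of g M h] mid by (intro mult_left_mono) auto
  finally show ?case using mid assms(1) lpow_scale[OF lpow_add[OF assms(1)], of g M h "1/2"] by auto
qed (use assms in auto)

text \<open>The pairing with g is linear and closed discs around \<open>L\<close> are convex, so a
  bound on the tail passes to its hull.\<close>

lemma midpoint_hull_integral:
  assumes pq: "1 < p" "1 < q" "1 / p + 1 / q = 1"
    and f: "\<And>n. f n \<in> lpow M p" and g: "g \<in> lpow M q"
    and near: "\<And>n. m \<le> n \<Longrightarrow> norm ((\<integral>x. f n x * g x \<partial>M) - L) \<le> e" and h: "h \<in> midpoint_hull f m"
  shows "h \<in> lpow M p \<and> norm ((\<integral>x. h x * g x \<partial>M) - L) \<le> e"
  using h
proof (induction rule: midpoint_hull.induct)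
  case (mid h k)
  have hk: "(\<lambda>x. (1/2) * (h x + k x)) \<in> lpow M p"
    using mid pq by (intro lpow_scale lpow_add) auto
  have "(\<integral>x. (1/2) * (h x + k x) * g x \<partial>M) = (1/2) * ((\<integral>x. h x * g x \<partial>M) + (\<integral>x. k x * g x \<partial>M))"
    using lpow_mult_integrable[OF pq _ g, of h] lpow_mult_integrable[OF pq _ g, of k] mid
    by (simp add: distrib_right add_divide_distrib)
  then have "(\<integral>x. (1/2) * (h x + k x) * g x \<partial>M) - L =
      (1/2) * (((\<integral>x. h x * g x \<partial>M) - L) + ((\<integral>x. k x * g x \<partial>M) - L))"
    by (simp add: field_simps)
  also have "norm \<dots> \<le> (1/2) * (e + e)"
    unfolding norm_mult using mid norm_triangle_le[of "(\<integral>x. h x * g x \<partial>M) - L" "(\<integral>x. k x * g x \<partial>M) - L" "e + e"]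
    by (intro mult_mono) auto
  finally show ?case using hk by simp
qed (use assms in auto)

lemma lnorm_tendsto_integral:
  assumes pq: "1 < p" "1 < q" "1 / p + 1 / q = 1"
    and f: "\<And>n. f n \<in> lpow M p" and g: "g \<in> lpow M p"
    and lim: "(\<lambda>n. lnorm M p (\<lambda>x. f n x - g x)) \<longlonglongrightarrow> 0" and h: "h \<in> lpow M q"
  shows "(\<lambda>n. \<integral>x. f n x * h x \<partial>M) \<longlonglongrightarrow> (\<integral>x. g x * h x \<partial>M)"
proof (rule LIM_zero_cancel, rule tendsto_norm_zero_cancel)
  have le: "norm ((\<integral>x. f n x * h x \<partial>M) - (\<integral>x. g x * h x \<partial>M)) \<le>
      lnorm M p (\<lambda>x. f n x - g x) * lnorm M q h" for n
  proof -
    have "(\<integral>x. f n x * h x \<partial>M) - (\<integral>x. g x * h x \<partial>M) = (\<integral>x. (f n x - g x) * h x \<partial>M)"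
      using lpow_mult_integrable[OF pq f h] lpow_mult_integrable[OF pq g h]
      by (simp add: left_diff_distrib)
    then show ?thesis using Holder[OF pq lpow_diff[OF pq(1) f g] h] by simp
  qed
  show "(\<lambda>n. norm ((\<integral>x. f n x * h x \<partial>M) - (\<integral>x. g x * h x \<partial>M))) \<longlonglongrightarrow> 0"
  proof (rule tendsto_sandwich[OF _ _ tendsto_const])
    show "(\<lambda>n. lnorm M p (\<lambda>x. f n x - g x) * lnorm M q h) \<longlonglongrightarrow> 0"
      using tendsto_mult[OF lim tendsto_const, of "lnorm M q h"] by simp
  qed (use le in auto)
qed

text \<open>The weak limit is the strong limit of midpoint combinations of nearly minimal norm, so that
  no representation theorem for the dual of \<open>L\<^sup>p\<close> is needed.\<close>

lemma (in finite_measure) weak_limit_exists: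
  fixes f :: "nat \<Rightarrow> 'a \<Rightarrow> complex"
  assumes pq: "1 < p" "1 < q" "1 / p + 1 / q = 1"
    and f: "\<And>n. f n \<in> lpow M p" and K: "\<And>n. lnorm M p (f n) \<le> K"
  obtains \<phi> where "\<phi> \<in> lpow M p" "lnorm M p \<phi> \<le> K"
    "\<And>g L. g \<in> lpow M q \<Longrightarrow> (\<lambda>n. \<integral>x. f n x * g x \<partial>M) \<longlonglongrightarrow> L \<Longrightarrow> (\<integral>x. \<phi> x * g x \<partial>M) = L"
proof -
  define I where "I = (\<lambda>g :: 'a \<Rightarrow> complex. \<integral>x. norm (g x) powr p \<partial>M)"
  define H where "H = midpoint_hull f"
  have K0: "0 \<le> K" using K[of 0] lnorm_nonneg order_trans by blast
  have Hl: "g \<in> lpow M p" "lnorm M p g \<le> K" if "g \<in> H m" for g m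
    using midpoint_hull_lnorm[OF pq(1) f K] that by (auto simp: H_def)
  have IK: "I g \<le> K powr p" "0 \<le> I g" if "g \<in> H m" for g m
    using Hl[OF that] lnorm_le_iff[of p K M g] pq K0 by (auto simp: I_def)
  \<comment> \<open>The hulls shrink as m grows, so these infima increase; being bounded by K^p they
    converge.\<close>
  define D where "D = (\<lambda>m. Inf (I ` H m))"
  have ne: "H m \<noteq> {}" for m using midpoint_hull.base[of m m f] by (auto simp: H_def)
  have bb: "bdd_below (I ` H m)" for m using IK by (auto intro!: bdd_belowI[of _ 0])
  have DI: "D m \<le> I g" if "g \<in> H m" for g m
    unfolding D_def using that bb by (intro cInf_lower) auto
  have Dm: "D m \<le> D m'" if "m \<le> m'" for m m'
    unfolding D_def using midpoint_hull_antimono[OF that, of f] ne bb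
    by (intro cInf_superset_mono) (auto simp: H_def)
  have DK: "D m \<le> K powr p" for m
    using ne[of m] DI IK(1) by (meson ex_in_conv order_trans)
  have "incseq D" using Dm by (auto simp: incseq_def)
  then obtain Dl where Dl: "D \<longlonglongrightarrow> Dl" "\<And>m. D m \<le> Dl"
    using incseq_convergent[of D "K powr p"] DK by blast
  have "\<exists>g. g \<in> H m \<and> I g < D m + 1 / real (Suc m)" for m
  proof -
    have "\<exists>y\<in>I ` H m. y < D m + 1 / real (Suc m)"
      unfolding D_def by (rule cInf_lessD) (use ne in auto)
    then show ?thesis by auto
  qed
  then obtain g where g: "\<And>m. g m \<in> H m" "\<And>m. I (g m) < D m + 1 / real (Suc m)" by metis
  have gl: "g m \<in> lpow M p" for m using Hl(1)[OF g(1)] .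
  have cauchy: "\<exists>N. \<forall>m\<ge>N. \<forall>n\<ge>N. lnorm M p (\<lambda>x. g m x - g n x) < e" if "e > 0" for e
  proof -
    define e' where "e' = (e/2) powr p"
    have e': "e' > 0" using that by (simp add: e'_def)
    \<comment> \<open>Makes the \<epsilon> part of the defect inequality at most e'/2, as both
      energies are at most K^p; the added 1 covers K = 0.\<close>
    define \<epsilon> where "\<epsilon> = e' / (4 * (K powr p + 1))"
    have \<epsilon>: "\<epsilon> > 0" unfolding \<epsilon>_def using e' by (intro divide_pos_pos) (auto simp: add_nonneg_pos)
    obtain C where C: "C > 0" "\<And>M f g. f \<in> lpow M p \<Longrightarrow> g \<in> lpow M p \<Longrightarrow>
        (\<integral>x. norm (f x - g x) powr p \<partial>M) \<le>
        \<epsilon> * ((\<integral>x. norm (f x) powr p \<partial>M) + (\<integral>x. norm (g x) powr p \<partial>M)) +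
        C * (((\<integral>x. norm (f x) powr p \<partial>M) + (\<integral>x. norm (g x) powr p \<partial>M)) / 2 -
           (\<integral>x. norm ((1/2) * (f x + g x :: complex)) powr p \<partial>(M :: 'a measure)))"
      using lpow_defect[OF pq(1) \<epsilon>] by blast
    have "(\<lambda>m. C * (Dl - D m + 1 / real (Suc m))) \<longlonglongrightarrow> C * (Dl - Dl + 0)"
      by (intro tendsto_intros Dl LIMSEQ_Suc lim_1_over_n)
    then have "\<forall>\<^sub>F m in sequentially. C * (Dl - D m + 1 / real (Suc m)) < e' / 2"
      using e' by (intro order_tendstoD(2)) auto
    then obtain N where N: "C * (Dl - D N + 1 / real (Suc N)) < e' / 2"
      by (auto simp: eventually_sequentially)
    have "lnorm M p (\<lambda>x. g m x - g n x) < e" if mn: "N \<le> m" "N \<le> n" for m n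
    proof -
      have I1: "I (g k) \<le> Dl + 1 / real (Suc N)" if "N \<le> k" for k
      proof -
        have "1 / real (Suc k) \<le> 1 / real (Suc N)" using that by (intro divide_left_mono) auto
        then show ?thesis using g(2)[of k] Dl(2)[of k] by linarith
      qed
      \<comment> \<open>The midpoint lies in the hull of the tail from N, so its energy is at least
        \<open>D N\<close>. Since both functions nearly minimise, the convexity defect is small, and
        with it their distance.\<close>
      have "(\<lambda>x. (1/2) * (g m x + g n x)) \<in> H N"
        using g(1)[of m] g(1)[of n] midpoint_hull_antimono[of N m f] midpoint_hull_antimono[of N n f] mn
        unfolding H_def by (intro midpoint_hull.mid) auto
      from DI[OF this] have I2: "D N \<le> I (\<lambda>x. (1/2) * (g m x + g n x))" .
      have "I (\<lambda>x. g m x - g n x) \<le> \<epsilon> * (I (g m) + I (g n)) +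
          C * ((I (g m) + I (g n)) / 2 - I (\<lambda>x. (1/2) * (g m x + g n x)))"
        unfolding I_def by (rule C(2)[OF gl gl])
      also have "\<dots> \<le> \<epsilon> * (K powr p + K powr p) + C * (Dl - D N + 1 / real (Suc N))"
      proof (rule add_mono)
        show "\<epsilon> * (I (g m) + I (g n)) \<le> \<epsilon> * (K powr p + K powr p)"
          using \<epsilon> IK(1)[OF g(1)] by (intro mult_left_mono add_mono) auto
        have "(I (g m) + I (g n)) / 2 - I (\<lambda>x. (1/2) * (g m x + g n x)) \<le> Dl - D N + 1 / real (Suc N)"
        proof -
          have "(a + b) / 2 - y \<le> c - d + u" if "a \<le> c + u" "b \<le> c + u" "d \<le> y" for a b c d u y :: real
            using that by (simp add: field_simps)
          from this[OF I1[OF mn(1)] I1[OF mn(2)] I2] show ?thesis .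
        qed
        then show "C * ((I (g m) + I (g n)) / 2 - I (\<lambda>x. (1/2) * (g m x + g n x))) \<le> C * (Dl - D N + 1 / real (Suc N))"
          using C(1) by simp
      qed
      also have "\<epsilon> * (K powr p + K powr p) \<le> e' / 2"
      proof -
        have "\<epsilon> * (K powr p + K powr p) \<le> \<epsilon> * (2 * (K powr p + 1))" using \<epsilon> by simp
        also have "\<dots> = e' / 2"
        proof -
          have "K powr p + 1 \<noteq> 0" using powr_ge_zero[of K p] by linarith
          then show ?thesis unfolding \<epsilon>_def by (simp add: field_simps)
        qed
        finally show ?thesis .
      qed
      finally have "I (\<lambda>x. g m x - g n x) \<le> e'" using N by linarith
      then have "I (\<lambda>x. g m x - g n x) \<le> (e/2) powr p" by (simp only: e'_def)
      then have "lnorm M p (\<lambda>x. g m x - g n x) \<le> e/2"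
        using pq that \<open>e > 0\<close> by (subst lnorm_le_iff) (auto simp: I_def)
      then show ?thesis using \<open>e > 0\<close> by simp
    qed
    then show ?thesis by blast
  qed
  obtain \<phi> where \<phi>: "\<phi> \<in> lpow M p" "(\<lambda>n. lnorm M p (\<lambda>x. g n x - \<phi> x)) \<longlonglongrightarrow> 0"
    using lpow_complete[OF pq(1) gl cauchy] by blast
  have "lnorm M p \<phi> \<le> K"
  proof (rule tendsto_lowerbound)
    have "(\<lambda>n. K + lnorm M p (\<lambda>x. g n x - \<phi> x)) \<longlonglongrightarrow> K + 0"
      by (intro tendsto_intros \<phi>(2))
    then show "(\<lambda>n. K + lnorm M p (\<lambda>x. g n x - \<phi> x)) \<longlonglongrightarrow> K" by simp
    show "\<forall>\<^sub>F n in sequentially. lnorm M p \<phi> \<le> K + lnorm M p (\<lambda>x. g n x - \<phi> x)"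
    proof (intro always_eventually allI)
      fix n
      show "lnorm M p \<phi> \<le> K + lnorm M p (\<lambda>x. g n x - \<phi> x)"
        using lnorm_diff_triangle[OF pq(1) \<phi>(1) gl, of n] Hl(2)[OF g(1), of n]
        unfolding lnorm_minus_commute[of M p \<phi>] by linarith
    qed
  qed simp
  moreover have "(\<integral>x. \<phi> x * \<psi> x \<partial>M) = L"
    if \<psi>: "\<psi> \<in> lpow M q" and L: "(\<lambda>n. \<integral>x. f n x * \<psi> x \<partial>M) \<longlonglongrightarrow> L" for \<psi> L
  proof (rule LIMSEQ_unique)
    show "(\<lambda>n. \<integral>x. g n x * \<psi> x \<partial>M) \<longlonglongrightarrow> (\<integral>x. \<phi> x * \<psi> x \<partial>M)"
      by (rule lnorm_tendsto_integral[OF pq gl \<phi> \<psi>])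
    show "(\<lambda>n. \<integral>x. g n x * \<psi> x \<partial>M) \<longlonglongrightarrow> L"
    proof (rule LIMSEQ_I)
      fix e :: real assume "e > 0"
      then obtain m where m: "\<And>n. m \<le> n \<Longrightarrow> norm ((\<integral>x. f n x * \<psi> x \<partial>M) - L) \<le> e / 2"
        using LIMSEQ_D[OF L, of "e / 2"] by (auto intro: less_imp_le)
      have "norm ((\<integral>x. g n x * \<psi> x \<partial>M) - L) < e" if "m \<le> n" for n
      proof -
        have "g n \<in> midpoint_hull f m"
          using g(1)[of n] midpoint_hull_antimono[OF that, of f] by (auto simp: H_def)
        then have "norm ((\<integral>x. g n x * \<psi> x \<partial>M) - L) \<le> e / 2"
          using midpoint_hull_integral[where f = f and m = m, OF pq f \<psi> m] by blast
        then show ?thesis using \<open>e > 0\<close> by linarith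
      qed
      then show "\<exists>no. \<forall>n\<ge>no. norm ((\<integral>x. g n x * \<psi> x \<partial>M) - L) < e" by blast
    qed
  qed
  ultimately show ?thesis using that[OF \<phi>(1)] by blast
qed

text \<open>A quantitative Radon-Riesz property. Pairing with the dual function of \<phi> bounds the
  norm of (f n + \<phi>)/2 from below by nearly 1, so the convexity defect is small.
  \<open>\<eta>\<close> is available before the sequence and its weak limit are known.\<close>

lemma weak_limit_close:
  assumes pq: "1 < p" "1 < q" "1 / p + 1 / q = 1" and "0 < \<epsilon>"
  obtains \<eta> where "0 < \<eta>" "\<And>f \<phi>. (\<And>n. f n \<in> lpow M p) \<Longrightarrow> (\<And>n. lnorm M p (f n) \<le> 1) \<Longrightarrow>
      \<phi> \<in> lpow M p \<Longrightarrow> 1 - \<eta> \<le> lnorm M p \<phi> \<Longrightarrow> lnorm M p \<phi> \<le> 1 \<Longrightarrow>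
      (\<And>g. g \<in> lpow M q \<Longrightarrow> (\<lambda>n. \<integral>x. f n x * g x \<partial>M) \<longlonglongrightarrow> (\<integral>x. \<phi> x * g x \<partial>M)) \<Longrightarrow>
      \<forall>\<^sub>F n in sequentially. lnorm M p (\<lambda>x. f n x - \<phi> x) < \<epsilon>"
proof -
  define e where "e = (\<epsilon> / 2) powr p"
  have e: "e > 0" using \<open>0 < \<epsilon>\<close> by (simp add: e_def)
  then have "e / 4 > 0" by simp
  from lpow_defect[OF pq(1) this] obtain C where C: "C > 0"
    "\<And>(M :: 'a measure) f g. f \<in> lpow M p \<Longrightarrow> g \<in> lpow M p \<Longrightarrow>
        (\<integral>x. norm (f x - g x) powr p \<partial>M) \<le>
        e / 4 * ((\<integral>x. norm (f x) powr p \<partial>M) + (\<integral>x. norm (g x) powr p \<partial>M)) +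
        C * (((\<integral>x. norm (f x) powr p \<partial>M) + (\<integral>x. norm (g x) powr p \<partial>M)) / 2 -
           (\<integral>x. norm ((1/2) * (f x + g x)) powr p \<partial>M))" by blast
  \<comment> \<open>(1 - \<eta>)^p bounds the pairing of \<phi> with its dual function from below;
    subtracting \<eta> leaves a strict margin for passing from the limit to large n.\<close>
  define b where "b = (\<lambda>\<eta>. (1 - \<eta>) powr p - \<eta>)"
  have b: "(b \<longlongrightarrow> 1) (at_right 0)"
  proof -
    have "((\<lambda>\<eta>. (1 - \<eta>) powr p - \<eta>) \<longlongrightarrow> (1 - 0) powr p - 0) (at_right 0)"
      by (intro tendsto_intros) auto
    then show ?thesis by (simp add: b_def)
  qed
  have "((\<lambda>\<eta>. C * (1 - b \<eta> powr p)) \<longlongrightarrow> C * (1 - 1 powr p)) (at_right 0)"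
    by (intro tendsto_intros b) auto
  then have "\<forall>\<^sub>F \<eta> in at_right 0. C * (1 - b \<eta> powr p) < e / 4"
    using e by (intro order_tendstoD(2)) auto
  moreover have "\<forall>\<^sub>F \<eta> in at_right 0. 0 < b \<eta>"
    using b by (intro order_tendstoD(1)) auto
  moreover have "\<forall>\<^sub>F \<eta> :: real in at_right 0. \<eta> < 1" "\<forall>\<^sub>F \<eta> :: real in at_right 0. 0 < \<eta>"
    using eventually_at_right_real[of 0 "1::real"] by (auto elim: eventually_mono)
  ultimately have "\<forall>\<^sub>F \<eta> in at_right 0. C * (1 - b \<eta> powr p) < e / 4 \<and> 0 < b \<eta> \<and> \<eta> < 1 \<and> 0 < \<eta>"
    by eventually_elim auto
  then obtain \<eta> where \<eta>: "C * (1 - b \<eta> powr p) < e / 4" "0 < b \<eta>" "\<eta> < 1" "0 < \<eta>"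
    using eventually_happens by fastforce
  show ?thesis
  proof (rule that[OF \<eta>(4)])
    fix f \<phi>
    assume f: "\<And>n. f n \<in> lpow M p" "\<And>n. lnorm M p (f n) \<le> 1"
      and \<phi>: "\<phi> \<in> lpow M p" "1 - \<eta> \<le> lnorm M p \<phi>" "lnorm M p \<phi> \<le> 1"
      and weak: "\<And>g. g \<in> lpow M q \<Longrightarrow> (\<lambda>n. \<integral>x. f n x * g x \<partial>M) \<longlonglongrightarrow> (\<integral>x. \<phi> x * g x \<partial>M)"
    define g where "g = (\<lambda>x. cnj (\<phi> x) * of_real (norm (\<phi> x) powr (p - 2)))"
    have g: "g \<in> lpow M q" "(\<integral>x. norm (g x) powr q \<partial>M) = (\<integral>x. norm (\<phi> x) powr p \<partial>M)"
      "(\<integral>x. \<phi> x * g x \<partial>M) = of_real (\<integral>x. norm (\<phi> x) powr p \<partial>M)"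
      unfolding g_def by (rule lpow_dual[OF pq \<phi>(1)])+
    have I1: "(\<integral>x. norm (h x) powr p \<partial>M) \<le> 1" if "lnorm M p h \<le> 1" for h
      using that lnorm_le_iff[of p 1 M h] pq by simp
    have "lnorm M q g powr q \<le> 1"
      using g(2) I1[OF \<phi>(3)] pq by (simp add: lnorm_powr)
    then have ng: "lnorm M q g \<le> 1"
      using pq by (metis gr_one_powr less_trans not_less zero_less_one)
    have "(\<lambda>n. (1/2) * ((\<integral>x. f n x * g x \<partial>M) + (\<integral>x. \<phi> x * g x \<partial>M))) \<longlonglongrightarrow>
        (1/2) * ((\<integral>x. \<phi> x * g x \<partial>M) + (\<integral>x. \<phi> x * g x \<partial>M))"
      by (intro tendsto_intros weak g(1))
    then have "(\<lambda>n. norm ((1/2) * ((\<integral>x. f n x * g x \<partial>M) + (\<integral>x. \<phi> x * g x \<partial>M)))) \<longlonglongrightarrow>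
        norm ((1/2) * ((\<integral>x. \<phi> x * g x \<partial>M) + (\<integral>x. \<phi> x * g x \<partial>M)))"
      by (rule tendsto_norm)
    moreover have "norm ((1/2) * ((\<integral>x. \<phi> x * g x \<partial>M) + (\<integral>x. \<phi> x * g x \<partial>M))) = lnorm M p \<phi> powr p"
      using pq by (simp add: g(3) lnorm_powr)
    moreover have "lnorm M p \<phi> powr p > b \<eta>"
    proof -
      have "(1 - \<eta>) powr p \<le> lnorm M p \<phi> powr p"
        using \<phi> \<eta> pq by (intro powr_mono2) auto
      then show ?thesis using \<eta> by (simp add: b_def)
    qed
    ultimately have "\<forall>\<^sub>F n in sequentially. b \<eta> < norm ((1/2) * ((\<integral>x. f n x * g x \<partial>M) + (\<integral>x. \<phi> x * g x \<partial>M)))"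
      by (intro order_tendstoD(1)) auto
    then show "\<forall>\<^sub>F n in sequentially. lnorm M p (\<lambda>x. f n x - \<phi> x) < \<epsilon>"
    proof eventually_elim
      case (elim n)
      let ?h = "\<lambda>x. (1/2) * (f n x + \<phi> x)"
      have h: "?h \<in> lpow M p" using pq by (intro lpow_scale lpow_add f \<phi>) auto
      have "(1/2) * ((\<integral>x. f n x * g x \<partial>M) + (\<integral>x. \<phi> x * g x \<partial>M)) = (\<integral>x. ?h x * g x \<partial>M)"
        using lpow_mult_integrable[OF pq f(1) g(1), of n] lpow_mult_integrable[OF pq \<phi>(1) g(1)]
        by (simp add: distrib_right add_divide_distrib)
      with elim have "b \<eta> < norm (\<integral>x. ?h x * g x \<partial>M)" by metis
      also have "\<dots> \<le> lnorm M p ?h * lnorm M q g" by (rule Holder[OF pq h g(1)])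
      also have "\<dots> \<le> lnorm M p ?h" using ng by (intro mult_left_le) auto
      finally have "b \<eta> powr p \<le> lnorm M p ?h powr p" using \<eta> pq by (intro powr_mono2) auto
      then have low: "b \<eta> powr p \<le> (\<integral>x. norm (?h x) powr p \<partial>M)"
        using pq by (subst (asm) lnorm_powr) auto
      let ?a = "\<integral>x. norm (f n x) powr p \<partial>M" and ?b = "\<integral>x. norm (\<phi> x) powr p \<partial>M"
      have ab: "?a \<le> 1" "?b \<le> 1" using I1[OF f(2)] I1[OF \<phi>(3)] by auto
      have "(\<integral>x. norm (f n x - \<phi> x) powr p \<partial>M) \<le> e / 4 * (?a + ?b) +
          C * ((?a + ?b) / 2 - (\<integral>x. norm (?h x) powr p \<partial>M))"
        by (rule C(2)[OF f(1) \<phi>(1)])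
      also have "\<dots> \<le> e / 4 * 2 + C * (1 - b \<eta> powr p)"
      proof -
        have "(?a + ?b) / 2 - (\<integral>x. norm (?h x) powr p \<partial>M) \<le> 1 - b \<eta> powr p"
          using ab low by (simp only: add_divide_distrib)
        then show ?thesis using ab e C(1) by (intro add_mono mult_left_mono) auto
      qed
      also have "\<dots> \<le> e" using \<eta>(1) e by simp
      finally have "lnorm M p (\<lambda>x. f n x - \<phi> x) \<le> \<epsilon> / 2"
        using \<open>0 < \<epsilon>\<close> pq by (subst lnorm_le_iff) (auto simp: e_def)
      then show ?case using \<open>0 < \<epsilon>\<close> by linarith
    qed
  qed
qed

section \<open>Density of trigonometric polynomials\<close>

text \<open>Pairing with these sums reads off values of \<open>extension_op\<close>, so pointwise
  convergence of extensions tests weak convergence. They are smooth, hence after normalisation also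
  competitors in \<open>extension_norm\<close>.\<close>

inductive_set trig_poly :: "('a::euclidean_space \<Rightarrow> complex) set" where
  trig_poly_exp: "(\<lambda>w. c * cis (x \<bullet> w)) \<in> trig_poly"
| trig_poly_add: "f \<in> trig_poly \<Longrightarrow> g \<in> trig_poly \<Longrightarrow> (\<lambda>w. f w + g w) \<in> trig_poly"

lemma trig_poly_const: "(\<lambda>w. c) \<in> trig_poly"
  using trig_poly_exp[of c 0] by simp

lemma trig_poly_mult:
  assumes "f \<in> trig_poly" "g \<in> trig_poly"
  shows "(\<lambda>w. f w * g w) \<in> trig_poly"
  using assms(1)
proof induction
  case (trig_poly_exp c x)
  show ?case using assms(2)
  proof induction
    case (trig_poly_exp c' x')
    have "(\<lambda>w. c * cis (x \<bullet> w) * (c' * cis (x' \<bullet> w))) = (\<lambda>w. (c * c') * cis ((x + x') \<bullet> w))"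
      by (simp add: fun_eq_iff inner_add_left cis_mult[symmetric] mult_ac)
    then show ?case using trig_poly.trig_poly_exp[of "c * c'" "x + x'"] by simp
  qed (auto simp: distrib_left intro: trig_poly_add)
qed (auto simp: distrib_right intro: trig_poly_add)

lemma trig_poly_continuous: "f \<in> trig_poly \<Longrightarrow> continuous_on A f"
  by (induction rule: trig_poly.induct) (auto intro!: continuous_intros)

lemma trig_poly_bounded: "f \<in> trig_poly \<Longrightarrow> \<exists>C. \<forall>w. norm (f w) \<le> C"
proof (induction rule: trig_poly.induct)
  case (trig_poly_add f g)
  then obtain C D where "\<forall>w. norm (f w) \<le> C" "\<forall>w. norm (g w) \<le> D" by auto
  then have "\<forall>w. norm (f w + g w) \<le> C + D" by (auto intro: norm_triangle_mono)
  then show ?case by blast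
qed (auto simp: norm_mult)

lemma trig_poly_measurable: "f \<in> trig_poly \<Longrightarrow> f \<in> borel_measurable sphere_measure"
  by (intro continuous_on_sphere_measurable trig_poly_continuous)

lemma trig_poly_derivative:
  assumes "f \<in> trig_poly"
  obtains D where "\<And>w. (f has_derivative D w) (at w)" "\<And>v. (\<lambda>w. D w v) \<in> trig_poly"
proof -
  have "\<exists>D. (\<forall>w. (f has_derivative D w) (at w)) \<and> (\<forall>v. (\<lambda>w. D w v) \<in> trig_poly)"
    using assms
  proof induction
    case (trig_poly_exp c x)
    let ?D = "\<lambda>w v. (c * (\<i> * of_real (x \<bullet> v))) * cis (x \<bullet> w)"
    have "((\<lambda>w. c * cis (x \<bullet> w)) has_derivative ?D w) (at w)" for w
      by (rule derivative_eq_intros refl | simp)+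
         (simp add: fun_eq_iff scaleR_conv_of_real mult_ac)
    then show ?case using trig_poly.trig_poly_exp by (intro exI[of _ ?D]) auto
  next
    case (trig_poly_add f g)
    then obtain D E where "\<forall>w. (f has_derivative D w) (at w)" "\<forall>v. (\<lambda>w. D w v) \<in> trig_poly"
        "\<forall>w. (g has_derivative E w) (at w)" "\<forall>v. (\<lambda>w. E w v) \<in> trig_poly" by blast
    then show ?case
      by (intro exI[of _ "\<lambda>w v. D w v + E w v"]) (auto intro: has_derivative_add trig_poly.trig_poly_add)
  qed
  then show ?thesis using that by blast
qed

text \<open>Directional derivatives are again trigonometric polynomials, so the induction on k
  closes.\<close>

lemma trig_poly_Ck: "f \<in> trig_poly \<Longrightarrow> Ck_on k U f"
proof (induction k arbitrary: f)
  case 0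
  then show ?case by (simp add: trig_poly_continuous)
next
  case (Suc k)
  obtain D where D: "\<And>w. (f has_derivative D w) (at w)" "\<And>v. (\<lambda>w. D w v) \<in> trig_poly"
    using trig_poly_derivative[OF Suc.prems] by blast
  have "frechet_derivative f (at w) = D w" for w
    using frechet_derivative_at[OF D(1)] by simp
  then show ?case using D Suc.IH by (auto intro: differentiableI)
qed

lemma trig_poly_smooth: "f \<in> trig_poly \<Longrightarrow> smooth_on_sphere f"
  unfolding smooth_on_sphere_def by (intro exI[of _ UNIV] exI[of _ f]) (auto intro: trig_poly_Ck)

lemma trig_poly_sin: "(\<lambda>w. complex_of_real (sin (x \<bullet> w))) \<in> trig_poly"
proof -
  have "(\<lambda>w. complex_of_real (sin (x \<bullet> w))) = (\<lambda>w. (- \<i> / 2) * cis (x \<bullet> w) + (\<i> / 2) * cis ((- x) \<bullet> w))"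
    by (auto simp: fun_eq_iff complex_eq_iff)
  then show ?thesis by (simp only: trig_poly_exp trig_poly_add)
qed

lemma trig_poly_approx_real:
  fixes f :: "'a::euclidean_space \<Rightarrow> real"
  assumes "continuous_on (sphere 0 1) f" "0 < e"
  obtains g where "(\<lambda>w. complex_of_real (g w)) \<in> trig_poly" "\<And>w. w \<in> sphere 0 1 \<Longrightarrow> \<bar>f w - g w\<bar> < e"
proof -
  let ?P = "\<lambda>g :: 'a \<Rightarrow> real. (\<lambda>w. complex_of_real (g w)) \<in> trig_poly"
  have "\<exists>g. ?P g \<and> (\<forall>w\<in>sphere 0 1. \<bar>f w - g w\<bar> < e)"
  proof (rule Stone_Weierstrass_HOL)
    show "continuous_on (sphere 0 1) g" if "?P g" for g
    proof -
      have "continuous_on (sphere 0 1) (\<lambda>w. Re (complex_of_real (g w)))"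
        by (intro continuous_on_Re trig_poly_continuous that)
      then show ?thesis by simp
    qed
    show "?P (\<lambda>x. g x + h x)" "?P (\<lambda>x. g x * h x)" if "?P g \<and> ?P h" for g h
      using trig_poly_add[of "\<lambda>w. of_real (g w)" "\<lambda>w. of_real (h w)"]
        trig_poly_mult[of "\<lambda>w. of_real (g w)" "\<lambda>w. of_real (h w)"] that by auto
    show "\<exists>g. ?P g \<and> g x \<noteq> g y" if xy: "x \<in> sphere 0 1 \<and> y \<in> sphere 0 1 \<and> x \<noteq> y" for x y
    proof (intro exI conjI)
      \<comment> \<open>The factor 1/2 keeps |z . w| <= 1 on the sphere, inside the interval where
        the sine increases, while z . x - z . y = |x - y|^2 / 2 is positive.\<close>
      define z where "z = (1/2) *\<^sub>R (x - y)"
      show "?P (\<lambda>w. sin (z \<bullet> w))" by (rule trig_poly_sin)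
      have "norm z \<le> 1" using norm_triangle_ineq4[of x y] xy by (simp add: z_def)
      then have b: "\<bar>z \<bullet> w\<bar> \<le> 1" if "norm w = 1" for w
        using Cauchy_Schwarz_ineq2[of z w] that by simp
      have "z \<bullet> x - z \<bullet> y = (1/2) * (norm (x - y))\<^sup>2"
        by (simp add: z_def power2_norm_eq_inner inner_diff_right)
      then have "z \<bullet> y < z \<bullet> x" using xy by (smt (verit) norm_eq_zero right_minus_eq zero_less_power2 mult_pos_pos divide_pos_pos)
      then have "sin (z \<bullet> y) < sin (z \<bullet> x)"
        using b[of x] b[of y] xy pi_gt3 by (intro sin_monotone_2pi) auto
      then show "sin (z \<bullet> x) \<noteq> sin (z \<bullet> y)" by simp
    qed
  qed (use assms trig_poly_const in auto)
  then show ?thesis using that by blast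
qed

lemma trig_poly_approx_continuous:
  fixes f :: "'a::euclidean_space \<Rightarrow> complex"
  assumes "continuous_on (sphere 0 1) f" "0 < e"
  obtains g where "g \<in> trig_poly" "\<And>w. w \<in> sphere 0 1 \<Longrightarrow> norm (f w - g w) < e"
proof -
  have "e / 2 > 0" using assms by simp
  obtain g1 where g1: "(\<lambda>w. complex_of_real (g1 w)) \<in> trig_poly"
      "\<And>w. w \<in> sphere 0 1 \<Longrightarrow> \<bar>Re (f w) - g1 w\<bar> < e / 2"
    using trig_poly_approx_real[OF continuous_on_Re[OF assms(1)] \<open>e / 2 > 0\<close>] by blast
  obtain g2 where g2: "(\<lambda>w. complex_of_real (g2 w)) \<in> trig_poly"
      "\<And>w. w \<in> sphere 0 1 \<Longrightarrow> \<bar>Im (f w) - g2 w\<bar> < e / 2"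
    using trig_poly_approx_real[OF continuous_on_Im[OF assms(1)] \<open>e / 2 > 0\<close>] by blast
  show ?thesis
  proof
    show "(\<lambda>w. complex_of_real (g1 w) + \<i> * complex_of_real (g2 w)) \<in> trig_poly"
      by (intro trig_poly_add trig_poly_mult trig_poly_const g1 g2)
    fix w assume w: "w \<in> sphere (0::'a) 1"
    have "norm (f w - (complex_of_real (g1 w) + \<i> * complex_of_real (g2 w))) \<le>
        \<bar>Re (f w) - g1 w\<bar> + \<bar>Im (f w) - g2 w\<bar>"
      using cmod_le[of "f w - (complex_of_real (g1 w) + \<i> * complex_of_real (g2 w))"] by simp
    then show "norm (f w - (complex_of_real (g1 w) + \<i> * complex_of_real (g2 w))) < e"
      using g1(2)[OF w] g2(2)[OF w] by linarith
  qed
qed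

section \<open>The norm closure of the trigonometric polynomials\<close>

definition trig_closure :: "real \<Rightarrow> ('a::euclidean_space \<Rightarrow> complex) set" where
  "trig_closure p = {f \<in> lpow sphere_measure p.
     \<forall>e>0. \<exists>g\<in>trig_poly. lnorm sphere_measure p (\<lambda>w. f w - g w) < e}"

context
  fixes p :: real
  assumes p: "1 < p"
begin

interpretation finite_measure "sphere_measure :: 'a::euclidean_space measure"
  by (rule finite_sphere_measure)

lemma trig_poly_lpow:
  assumes "f \<in> trig_poly" shows "f \<in> lpow sphere_measure p"
proof -
  obtain C where "\<forall>w. norm (f w) \<le> C" using trig_poly_bounded[OF assms] by blast
  then show ?thesis
    using lpow_bounded[OF trig_poly_measurable[OF assms], of C p] p by auto
qed

lemma trig_closure_lpow: "f \<in> trig_closure p \<Longrightarrow> f \<in> lpow sphere_measure p"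
  by (simp add: trig_closure_def)

lemma trig_closure_limit:
  assumes f: "f \<in> lpow sphere_measure p"
    and app: "\<And>e. 0 < e \<Longrightarrow> \<exists>g\<in>trig_closure p. lnorm sphere_measure p (\<lambda>w. f w - g w) < e"
  shows "f \<in> trig_closure p"
  unfolding trig_closure_def
proof (intro CollectI conjI f allI impI)
  fix e :: real assume "e > 0"
  then obtain g where g: "g \<in> trig_closure p" "lnorm sphere_measure p (\<lambda>w. f w - g w) < e / 2"
    using app[of "e / 2"] by auto
  then obtain h where h: "h \<in> trig_poly" "lnorm sphere_measure p (\<lambda>w. g w - h w) < e / 2"
    using \<open>e > 0\<close> unfolding trig_closure_def by (auto dest: spec[of _ "e / 2"])
  have "lnorm sphere_measure p (\<lambda>w. f w - h w) \<le> lnorm sphere_measure p (\<lambda>w. f w - g w) + lnorm sphere_measure p (\<lambda>w. g w - h w)"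
    by (intro lnorm_triangle3 p f trig_closure_lpow g trig_poly_lpow h)
  with g(2) h(2) have "lnorm sphere_measure p (\<lambda>w. f w - h w) < e" by linarith
  with h(1) show "\<exists>g\<in>trig_poly. lnorm sphere_measure p (\<lambda>w. f w - g w) < e" by blast
qed

lemma trig_poly_closure: "f \<in> trig_poly \<Longrightarrow> f \<in> trig_closure p"
  using trig_poly_lpow by (auto simp: trig_closure_def intro!: bexI[of _ f])

lemma trig_closure_add:
  assumes f: "f \<in> trig_closure p" and g: "g \<in> trig_closure p"
  shows "(\<lambda>w. f w + g w) \<in> trig_closure p"
  unfolding trig_closure_def
proof (intro CollectI conjI lpow_add p trig_closure_lpow f g allI impI)
  fix e :: real assume "e > 0"
  obtain h where h: "h \<in> trig_poly" "lnorm sphere_measure p (\<lambda>w. f w - h w) < e / 2"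
    using \<open>e > 0\<close> f unfolding trig_closure_def by (auto dest: spec[of _ "e / 2"])
  obtain k where k: "k \<in> trig_poly" "lnorm sphere_measure p (\<lambda>w. g w - k w) < e / 2"
    using \<open>e > 0\<close> g unfolding trig_closure_def by (auto dest: spec[of _ "e / 2"])
  have "lnorm sphere_measure p (\<lambda>w. (f w - h w) + (g w - k w)) \<le>
      lnorm sphere_measure p (\<lambda>w. f w - h w) + lnorm sphere_measure p (\<lambda>w. g w - k w)"
    by (intro lnorm_triangle p lpow_diff trig_closure_lpow f g trig_poly_lpow h k)
  moreover have "(\<lambda>w. (f w - h w) + (g w - k w)) = (\<lambda>w. (f w + g w) - (h w + k w))"
    by (simp add: fun_eq_iff)
  ultimately have "lnorm sphere_measure p (\<lambda>w. (f w + g w) - (h w + k w)) < e"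
    using h(2) k(2) by simp
  then show "\<exists>h\<in>trig_poly. lnorm sphere_measure p (\<lambda>w. f w + g w - h w) < e"
    using trig_poly_add[OF h(1) k(1)] by (intro bexI[of _ "\<lambda>w. h w + k w"])
qed

lemma trig_closure_scale:
  assumes f: "f \<in> trig_closure p"
  shows "(\<lambda>w. c * f w) \<in> trig_closure p"
  unfolding trig_closure_def
proof (intro CollectI conjI lpow_scale trig_closure_lpow f allI impI)
  fix e :: real assume "e > 0"
  then have "e / (norm c + 1) > 0" by (intro divide_pos_pos) (auto simp: add_nonneg_pos)
  then obtain h where h: "h \<in> trig_poly" "lnorm sphere_measure p (\<lambda>w. f w - h w) < e / (norm c + 1)"
    using f unfolding trig_closure_def by blast
  have "lnorm sphere_measure p (\<lambda>w. c * (f w - h w)) = norm c * lnorm sphere_measure p (\<lambda>w. f w - h w)"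
    using p by (intro lnorm_scale) auto
  also have "\<dots> \<le> (norm c + 1) * lnorm sphere_measure p (\<lambda>w. f w - h w)"
    by (intro mult_right_mono) auto
  also have "\<dots> < (norm c + 1) * (e / (norm c + 1))"
    using h(2) by (intro mult_strict_left_mono) (auto simp: add_nonneg_pos)
  also have "\<dots> = e"
  proof -
    have "norm c + 1 \<noteq> 0" using norm_ge_zero[of c] by linarith
    then show ?thesis by simp
  qed
  finally have "lnorm sphere_measure p (\<lambda>w. c * f w - c * h w) < e" by (simp add: right_diff_distrib)
  then show "\<exists>h\<in>trig_poly. lnorm sphere_measure p (\<lambda>w. c * f w - h w) < e"
    using trig_poly_mult[OF trig_poly_const h(1)] by (intro bexI[of _ "\<lambda>w. c * h w"])
qed (use p in auto)

lemma trig_closure_continuous: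
  fixes f :: "'a::euclidean_space \<Rightarrow> complex"
  assumes "continuous_on (sphere 0 1) f"
  shows "f \<in> trig_closure p"
proof (rule trig_closure_limit)
  have m: "f \<in> borel_measurable sphere_measure" by (rule continuous_on_sphere_measurable[OF assms])
  have "bounded (f ` sphere 0 1)" by (intro compact_imp_bounded compact_continuous_image assms) simp
  then obtain C where "\<forall>w\<in>sphere 0 1. norm (f w) \<le> C" by (auto simp: bounded_iff)
  then show fl: "f \<in> lpow sphere_measure p"
    using m p by (intro lpow_bounded[of _ C]) auto
  fix e :: real assume "e > 0"
  define A where "A = lnorm sphere_measure p (\<lambda>w::'a. 1)"
  have "e / (A + 1) > 0" using \<open>e > 0\<close> by (intro divide_pos_pos) (auto simp: add_nonneg_pos A_def)
  then obtain g where g: "g \<in> trig_poly" "\<And>w. w \<in> sphere 0 1 \<Longrightarrow> norm (f w - g w) < e / (A + 1)"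
    using trig_poly_approx_continuous[OF assms] by blast
  have "lnorm sphere_measure p (\<lambda>w. f w - g w) \<le> e / (A + 1) * A"
  proof -
    have "(\<integral>w. norm (f w - g w) powr p \<partial>sphere_measure) \<le> (\<integral>w. (e / (A + 1)) powr p * (norm (1::complex) powr p) \<partial>(sphere_measure :: 'a measure))"
    proof (rule integral_mono)
      show "integrable sphere_measure (\<lambda>w. norm (f w - g w) powr p)"
        by (intro lpow_integrable lpow_diff p fl trig_poly_lpow g)
      show "norm (f w - g w) powr p \<le> (e / (A + 1)) powr p * (norm (1::complex) powr p)" if "w \<in> space sphere_measure" for w
        using g(2)[of w] that p by (auto intro!: powr_mono2)
    qed simp
    also have "\<dots> = (e / (A + 1)) powr p * A powr p"
      unfolding A_def using p by (subst lnorm_powr) auto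
    also have "\<dots> = (e / (A + 1) * A) powr p" by (rule powr_mult[symmetric])
    finally have *: "(\<integral>w. norm (f w - g w) powr p \<partial>sphere_measure) \<le> (e / (A + 1) * A) powr p" .
    have "0 \<le> e / (A + 1) * A"
      using \<open>e / (A + 1) > 0\<close> by (intro mult_nonneg_nonneg) (auto simp: A_def)
    from lnorm_le_iff[THEN iffD2, OF _ this *] p show ?thesis by simp
  qed
  also have "\<dots> < e"
  proof -
    have "A + 1 > 0" by (auto simp: add_nonneg_pos A_def)
    then show ?thesis using \<open>e > 0\<close> by (simp add: field_simps)
  qed
  finally show "\<exists>g\<in>trig_closure p. lnorm sphere_measure p (\<lambda>w. f w - g w) < e"
    using trig_poly_closure[OF g(1)] by blast
qed

lemma trig_closure_bounded_limit:
  fixes f :: "'a::euclidean_space \<Rightarrow> complex"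
  assumes u: "\<And>n. u n \<in> trig_closure p" and f: "f \<in> borel_measurable sphere_measure"
    and lim: "\<And>w. norm w = 1 \<Longrightarrow> (\<lambda>n. u n w) \<longlonglongrightarrow> f w" and b: "\<And>n w. norm w = 1 \<Longrightarrow> norm (u n w) \<le> 1"
  shows "f \<in> trig_closure p"
proof (rule trig_closure_limit)
  have [measurable]: "u n \<in> borel_measurable sphere_measure" "f \<in> borel_measurable sphere_measure" for n
    using trig_closure_lpow[OF u, of n] f by (auto simp: lpow_def)
  have fb: "norm (f w) \<le> 1" if "norm w = 1" for w
    using tendsto_norm[OF lim[OF that]] b[OF that] by (intro LIMSEQ_le_const2[of "\<lambda>n. norm (u n w)"]) auto
  show "f \<in> lpow sphere_measure p" using fb p by (intro lpow_bounded[of _ 1]) auto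
  fix e :: real assume "e > 0"
  have "(\<lambda>n. \<integral>w. norm (f w - u n w) powr p \<partial>sphere_measure) \<longlonglongrightarrow> (\<integral>w. 0 \<partial>(sphere_measure :: 'a measure))"
  proof (rule integral_dominated_convergence)
    show "integrable sphere_measure (\<lambda>w::'a. 2 powr p)" by simp
    show "AE w in sphere_measure. (\<lambda>n. norm (f w - u n w) powr p) \<longlonglongrightarrow> 0"
    proof (rule AE_I2)
      fix w :: 'a assume "w \<in> space sphere_measure"
      then have "(\<lambda>n. norm (f w - u n w) powr p) \<longlonglongrightarrow> norm (f w - f w) powr p"
        using lim p by (intro tendsto_powr' tendsto_norm tendsto_diff tendsto_const) auto
      then show "(\<lambda>n. norm (f w - u n w) powr p) \<longlonglongrightarrow> 0" by simp
    qed
    show "AE w in sphere_measure. norm (norm (f w - u n w) powr p) \<le> 2 powr p" for n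
    proof (rule AE_I2)
      fix w :: 'a assume "w \<in> space sphere_measure"
      then have "norm (f w - u n w) \<le> 2"
        using fb[of w] b[of w n] norm_triangle_ineq4[of "f w" "u n w"] by auto
      then show "norm (norm (f w - u n w) powr p) \<le> 2 powr p" using p by (auto intro!: powr_mono2)
    qed
  qed auto
  then have "\<forall>\<^sub>F n in sequentially. (\<integral>w. norm (f w - u n w) powr p \<partial>sphere_measure) < (e/2) powr p"
    using \<open>e > 0\<close> by (intro order_tendstoD(2)) auto
  then obtain n where "(\<integral>w. norm (f w - u n w) powr p \<partial>sphere_measure) < (e/2) powr p"
    by (auto simp: eventually_sequentially)
  then have "lnorm sphere_measure p (\<lambda>w. f w - u n w) \<le> e/2"
    using \<open>e > 0\<close> p by (subst lnorm_le_iff) auto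
  then show "\<exists>g\<in>trig_closure p. lnorm sphere_measure p (\<lambda>w. f w - g w) < e"
    using u \<open>e > 0\<close> by (intro bexI[of _ "u n"]) auto
qed

lemma indicator_measurable_sphere:
  "A \<in> sets borel \<Longrightarrow> (indicator A :: 'a::euclidean_space \<Rightarrow> complex) \<in> borel_measurable sphere_measure"
  unfolding sphere_measure_def by (intro measurable_restrict_space1) auto

text \<open>Induction over the Borel sets, generated by the closed sets. A closed set is reached by
  the cut-offs max 0 (1 - n dist), complements by linearity, disjoint unions by linearity and
  bounded limits.\<close>

lemma trig_closure_indicator:
  fixes A :: "'a::euclidean_space set"
  assumes "A \<in> sets borel"
  shows "(indicator A :: 'a \<Rightarrow> complex) \<in> trig_closure p"
proof -
  have zero0: "(\<lambda>w::'a. 0) \<in> trig_closure p"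
    by (rule trig_poly_closure[OF trig_poly_const])
  then have zero: "(indicator {} :: 'a \<Rightarrow> complex) \<in> trig_closure p"
    by (simp add: indicator_def[abs_def])
  have "Int_stable (Collect closed :: 'a set set)" "(Collect closed :: 'a set set) \<subseteq> Pow UNIV"
    "A \<in> sigma_sets UNIV (Collect closed)"
    using assms by (auto simp: borel_eq_closed Int_stable_def)
  then have "A \<in> sets borel \<and> (indicator A :: 'a \<Rightarrow> complex) \<in> trig_closure p"
  proof (induction rule: sigma_sets_induct_disjoint)
    case (basic F)
    then have F: "closed F" by simp
    show ?case
    proof (intro conjI)
      show "F \<in> sets borel" using F by auto
      show "(indicator F :: 'a \<Rightarrow> complex) \<in> trig_closure p"
      \<comment> \<open>\<open>infdist\<close> to the empty set is 0, so there the cut-offs would be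
        constantly 1 instead of tending to 0.\<close>
      proof (cases "F = {}")
        case True
        then show ?thesis using zero zero0 by simp
      next
        case False
        define u where "u = (\<lambda>n w. complex_of_real (max 0 (1 - real n * infdist w F)))"
        show ?thesis
        proof (rule trig_closure_bounded_limit[of u])
          show "u n \<in> trig_closure p" for n
            unfolding u_def by (intro trig_closure_continuous continuous_intros)
          show "(indicator F :: 'a \<Rightarrow> complex) \<in> borel_measurable sphere_measure"
            using F by (intro indicator_measurable_sphere) auto
          show "norm (u n w) \<le> 1" for n w
            using infdist_nonneg[of w F] by (auto simp: u_def)
          show "(\<lambda>n. u n w) \<longlonglongrightarrow> indicator F w" for w
          proof (cases "w \<in> F")
            case True
            then show ?thesis by (simp add: u_def)
          next
            case w: False
            then have pos: "infdist w F > 0" using F False by (intro infdist_pos_not_in_closed) auto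
            obtain N where N: "1 < real N * infdist w F" using reals_Archimedean3[OF pos] by blast
            have "u n w = 0" if "N \<le> n" for n
            proof -
              have "real N * infdist w F \<le> real n * infdist w F"
                using that pos by (intro mult_right_mono) auto
              then show ?thesis using N by (simp add: u_def)
            qed
            then show ?thesis using w by (intro tendsto_eventually) (auto simp: eventually_sequentially)
          qed
        qed
      qed
    qed
  next
    case empty
    then show ?case using zero zero0 by simp
  next
    case (compl A)
    have "(\<lambda>w. 1 + (- 1) * indicator A w :: complex) \<in> trig_closure p"
      using compl(2) by (intro trig_closure_add[OF trig_poly_closure[OF trig_poly_const] trig_closure_scale]) auto
    moreover have "(\<lambda>w. 1 + (- 1) * indicator A w :: complex) = indicator (UNIV - A)"
      by (auto simp: fun_eq_iff indicator_def)
    ultimately show ?case using compl by auto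
  next
    case (union A)
    have fin: "(indicator (\<Union>i<n. A i) :: 'a \<Rightarrow> complex) \<in> trig_closure p" for n :: nat
    proof (induction n)
      case 0
      then show ?case using zero zero0 by simp
    next
      case (Suc n)
      have "A n \<inter> (\<Union>i<n. A i) = {}"
      proof -
        have "A n \<inter> A i = {}" if "i < n" for i
          using union(1) that by (intro disjoint_family_onD[of A UNIV]) auto
        then show ?thesis by blast
      qed
      then have "(indicator (\<Union>i<Suc n. A i) :: 'a \<Rightarrow> complex) = (\<lambda>w. indicator (A n) w + indicator (\<Union>i<n. A i) w)"
        by (auto simp: fun_eq_iff indicator_def lessThan_Suc)
      then show ?case using trig_closure_add[OF _ Suc.IH] union(3) by auto
    qed
    show ?case
    proof (intro conjI)
      show U: "(\<Union>i. A i) \<in> sets borel" using union(3) by auto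
      show "(indicator (\<Union>i. A i) :: 'a \<Rightarrow> complex) \<in> trig_closure p"
      proof (rule trig_closure_bounded_limit[OF fin])
        show "(\<lambda>n. indicator (\<Union>i<n. A i) w :: complex) \<longlonglongrightarrow> indicator (\<Union>i. A i) w" for w
          by (rule LIMSEQ_indicator_UN)
        show "(indicator (\<Union>i. A i) :: 'a \<Rightarrow> complex) \<in> borel_measurable sphere_measure"
          by (rule indicator_measurable_sphere[OF U])
        show "norm (indicator (\<Union>i<n. A i) w :: complex) \<le> 1" for n w
          by (simp add: indicator_def)
      qed
    qed
  qed
  then show ?thesis by simp
qed

lemma trig_closure_simple:
  fixes s :: "'a::euclidean_space \<Rightarrow> complex"
  assumes "simple_function sphere_measure s"
  shows "s \<in> trig_closure p"
proof -
  let ?S = "sphere (0::'a) 1"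
  have fin: "finite (s ` ?S)" and meas: "s -` {y} \<inter> ?S \<in> sets sphere_measure" if "y \<in> s ` ?S" for y
    using assms that by (auto simp: simple_function_def)
  have fin: "finite (s ` ?S)" using assms by (simp add: simple_function_def)
  have bor: "s -` {y} \<inter> ?S \<in> sets borel" if "y \<in> s ` ?S" for y
    using meas[OF that] unfolding sets_sphere_measure by (auto simp: sets_restrict_space)
  define t where "t = (\<lambda>w. \<Sum>y\<in>s ` ?S. y * indicator (s -` {y} \<inter> ?S) w)"
  have "(\<lambda>w. \<Sum>y\<in>Y. y * indicator (s -` {y} \<inter> ?S) w) \<in> trig_closure p"
    if "finite Y" "Y \<subseteq> s ` ?S" for Y
    using that
  proof (induction Y)
    case empty
    then show ?case using trig_poly_closure[OF trig_poly_const[of 0]] by simp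
  next
    case (insert y Y)
    show ?case
      unfolding sum.insert[OF insert(1,2)]
      by (intro trig_closure_add trig_closure_scale trig_closure_indicator bor) (use insert in auto)
  qed
  from this[OF fin order_refl] have t: "t \<in> trig_closure p" by (simp add: t_def)
  \<comment> \<open>The two agree on the sphere only, as \<open>s\<close> is arbitrary elsewhere;
    they are identified through the seminorm.\<close>
  have st: "s w = t w" if "w \<in> ?S" for w
  proof -
    have "t w = (\<Sum>y\<in>s ` ?S. if y = s w then y else 0)"
      unfolding t_def using that by (intro sum.cong) (auto simp: indicator_def)
    then show ?thesis using that fin by simp
  qed
  show ?thesis
  proof (rule trig_closure_limit)
    show "s \<in> lpow sphere_measure p"
    proof (rule lpow_cong_norm[OF trig_closure_lpow[OF t]])
      show "s \<in> borel_measurable sphere_measure" by (rule borel_measurable_simple_function[OF assms])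
      show "norm (s w) = norm (t w)" if "w \<in> space sphere_measure" for w using st[of w] that by simp
    qed (use p in simp)
    fix e :: real assume "e > 0"
    moreover have "lnorm sphere_measure p (\<lambda>w. s w - t w) = lnorm sphere_measure p (\<lambda>w::'a. 0)"
      using st by (intro lnorm_cong_norm) auto
    ultimately show "\<exists>g\<in>trig_closure p. lnorm sphere_measure p (\<lambda>w. s w - g w) < e"
      using t by (intro bexI[of _ t]) auto
  qed
qed

theorem trig_poly_dense:
  fixes f :: "'a::euclidean_space \<Rightarrow> complex"
  assumes f: "f \<in> lpow sphere_measure p" and "0 < e"
  obtains g where "g \<in> trig_poly" "lnorm sphere_measure p (\<lambda>w. f w - g w) < e"
proof -
  have "f \<in> trig_closure p"
  proof (rule trig_closure_limit[OF f])
    fix e :: real assume "0 < e"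
    then show "\<exists>g\<in>trig_closure p. lnorm sphere_measure p (\<lambda>w. f w - g w) < e"
      using lpow_simple_approx[OF p f] trig_closure_simple by metis
  qed
  then show ?thesis using that \<open>0 < e\<close> unfolding trig_closure_def by blast
qed

end

section \<open>The extension operator\<close>

lemma eLp_norm_eq_lnorm:
  assumes "0 < p" "f \<in> lpow M p"
  shows "eLp_norm M (ennreal p) f = ennreal (lnorm M p f)"
proof -
  have "(\<integral>\<^sup>+x. ennreal (norm (f x) powr p) \<partial>M) = ennreal (\<integral>x. norm (f x) powr p \<partial>M)"
    using lpow_integrable[OF assms(2)] by (intro nn_integral_eq_integral) auto
  then show ?thesis using assms(1) by (simp add: eLp_norm_def lnorm_def Let_def)
qed

lemma Lp_eq_lpow:
  assumes "0 < p"
  shows "Lp M (ennreal p) = lpow M p"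
proof (intro set_eqI iffI)
  fix f :: "'a \<Rightarrow> complex" assume "f \<in> lpow M p"
  then show "f \<in> Lp M (ennreal p)"
    using eLp_norm_eq_lnorm[OF assms, of f M] by (auto simp: Lp_def dest: lpow_measurable)
next
  fix f :: "'a \<Rightarrow> complex" assume f: "f \<in> Lp M (ennreal p)"
  then have [measurable]: "f \<in> borel_measurable M" by (simp add: Lp_def)
  have "(\<integral>\<^sup>+x. ennreal (norm (f x) powr p) \<partial>M) \<noteq> \<infinity>"
    using f assms by (auto simp: Lp_def eLp_norm_def Let_def split: if_splits)
  then have "integrable M (\<lambda>x. norm (f x) powr p)"
    by (intro integrableI_nonneg) (auto simp: less_top)
  then show "f \<in> lpow M p" by (intro lpowI) auto
qed

lemma norm_cis_diff_le: "norm (cis a - cis b) \<le> \<bar>a - b\<bar>"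
proof -
  have "(norm (cis a - cis b))\<^sup>2 = (cos a - cos b)\<^sup>2 + (sin a - sin b)\<^sup>2"
    by (simp add: cmod_power2)
  also have "\<dots> = ((cos a)\<^sup>2 + (sin a)\<^sup>2) + ((cos b)\<^sup>2 + (sin b)\<^sup>2) - 2 * (cos a * cos b + sin a * sin b)"
    by (simp add: power2_eq_square algebra_simps)
  also have "\<dots> = 2 - 2 * cos (a - b)"
    by (simp add: cos_diff)
  also have "\<dots> = 4 * (sin ((a - b) / 2))\<^sup>2"
  proof -
    have "2 * ((a - b) / 2) = a - b" by simp
    then show ?thesis using cos_double_sin[of "(a - b) / 2"] by (simp only:) simp
  qed
  also have "\<dots> \<le> 4 * ((a - b) / 2)\<^sup>2"
    using abs_sin_x_le_abs_x[of "(a - b) / 2"] by (simp only: abs_le_square_iff mult_le_cancel_left) simp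
  also have "\<dots> = \<bar>a - b\<bar>\<^sup>2" by (simp add: power_divide)
  finally show ?thesis by (rule power2_le_imp_le) simp
qed

context
begin

interpretation finite_measure "sphere_measure :: 'a::euclidean_space measure"
  by (rule finite_sphere_measure)

lemma cis_inner_measurable [measurable]:
  "(\<lambda>w. cis (x \<bullet> w)) \<in> borel_measurable (sphere_measure :: 'a::euclidean_space measure)"
  by (intro continuous_on_sphere_measurable continuous_intros)

lemma extension_integrable:
  fixes f :: "'a::euclidean_space \<Rightarrow> complex"
  assumes "integrable sphere_measure f"
  shows "integrable sphere_measure (\<lambda>w. cis (x \<bullet> w) * f w)"
proof (rule Bochner_Integration.integrable_bound[OF assms])
  have [measurable]: "f \<in> borel_measurable sphere_measure" using assms by simp
  show "(\<lambda>w. cis (x \<bullet> w) * f w) \<in> borel_measurable sphere_measure" by measurable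
qed (simp add: norm_mult)

lemma extension_op_bound:
  fixes f :: "'a::euclidean_space \<Rightarrow> complex"
  shows "norm (extension_op f x) \<le> (\<integral>w. norm (f w) \<partial>sphere_measure)"
  using integral_norm_bound[of "sphere_measure :: 'a measure" "\<lambda>w. cis (x \<bullet> w) * f w"]
  by (simp add: extension_op_def norm_mult)

lemma extension_op_Lipschitz:
  fixes f :: "'a::euclidean_space \<Rightarrow> complex"
  assumes "integrable sphere_measure f"
  shows "norm (extension_op f x - extension_op f y) \<le> (\<integral>w. norm (f w) \<partial>sphere_measure) * dist x y"
proof -
  have "extension_op f x - extension_op f y = (\<integral>w. cis (x \<bullet> w) * f w - cis (y \<bullet> w) * f w \<partial>sphere_measure)"
    unfolding extension_op_def by (intro Bochner_Integration.integral_diff[symmetric] extension_integrable assms)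
  also have "norm \<dots> \<le> (\<integral>w. norm (cis (x \<bullet> w) * f w - cis (y \<bullet> w) * f w) \<partial>sphere_measure)"
    by (rule integral_norm_bound)
  also have "\<dots> \<le> (\<integral>w. norm (f w) * dist x y \<partial>sphere_measure)"
  proof (rule integral_mono)
    show "integrable sphere_measure (\<lambda>w. norm (cis (x \<bullet> w) * f w - cis (y \<bullet> w) * f w))"
      by (intro integrable_norm Bochner_Integration.integrable_diff extension_integrable assms)
    show "integrable sphere_measure (\<lambda>w. norm (f w) * dist x y)" using assms by auto
    fix w :: 'a assume "w \<in> space sphere_measure"
    then have w: "norm w = 1" by simp
    have "norm (cis (x \<bullet> w) * f w - cis (y \<bullet> w) * f w) = norm (cis (x \<bullet> w) - cis (y \<bullet> w)) * norm (f w)"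
      by (simp add: norm_mult[symmetric] left_diff_distrib)
    also have "\<dots> \<le> dist x y * norm (f w)"
    proof (rule mult_right_mono)
      have "\<bar>x \<bullet> w - y \<bullet> w\<bar> \<le> dist x y"
        using Cauchy_Schwarz_ineq2[of "x - y" w] w by (simp add: inner_diff_left dist_norm)
      then show "norm (cis (x \<bullet> w) - cis (y \<bullet> w)) \<le> dist x y"
        using norm_cis_diff_le order_trans by blast
    qed simp
    finally show "norm (cis (x \<bullet> w) * f w - cis (y \<bullet> w) * f w) \<le> norm (f w) * dist x y"
      by (simp add: mult.commute)
  qed
  finally show ?thesis by simp
qed

text \<open>Modulation turns into translation. It changes neither the norm of f nor that of its
  extension, so it is the noncompact symmetry that the points x_n have to undo.\<close>

lemma extension_op_modulate: "extension_op (\<lambda>w. cis (y \<bullet> w) * f w) x = extension_op f (x + y)"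
  unfolding extension_op_def
  by (simp add: inner_add_left cis_mult[symmetric] mult.assoc)

lemma extension_op_diff:
  fixes f g :: "'a::euclidean_space \<Rightarrow> complex"
  assumes "integrable sphere_measure f" "integrable sphere_measure g"
  shows "extension_op (\<lambda>w. f w - g w) x = extension_op f x - extension_op g x"
  unfolding extension_op_def
  using Bochner_Integration.integral_diff[OF extension_integrable[OF assms(1), of x] extension_integrable[OF assms(2), of x]]
  by (simp add: right_diff_distrib)

lemma extension_op_scale: "extension_op (\<lambda>w. c * f w) x = c * extension_op f x"
  unfolding extension_op_def by (simp add: mult.left_commute)

lemma extension_op_continuous:
  fixes f :: "'a::euclidean_space \<Rightarrow> complex"
  assumes "integrable sphere_measure f"
  shows "continuous_on UNIV (extension_op f)"
proof -
  have "lipschitz_on (\<integral>w. norm (f w) \<partial>sphere_measure) UNIV (extension_op f)"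
    using extension_op_Lipschitz[OF assms] by (intro lipschitz_onI) (auto simp: dist_norm)
  then show ?thesis by (rule lipschitz_on_continuous_on)
qed

lemma extension_op_measurable:
  fixes f :: "'a::euclidean_space \<Rightarrow> complex"
  assumes "integrable sphere_measure f"
  shows "extension_op f \<in> borel_measurable borel"
  by (intro borel_measurable_continuous_onI extension_op_continuous assms)

end

section \<open>Superlevel sets of Lipschitz functions in L^s\<close>

lemma superlevel_packing:
  fixes F :: "'a::euclidean_space \<Rightarrow> complex"
  assumes L: "0 < L" and lip: "\<And>x y. norm (F x - F y) \<le> L * dist x y"
    and s: "0 < s" and F: "F \<in> lpow lborel s" and \<delta>: "0 < \<delta>"
    and X: "finite X" "\<And>x. x \<in> X \<Longrightarrow> \<delta> \<le> norm (F x)"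
    and sep: "\<And>x y. x \<in> X \<Longrightarrow> y \<in> X \<Longrightarrow> x \<noteq> y \<Longrightarrow> 1 \<le> dist x y"
  shows "real (card X) * (unit_ball_vol (real DIM('a)) * (min (1/2) (\<delta> / (2 * L))) ^ DIM('a) * (\<delta> / 2) powr s)
    \<le> (\<integral>x. norm (F x) powr s \<partial>lborel)"
proof -
  \<comment> \<open>Radius at most 1/2 makes the balls about the 1-separated points disjoint; radius
    at most \<delta>/(2 L) keeps |F| >= \<delta>/2 on them. Integrating |F|^s over their union
    bounds their number.\<close>
  define r where "r = min (1/2) (\<delta> / (2 * L))"
  have r: "0 < r" "r \<le> 1/2" "L * r \<le> \<delta> / 2"
    using L \<delta> by (auto simp: r_def min_def field_simps)
  define U where "U = (\<Union>x\<in>X. ball x r)"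
  have U: "U \<in> sets borel" "bounded U" unfolding U_def using X(1) by (auto intro!: sets.finite_UN)
  have "measure lborel U = (\<Sum>x\<in>X. measure lborel (ball x r))"
    unfolding U_def
  proof (rule measure_finite_Union)
    show "disjoint_family_on (\<lambda>x. ball x r) X"
      unfolding disjoint_family_on_def
    proof (intro ballI impI)
      fix x y assume "x \<in> X" "y \<in> X" "x \<noteq> y"
      from sep[OF this] show "ball x r \<inter> ball y r = {}"
        using disjoint_ballI[of r r x y] r by simp
    qed
  qed (use X r in \<open>auto simp: emeasure_ball\<close>)
  then have mU: "measure lborel U = real (card X) * (unit_ball_vol (real DIM('a)) * r ^ DIM('a))"
    using r by (simp add: content_ball)
  have "measure lborel U * (\<delta> / 2) powr s = (\<integral>x. indicator U x * (\<delta> / 2) powr s \<partial>lborel)"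
    using U emeasure_bounded_finite[OF U(2)] by (simp add: less_top)
  also have "\<dots> \<le> (\<integral>x. norm (F x) powr s \<partial>lborel)"
  proof (rule integral_mono)
    show "integrable lborel (\<lambda>x. indicator U x * (\<delta> / 2) powr s)"
      using U emeasure_bounded_finite[OF U(2)] by (intro integrable_mult_left) (auto simp: less_top)
    show "integrable lborel (\<lambda>x. norm (F x) powr s)" by (rule lpow_integrable[OF F])
    fix x :: 'a
    show "indicator U x * (\<delta> / 2) powr s \<le> norm (F x) powr s"
    proof (cases "x \<in> U")
      case True
      then obtain y where y: "y \<in> X" "dist y x < r" by (auto simp: U_def)
      have "norm (F y - F x) \<le> L * r"
        using lip[of y x] y L by (meson less_imp_le mult_left_mono order_trans)
      then have "\<delta> / 2 \<le> norm (F x)"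
        using X(2)[OF y(1)] norm_triangle_ineq2[of "F y" "F x"] r by linarith
      then show ?thesis using True \<delta> s by (simp add: powr_mono2)
    qed simp
  qed
  finally show ?thesis by (simp add: mU r_def mult_ac)
qed

text \<open>A maximal 1-separated subset of the superlevel set is a net, and the packing estimate
  bounds its size. \<open>N\<close> is obtained before \<open>F\<close>, which makes it uniform
  along a sequence.\<close>

lemma superlevel_cover:
  fixes L \<delta> s B :: real
  assumes L: "0 < L" and s: "0 < s" and \<delta>: "0 < \<delta>"
  obtains N where "\<And>F :: 'a::euclidean_space \<Rightarrow> complex. (\<And>x y. norm (F x - F y) \<le> L * dist x y) \<Longrightarrow>
      F \<in> lpow lborel s \<Longrightarrow> (\<integral>x. norm (F x) powr s \<partial>lborel) \<le> B \<Longrightarrow>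
      \<exists>X. finite X \<and> card X \<le> N \<and> {x. \<delta> \<le> norm (F x)} \<subseteq> (\<Union>x\<in>X. ball x 1)"
proof -
  define v where "v = unit_ball_vol (real DIM('a)) * (min (1/2) (\<delta> / (2 * L))) ^ DIM('a) * (\<delta> / 2) powr s"
  have v: "v > 0" unfolding v_def using L \<delta> by (intro mult_pos_pos zero_less_power) auto
  show ?thesis
  proof (rule that[of "nat \<lfloor>B / v\<rfloor>"])
    fix F :: "'a \<Rightarrow> complex"
    assume lip: "\<And>x y. norm (F x - F y) \<le> L * dist x y" and F: "F \<in> lpow lborel s"
      and B: "(\<integral>x. norm (F x) powr s \<partial>lborel) \<le> B"
    have "card X \<le> nat \<lfloor>B / v\<rfloor>" if "X \<subseteq> {x. \<delta> \<le> norm (F x)}" "finite X"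
      "\<And>x y. x \<in> X \<Longrightarrow> y \<in> X \<Longrightarrow> x \<noteq> y \<Longrightarrow> 1 \<le> dist x y" for X
    proof -
      have "real (card X) * v \<le> B"
        unfolding v_def using superlevel_packing[OF L lip s F \<delta> that(2) _ that(3)] that(1) B by force
      then have "real (card X) \<le> B / v" using v by (simp add: field_simps)
      then show ?thesis by linarith
    qed
    then obtain X where "finite X" "card X \<le> nat \<lfloor>B / v\<rfloor>" "{x. \<delta> \<le> norm (F x)} \<subseteq> (\<Union>x\<in>X. ball x 1)"
      using separated_net[of 1 "{x. \<delta> \<le> norm (F x)}" "nat \<lfloor>B / v\<rfloor>"] by (metis zero_less_one)
    then show "\<exists>X. finite X \<and> card X \<le> nat \<lfloor>B / v\<rfloor> \<and> {x. \<delta> \<le> norm (F x)} \<subseteq> (\<Union>x\<in>X. ball x 1)" by blast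
  qed
qed

lemma Lipschitz_lpow_decay:
  fixes F :: "'a::euclidean_space \<Rightarrow> complex"
  assumes lip: "\<And>x y. norm (F x - F y) \<le> L * dist x y" and "0 < s" "F \<in> lpow lborel s" "0 < \<delta>"
  shows "bounded {x. \<delta> \<le> norm (F x)}"
proof -
  \<comment> \<open>The covering lemma asks for a positive Lipschitz constant.\<close>
  have lip': "norm (F x - F y) \<le> max L 1 * dist x y" for x y
    by (rule order_trans[OF lip[of x y]]) (intro mult_right_mono, auto)
  obtain X where "finite X" "{x. \<delta> \<le> norm (F x)} \<subseteq> (\<Union>x\<in>X. ball x 1)"
    using superlevel_cover[of "max L 1" s \<delta> "\<integral>x. norm (F x) powr s \<partial>lborel"] lip' assms
    by (metis less_max_iff_disj order_refl zero_less_one)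
  then show ?thesis by (meson bounded_UN bounded_ball bounded_subset)
qed

lemma Lipschitz_lpow_tendsto_zero:
  fixes F :: "'a::euclidean_space \<Rightarrow> complex"
  assumes "\<And>x y. norm (F x - F y) \<le> L * dist x y" "0 < s" "F \<in> lpow lborel s"
    and x: "filterlim x at_infinity A"
  shows "((\<lambda>n. F (x n)) \<longlongrightarrow> 0) A"
proof (rule tendstoI)
  fix e :: real assume "e > 0"
  obtain B where B: "\<And>y. e \<le> norm (F y) \<Longrightarrow> norm y \<le> B"
    using Lipschitz_lpow_decay[OF assms(1-3) \<open>e > 0\<close>] by (auto simp: bounded_iff)
  have "\<forall>\<^sub>F n in A. B + 1 \<le> norm (x n)" 
    using filterlim_at_infinity_imp_norm_at_top[OF x] by (simp add: filterlim_at_top)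
  then show "\<forall>\<^sub>F n in A. dist (F (x n)) 0 < e"
    by eventually_elim (use B in \<open>force simp: not_le[symmetric]\<close>)
qed

section \<open>The extension inequality on all of L^p\<close>

context
begin

interpretation finite_measure "sphere_measure :: 'a::euclidean_space measure"
  by (rule finite_sphere_measure)

lemma extension_op_lnorm_bound:
  fixes f :: "'a::euclidean_space \<Rightarrow> complex"
  assumes "1 < p" "f \<in> lpow sphere_measure p"
  shows "norm (extension_op f x) \<le> lnorm sphere_measure p f * lnorm sphere_measure (p / (p - 1)) (\<lambda>w::'a. 1)"
proof -
  have q: "1 < p / (p - 1)" "1 / p + 1 / (p / (p - 1)) = 1" using assms(1) by (auto simp: field_simps)
  show ?thesis
    using extension_op_bound[of f x] L1_le_lnorm[OF assms(1) q assms(2)] by linarith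
qed

lemma lpow_sphere_integrable:
  fixes f :: "'a::euclidean_space \<Rightarrow> complex"
  assumes "1 < p" "f \<in> lpow sphere_measure p"
  shows "integrable sphere_measure f"
proof (rule lpow_imp_integrable[OF assms(1) _ _ assms(2)])
  show "1 < p / (p - 1)" "1 / p + 1 / (p / (p - 1)) = 1" using assms(1) by (auto simp: field_simps)
qed

text \<open>Carries estimates from smooth functions to all of L^p: the norms stay controlled, and
  the extensions converge at every point because the L^p norm dominates the supremum of the
  extension.\<close>

lemma trig_poly_sequence:
  fixes f :: "'a::euclidean_space \<Rightarrow> complex"
  assumes "1 < p" "f \<in> lpow sphere_measure p" "0 < e"
  obtains g where "\<And>k. g k \<in> trig_poly" "\<And>k. lnorm sphere_measure p (g k) \<le> lnorm sphere_measure p f + e"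
    "\<And>x. (\<lambda>k. extension_op (g k) x) \<longlonglongrightarrow> extension_op f x"
proof -
  have "\<exists>g\<in>trig_poly. lnorm sphere_measure p (\<lambda>w. f w - g w) < min e (inverse (real (Suc k)))" for k
    using trig_poly_dense[OF assms(1,2), of "min e (inverse (real (Suc k)))"] \<open>0 < e\<close>
    by (metis inverse_positive_iff_positive min_less_iff_conj of_nat_0_less_iff zero_less_Suc)
  then obtain g where g: "\<And>k. g k \<in> trig_poly"
      "\<And>k. lnorm sphere_measure p (\<lambda>w. f w - g k w) < min e (inverse (real (Suc k)))" by metis
  note gl = trig_poly_lpow[OF assms(1) g(1)]
  define C where "C = lnorm sphere_measure (p / (p - 1)) (\<lambda>w::'a. 1)"
  show ?thesis
  proof (rule that[OF g(1)])
    fix k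
    have "lnorm sphere_measure p (g k) \<le> lnorm sphere_measure p f + lnorm sphere_measure p (\<lambda>w. g k w - f w)"
      by (rule lnorm_diff_triangle[OF assms(1) gl assms(2)])
    also have "lnorm sphere_measure p (\<lambda>w. g k w - f w) \<le> e"
      using g(2)[of k] by (subst lnorm_minus_commute) auto
    finally show "lnorm sphere_measure p (g k) \<le> lnorm sphere_measure p f + e" by simp
  next
    fix x
    have le: "norm (extension_op f x - extension_op (g k) x) \<le> inverse (real (Suc k)) * C" for k
    proof -
      have "norm (extension_op f x - extension_op (g k) x) \<le> lnorm sphere_measure p (\<lambda>w. f w - g k w) * C"
        using extension_op_lnorm_bound[OF assms(1) lpow_diff[OF assms(1,2) gl], of k x]
        by (simp add: C_def extension_op_diff lpow_sphere_integrable[OF assms(1)] assms(2) gl)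
      also have "\<dots> \<le> inverse (real (Suc k)) * C"
        using g(2)[of k] by (intro mult_right_mono) (auto simp: C_def)
      finally show ?thesis .
    qed
    have "(\<lambda>k. inverse (real (Suc k)) * C) \<longlonglongrightarrow> 0"
      using tendsto_mult[OF LIMSEQ_inverse_real_of_nat tendsto_const[of C]] by simp
    then have "(\<lambda>k. extension_op f x - extension_op (g k) x) \<longlonglongrightarrow> 0"
      by (rule Lim_null_comparison[OF always_eventually[OF allI[OF le]]])
    from tendsto_diff[OF tendsto_const[of "extension_op f x"] this]
    show "(\<lambda>k. extension_op (g k) x) \<longlonglongrightarrow> extension_op f x" by simp
  qed
qed

lemma extension_norm_trig_poly:
  fixes g :: "'a::euclidean_space \<Rightarrow> complex"
  assumes "1 < p" and g: "g \<in> trig_poly" and pos: "0 < lnorm sphere_measure p g"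
  shows "eLp_norm lborel q (extension_op (\<lambda>w. of_real (1 / lnorm sphere_measure p g) * g w))
    \<le> extension_norm TYPE('a) (ennreal p) q"
proof -
  define h where "h = (\<lambda>w. of_real (1 / lnorm sphere_measure p g) * g w)"
  have h: "h \<in> trig_poly" unfolding h_def by (intro trig_poly_mult trig_poly_const g)
  have "lnorm sphere_measure p h = 1"
    unfolding h_def using assms(1) pos by (subst lnorm_scale) (auto simp: norm_divide)
  then have "eLp_norm sphere_measure (ennreal p) h = 1"
    using eLp_norm_eq_lnorm[of p h sphere_measure] trig_poly_lpow[OF assms(1) h] assms(1) by simp
  then show ?thesis
    unfolding extension_norm_def h_def[symmetric] using trig_poly_smooth[OF h] by (intro SUP_upper) auto
qed

lemma lnorm_zero_extension:
  fixes g :: "'a::euclidean_space \<Rightarrow> complex"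
  assumes "1 < p" "g \<in> lpow sphere_measure p" "lnorm sphere_measure p g = 0"
  shows "extension_op g x = 0"
  using extension_op_lnorm_bound[OF assms(1,2), of x] assms(3) by simp

text \<open>\<open>extension_norm\<close> is a supremum over smooth functions. Normalised
  trigonometric polynomials obey it by definition; approximation and Fatou give the general case
  with a loss e in the norm, which is sent to 0 at the end.\<close>

lemma extension_bound_finite:
  fixes f :: "'a::euclidean_space \<Rightarrow> complex"
  assumes p: "1 < p" and q: "0 < q" and fin: "extension_norm TYPE('a) (ennreal p) (ennreal q) < \<infinity>"
    and f: "f \<in> lpow sphere_measure p"
  shows "extension_op f \<in> lpow lborel q"
    and "lnorm lborel q (extension_op f) \<le>
      enn2real (extension_norm TYPE('a) (ennreal p) (ennreal q)) * lnorm sphere_measure p f"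
proof -
  define S where "S = enn2real (extension_norm TYPE('a) (ennreal p) (ennreal q))"
  have S0: "S \<ge> 0" by (simp add: S_def)
  have eS: "extension_norm TYPE('a) (ennreal p) (ennreal q) = ennreal S"
    using fin by (simp add: S_def)
  have trig: "extension_op g \<in> lpow lborel q \<and> lnorm lborel q (extension_op g) \<le> S * lnorm sphere_measure p g"
    if g: "g \<in> trig_poly" for g :: "'a \<Rightarrow> complex"
  \<comment> \<open>A function of norm zero cannot be normalised, but its extension vanishes
    identically.\<close>
  proof (cases "lnorm sphere_measure p g = 0")
    case True
    then have "extension_op g = (\<lambda>x. 0)"
      using lnorm_zero_extension[OF p trig_poly_lpow[OF p g]] by auto
    then show ?thesis using True by simp
  next
    case False
    then have pos: "0 < lnorm sphere_measure p g" using lnorm_nonneg[of sphere_measure p g] by linarith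
    define h where "h = (\<lambda>w. of_real (1 / lnorm sphere_measure p g) * g w)"
    have h: "h \<in> lpow sphere_measure p"
      unfolding h_def using p by (intro lpow_scale trig_poly_lpow g) auto
    have le: "eLp_norm lborel (ennreal q) (extension_op h) \<le> ennreal S"
      using extension_norm_trig_poly[OF p g pos, of "ennreal q"] by (simp add: h_def eS)
    then have "extension_op h \<in> Lp lborel (ennreal q)"
      using extension_op_measurable[OF lpow_sphere_integrable[OF p h]] by (auto simp: Lp_def le_less_trans)
    then have hl: "extension_op h \<in> lpow lborel q" using Lp_eq_lpow[OF q] by blast
    then have hS: "lnorm lborel q (extension_op h) \<le> S"
      using le eLp_norm_eq_lnorm[OF q hl] S0 by simp
    have "g = (\<lambda>w. of_real (lnorm sphere_measure p g) * h w)" using pos by (simp add: h_def)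
    then have gh: "extension_op g = (\<lambda>x. of_real (lnorm sphere_measure p g) * extension_op h x)"
      using extension_op_scale by metis
    have "lnorm lborel q (extension_op g) = lnorm sphere_measure p g * lnorm lborel q (extension_op h)"
      using pos q by (subst gh, subst lnorm_scale) auto
    also have "\<dots> \<le> lnorm sphere_measure p g * S" using hS pos by simp
    finally have "lnorm lborel q (extension_op g) \<le> S * lnorm sphere_measure p g" by (simp only: mult.commute)
    moreover have "extension_op g \<in> lpow lborel q" by (subst gh) (rule lpow_scale[OF hl q])
    ultimately show ?thesis by blast
  qed
  have *: "extension_op f \<in> lpow lborel q \<and> lnorm lborel q (extension_op f) \<le> S * (lnorm sphere_measure p f + e)"
    if "e > 0" for e
  proof -
    obtain g where g: "\<And>k. g k \<in> trig_poly" "\<And>k. lnorm sphere_measure p (g k) \<le> lnorm sphere_measure p f + e"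
      "\<And>x. (\<lambda>k. extension_op (g k) x) \<longlonglongrightarrow> extension_op f x"
      using trig_poly_sequence[OF p f \<open>e > 0\<close>] by blast
    have "lnorm lborel q (extension_op (g k)) \<le> S * (lnorm sphere_measure p f + e)" for k
      using trig[OF g(1), of k] mult_left_mono[OF g(2) S0, of k] by linarith
    then show ?thesis
      using lpow_Fatou[of q "\<lambda>k. extension_op (g k)" lborel "S * (lnorm sphere_measure p f + e)" "extension_op f"]
        trig[OF g(1)] q S0 that g(3) extension_op_measurable[OF lpow_sphere_integrable[OF p f]]
      by (auto intro!: mult_nonneg_nonneg add_nonneg_nonneg)
  qed
  show "extension_op f \<in> lpow lborel q" using *[of 1] by simp
  show "lnorm lborel q (extension_op f) \<le> S * lnorm sphere_measure p f"
  proof (rule tendsto_lowerbound)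
    have "((\<lambda>e. S * (lnorm sphere_measure p f + e)) \<longlongrightarrow> S * (lnorm sphere_measure p f + 0)) (at_right 0)"
      by (intro tendsto_intros)
    then show "((\<lambda>e. S * (lnorm sphere_measure p f + e)) \<longlongrightarrow> S * lnorm sphere_measure p f) (at_right 0)" by simp
    show "\<forall>\<^sub>F e in at_right 0. lnorm lborel q (extension_op f) \<le> S * (lnorm sphere_measure p f + e)"
      using * by (auto simp: eventually_at_filter)
  qed simp
qed

text \<open>The set where a continuous |h| exceeds a constant is open, and nonempty open sets are
  not Lebesgue null; so the essential supremum dominates every value.\<close>

lemma le_esssup_continuous:
  fixes h :: "'a::euclidean_space \<Rightarrow> complex"
  assumes "continuous_on UNIV h"
  shows "ennreal (norm (h x)) \<le> eLp_norm lborel \<infinity> h"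
proof (rule ccontr)
  assume "\<not> ?thesis"
  then have lt: "eLp_norm lborel \<infinity> h < ennreal (norm (h x))" by simp
  then obtain c where c: "c \<ge> 0" "eLp_norm lborel \<infinity> h = ennreal c"
    by (metis ennreal_cases ennreal_less_top less_trans order_less_irrefl)
  have "c < norm (h x)" using lt c by (simp add: ennreal_less_iff)
  have op: "open {y. c < norm (h y)}"
    by (intro open_Collect_less continuous_intros assms)
  have [measurable]: "h \<in> borel_measurable borel" by (rule borel_measurable_continuous_onI[OF assms])
  have "AE y in lborel. ennreal (norm (h y)) \<le> ennreal c"
    using esssup_AE[of "\<lambda>y. ennreal (norm (h y))" lborel] c by (simp add: eLp_norm_def)
  then have "AE y in lborel. y \<notin> {y. c < norm (h y)}" by eventually_elim (use c in auto)
  then have "emeasure lborel {y. c < norm (h y)} = 0"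
    using op by (subst (asm) AE_iff_measurable[OF _ refl]) auto
  then have "{y. c < norm (h y)} \<in> null_sets lborel" using op by auto
  then have "negligible {y. c < norm (h y)}" using negligible_iff_null_sets null_sets_completionI by blast
  then have "{y. c < norm (h y)} = {}" using open_not_negligible[OF op] by blast
  then show False using \<open>c < norm (h x)\<close> by auto
qed

lemma esssup_le_bound:
  fixes h :: "'a::euclidean_space \<Rightarrow> complex"
  assumes "h \<in> borel_measurable borel" "\<And>x. norm (h x) \<le> c"
  shows "eLp_norm lborel \<infinity> h \<le> ennreal c"
  using assms by (auto simp: eLp_norm_def intro!: esssup_I ennreal_leI)

lemma extension_bound_infinite:
  fixes f :: "'a::euclidean_space \<Rightarrow> complex"
  assumes p: "1 < p" and fin: "extension_norm TYPE('a) (ennreal p) \<infinity> < \<infinity>"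
    and f: "f \<in> lpow sphere_measure p"
  shows "norm (extension_op f x) \<le> enn2real (extension_norm TYPE('a) (ennreal p) \<infinity>) * lnorm sphere_measure p f"
proof -
  define S where "S = enn2real (extension_norm TYPE('a) (ennreal p) \<infinity>)"
  have S0: "S \<ge> 0" by (simp add: S_def)
  have eS: "extension_norm TYPE('a) (ennreal p) \<infinity> = ennreal S"
    using fin by (simp add: S_def)
  have trig: "norm (extension_op g x) \<le> S * lnorm sphere_measure p g"
    if g: "g \<in> trig_poly" for g :: "'a \<Rightarrow> complex"
  proof (cases "lnorm sphere_measure p g = 0")
    case True
    then show ?thesis using lnorm_zero_extension[OF p trig_poly_lpow[OF p g]] by simp
  next
    case False
    then have pos: "0 < lnorm sphere_measure p g" using lnorm_nonneg[of sphere_measure p g] by linarith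
    define h where "h = (\<lambda>w. of_real (1 / lnorm sphere_measure p g) * g w)"
    have h: "h \<in> lpow sphere_measure p"
      unfolding h_def using p by (intro lpow_scale trig_poly_lpow g) auto
    have "ennreal (norm (extension_op h x)) \<le> eLp_norm lborel \<infinity> (extension_op h)"
      by (intro le_esssup_continuous extension_op_continuous lpow_sphere_integrable[OF p h])
    also have "\<dots> \<le> ennreal S"
      using extension_norm_trig_poly[OF p g pos, of "\<infinity>"] unfolding h_def[symmetric] eS .
    finally have "norm (extension_op h x) \<le> S" using S0 by simp
    moreover have "extension_op h x = of_real (1 / lnorm sphere_measure p g) * extension_op g x"
      unfolding h_def by (rule extension_op_scale)
    ultimately show ?thesis using pos by (simp add: norm_mult norm_divide field_simps)
  qed
  have "norm (extension_op f x) \<le> S * (lnorm sphere_measure p f + e)" if "e > 0" for e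
  proof -
    obtain g where g: "\<And>k. g k \<in> trig_poly" "\<And>k. lnorm sphere_measure p (g k) \<le> lnorm sphere_measure p f + e"
      "\<And>x. (\<lambda>k. extension_op (g k) x) \<longlonglongrightarrow> extension_op f x"
      using trig_poly_sequence[OF p f \<open>e > 0\<close>] by blast
    have "norm (extension_op (g k) x) \<le> S * (lnorm sphere_measure p f + e)" for k
      using trig[OF g(1), of k] mult_left_mono[OF g(2) S0, of k] by linarith
    then show ?thesis
      using tendsto_norm[OF g(3)] by (intro LIMSEQ_le_const2[of "\<lambda>k. norm (extension_op (g k) x)"]) auto
  qed
  then show ?thesis
    unfolding S_def[symmetric]
    by (intro tendsto_lowerbound[of "\<lambda>e. S * (lnorm sphere_measure p f + e)" _ "at_right 0"])
       (auto simp: eventually_at_filter intro!: tendsto_eq_intros)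
qed

text \<open>No stationary phase is needed: \<open>\<E>h\<close> is Lipschitz and, by the assumed extension estimate,
  lies in a Lebesgue space, hence it vanishes at infinity.\<close>

lemma extension_op_tendsto_zero:
  fixes h :: "'a::euclidean_space \<Rightarrow> complex"
  assumes p: "1 < p" and q: "0 < q" and fin: "extension_norm TYPE('a) (ennreal p) (ennreal q) < \<infinity>"
    and h: "integrable sphere_measure h" and x: "filterlim x at_infinity A"
  shows "((\<lambda>n. extension_op h (x n)) \<longlongrightarrow> 0) A"
proof (rule tendstoI)
  fix e :: real assume "e > 0"
  have [measurable]: "h \<in> borel_measurable sphere_measure" using h by simp
  \<comment> \<open>\<open>h\<close> is merely integrable, while the decay argument needs L^p:
    bounded truncations lie in L^p on the finite measure and are L^1-close to \<open>h\<close>, so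
    their extensions are uniformly close.\<close>
  define u where "u = (\<lambda>k w. if norm (h w) \<le> real k then h w else 0)"
  have [measurable]: "u k \<in> borel_measurable sphere_measure" for k unfolding u_def by measurable
  have "(\<lambda>k. \<integral>w. norm (h w - u k w) \<partial>sphere_measure) \<longlonglongrightarrow> (\<integral>w. 0 \<partial>(sphere_measure :: 'a measure))"
  proof (rule integral_dominated_convergence)
    show "integrable sphere_measure (\<lambda>w. norm (h w))" using h by simp
    show "AE w in sphere_measure. (\<lambda>k. norm (h w - u k w)) \<longlonglongrightarrow> 0"
    proof (rule AE_I2)
      fix w
      obtain N where "norm (h w) \<le> real N" using real_arch_simple by blast
      then have "norm (h w - u k w) = 0" if "N \<le> k" for k
        using that by (auto simp: u_def)
      then show "(\<lambda>k. norm (h w - u k w)) \<longlonglongrightarrow> 0"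
        by (intro tendsto_eventually) (auto simp: eventually_sequentially)
    qed
    show "AE w in sphere_measure. norm (norm (h w - u k w)) \<le> norm (h w)" for k
      by (auto simp: u_def)
  qed auto
  then have "\<forall>\<^sub>F k in sequentially. (\<integral>w. norm (h w - u k w) \<partial>sphere_measure) < e / 3"
    using \<open>e > 0\<close> by (intro order_tendstoD(2)) auto
  then obtain k where k: "(\<integral>w. norm (h w - u k w) \<partial>sphere_measure) < e / 3"
    by (auto simp: eventually_sequentially)
  have ul: "u k \<in> lpow sphere_measure p"
    using p by (intro lpow_bounded[of _ "real k"]) (auto simp: u_def)
  have ui: "integrable sphere_measure (u k)" by (rule lpow_sphere_integrable[OF p ul])
  have "\<forall>\<^sub>F n in A. dist (extension_op (u k) (x n)) 0 < e / 3"
  proof (rule tendstoD[OF Lipschitz_lpow_tendsto_zero[OF _ q _ x]])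
    show "norm (extension_op (u k) x - extension_op (u k) y) \<le> (\<integral>w. norm (u k w) \<partial>sphere_measure) * dist x y" for x y
      by (rule extension_op_Lipschitz[OF ui])
    show "extension_op (u k) \<in> lpow lborel q" by (rule extension_bound_finite(1)[OF p q fin ul])
  qed (use \<open>e > 0\<close> in simp)
  then show "\<forall>\<^sub>F n in A. dist (extension_op h (x n)) 0 < e"
  proof eventually_elim
    case (elim n)
    have "norm (extension_op h (x n) - extension_op (u k) (x n)) \<le> (\<integral>w. norm (h w - u k w) \<partial>sphere_measure)"
      using extension_op_bound[of "\<lambda>w. h w - u k w" "x n"] by (simp add: extension_op_diff[OF h ui])
    then have "norm (extension_op h (x n) - extension_op (u k) (x n)) < e / 3" using k by linarith
    then show ?case
      using elim norm_triangle_ineq[of "extension_op h (x n) - extension_op (u k) (x n)" "extension_op (u k) (x n)"] \<open>e > 0\<close>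
      by simp
  qed
qed

text \<open>A diagonal subsequence makes the extensions converge on a countable dense set, their
  common Lipschitz bound at every point. This is convergence against trigonometric polynomials, and
  density in L^q gives all test functions.\<close>

lemma weakly_convergent_subsequence:
  fixes f :: "nat \<Rightarrow> 'a::euclidean_space \<Rightarrow> complex"
  assumes pq: "1 < p" "1 < q" "1 / p + 1 / q = 1"
    and f: "\<And>n. f n \<in> lpow sphere_measure p" and K: "\<And>n. lnorm sphere_measure p (f n) \<le> K"
  obtains r \<phi> where "strict_mono r" "\<phi> \<in> lpow sphere_measure p" "lnorm sphere_measure p \<phi> \<le> K"
    "\<And>g. g \<in> lpow sphere_measure q \<Longrightarrow>
      (\<lambda>n. \<integral>w. f (r n) w * g w \<partial>sphere_measure) \<longlonglongrightarrow> (\<integral>w. \<phi> w * g w \<partial>sphere_measure)"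
proof -
  have K0: "0 \<le> K" using K[of 0] lnorm_nonneg order_trans by blast
  define C where "C = lnorm sphere_measure q (\<lambda>w::'a. 1)"
  have C0: "0 \<le> C" by (simp add: C_def)
  have fi: "integrable sphere_measure (f n)" for n by (rule lpow_sphere_integrable[OF pq(1) f])
  have L1: "(\<integral>w. norm (f n w) \<partial>sphere_measure) \<le> K * C" for n
    using L1_le_lnorm[OF pq f, of n] mult_right_mono[OF K C0, of n] unfolding C_def by linarith
  obtain D :: "'a set" where D: "countable D" "\<And>X. open X \<Longrightarrow> X \<noteq> {} \<Longrightarrow> \<exists>d\<in>D. d \<in> X"
    using countable_dense_setE by blast
  have "norm (extension_op (f n) x) \<le> K * C" for n x
    using extension_op_bound[of "f n" x] L1[of n] by linarith
  then obtain r where r: "strict_mono (r :: nat \<Rightarrow> nat)" "\<And>x. x \<in> D \<Longrightarrow> \<exists>l. (\<lambda>n. extension_op (f (r n)) x) \<longlonglongrightarrow> l"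
    using function_convergent_subsequence[OF D(1), of "\<lambda>n. extension_op (f n)" "K * C"] by blast
  have conv: "convergent (\<lambda>n. extension_op (f (r n)) x)" for x
    unfolding Cauchy_convergent_iff[symmetric]
  proof (rule metric_CauchyI)
    fix e :: real assume "e > 0"
    \<comment> \<open>All extensions share the Lipschitz constant K C, so at points within d their
      values differ by at most e/3; the added 1 covers K C = 0.\<close>
    define d where "d = e / (3 * (K * C + 1))"
    have KC: "0 \<le> K * C" using K0 C0 by simp
    have d: "d > 0" unfolding d_def using KC \<open>e > 0\<close> by (intro divide_pos_pos) auto
    have "K * C * d \<le> (K * C + 1) * d" using d by (intro mult_right_mono) auto
    also have "\<dots> = e / 3" using KC by (simp add: d_def field_simps)
    finally have KCd: "K * C * d \<le> e / 3" .
    obtain y where y: "y \<in> D" "dist x y < d" using D(2)[of "ball x d"] d by auto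
    obtain l where "(\<lambda>n. extension_op (f (r n)) y) \<longlonglongrightarrow> l" using r(2)[OF y(1)] by blast
    then have c: "Cauchy (\<lambda>n. extension_op (f (r n)) y)" by (rule LIMSEQ_imp_Cauchy)
    have "e / 3 > 0" using \<open>e > 0\<close> by simp
    from metric_CauchyD[OF c this] obtain N where
      "\<forall>m\<ge>N. \<forall>n\<ge>N. dist (extension_op (f (r m)) y) (extension_op (f (r n)) y) < e / 3" ..
    note N = this[rule_format]
    have near: "dist (extension_op (f n) x) (extension_op (f n) y) \<le> e / 3" for n
    proof -
      have "dist (extension_op (f n) x) (extension_op (f n) y) \<le> (\<integral>w. norm (f n w) \<partial>sphere_measure) * dist x y"
        using extension_op_Lipschitz[OF fi] by (simp add: dist_norm)
      also have "\<dots> \<le> K * C * d" using L1 y KC by (intro mult_mono) auto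
      finally show ?thesis using KCd by linarith
    qed
    have "dist (extension_op (f (r m)) x) (extension_op (f (r n)) x) < e" if "N \<le> m" "N \<le> n" for m n
      using near[of "r m"] near[of "r n"] N[OF that]
        dist_triangle[of "extension_op (f (r m)) x" "extension_op (f (r n)) x" "extension_op (f (r m)) y"]
        dist_triangle[of "extension_op (f (r m)) y" "extension_op (f (r n)) x" "extension_op (f (r n)) y"]
        dist_commute[of "extension_op (f (r n)) y" "extension_op (f (r n)) x"]
      by linarith
    then show "\<exists>N. \<forall>m\<ge>N. \<forall>n\<ge>N. dist (extension_op (f (r m)) x) (extension_op (f (r n)) x) < e" by blast
  qed
  have trig: "convergent (\<lambda>n. \<integral>w. f (r n) w * g w \<partial>sphere_measure)" if "g \<in> trig_poly" for g
    using that
  proof induction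
    case (trig_poly_exp c x)
    have "(\<integral>w. f (r n) w * (c * cis (x \<bullet> w)) \<partial>sphere_measure) = c * extension_op (f (r n)) x" for n
    proof -
      have "f (r n) w * (c * cis (x \<bullet> w)) = c * (cis (x \<bullet> w) * f (r n) w)" for w by (simp only: mult_ac)
      then show ?thesis unfolding extension_op_def by (simp only: integral_mult_right_zero)
    qed
    then have "(\<lambda>n. \<integral>w. f (r n) w * (c * cis (x \<bullet> w)) \<partial>sphere_measure) = (\<lambda>n. c * extension_op (f (r n)) x)"
      by (rule ext)
    moreover have "convergent (\<lambda>n. c * extension_op (f (r n)) x)"
      by (intro convergent_mult convergent_const conv)
    ultimately show ?case by simp
  next
    case (trig_poly_add g h)
    have "(\<lambda>n. \<integral>w. f (r n) w * (g w + h w) \<partial>sphere_measure) =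
      (\<lambda>n. (\<integral>w. f (r n) w * g w \<partial>sphere_measure) + (\<integral>w. f (r n) w * h w \<partial>sphere_measure))"
      using lpow_mult_integrable[OF pq f trig_poly_lpow[OF pq(2)]] trig_poly_add(1,2)
      by (simp add: distrib_left)
    then show ?case using convergent_add[OF trig_poly_add(3,4)] by simp
  qed
  have conv2: "convergent (\<lambda>n. \<integral>w. f (r n) w * g w \<partial>sphere_measure)" if g: "g \<in> lpow sphere_measure q" for g
    unfolding Cauchy_convergent_iff[symmetric]
  proof (rule metric_CauchyI)
    fix e :: real assume "e > 0"
    define d where "d = e / (3 * (K + 1))"
    have d: "d > 0" unfolding d_def using K0 \<open>e > 0\<close> by (intro divide_pos_pos) auto
    obtain h where h: "h \<in> trig_poly" "lnorm sphere_measure q (\<lambda>w. g w - h w) < d"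
      using trig_poly_dense[OF pq(2) g d] by blast
    note hl = trig_poly_lpow[OF pq(2) h(1)]
    have "K * d \<le> (K + 1) * d" using d by (intro mult_right_mono) auto
    also have "\<dots> = e / 3" using K0 by (simp add: d_def field_simps)
    finally have Kd: "K * d \<le> e / 3" .
    have near: "dist (\<integral>w. f n w * g w \<partial>sphere_measure) (\<integral>w. f n w * h w \<partial>sphere_measure) \<le> e / 3" for n
    proof -
      have "(\<integral>w. f n w * g w \<partial>sphere_measure) - (\<integral>w. f n w * h w \<partial>sphere_measure) = (\<integral>w. f n w * (g w - h w) \<partial>sphere_measure)"
        using lpow_mult_integrable[OF pq f g, of n] lpow_mult_integrable[OF pq f hl, of n]
        by (simp add: right_diff_distrib)
      also have "norm \<dots> \<le> lnorm sphere_measure p (f n) * lnorm sphere_measure q (\<lambda>w. g w - h w)"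
        by (rule Holder[OF pq f lpow_diff[OF pq(2) g hl]])
      also have "\<dots> \<le> K * d" using K h(2) K0 by (intro mult_mono) auto
      finally show ?thesis using Kd by (simp add: dist_norm)
    qed
    have c: "Cauchy (\<lambda>n. \<integral>w. f (r n) w * h w \<partial>sphere_measure)"
      using trig[OF h(1)] by (simp add: Cauchy_convergent_iff)
    have "e / 3 > 0" using \<open>e > 0\<close> by simp
    from metric_CauchyD[OF c this] obtain N where "\<forall>m\<ge>N. \<forall>n\<ge>N.
        dist (\<integral>w. f (r m) w * h w \<partial>sphere_measure) (\<integral>w. f (r n) w * h w \<partial>sphere_measure) < e / 3" ..
    note N = this[rule_format]
    have "dist (\<integral>w. f (r m) w * g w \<partial>sphere_measure) (\<integral>w. f (r n) w * g w \<partial>sphere_measure) < e" if "N \<le> m" "N \<le> n" for m n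
      using near[of "r m"] near[of "r n"] N[OF that]
        dist_triangle[of "\<integral>w. f (r m) w * g w \<partial>sphere_measure" "\<integral>w. f (r n) w * g w \<partial>sphere_measure" "\<integral>w. f (r m) w * h w \<partial>sphere_measure"]
        dist_triangle[of "\<integral>w. f (r m) w * h w \<partial>sphere_measure" "\<integral>w. f (r n) w * g w \<partial>sphere_measure" "\<integral>w. f (r n) w * h w \<partial>sphere_measure"]
        dist_commute[of "\<integral>w. f (r n) w * h w \<partial>sphere_measure" "\<integral>w. f (r n) w * g w \<partial>sphere_measure"]
      by linarith
    then show "\<exists>N. \<forall>m\<ge>N. \<forall>n\<ge>N. dist (\<integral>w. f (r m) w * g w \<partial>sphere_measure) (\<integral>w. f (r n) w * g w \<partial>sphere_measure) < e" by blast
  qed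
  obtain \<phi> where \<phi>: "\<phi> \<in> lpow sphere_measure p" "lnorm sphere_measure p \<phi> \<le> K"
    "\<And>g L. g \<in> lpow sphere_measure q \<Longrightarrow> (\<lambda>n. \<integral>w. f (r n) w * g w \<partial>sphere_measure) \<longlonglongrightarrow> L \<Longrightarrow>
      (\<integral>w. \<phi> w * g w \<partial>sphere_measure) = L"
    using weak_limit_exists[OF pq, of "\<lambda>n. f (r n)" K] f K by blast
  show ?thesis
  proof (rule that[OF r(1) \<phi>(1,2)])
    fix g assume g: "g \<in> lpow (sphere_measure :: 'a measure) q"
    obtain L where "(\<lambda>n. \<integral>w. f (r n) w * g w \<partial>sphere_measure) \<longlonglongrightarrow> L"
      using conv2[OF g] by (auto simp: convergent_def)
    with \<phi>(3)[OF g this] show "(\<lambda>n. \<integral>w. f (r n) w * g w \<partial>sphere_measure) \<longlonglongrightarrow> (\<integral>w. \<phi> w * g w \<partial>sphere_measure)" by simp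
  qed
qed

end

section \<open>Asymptotically orthogonal modulations\<close>

lemma three_lines_exp_sum:
  fixes c :: "'k \<Rightarrow> complex" and l :: "'k \<Rightarrow> real"
  assumes "finite K" and \<Phi>: "\<And>z. \<Phi> z = (\<Sum>k\<in>K. c k * exp (of_real (l k) * z))"
    and "\<And>z. Re z = a \<Longrightarrow> norm (\<Phi> z) \<le> B" "\<And>z. Re z = b \<Longrightarrow> norm (\<Phi> z) \<le> B"
    and t: "a \<le> t" "t \<le> b" and B: "0 < B"
  shows "norm (\<Phi> (of_real t)) \<le> B"
proof -
  define f where "f = (\<lambda>z. (\<Sum>k\<in>K. c k * exp (of_real (l k) * z)) / of_real B)"
  have f\<Phi>: "f z = \<Phi> z / of_real B" for z by (simp add: f_def \<Phi>)
  have "norm (f (of_real t)) \<le> 1"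
  proof (rule three_lines[where a = a and b = b])
    show "f holomorphic_on {z. a < Re z \<and> Re z < b}"
      unfolding f_def by (intro holomorphic_intros) (use B in auto)
    show "continuous_on {z. a \<le> Re z \<and> Re z \<le> b} f"
      unfolding f_def by (intro continuous_intros) (use B in auto)
    \<comment> \<open>Real frequencies make every exponential bounded on the strip, which supplies
      the boundedness hypothesis of \<open>three_lines\<close>.\<close>
    have "norm (f z) \<le> (\<Sum>k\<in>K. norm (c k) * exp (\<bar>l k\<bar> * (\<bar>a\<bar> + \<bar>b\<bar>))) / B" if "a \<le> Re z" "Re z \<le> b" for z
    proof -
      have "norm (\<Sum>k\<in>K. c k * exp (of_real (l k) * z)) \<le> (\<Sum>k\<in>K. norm (c k) * exp (\<bar>l k\<bar> * (\<bar>a\<bar> + \<bar>b\<bar>)))"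
      proof (rule sum_norm_le)
        fix k
        have "l k * Re z \<le> \<bar>l k\<bar> * \<bar>Re z\<bar>" by (metis abs_ge_self abs_mult)
        also have "\<dots> \<le> \<bar>l k\<bar> * (\<bar>a\<bar> + \<bar>b\<bar>)" using that by (intro mult_left_mono) auto
        finally show "norm (c k * exp (of_real (l k) * z)) \<le> norm (c k) * exp (\<bar>l k\<bar> * (\<bar>a\<bar> + \<bar>b\<bar>))"
          by (simp add: norm_mult mult_left_mono)
      qed
      then show ?thesis using B by (simp add: f_def norm_divide divide_right_mono)
    qed
    then show "bounded (f ` {z. a \<le> Re z \<and> Re z \<le> b})" by (auto simp: bounded_iff)
  qed (use assms f\<Phi> in \<open>auto simp: norm_divide\<close>)
  then show ?thesis using B by (simp add: f\<Phi> norm_divide)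
qed

text \<open>The factor is the entire family sgn c |c|^(a z), by which functions are deformed along
  the strip. At c = 0 both sides vanish, as \<open>sgn 0 = 0\<close> and
  \<open>0 powr _ = 0\<close>.\<close>

lemma norm_sgn_exp:
  fixes c z :: complex and a :: real
  shows "norm (sgn c * exp (of_real (a * ln (norm c)) * z)) = norm c powr (a * Re z)"
  by (cases "c = 0") (auto simp: norm_mult norm_sgn powr_def mult_ac)

lemma sgn_exp_eq:
  fixes c :: complex
  shows "sgn c * exp (of_real (ln (norm c))) = c"
  by (cases "c = 0") (auto simp: sgn_eq exp_of_real)

text \<open>Summing over the finitely many values of \<open>g\<close> takes \<open>H\<close> out of
  the integral. A complex parameter inside \<open>H\<close> then sits in finitely many coefficients,
  so holomorphy needs no differentiation under the integral.\<close>

lemma integral_simple_function_times: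
  fixes g :: "'b \<Rightarrow> 'c" and H :: "'c \<Rightarrow> complex" and u :: "'b \<Rightarrow> complex"
  assumes g: "simple_function M g" and u: "integrable M u"
  shows "integrable M (\<lambda>x. H (g x) * u x)"
    and "(\<integral>x. H (g x) * u x \<partial>M) = (\<Sum>y\<in>g ` space M. H y * (\<integral>x. indicator (g -` {y} \<inter> space M) x * u x \<partial>M))"
proof -
  have fin: "finite (g ` space M)" using g by (simp add: simple_function_def)
  have int: "integrable M (\<lambda>x. indicator (g -` {y} \<inter> space M) x * u x)" if "y \<in> g ` space M" for y
  proof (rule Bochner_Integration.integrable_bound[OF u])
    have "g -` {y} \<inter> space M \<in> sets M" using g that by (auto simp: simple_function_def)
    moreover have "u \<in> borel_measurable M" using u by simp
    ultimately show "(\<lambda>x. indicator (g -` {y} \<inter> space M) x * u x) \<in> borel_measurable M"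
      by (intro borel_measurable_times borel_measurable_indicator)
  qed (auto simp: indicator_def)
  have eq: "H (g x) * u x = (\<Sum>y\<in>g ` space M. H y * (indicator (g -` {y} \<inter> space M) x * u x))" if "x \<in> space M" for x
  proof -
    have "(\<Sum>y\<in>g ` space M. H y * (indicator (g -` {y} \<inter> space M) x * u x)) =
        (\<Sum>y\<in>g ` space M. if y = g x then H y * u x else 0)"
      using that by (intro sum.cong) (auto simp: indicator_def)
    then show ?thesis using that fin by simp
  qed
  have "integrable M (\<lambda>x. \<Sum>y\<in>g ` space M. H y * (indicator (g -` {y} \<inter> space M) x * u x))"
    by (intro Bochner_Integration.integrable_sum integrable_mult_right int)
  then show "integrable M (\<lambda>x. H (g x) * u x)"
    using eq by (subst Bochner_Integration.integrable_cong[OF refl eq]) auto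
  have "(\<integral>x. H (g x) * u x \<partial>M) = (\<integral>x. (\<Sum>y\<in>g ` space M. H y * (indicator (g -` {y} \<inter> space M) x * u x)) \<partial>M)"
    by (intro Bochner_Integration.integral_cong eq) auto
  also have "\<dots> = (\<Sum>y\<in>g ` space M. \<integral>x. H y * (indicator (g -` {y} \<inter> space M) x * u x) \<partial>M)"
    by (intro Bochner_Integration.integral_sum integrable_mult_right int)
  also have "\<dots> = (\<Sum>y\<in>g ` space M. H y * (\<integral>x. indicator (g -` {y} \<inter> space M) x * u x \<partial>M))"
    by simp
  finally show "(\<integral>x. H (g x) * u x \<partial>M) = (\<Sum>y\<in>g ` space M. H y * (\<integral>x. indicator (g -` {y} \<inter> space M) x * u x \<partial>M))" .
qed

text \<open>The off-diagonal terms of the \<open>L\<^sup>2\<close> bound on the left boundary line of the interpolation, for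
  simple \<open>\<psi> j\<close>; they disappear in the limit when the \<open>u j\<close> are asymptotically orthogonal.\<close>

definition correlation :: "'b measure \<Rightarrow> real \<Rightarrow> real \<Rightarrow> 'j set \<Rightarrow> ('j \<Rightarrow> 'b \<Rightarrow> complex) \<Rightarrow> ('j \<Rightarrow> 'b \<Rightarrow> complex) \<Rightarrow> real" where
  "correlation M p s J \<psi> u = (\<Sum>j\<in>J. \<Sum>k\<in>J - {j}. \<Sum>y\<in>(\<lambda>x. (\<psi> j x, \<psi> k x)) ` space M.
     norm (fst y) powr (s / 2) * lnorm M s (\<psi> j) powr ((p - s) / 2) *
     (norm (snd y) powr (s / 2) * lnorm M s (\<psi> k) powr ((p - s) / 2)) *
     norm (\<integral>x. indicator ((\<lambda>x. (\<psi> j x, \<psi> k x)) -` {y} \<inter> space M) x * (u j x * cnj (u k x)) \<partial>M))"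

lemma correlation_nonneg: "0 \<le> correlation M p s J \<psi> u"
  unfolding correlation_def by (intro sum_nonneg mult_nonneg_nonneg) auto

context finite_measure
begin

text \<open>A Hausdorff--Young inequality for almost orthogonal unimodular functions. It interpolates between
  \<open>\<ell>\<^sup>1L\<^sup>\<infinity>\<close> and \<open>\<ell>\<^sup>2L\<^sup>2\<close> by the three lines theorem.\<close>

lemma pairing_le_correlation:
  fixes f :: "'a \<Rightarrow> complex" and \<psi> u :: "'j \<Rightarrow> 'a \<Rightarrow> complex"
  assumes ps: "1 < p" "p \<le> 2" "1 / p + 1 / s = 1" and J: "finite J"
    and f: "simple_function M f" "f \<in> lpow M p" "lnorm M p f = 1"
    and \<psi>: "\<And>j. j \<in> J \<Longrightarrow> simple_function M (\<psi> j)" "\<And>j. j \<in> J \<Longrightarrow> \<psi> j \<in> lpow M s"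
      "\<And>j. j \<in> J \<Longrightarrow> 0 < lnorm M s (\<psi> j)" "(\<Sum>j\<in>J. lnorm M s (\<psi> j) powr p) = 1"
    and u [measurable]: "\<And>j. j \<in> J \<Longrightarrow> u j \<in> borel_measurable M"
      and un: "\<And>j x. j \<in> J \<Longrightarrow> x \<in> space M \<Longrightarrow> norm (u j x) = 1"
  shows "norm (\<Sum>j\<in>J. \<integral>x. f x * (u j x * \<psi> j x) \<partial>M) \<le> sqrt (1 + correlation M p s J \<psi> u)"
proof -
  have s: "2 \<le> s" "s > 0" "s / p = s - 1"
  proof -
    have "s \<noteq> 0" using ps by auto
    then have sp: "s + p = p * s" using ps by (simp add: field_simps)
    have "s > 0"
    proof (rule ccontr)
      assume "\<not> s > 0"
      then have "1 / s \<le> 0" by (simp add: divide_le_0_iff)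
      moreover have "1 / p < 1" using ps by simp
      ultimately show False using ps(3) by linarith
    qed
    moreover have "1 / p \<ge> 1 / 2" using ps by (intro divide_left_mono) auto
    then have "1 / s \<le> 1 / 2" using ps(3) by linarith
    ultimately show "2 \<le> s" "s > 0" by (auto simp: field_simps)
    show "s / p = s - 1" using sp ps by (simp add: field_simps)
  qed
  define b where "b = (\<lambda>j. lnorm M s (\<psi> j))"
  define \<delta> where "\<delta> = correlation M p s J \<psi> u"
  have \<delta>0: "\<delta> \<ge> 0" unfolding \<delta>_def by (rule correlation_nonneg)
  \<comment> \<open>Analytic family equal to f at z = 1/p. Its modulus |f|^(p Re z) makes it
    normalised in L^1 on Re z = 1 and in L^2 on Re z = 1/2.\<close>
  define F where "F = (\<lambda>v z. sgn v * exp (of_real (p * ln (norm v)) * z) :: complex)"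
  \<comment> \<open>Analytic family equal to \<psi> j at z = 1/p. The powers of \<open>b j\<close>
    make |P| at most b_j^p on Re z = 1, and |P|^2 = b_j^(p-s) |\<psi> j|^s, of integral b_j^p, on Re
    z = 1/2.\<close>
  define P where "P = (\<lambda>j w z. sgn w * exp (of_real (s * ln (norm w)) * (1 - z)) *
      exp (of_real (ln (b j)) * (- of_real s + of_real (p + s) * z)) :: complex)"
  have nF: "norm (F v z) = norm v powr (p * Re z)" for v z
    unfolding F_def by (rule norm_sgn_exp)
  have nP: "norm (P j w z) = norm w powr (s * (1 - Re z)) * b j powr (- s + (p + s) * Re z)" if "j \<in> J" for j w z
  proof -
    have "norm (exp (of_real (ln (b j)) * (- of_real s + of_real (p + s) * z))) = b j powr (- s + (p + s) * Re z)"
      using \<psi>(3)[OF that] by (simp add: powr_def b_def mult_ac)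
    then show ?thesis unfolding P_def norm_mult[of _ "exp (of_real (ln (b j)) * _)"]
      by (simp only: norm_sgn_exp) simp
  qed
  have uint: "integrable M (u j)" if "j \<in> J" for j
    using un that by (intro integrable_const_bound[of _ 1]) auto
  have sf: "simple_function M (\<lambda>x. (f x, \<psi> j x))" if "j \<in> J" for j
    by (intro simple_function_Pair f \<psi> that)
  define \<Phi> where "\<Phi> = (\<lambda>z. \<Sum>j\<in>J. \<integral>x. F (f x) z * P j (\<psi> j x) z * u j x \<partial>M)"
  define K where "K = (SIGMA j:J. (\<lambda>x. (f x, \<psi> j x)) ` space M)"
  define c where "c = (\<lambda>(j, v, w). sgn v * (sgn w * exp (of_real (s * ln (norm w))) * exp (of_real (ln (b j) * - s))) *
    (\<integral>x. indicator ((\<lambda>x. (f x, \<psi> j x)) -` {(v, w)} \<inter> space M) x * u j x \<partial>M))"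
  define l where "l = (\<lambda>(j, v :: complex, w :: complex). p * ln (norm v) - s * ln (norm w) + ln (b j) * (p + s))"
  have finK: "finite K" unfolding K_def using J sf by (intro finite_SigmaI) (auto simp: simple_function_def)
  have \<Phi>_sum: "\<Phi> z = (\<Sum>k\<in>K. c k * exp (of_real (l k) * z))" for z
  proof -
    have "\<Phi> z = (\<Sum>j\<in>J. \<Sum>y\<in>(\<lambda>x. (f x, \<psi> j x)) ` space M. F (fst y) z * P j (snd y) z *
      (\<integral>x. indicator ((\<lambda>x. (f x, \<psi> j x)) -` {y} \<inter> space M) x * u j x \<partial>M))"
      unfolding \<Phi>_def
    proof (rule sum.cong[OF refl])
      fix j assume "j \<in> J"
      from integral_simple_function_times(2)[OF sf[OF this] uint[OF this], where H = "\<lambda>y. F (fst y) z * P j (snd y) z"]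
      show "(\<integral>x. F (f x) z * P j (\<psi> j x) z * u j x \<partial>M) =
        (\<Sum>y\<in>(\<lambda>x. (f x, \<psi> j x)) ` space M. F (fst y) z * P j (snd y) z *
          (\<integral>x. indicator ((\<lambda>x. (f x, \<psi> j x)) -` {y} \<inter> space M) x * u j x \<partial>M))" by simp
    qed
    also have "\<dots> = (\<Sum>(j, y)\<in>K. F (fst y) z * P j (snd y) z *
      (\<integral>x. indicator ((\<lambda>x. (f x, \<psi> j x)) -` {y} \<inter> space M) x * u j x \<partial>M))"
      unfolding K_def using J sf by (intro sum.Sigma) (auto simp: simple_function_def)
    also have "\<dots> = (\<Sum>k\<in>K. c k * exp (of_real (l k) * z))"
    proof (rule sum.cong[OF refl])
      fix k assume "k \<in> K"
      obtain j v w where k: "k = (j, v, w)" by (metis prod_cases3)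
      have "F v z * P j w z = sgn v * (sgn w * exp (of_real (s * ln (norm w))) * exp (of_real (ln (b j) * - s))) *
          exp (of_real (l k) * z)"
        unfolding F_def P_def l_def k
        by (simp add: exp_add[symmetric] exp_diff algebra_simps exp_minus) (simp add: exp_add exp_diff exp_minus field_simps)
      then show "(case k of (j, y) \<Rightarrow> F (fst y) z * P j (snd y) z *
        (\<integral>x. indicator ((\<lambda>x. (f x, \<psi> j x)) -` {y} \<inter> space M) x * u j x \<partial>M)) = c k * exp (of_real (l k) * z)"
        by (simp add: k c_def mult_ac)
    qed
    finally show ?thesis .
  qed
  have fp: "(\<integral>x. norm (f x) powr p \<partial>M) = 1"
    using f(3) lnorm_powr[of p M f] ps by simp
  \<comment> \<open>On this line absolute values alone give \<Sum> b_j^p = 1.\<close>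
  have right: "norm (\<Phi> z) \<le> sqrt (1 + \<delta>)" if z: "Re z = 1" for z
  proof -
    have "norm (\<integral>x. F (f x) z * P j (\<psi> j x) z * u j x \<partial>M) \<le> b j powr p" if j: "j \<in> J" for j
    proof -
      have "norm (\<integral>x. F (f x) z * P j (\<psi> j x) z * u j x \<partial>M) \<le> (\<integral>x. norm (F (f x) z * P j (\<psi> j x) z * u j x) \<partial>M)"
        by (rule integral_norm_bound)
      also have "\<dots> \<le> (\<integral>x. norm (f x) powr p * b j powr p \<partial>M)"
      proof (rule integral_mono)
        show "integrable M (\<lambda>x. norm (F (f x) z * P j (\<psi> j x) z * u j x))"
          using integral_simple_function_times(1)[OF sf[OF j] uint[OF j], where H = "\<lambda>y. F (fst y) z * P j (snd y) z"] by simp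
        show "integrable M (\<lambda>x. norm (f x) powr p * b j powr p)" using lpow_integrable[OF f(2)] by auto
        fix x assume "x \<in> space M"
        then show "norm (F (f x) z * P j (\<psi> j x) z * u j x) \<le> norm (f x) powr p * b j powr p"
          using un[OF j] z by (simp add: norm_mult nF nP[OF j] mult_le_cancel_left mult_le_cancel_right powr_def)
      qed
      also have "\<dots> = b j powr p" using fp by simp
      finally show ?thesis .
    qed
    then have "norm (\<Phi> z) \<le> (\<Sum>j\<in>J. b j powr p)" unfolding \<Phi>_def by (intro sum_norm_le)
    also have "\<dots> = 1" using \<psi>(4) by (simp add: b_def)
    also have "\<dots> \<le> sqrt (1 + \<delta>)" using \<delta>0 by simp
    finally show ?thesis .
  qed
  \<comment> \<open>Cauchy-Schwarz leaves the L^2 norm of \<Sum> P_j u_j: its diagonal terms sum to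
    at most 1, and the others are dominated by the correlation.\<close>
  have left: "norm (\<Phi> z) \<le> sqrt (1 + \<delta>)" if z: "Re z = 1 / 2" for z
  proof -
    define G where "G = (\<lambda>x. \<Sum>j\<in>J. P j (\<psi> j x) z * u j x)"
    define h where "h = (\<lambda>x. F (f x) z)"
    have e: "- s + (p + s) * (1 / 2) = (p - s) / 2" "s * (1 - 1 / 2) = s / 2" by (auto simp: field_simps)
    have nP2: "norm (P j w z) powr 2 = b j powr (p - s) * norm w powr s" if "j \<in> J" for j w
    proof -
      have "(p - s) / 2 * 2 = p - s" "s / 2 * 2 = s" by simp_all
      then show ?thesis
        unfolding nP[OF that] z e powr_mult powr_powr by (simp only: mult.commute)
    qed
    have "simple_function M h"
      unfolding h_def using simple_function_compose[OF f(1), of "\<lambda>v. F v z"] by (simp add: comp_def)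
    then have [measurable]: "h \<in> borel_measurable M" by (rule borel_measurable_simple_function)
    have h2: "norm (h x) powr 2 = norm (f x) powr p" for x
      unfolding h_def nF z powr_powr by simp
    have hl: "h \<in> lpow M 2" using lpow_integrable[OF f(2)] by (intro lpowI) (auto simp: h2)
    have hn: "lnorm M 2 h = 1" unfolding lnorm_def h2 fp by simp
    have Psf: "simple_function M (\<lambda>x. P j (\<psi> j x) z)" if "j \<in> J" for j
      using simple_function_compose[OF \<psi>(1)[OF that], of "\<lambda>w. P j w z"] by (simp add: comp_def)
    have Pl: "(\<lambda>x. P j (\<psi> j x) z * u j x) \<in> lpow M 2" if j: "j \<in> J" for j
    proof (rule lpow_cong_norm)
      have [measurable]: "(\<lambda>x. P j (\<psi> j x) z) \<in> borel_measurable M"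
        using Psf[OF j] by (rule borel_measurable_simple_function)
      show "(\<lambda>x. P j (\<psi> j x) z * u j x) \<in> borel_measurable M" using u[OF j] by measurable
      show "(\<lambda>x. P j (\<psi> j x) z) \<in> lpow M 2"
        using lpow_integrable[OF \<psi>(2)[OF j]] by (intro lpowI) (auto simp: nP2[OF j])
    qed (use un[OF j] in \<open>auto simp: norm_mult\<close>)
    have Gl: "G \<in> lpow M 2" unfolding G_def by (intro lpow_sum Pl J) auto
    have "\<Phi> z = (\<integral>x. h x * G x \<partial>M)"
    proof -
      have "(\<integral>x. h x * G x \<partial>M) = (\<integral>x. (\<Sum>j\<in>J. h x * (P j (\<psi> j x) z * u j x)) \<partial>M)"
        by (simp add: G_def sum_distrib_left)
      also have "\<dots> = (\<Sum>j\<in>J. \<integral>x. h x * (P j (\<psi> j x) z * u j x) \<partial>M)"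
        using lpow_mult_integrable[of 2 2 h M, OF _ _ _ hl Pl] by (intro Bochner_Integration.integral_sum) auto
      finally show ?thesis by (simp add: \<Phi>_def h_def mult_ac)
    qed
    then have "norm (\<Phi> z) \<le> lnorm M 2 h * lnorm M 2 G"
      using Holder[of 2 2 h M G] hl Gl by simp
    then have \<Phi>G: "norm (\<Phi> z) \<le> lnorm M 2 G" by (simp add: hn)
    have prodint: "integrable M (\<lambda>x. P j (\<psi> j x) z * u j x * cnj (P k (\<psi> k x) z * u k x))" if "j \<in> J" "k \<in> J" for j k
    proof -
      have "(\<lambda>x. cnj (P k (\<psi> k x) z * u k x)) \<in> lpow M 2"
      proof (rule lpow_cong_norm[OF Pl[OF that(2)]])
        have "(\<lambda>x. P k (\<psi> k x) z * u k x) \<in> borel_measurable M" using Pl[OF that(2)] by (rule lpow_measurable)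
        then show "(\<lambda>x. cnj (P k (\<psi> k x) z * u k x)) \<in> borel_measurable M"
          by (rule measurable_compose) (auto intro!: borel_measurable_continuous_onI continuous_intros)
      qed (simp_all del: complex_cnj_mult)
      from lpow_mult_integrable[of 2 2, OF _ _ _ Pl[OF that(1)] this] show ?thesis by simp
    qed
    have "of_real (\<integral>x. norm (G x) powr 2 \<partial>M) = (\<integral>x. G x * cnj (G x) \<partial>M)"
      by (simp add: complex_norm_square[symmetric] del: of_real_power)
    also have "\<dots> = (\<integral>x. (\<Sum>j\<in>J. \<Sum>k\<in>J. P j (\<psi> j x) z * u j x * cnj (P k (\<psi> k x) z * u k x)) \<partial>M)"
      by (simp add: G_def sum_product cnj_sum del: complex_cnj_mult)
    also have "\<dots> = (\<Sum>j\<in>J. \<Sum>k\<in>J. \<integral>x. P j (\<psi> j x) z * u j x * cnj (P k (\<psi> k x) z * u k x) \<partial>M)"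
    proof -
      have "(\<integral>x. (\<Sum>j\<in>J. \<Sum>k\<in>J. P j (\<psi> j x) z * u j x * cnj (P k (\<psi> k x) z * u k x)) \<partial>M) =
        (\<Sum>j\<in>J. \<integral>x. (\<Sum>k\<in>J. P j (\<psi> j x) z * u j x * cnj (P k (\<psi> k x) z * u k x)) \<partial>M)"
        by (intro Bochner_Integration.integral_sum Bochner_Integration.integrable_sum prodint)
      also have "\<dots> = (\<Sum>j\<in>J. \<Sum>k\<in>J. \<integral>x. P j (\<psi> j x) z * u j x * cnj (P k (\<psi> k x) z * u k x) \<partial>M)"
        by (intro sum.cong refl Bochner_Integration.integral_sum prodint)
      finally show ?thesis .
    qed
    finally have Gexp: "of_real (\<integral>x. norm (G x) powr 2 \<partial>M) =
      (\<Sum>j\<in>J. \<Sum>k\<in>J. \<integral>x. P j (\<psi> j x) z * u j x * cnj (P k (\<psi> k x) z * u k x) \<partial>M)" .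
    have diag: "norm (\<integral>x. P j (\<psi> j x) z * u j x * cnj (P j (\<psi> j x) z * u j x) \<partial>M) \<le> b j powr p" if j: "j \<in> J" for j
    proof -
      have "norm (\<integral>x. P j (\<psi> j x) z * u j x * cnj (P j (\<psi> j x) z * u j x) \<partial>M) \<le>
        (\<integral>x. norm (P j (\<psi> j x) z * u j x * cnj (P j (\<psi> j x) z * u j x)) \<partial>M)"
        by (rule integral_norm_bound)
      also have "\<dots> = (\<integral>x. b j powr (p - s) * norm (\<psi> j x) powr s \<partial>M)"
      proof (intro Bochner_Integration.integral_cong refl)
        fix x assume "x \<in> space M"
        then have "norm (P j (\<psi> j x) z * u j x * cnj (P j (\<psi> j x) z * u j x)) = norm (P j (\<psi> j x) z) powr 2"
          using un[OF j] by (simp add: norm_mult power2_eq_square)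
        also have "\<dots> = b j powr (p - s) * norm (\<psi> j x) powr s" by (rule nP2[OF j])
        finally show "norm (P j (\<psi> j x) z * u j x * cnj (P j (\<psi> j x) z * u j x)) = b j powr (p - s) * norm (\<psi> j x) powr s" .
      qed
      also have "\<dots> = b j powr (p - s) * b j powr s"
        using s by (simp add: b_def lnorm_powr)
      also have "\<dots> = b j powr p" by (simp add: powr_add[symmetric])
      finally show ?thesis .
    qed
    have off: "norm (\<integral>x. P j (\<psi> j x) z * u j x * cnj (P k (\<psi> k x) z * u k x) \<partial>M) \<le>
      (\<Sum>y\<in>(\<lambda>x. (\<psi> j x, \<psi> k x)) ` space M.
       norm (fst y) powr (s / 2) * b j powr ((p - s) / 2) * (norm (snd y) powr (s / 2) * b k powr ((p - s) / 2)) *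
       norm (\<integral>x. indicator ((\<lambda>x. (\<psi> j x, \<psi> k x)) -` {y} \<inter> space M) x * (u j x * cnj (u k x)) \<partial>M))"
      if jk: "j \<in> J" "k \<in> J" for j k
    proof -
      have [measurable]: "u j \<in> borel_measurable M" "u k \<in> borel_measurable M" using u jk by auto
      have [measurable]: "(\<lambda>x. cnj (u k x)) \<in> borel_measurable M"
        by (rule measurable_compose[OF \<open>u k \<in> borel_measurable M\<close>])
          (auto intro!: borel_measurable_continuous_onI continuous_intros)
      have ujk: "integrable M (\<lambda>x. u j x * cnj (u k x))"
        using un jk by (intro integrable_const_bound[of _ 1]) (auto simp: norm_mult)
      have "(\<integral>x. P j (\<psi> j x) z * u j x * cnj (P k (\<psi> k x) z * u k x) \<partial>M) =
        (\<integral>x. (\<lambda>y. P j (fst y) z * cnj (P k (snd y) z)) (\<psi> j x, \<psi> k x) * (u j x * cnj (u k x)) \<partial>M)"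
        by (simp add: mult_ac)
      also have "\<dots> = (\<Sum>y\<in>(\<lambda>x. (\<psi> j x, \<psi> k x)) ` space M. P j (fst y) z * cnj (P k (snd y) z) *
         (\<integral>x. indicator ((\<lambda>x. (\<psi> j x, \<psi> k x)) -` {y} \<inter> space M) x * (u j x * cnj (u k x)) \<partial>M))"
        by (rule integral_simple_function_times(2)[OF simple_function_Pair ujk]) (use \<psi> jk in auto)
      finally have eq: "(\<integral>x. P j (\<psi> j x) z * u j x * cnj (P k (\<psi> k x) z * u k x) \<partial>M) = (\<Sum>y\<in>(\<lambda>x. (\<psi> j x, \<psi> k x)) ` space M. P j (fst y) z * cnj (P k (snd y) z) *
         (\<integral>x. indicator ((\<lambda>x. (\<psi> j x, \<psi> k x)) -` {y} \<inter> space M) x * (u j x * cnj (u k x)) \<partial>M))" .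
      show ?thesis
        unfolding eq
      proof (rule sum_norm_le)
        fix y
        show "norm (P j (fst y) z * cnj (P k (snd y) z) *
         (\<integral>x. indicator ((\<lambda>x. (\<psi> j x, \<psi> k x)) -` {y} \<inter> space M) x * (u j x * cnj (u k x)) \<partial>M)) \<le>
         norm (fst y) powr (s / 2) * b j powr ((p - s) / 2) * (norm (snd y) powr (s / 2) * b k powr ((p - s) / 2)) *
         norm (\<integral>x. indicator ((\<lambda>x. (\<psi> j x, \<psi> k x)) -` {y} \<inter> space M) x * (u j x * cnj (u k x)) \<partial>M)"
          unfolding norm_mult complex_mod_cnj nP[OF jk(1)] nP[OF jk(2)] z e by simp
      qed
    qed
    have "(\<integral>x. norm (G x) powr 2 \<partial>M) = norm (of_real (\<integral>x. norm (G x) powr 2 \<partial>M) :: complex)"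
      unfolding norm_of_real by (intro abs_of_nonneg[symmetric] integral_powr_nonneg)
    also have "\<dots> \<le> (\<Sum>j\<in>J. \<Sum>k\<in>J. norm (\<integral>x. P j (\<psi> j x) z * u j x * cnj (P k (\<psi> k x) z * u k x) \<partial>M))"
      unfolding Gexp by (intro sum_norm_le order_trans[OF norm_sum] sum_mono order_refl)
    also have "\<dots> = (\<Sum>j\<in>J. norm (\<integral>x. P j (\<psi> j x) z * u j x * cnj (P j (\<psi> j x) z * u j x) \<partial>M) +
        (\<Sum>k\<in>J - {j}. norm (\<integral>x. P j (\<psi> j x) z * u j x * cnj (P k (\<psi> k x) z * u k x) \<partial>M)))"
      using J by (intro sum.cong refl sum.remove) auto
    also have "\<dots> \<le> (\<Sum>j\<in>J. b j powr p + (\<Sum>k\<in>J - {j}. (\<Sum>y\<in>(\<lambda>x. (\<psi> j x, \<psi> k x)) ` space M.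
       norm (fst y) powr (s / 2) * b j powr ((p - s) / 2) * (norm (snd y) powr (s / 2) * b k powr ((p - s) / 2)) *
       norm (\<integral>x. indicator ((\<lambda>x. (\<psi> j x, \<psi> k x)) -` {y} \<inter> space M) x * (u j x * cnj (u k x)) \<partial>M))))"
      by (intro sum_mono add_mono diag off) auto
    also have "\<dots> = 1 + \<delta>"
      using \<psi>(4) by (simp add: sum.distrib \<delta>_def correlation_def b_def)
    finally have "(\<integral>x. norm (G x) powr 2 \<partial>M) \<le> 1 + \<delta>" .
    then have "lnorm M 2 G \<le> sqrt (1 + \<delta>)"
      using \<delta>0 by (subst lnorm_le_iff) auto
    with \<Phi>G show ?thesis by linarith
  qed
  \<comment> \<open>The point 1/p lies in [1/2, 1] because 1 < p <= 2.\<close>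
  have "norm (\<Phi> (of_real (1 / p))) \<le> sqrt (1 + \<delta>)"
    by (rule three_lines_exp_sum[where a = "1 / 2" and b = 1, OF finK \<Phi>_sum left right]) (use ps \<delta>0 in \<open>auto simp: field_simps\<close>)
  moreover have "\<Phi> (of_real (1 / p)) = (\<Sum>j\<in>J. \<integral>x. f x * (u j x * \<psi> j x) \<partial>M)"
  proof -
    have Ff: "F v (of_real (1 / p)) = v" for v
    proof -
      have "of_real (p * ln (norm v)) * of_real (1 / p) = (of_real (ln (norm v)) :: complex)"
        using ps by (simp only: of_real_mult[symmetric]) simp
      then show ?thesis unfolding F_def by (simp only: sgn_exp_eq)
    qed
    have Pw: "P j w (of_real (1 / p)) = w" for j w
    proof -
      have "s * (1 - 1 / p) = 1" using ps s by (simp add: field_simps)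
      then have "s * ln (norm w) * (1 - 1 / p) = ln (norm w)" by (simp add: mult_ac)
      moreover have "- s + (p + s) * (1 / p) = 0" using s ps by (simp add: add_divide_distrib distrib_right)
      ultimately have "of_real (s * ln (norm w)) * (1 - of_real (1 / p)) = (of_real (ln (norm w)) :: complex)"
        "- of_real s + of_real (p + s) * of_real (1 / p) = (0 :: complex)"
        by (metis of_real_1 of_real_diff of_real_mult, metis of_real_0 of_real_add of_real_minus of_real_mult)
      then show ?thesis unfolding P_def by (simp only: sgn_exp_eq mult_zero_right exp_zero mult_1_right)
    qed
    show ?thesis unfolding \<Phi>_def Ff Pw by (simp add: mult_ac)
  qed
  ultimately show ?thesis by (simp add: \<delta>_def)
qed

lemma lpow_unimodular_times:
  assumes "0 < p" "\<psi> \<in> lpow M p" "u \<in> borel_measurable M" "\<And>x. x \<in> space M \<Longrightarrow> norm (u x) = 1"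
  shows "(\<lambda>x. u x * \<psi> x) \<in> lpow M p" "lnorm M p (\<lambda>x. u x * \<psi> x) = lnorm M p \<psi>"
proof -
  have "(\<lambda>x. u x * \<psi> x) \<in> borel_measurable M" using assms(3) lpow_measurable[OF assms(2)] by measurable
  then show "(\<lambda>x. u x * \<psi> x) \<in> lpow M p"
    using assms by (intro lpow_cong_norm[OF assms(2)]) (auto simp: norm_mult)
  show "lnorm M p (\<lambda>x. u x * \<psi> x) = lnorm M p \<psi>"
    using assms by (intro lnorm_cong_norm) (auto simp: norm_mult)
qed

text \<open>Dualises the pairing estimate: density extends it from simple f to all of L^p, and
  testing with the dual function of the sum recovers the L^s norm.\<close>

lemma lnorm_sum_le_correlation:
  fixes \<psi> u :: "'j \<Rightarrow> 'a \<Rightarrow> complex"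
  assumes ps: "1 < p" "p \<le> 2" "1 < s" "1 / p + 1 / s = 1" and J: "finite J"
    and \<psi>: "\<And>j. j \<in> J \<Longrightarrow> simple_function M (\<psi> j)" "\<And>j. j \<in> J \<Longrightarrow> \<psi> j \<in> lpow M s"
      "\<And>j. j \<in> J \<Longrightarrow> 0 < lnorm M s (\<psi> j)" "(\<Sum>j\<in>J. lnorm M s (\<psi> j) powr p) = 1"
    and u: "\<And>j. j \<in> J \<Longrightarrow> u j \<in> borel_measurable M"
      and un: "\<And>j x. j \<in> J \<Longrightarrow> x \<in> space M \<Longrightarrow> norm (u j x) = 1"
  shows "lnorm M s (\<lambda>x. \<Sum>j\<in>J. u j x * \<psi> j x) \<le> sqrt (1 + correlation M p s J \<psi> u)"
proof -
  define \<delta> where "\<delta> = correlation M p s J \<psi> u"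
  have \<delta>0: "\<delta> \<ge> 0" unfolding \<delta>_def by (rule correlation_nonneg)
  define F where "F = (\<lambda>x. \<Sum>j\<in>J. u j x * \<psi> j x)"
  have up: "(\<lambda>x. u j x * \<psi> j x) \<in> lpow M s" if "j \<in> J" for j
    using that ps u un \<psi> by (intro lpow_unimodular_times) auto
  have Fl: "F \<in> lpow M s" unfolding F_def by (intro lpow_sum up ps J)
  have split: "(\<integral>x. f x * F x \<partial>M) = (\<Sum>j\<in>J. \<integral>x. f x * (u j x * \<psi> j x) \<partial>M)" if "f \<in> lpow M p" for f
    unfolding F_def sum_distrib_left
    by (intro Bochner_Integration.integral_sum lpow_mult_integrable[OF ps(1,3,4) that up])
  have simple: "norm (\<integral>x. f x * F x \<partial>M) \<le> sqrt (1 + \<delta>) * lnorm M p f"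
    if f: "simple_function M f" "f \<in> lpow M p" for f
  proof (cases "lnorm M p f = 0")
    case True
    then show ?thesis using Holder[OF ps(1,3,4) f(2) Fl] by simp
  next
    case False
    then have pos: "0 < lnorm M p f" using lnorm_nonneg[of M p f] by linarith
    define g where "g = (\<lambda>x. of_real (1 / lnorm M p f) * f x)"
    have gl: "g \<in> lpow M p" unfolding g_def using ps f by (intro lpow_scale) auto
    have "simple_function M g"
      unfolding g_def using simple_function_compose[OF f(1), of "\<lambda>v. of_real (1 / lnorm M p f) * v"] by (simp add: comp_def)
    moreover have "lnorm M p g = 1"
      unfolding g_def using ps pos by (subst lnorm_scale) (auto simp: norm_divide)
    ultimately have "norm (\<integral>x. g x * F x \<partial>M) \<le> sqrt (1 + \<delta>)"
      unfolding split[OF gl] \<delta>_def using gl ps J \<psi> u un by (intro pairing_le_correlation) auto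
    moreover have "(\<integral>x. g x * F x \<partial>M) = of_real (1 / lnorm M p f) * (\<integral>x. f x * F x \<partial>M)"
      unfolding g_def mult.assoc by (rule integral_mult_right_zero)
    then have "norm (\<integral>x. g x * F x \<partial>M) = norm (\<integral>x. f x * F x \<partial>M) / lnorm M p f"
      using pos by (simp only: norm_mult norm_of_real) simp
    ultimately show ?thesis using pos by (simp add: divide_le_eq)
  qed
  have general: "norm (\<integral>x. f x * F x \<partial>M) \<le> sqrt (1 + \<delta>) * lnorm M p f" if f: "f \<in> lpow M p" for f
  proof -
    have *: "norm (\<integral>x. f x * F x \<partial>M) \<le> sqrt (1 + \<delta>) * (lnorm M p f + e) + e * lnorm M s F" if "e > 0" for e
    proof -
      obtain g where g: "simple_function M g" "g \<in> lpow M p" "lnorm M p (\<lambda>x. f x - g x) < e"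
        using lpow_simple_approx[OF ps(1) f \<open>e > 0\<close>] by blast
      have "(\<integral>x. f x * F x \<partial>M) = (\<integral>x. g x * F x \<partial>M) + (\<integral>x. (f x - g x) * F x \<partial>M)"
        using lpow_mult_integrable[OF ps(1,3,4) f Fl] lpow_mult_integrable[OF ps(1,3,4) g(2) Fl]
        by (simp add: left_diff_distrib)
      then have "norm (\<integral>x. f x * F x \<partial>M) \<le> norm (\<integral>x. g x * F x \<partial>M) + norm (\<integral>x. (f x - g x) * F x \<partial>M)"
        by (simp add: norm_triangle_ineq)
      also have "\<dots> \<le> sqrt (1 + \<delta>) * lnorm M p g + lnorm M p (\<lambda>x. f x - g x) * lnorm M s F"
        by (intro add_mono simple[OF g(1,2)] Holder[OF ps(1,3,4) lpow_diff[OF ps(1) f g(2)] Fl])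
      also have "\<dots> \<le> sqrt (1 + \<delta>) * (lnorm M p f + e) + e * lnorm M s F"
        using lnorm_diff_triangle[OF ps(1) g(2) f] g(3) \<delta>0
        unfolding lnorm_minus_commute[of M p g f] by (intro add_mono mult_left_mono mult_right_mono) auto
      finally show ?thesis .
    qed
    show ?thesis
    proof (rule tendsto_lowerbound)
      have "((\<lambda>e. sqrt (1 + \<delta>) * (lnorm M p f + e) + e * lnorm M s F) \<longlongrightarrow>
        sqrt (1 + \<delta>) * (lnorm M p f + 0) + 0 * lnorm M s F) (at_right 0)"
        by (intro tendsto_intros)
      then show "((\<lambda>e. sqrt (1 + \<delta>) * (lnorm M p f + e) + e * lnorm M s F) \<longlongrightarrow> sqrt (1 + \<delta>) * lnorm M p f) (at_right 0)"
        by simp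
      show "\<forall>\<^sub>F e in at_right 0. norm (\<integral>x. f x * F x \<partial>M) \<le> sqrt (1 + \<delta>) * (lnorm M p f + e) + e * lnorm M s F"
        using * by (auto simp: eventually_at_filter)
    qed simp
  qed
  define N where "N = lnorm M s F"
  define g where "g = (\<lambda>x. cnj (F x) * of_real (norm (F x) powr (s - 2)))"
  have sp: "1 / s + 1 / p = 1" using ps by simp
  have g: "g \<in> lpow M p" "(\<integral>x. norm (g x) powr p \<partial>M) = (\<integral>x. norm (F x) powr s \<partial>M)"
    "(\<integral>x. F x * g x \<partial>M) = of_real (\<integral>x. norm (F x) powr s \<partial>M)"
    unfolding g_def by (rule lpow_dual[OF ps(3,1) sp Fl])+
  have Ns: "(\<integral>x. norm (F x) powr s \<partial>M) = N powr s" unfolding N_def using ps by (simp add: lnorm_powr)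
  have "lnorm M p g = N powr (s / p)" unfolding lnorm_def g(2) Ns powr_powr by simp
  also have "s / p = s - 1" using ps by (simp add: field_simps)
  finally have ng: "lnorm M p g = N powr (s - 1)" .
  have "N powr s = norm (\<integral>x. g x * F x \<partial>M)"
    using g(3) Ns by (simp add: mult.commute)
  also have "\<dots> \<le> sqrt (1 + \<delta>) * N powr (s - 1)" using general[OF g(1)] by (simp add: ng)
  finally have *: "N powr s \<le> sqrt (1 + \<delta>) * N powr (s - 1)" .
  have "N \<le> sqrt (1 + \<delta>)"
  proof (cases "N = 0")
    case True
    then show ?thesis using \<delta>0 by simp
  next
    case False
    then have "N > 0" unfolding N_def using lnorm_nonneg[of M s F] by linarith
    then have "N powr s = N * N powr (s - 1)" by (simp add: powr_diff)
    with * \<open>N > 0\<close> show ?thesis by simp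
  qed
  then show ?thesis by (simp add: N_def F_def \<delta>_def)
qed

text \<open>Each summand is a constant times u_j cnj u_k tested against the indicator of a level
  set, which is integrable because the measure is finite.\<close>

lemma correlation_tendsto_zero:
  fixes \<psi> :: "'j \<Rightarrow> 'a \<Rightarrow> complex" and u :: "'j \<Rightarrow> nat \<Rightarrow> 'a \<Rightarrow> complex"
  assumes "finite J" and \<psi>: "\<And>j. j \<in> J \<Longrightarrow> simple_function M (\<psi> j)"
    and orth: "\<And>j k h. j \<in> J \<Longrightarrow> k \<in> J \<Longrightarrow> j \<noteq> k \<Longrightarrow> integrable M h \<Longrightarrow>
      (\<lambda>n. \<integral>x. h x * (u j n x * cnj (u k n x)) \<partial>M) \<longlonglongrightarrow> 0"
  shows "(\<lambda>n. correlation M p s J \<psi> (\<lambda>j. u j n)) \<longlonglongrightarrow> 0"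
  unfolding correlation_def
proof (intro tendsto_null_sum tendsto_mult_right_zero tendsto_norm_zero orth)
  fix j k y assume jk: "j \<in> J" "k \<in> J - {j}" "y \<in> (\<lambda>x. (\<psi> j x, \<psi> k x)) ` space M"
  then have "simple_function M (\<lambda>x. (\<psi> j x, \<psi> k x))" by (intro simple_function_Pair \<psi>) auto
  then have "(\<lambda>x. (\<psi> j x, \<psi> k x)) -` {y} \<inter> space M \<in> sets M"
    using jk(3) by (auto simp: simple_function_def)
  then show "integrable M (indicator ((\<lambda>x. (\<psi> j x, \<psi> k x)) -` {y} \<inter> space M) :: 'a \<Rightarrow> complex)"
    by (intro integrable_const_bound[of _ 1]) (auto simp: indicator_def)
qed auto

text \<open>Each \<psi> j is replaced by a simple function, the family is rescaled to \<Sum> norm^p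
  = 1, and the correlation tends to 0. Undoing the rescaling produces the l^p sum on the
  right.\<close>

lemma lnorm_sum_eventually_le_small:
  fixes \<psi> :: "'j \<Rightarrow> 'a \<Rightarrow> complex" and u :: "'j \<Rightarrow> nat \<Rightarrow> 'a \<Rightarrow> complex"
  assumes ps: "1 < p" "p \<le> 2" "1 < s" "1 / p + 1 / s = 1" and J: "finite J"
    and \<psi>: "\<And>j. j \<in> J \<Longrightarrow> \<psi> j \<in> lpow M s"
    and u: "\<And>j n. j \<in> J \<Longrightarrow> u j n \<in> borel_measurable M"
    and un: "\<And>j n x. j \<in> J \<Longrightarrow> x \<in> space M \<Longrightarrow> norm (u j n x) = 1"
    and orth: "\<And>j k h. j \<in> J \<Longrightarrow> k \<in> J \<Longrightarrow> j \<noteq> k \<Longrightarrow> integrable M h \<Longrightarrow>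
      (\<lambda>n. \<integral>x. h x * (u j n x * cnj (u k n x)) \<partial>M) \<longlonglongrightarrow> 0"
    and "0 < e"
  shows "\<forall>\<^sub>F n in sequentially. lnorm M s (\<lambda>x. \<Sum>j\<in>J. u j n x * \<psi> j x) \<le>
    (\<Sum>j\<in>J. lnorm M s (\<psi> j) powr p) powr (1 / p) + e"
proof -
  define b where "b = (\<lambda>j. lnorm M s (\<psi> j))"
  \<comment> \<open>The perturbed right-hand side: each norm may grow by d under approximation, and
    T d tends to T 0.\<close>
  define T where "T = (\<lambda>d. (\<Sum>j\<in>J. (b j + d) powr p) powr (1 / p))"
  have "((\<lambda>d. \<Sum>j\<in>J. (b j + d) powr p) \<longlongrightarrow> (\<Sum>j\<in>J. (b j + 0) powr p)) (at_right 0)"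
    using ps by (intro tendsto_sum tendsto_powr' tendsto_add tendsto_const tendsto_ident_at)
      (auto simp: b_def eventually_at_filter)
  then have "(T \<longlongrightarrow> T 0) (at_right 0)"
    unfolding T_def using ps
    by (intro tendsto_powr' tendsto_const disjI2 conjI always_eventually allI sum_nonneg) auto
  then have "((\<lambda>d. T d * (1 + d) + real (card J) * d) \<longlongrightarrow> T 0 * (1 + 0) + real (card J) * 0) (at_right 0)"
    by (intro tendsto_intros)
  then have "\<forall>\<^sub>F d in at_right 0. T d * (1 + d) + real (card J) * d < T 0 + e"
    using \<open>0 < e\<close> by (intro order_tendstoD(2)) auto
  moreover have "\<forall>\<^sub>F d::real in at_right 0. 0 < d"
    using eventually_at_right_real[of 0 "1::real"] by (auto elim: eventually_mono)
  ultimately have "\<forall>\<^sub>F d in at_right 0. T d * (1 + d) + real (card J) * d < T 0 + e \<and> 0 < d"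
    by eventually_elim auto
  then obtain d where d: "T d * (1 + d) + real (card J) * d < T 0 + e" "0 < d"
    using eventually_happens by fastforce
  have "\<exists>g. simple_function M g \<and> g \<in> lpow M s \<and> lnorm M s (\<lambda>x. \<psi> j x - g x) < d" if "j \<in> J" for j
    using lpow_simple_approx[OF ps(3) \<psi>[OF that] d(2)] by blast
  then obtain g where g: "\<And>j. j \<in> J \<Longrightarrow> simple_function M (g j)" "\<And>j. j \<in> J \<Longrightarrow> g j \<in> lpow M s"
    "\<And>j. j \<in> J \<Longrightarrow> lnorm M s (\<lambda>x. \<psi> j x - g j x) < d" by metis
  \<comment> \<open>The correlation bound asks for positive norms, so approximants of norm zero are
    dropped; their \<psi> j have norm at most d and go into the error \<open>D\<close>.\<close>
  define J' where "J' = {j \<in> J. 0 < lnorm M s (g j)}"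
  have J': "finite J'" "J' \<subseteq> J" using J by (auto simp: J'_def)
  define R where "R = (\<Sum>j\<in>J'. lnorm M s (g j) powr p) powr (1 / p)"
  have gb: "lnorm M s (g j) \<le> b j + d" if "j \<in> J" for j
    using lnorm_diff_triangle[OF ps(3) g(2)[OF that] \<psi>[OF that]] g(3)[OF that]
    unfolding lnorm_minus_commute[of M s "g j"] by (simp add: b_def)
  have RT: "R \<le> T d"
  proof -
    have "(\<Sum>j\<in>J'. lnorm M s (g j) powr p) \<le> (\<Sum>j\<in>J'. (b j + d) powr p)"
      using gb J' ps by (intro sum_mono powr_mono2) auto
    also have "\<dots> \<le> (\<Sum>j\<in>J. (b j + d) powr p)"
      using J J' by (intro sum_mono2) auto
    finally show ?thesis
      unfolding R_def T_def using ps by (intro powr_mono2) (auto intro!: sum_nonneg)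
  qed
  have main: "\<forall>\<^sub>F n in sequentially. lnorm M s (\<lambda>x. \<Sum>j\<in>J'. u j n x * g j x) \<le> R * (1 + d)"
  proof (cases "J' = {}")
    case True
    moreover have "0 \<le> R * (1 + d)" using d by (simp add: R_def)
    ultimately show ?thesis by simp
  next
    case False
    have Spos: "(\<Sum>j\<in>J'. lnorm M s (g j) powr p) > 0"
      using False J' by (intro sum_pos) (auto simp: J'_def)
    then have R: "R > 0" by (simp add: R_def)
    define h where "h = (\<lambda>j x. of_real (1 / R) * g j x)"
    have h: "simple_function M (h j)" "h j \<in> lpow M s" "lnorm M s (h j) = lnorm M s (g j) / R" if "j \<in> J'" for j
    proof -
      have j: "j \<in> J" using that J' by auto
      show "simple_function M (h j)"
        unfolding h_def using simple_function_compose[OF g(1)[OF j], of "\<lambda>v. of_real (1 / R) * v"] by (simp add: comp_def)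
      show "h j \<in> lpow M s" unfolding h_def using ps g(2)[OF j] by (intro lpow_scale) auto
      show "lnorm M s (h j) = lnorm M s (g j) / R"
        unfolding h_def using ps R by (subst lnorm_scale) (auto simp: norm_divide)
    qed
    have hsum: "(\<Sum>j\<in>J'. lnorm M s (h j) powr p) = 1"
    proof -
      have "(\<Sum>j\<in>J'. lnorm M s (h j) powr p) = (\<Sum>j\<in>J'. lnorm M s (g j) powr p / R powr p)"
        using h(3) R by (intro sum.cong refl) (simp add: powr_divide)
      also have "\<dots> = (\<Sum>j\<in>J'. lnorm M s (g j) powr p) / R powr p" by (rule sum_divide_distrib[symmetric])
      also have "R powr p = (\<Sum>j\<in>J'. lnorm M s (g j) powr p)"
        unfolding R_def powr_powr using ps Spos by simp
      finally show ?thesis using Spos by simp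
    qed
    have corr: "(\<lambda>n. correlation M p s J' h (\<lambda>j. u j n)) \<longlonglongrightarrow> 0"
    proof (rule correlation_tendsto_zero[OF J'(1) h(1)])
      fix j k and h :: "'a \<Rightarrow> complex" assume "j \<in> J'" "k \<in> J'" "j \<noteq> k" and h: "integrable M h"
      then show "(\<lambda>n. \<integral>x. h x * (u j n x * cnj (u k n x)) \<partial>M) \<longlonglongrightarrow> 0"
        using J' by (intro orth h) auto
    qed
    have "(\<lambda>n. sqrt (1 + correlation M p s J' h (\<lambda>j. u j n))) \<longlonglongrightarrow> sqrt (1 + 0)"
      by (intro tendsto_intros corr)
    then have "\<forall>\<^sub>F n in sequentially. sqrt (1 + correlation M p s J' h (\<lambda>j. u j n)) < 1 + d"
      using d by (intro order_tendstoD(2)) auto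
    then show ?thesis
    proof eventually_elim
      case (elim n)
      have "lnorm M s (\<lambda>x. \<Sum>j\<in>J'. u j n x * h j x) \<le> sqrt (1 + correlation M p s J' h (\<lambda>j. u j n))"
      proof (rule lnorm_sum_le_correlation[OF ps J'(1)])
        show "0 < lnorm M s (h j)" if "j \<in> J'" for j using h(3)[OF that] that R by (simp add: J'_def)
      qed (use h hsum u un J' in auto)
      then have "R * lnorm M s (\<lambda>x. \<Sum>j\<in>J'. u j n x * h j x) \<le> R * (1 + d)" using elim R by auto
      moreover have "lnorm M s (\<lambda>x. \<Sum>j\<in>J'. u j n x * g j x) = R * lnorm M s (\<lambda>x. \<Sum>j\<in>J'. u j n x * h j x)"
      proof -
        have "(\<lambda>x. \<Sum>j\<in>J'. u j n x * g j x) = (\<lambda>x. of_real R * (\<Sum>j\<in>J'. u j n x * h j x))"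
          unfolding h_def sum_distrib_left using R by (intro ext sum.cong) auto
        then show ?thesis using ps R by (simp only: lnorm_scale) simp
      qed
      ultimately show ?case by simp
    qed
  qed
  then show ?thesis
  proof eventually_elim
    case (elim n)
    define D where "D = (\<lambda>j x. u j n x * (\<psi> j x - (if j \<in> J' then g j x else 0)))"
    have dif: "(\<lambda>x. \<psi> j x - (if j \<in> J' then g j x else 0)) \<in> lpow M s \<and>
      lnorm M s (\<lambda>x. \<psi> j x - (if j \<in> J' then g j x else 0)) \<le> d" if j: "j \<in> J" for j
    proof (cases "j \<in> J'")
      case True
      then show ?thesis using lpow_diff[OF ps(3) \<psi>[OF j] g(2)[OF j]] g(3)[OF j] by auto
    next
      case False
      then have "lnorm M s (g j) = 0" using j lnorm_nonneg[of M s "g j"] by (auto simp: J'_def)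
      then show ?thesis
        using False lnorm_diff_triangle[OF ps(3) \<psi>[OF j] g(2)[OF j]] g(3)[OF j] \<psi>[OF j] by auto
    qed
    have D: "D j \<in> lpow M s" "lnorm M s (D j) \<le> d" if "j \<in> J" for j
      unfolding D_def
      using lpow_unimodular_times[of s "\<lambda>x. \<psi> j x - (if j \<in> J' then g j x else 0)" "u j n"] dif[OF that] u un that ps by auto
    have gl: "(\<lambda>x. \<Sum>j\<in>J'. u j n x * g j x) \<in> lpow M s"
      by (intro lpow_sum lpow_unimodular_times ps J') (use g u un J' ps in auto)
    have Dl: "(\<lambda>x. \<Sum>j\<in>J. D j x) \<in> lpow M s" by (intro lpow_sum D ps J)
    have "(\<Sum>j\<in>J. u j n x * \<psi> j x) = (\<Sum>j\<in>J'. u j n x * g j x) + (\<Sum>j\<in>J. D j x)" for x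
    proof -
      have "(\<Sum>j\<in>J'. u j n x * g j x) = (\<Sum>j\<in>J. u j n x * (if j \<in> J' then g j x else 0))"
        using J J' by (intro sum.mono_neutral_cong_left) auto
      then show ?thesis by (simp add: D_def sum.distrib[symmetric] right_diff_distrib)
    qed
    then have "lnorm M s (\<lambda>x. \<Sum>j\<in>J. u j n x * \<psi> j x) \<le>
      lnorm M s (\<lambda>x. \<Sum>j\<in>J'. u j n x * g j x) + lnorm M s (\<lambda>x. \<Sum>j\<in>J. D j x)"
      using lnorm_triangle[OF ps(3) gl Dl] by simp
    also have "\<dots> \<le> R * (1 + d) + (\<Sum>j\<in>J. d)"
      using lnorm_sum_le[OF ps(3) J, of D] D by (intro add_mono elim order_trans[OF lnorm_sum_le[OF ps(3) J]] sum_mono) auto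
    also have "\<dots> \<le> T d * (1 + d) + real (card J) * d"
      using RT d by (intro add_mono mult_right_mono) auto
    also have "\<dots> \<le> T 0 + e" using d(1) by simp
    finally show ?case by (simp add: T_def b_def)
  qed
qed

end

section \<open>The weighted L^2 argument for s at most 2, and the bound on weak limits\<close>

lemma powr_sum_le:
  fixes t :: "'j \<Rightarrow> real"
  assumes "0 < \<theta>" "\<theta> \<le> 1" "\<And>j. j \<in> J \<Longrightarrow> 0 \<le> t j"
  shows "(\<Sum>j\<in>J. t j) powr \<theta> \<le> (\<Sum>j\<in>J. t j powr \<theta>)"
proof (cases "finite J \<and> 0 < (\<Sum>j\<in>J. t j)")
  case True
  define T where "T = (\<Sum>j\<in>J. t j)"
  have T: "T > 0" using True by (simp add: T_def)
  have "T powr \<theta> = (\<Sum>j\<in>J. t j / T) * T powr \<theta>"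
    using T by (simp add: sum_divide_distrib[symmetric] T_def)
  also have "\<dots> = (\<Sum>j\<in>J. t j / T * T powr \<theta>)" by (rule sum_distrib_right)
  also have "\<dots> \<le> (\<Sum>j\<in>J. t j powr \<theta>)"
  proof (rule sum_mono)
    fix j assume j: "j \<in> J"
    have "t j \<le> T" unfolding T_def using True j assms(3) by (intro member_le_sum) auto
    then have "t j / T \<le> 1" "0 \<le> t j / T" using T assms(3)[OF j] by auto
    \<comment> \<open>A ratio in [0, 1] does not decrease under a power \<theta> <= 1; multiplying
      by T^\<theta> and summing gives the subadditivity.\<close>
    then have "t j / T \<le> (t j / T) powr \<theta>"
      using powr_mono'[of \<theta> 1 "t j / T"] assms by (cases "t j / T = 0") (simp_all only: powr_one powr_0)
    then have "t j / T * T powr \<theta> \<le> (t j / T) powr \<theta> * T powr \<theta>" by (intro mult_right_mono) auto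
    also have "\<dots> = t j powr \<theta>" using T by (simp add: powr_divide)
    finally show "t j / T * T powr \<theta> \<le> t j powr \<theta>" .
  qed
  finally show ?thesis by (simp add: T_def)
next
  case False
  moreover have "0 \<le> (\<Sum>j\<in>J. t j)" using assms(3) by (rule sum_nonneg)
  ultimately have "(\<Sum>j\<in>J. t j) = 0" by (cases "finite J") auto
  then show ?thesis by (simp add: sum_nonneg)
qed

context finite_measure
begin

text \<open>For \<open>s \<le> 2\<close> the weight \<open>w powr ((s - 2) / 2)\<close> with \<open>w = \<Sum> \<bar>\<psi> j\<bar>\<^sup>2\<close> reduces
  the \<open>L\<^sup>s\<close> norm of the sum to a weighted \<open>L\<^sup>2\<close> norm, in which the cross terms vanish in the limit.\<close>

lemma lnorm_sum_eventually_le_large: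
  fixes \<psi> :: "'j \<Rightarrow> 'a \<Rightarrow> complex" and u :: "'j \<Rightarrow> nat \<Rightarrow> 'a \<Rightarrow> complex"
  assumes s: "1 < s" "s \<le> 2" and J: "finite J"
    and \<psi>: "\<And>j. j \<in> J \<Longrightarrow> \<psi> j \<in> lpow M s"
    and u: "\<And>j n. j \<in> J \<Longrightarrow> u j n \<in> borel_measurable M"
    and un: "\<And>j n x. j \<in> J \<Longrightarrow> x \<in> space M \<Longrightarrow> norm (u j n x) = 1"
    and orth: "\<And>j k h. j \<in> J \<Longrightarrow> k \<in> J \<Longrightarrow> j \<noteq> k \<Longrightarrow> integrable M h \<Longrightarrow>
      (\<lambda>n. \<integral>x. h x * (u j n x * cnj (u k n x)) \<partial>M) \<longlonglongrightarrow> 0"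
    and "0 < e"
  shows "\<forall>\<^sub>F n in sequentially. lnorm M s (\<lambda>x. \<Sum>j\<in>J. u j n x * \<psi> j x) \<le>
    (\<Sum>j\<in>J. lnorm M s (\<psi> j) powr s) powr (1 / s) + e"
proof -
  have [measurable]: "\<psi> j \<in> borel_measurable M" if "j \<in> J" for j using \<psi>[OF that] by (rule lpow_measurable)
  have cnjm: "(\<lambda>x. cnj (g x)) \<in> borel_measurable M" if "g \<in> borel_measurable M" for g :: "'a \<Rightarrow> complex"
    by (rule measurable_compose[OF that]) (auto intro!: borel_measurable_continuous_onI continuous_intros)
  define w where "w = (\<lambda>x. \<Sum>j\<in>J. (norm (\<psi> j x))\<^sup>2)"
  \<comment> \<open>The exponent is negative for s < 2. Where \<open>w\<close> vanishes all \<psi> j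
    vanish too, and \<open>0 powr _ = 0\<close> makes the weight harmless there.\<close>
  define v where "v = (\<lambda>x. w x powr ((s - 2) / 2))"
  define W where "W = (\<integral>x. w x powr (s / 2) \<partial>M)"
  define F where "F = (\<lambda>n x. \<Sum>j\<in>J. u j n x * \<psi> j x)"
  have w0: "0 \<le> w x" for x unfolding w_def by (intro sum_nonneg) auto
  have [measurable]: "w \<in> borel_measurable M" unfolding w_def by measurable
  have [measurable]: "v \<in> borel_measurable M" unfolding v_def by measurable
  have wv: "w x * v x = w x powr (s / 2)" for x
  proof (cases "w x = 0")
    case False
    then have "w x > 0" using w0[of x] by simp
    then have "w x * v x = w x powr (1 + (s - 2) / 2)" unfolding v_def by (simp add: powr_add)
    also have "1 + (s - 2) / 2 = s / 2" by (simp add: field_simps)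
    finally show ?thesis .
  qed simp
  have wle: "w x powr (s / 2) \<le> (\<Sum>j\<in>J. norm (\<psi> j x) powr s)" for x
  proof -
    have "w x powr (s / 2) \<le> (\<Sum>j\<in>J. ((norm (\<psi> j x))\<^sup>2) powr (s / 2))"
      unfolding w_def using s by (intro powr_sum_le) auto
    also have "\<dots> = (\<Sum>j\<in>J. norm (\<psi> j x) powr s)"
      by (intro sum.cong refl) (simp add: powr_powr flip: powr_numeral)
    finally show ?thesis .
  qed
  have sumint: "integrable M (\<lambda>x. \<Sum>j\<in>J. norm (\<psi> j x) powr s)"
    by (intro Bochner_Integration.integrable_sum lpow_integrable \<psi>)
  have wint: "integrable M (\<lambda>x. w x powr (s / 2))"
    by (rule Bochner_Integration.integrable_bound[OF sumint])
       (use wle in \<open>auto simp: abs_of_nonneg sum_nonneg\<close>)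
  have WS: "W \<le> (\<Sum>j\<in>J. lnorm M s (\<psi> j) powr s)"
  proof -
    have "W \<le> (\<integral>x. (\<Sum>j\<in>J. norm (\<psi> j x) powr s) \<partial>M)"
      unfolding W_def by (intro integral_mono wint sumint wle)
    also have "\<dots> = (\<Sum>j\<in>J. \<integral>x. norm (\<psi> j x) powr s \<partial>M)"
      by (intro Bochner_Integration.integral_sum lpow_integrable \<psi>)
    finally show ?thesis using s by (simp add: lnorm_powr)
  qed
  define h where "h = (\<lambda>j k x. \<psi> j x * cnj (\<psi> k x) * of_real (v x))"
  \<comment> \<open>|\<psi> j| and |\<psi> k| are at most sqrt w, so |h j k| <= w v = w^(s/2): the
    weight makes the cross terms integrable, as \<open>orth\<close> requires, although \<psi> j
    itself need not be in L^2.\<close>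
  have hint: "integrable M (h j k)" if jk: "j \<in> J" "k \<in> J" for j k
  proof (rule Bochner_Integration.integrable_bound[OF wint])
    have [measurable]: "\<psi> j \<in> borel_measurable M" "(\<lambda>x. cnj (\<psi> k x)) \<in> borel_measurable M"
      using \<psi> jk by (auto intro: cnjm lpow_measurable)
    show "h j k \<in> borel_measurable M" unfolding h_def by measurable
    have "norm (h j k x) \<le> w x powr (s / 2)" for x
    proof -
      have le: "(norm (\<psi> i x))\<^sup>2 \<le> w x" if "i \<in> J" for i
        unfolding w_def using that J by (intro member_le_sum) auto
      have "norm (\<psi> i x) \<le> sqrt (w x)" if "i \<in> J" for i
        using le[OF that] real_le_rsqrt by blast
      then have "norm (\<psi> j x) * norm (\<psi> k x) \<le> sqrt (w x) * sqrt (w x)"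
        using jk by (intro mult_mono) (auto simp: w0)
      then have "norm (\<psi> j x) * norm (\<psi> k x) * v x \<le> w x * v x"
        using w0 by (intro mult_right_mono) (auto simp: v_def)
      then have "norm (\<psi> j x) * norm (\<psi> k x) * v x \<le> w x powr (s / 2)" by (simp only: wv)
      then show ?thesis by (simp add: h_def norm_mult v_def)
    qed
    then show "AE x in M. norm (h j k x) \<le> norm (w x powr (s / 2))" by simp
  qed
  have huint: "integrable M (\<lambda>x. h j k x * (u j n x * cnj (u k n x)))" if jk: "j \<in> J" "k \<in> J" for j k n
  proof (rule Bochner_Integration.integrable_bound[OF hint[OF jk]])
    have [measurable]: "u j n \<in> borel_measurable M" "(\<lambda>x. cnj (u k n x)) \<in> borel_measurable M" "h j k \<in> borel_measurable M"
      using u jk hint[OF jk] by (auto intro: cnjm)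
    show "(\<lambda>x. h j k x * (u j n x * cnj (u k n x))) \<in> borel_measurable M" by measurable
  qed (use un jk in \<open>auto simp: norm_mult\<close>)
  have Fexp: "of_real ((norm (F n x))\<^sup>2 * v x) = (\<Sum>j\<in>J. \<Sum>k\<in>J. h j k x * (u j n x * cnj (u k n x)))" for n x
  proof -
    have "of_real ((norm (F n x))\<^sup>2 * v x) = F n x * cnj (F n x) * of_real (v x)"
      by (simp only: of_real_mult complex_norm_square)
    also have "\<dots> = (\<Sum>j\<in>J. \<Sum>k\<in>J. u j n x * \<psi> j x * cnj (u k n x * \<psi> k x) * of_real (v x))"
      unfolding F_def cnj_sum sum_product by (simp only: sum_distrib_right)
    also have "\<dots> = (\<Sum>j\<in>J. \<Sum>k\<in>J. h j k x * (u j n x * cnj (u k n x)))"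
      by (simp add: h_def mult_ac)
    finally show ?thesis .
  qed
  have "integrable M (\<lambda>x. complex_of_real ((norm (F n x))\<^sup>2 * v x))" for n
    unfolding Fexp by (intro Bochner_Integration.integrable_sum huint)
  then have F2int': "integrable M (\<lambda>x. (norm (F n x))\<^sup>2 * v x)" for n
    unfolding complex_of_real_integrable_eq .
  have Aeq: "of_real (\<integral>x. (norm (F n x))\<^sup>2 * v x \<partial>M) = (\<Sum>j\<in>J. \<Sum>k\<in>J. \<integral>x. h j k x * (u j n x * cnj (u k n x)) \<partial>M)" for n
  proof -
    have "of_real (\<integral>x. (norm (F n x))\<^sup>2 * v x \<partial>M) = (\<integral>x. complex_of_real ((norm (F n x))\<^sup>2 * v x) \<partial>M)"
      by (rule integral_complex_of_real[symmetric])
    also have "\<dots> = (\<integral>x. (\<Sum>j\<in>J. \<Sum>k\<in>J. h j k x * (u j n x * cnj (u k n x))) \<partial>M)"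
      by (simp only: Fexp)
    also have "\<dots> = (\<Sum>j\<in>J. \<integral>x. (\<Sum>k\<in>J. h j k x * (u j n x * cnj (u k n x))) \<partial>M)"
      by (intro Bochner_Integration.integral_sum Bochner_Integration.integrable_sum huint)
    also have "\<dots> = (\<Sum>j\<in>J. \<Sum>k\<in>J. \<integral>x. h j k x * (u j n x * cnj (u k n x)) \<partial>M)"
      by (intro sum.cong refl Bochner_Integration.integral_sum huint)
    finally show ?thesis .
  qed
  have lim: "(\<lambda>n. \<integral>x. h j k x * (u j n x * cnj (u k n x)) \<partial>M) \<longlonglongrightarrow> (if k = j then (\<integral>x. h j j x \<partial>M) else 0)"
    if jk: "j \<in> J" "k \<in> J" for j k
  proof (cases "k = j")
    case True
    have "(\<integral>x. h j j x * (u j n x * cnj (u j n x)) \<partial>M) = (\<integral>x. h j j x \<partial>M)" for n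
    proof (intro Bochner_Integration.integral_cong refl)
      fix x assume "x \<in> space M"
      then have "u j n x * cnj (u j n x) = 1"
        using un[OF jk(1)] by (simp add: complex_norm_square[symmetric])
      then show "h j j x * (u j n x * cnj (u j n x)) = h j j x" by simp
    qed
    then show ?thesis using True by simp
  qed (use orth[OF jk] hint[OF jk] in auto)
  have "(\<lambda>n. \<Sum>j\<in>J. \<Sum>k\<in>J. \<integral>x. h j k x * (u j n x * cnj (u k n x)) \<partial>M) \<longlonglongrightarrow>
      (\<Sum>j\<in>J. \<Sum>k\<in>J. if k = j then (\<integral>x. h j j x \<partial>M) else 0)"
    by (intro tendsto_sum lim)
  also have "(\<Sum>j\<in>J. \<Sum>k\<in>J. if k = j then (\<integral>x. h j j x \<partial>M) else 0) = (\<Sum>j\<in>J. \<integral>x. h j j x \<partial>M)"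
    using J by (intro sum.cong refl) simp
  also have "\<dots> = (\<integral>x. (\<Sum>j\<in>J. h j j x) \<partial>M)"
    by (intro Bochner_Integration.integral_sum[symmetric] hint)
  also have "\<dots> = (\<integral>x. complex_of_real (w x powr (s / 2)) \<partial>M)"
  proof (intro Bochner_Integration.integral_cong refl)
    fix x
    have "(\<Sum>j\<in>J. h j j x) = (\<Sum>j\<in>J. of_real ((norm (\<psi> j x))\<^sup>2 * v x))"
      by (intro sum.cong refl) (simp only: h_def of_real_mult complex_norm_square)
    also have "\<dots> = of_real (w x * v x)" by (simp add: w_def sum_distrib_right)
    finally show "(\<Sum>j\<in>J. h j j x) = of_real (w x powr (s / 2))" by (simp add: wv)
  qed
  also have "\<dots> = of_real W" unfolding W_def by (rule integral_complex_of_real)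
  finally have "(\<lambda>n. complex_of_real (\<integral>x. (norm (F n x))\<^sup>2 * v x \<partial>M)) \<longlonglongrightarrow> of_real W"
    by (simp only: Aeq)
  then have A: "(\<lambda>n. \<integral>x. (norm (F n x))\<^sup>2 * v x \<partial>M) \<longlonglongrightarrow> W" by (simp only: tendsto_of_real_iff)
  \<comment> \<open>Weighted arithmetic-geometric mean with weights s/2 and 1 - s/2 for |F|^2 v and
    w^(s/2): the powers of \<open>w\<close> cancel and |F|^s remains.\<close>
  have pt: "norm (F n x) powr s \<le> (s / 2) * ((norm (F n x))\<^sup>2 * v x) + (1 - s / 2) * w x powr (s / 2)" for n x
  proof (cases "F n x = 0")
    case True
    then show ?thesis using s by simp
  next
    case False
    have "w x \<noteq> 0"
    proof
      assume "w x = 0"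
      then have "\<forall>j\<in>J. \<psi> j x = 0" unfolding w_def using J by (subst (asm) sum_nonneg_eq_0_iff) auto
      then show False using False by (simp add: F_def)
    qed
    then have wp: "w x > 0" using w0[of x] by simp
    have fp: "norm (F n x) > 0" using False by simp
    have "((norm (F n x))\<^sup>2 * v x) powr (s / 2) * (w x powr (s / 2)) powr (1 - s / 2) \<le>
        (s / 2) * ((norm (F n x))\<^sup>2 * v x) + (1 - s / 2) * w x powr (s / 2)"
      using s wp fp by (intro Youngs_inequality_0) (auto simp: v_def)
    moreover have "((norm (F n x))\<^sup>2 * v x) powr (s / 2) * (w x powr (s / 2)) powr (1 - s / 2) = norm (F n x) powr s"
    proof -
      have "((norm (F n x))\<^sup>2) powr (s / 2) = norm (F n x) powr s"
        using fp by (simp add: powr_powr flip: powr_numeral)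
      moreover have "v x powr (s / 2) * (w x powr (s / 2)) powr (1 - s / 2) = w x powr ((s - 2) / 2 * (s / 2) + s / 2 * (1 - s / 2))"
        by (simp add: v_def powr_powr powr_add)
      moreover have "(s - 2) / 2 * (s / 2) + s / 2 * (1 - s / 2) = 0" by (simp add: field_simps)
      ultimately show ?thesis using wp by (simp add: powr_mult mult.assoc)
    qed
    ultimately show ?thesis by simp
  qed
  have Fl: "F n \<in> lpow M s" for n
    unfolding F_def using s u un \<psi> by (intro lpow_sum lpow_unimodular_times J) auto
  have Fle: "(\<integral>x. norm (F n x) powr s \<partial>M) \<le> (s / 2) * (\<integral>x. (norm (F n x))\<^sup>2 * v x \<partial>M) + (1 - s / 2) * W" for n
  proof -
    have "(\<integral>x. norm (F n x) powr s \<partial>M) \<le> (\<integral>x. (s / 2) * ((norm (F n x))\<^sup>2 * v x) + (1 - s / 2) * w x powr (s / 2) \<partial>M)"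
      using F2int' wint by (intro integral_mono lpow_integrable Fl pt) auto
    also have "\<dots> = (s / 2) * (\<integral>x. (norm (F n x))\<^sup>2 * v x \<partial>M) + (1 - s / 2) * W"
      unfolding W_def using F2int'[of n] wint by simp
    finally show ?thesis .
  qed
  define S where "S = (\<Sum>j\<in>J. lnorm M s (\<psi> j) powr s)"
  have S0: "0 \<le> S" unfolding S_def by (intro sum_nonneg) auto
  have "(\<lambda>n. (s / 2) * (\<integral>x. (norm (F n x))\<^sup>2 * v x \<partial>M) + (1 - s / 2) * W) \<longlonglongrightarrow> (s / 2) * W + (1 - s / 2) * W"
    by (intro tendsto_intros A)
  moreover have "(s / 2) * W + (1 - s / 2) * W < (S powr (1 / s) + e) powr s"
  proof -
    have "(s / 2) * W + (1 - s / 2) * W = W" by (simp add: field_simps)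
    also have "\<dots> \<le> S" using WS by (simp add: S_def)
    also have "S = (S powr (1 / s)) powr s" using s S0 by (simp add: powr_powr)
    also have "\<dots> < (S powr (1 / s) + e) powr s" using s \<open>0 < e\<close> by (intro powr_less_mono2) auto
    finally show ?thesis .
  qed
  ultimately have "\<forall>\<^sub>F n in sequentially. (s / 2) * (\<integral>x. (norm (F n x))\<^sup>2 * v x \<partial>M) + (1 - s / 2) * W < (S powr (1 / s) + e) powr s"
    by (rule order_tendstoD(2))
  then show ?thesis
  proof eventually_elim
    case (elim n)
    then have "(\<integral>x. norm (F n x) powr s \<partial>M) \<le> (S powr (1 / s) + e) powr s" using Fle[of n] by linarith
    then have "lnorm M s (F n) \<le> S powr (1 / s) + e"
      using s \<open>0 < e\<close> by (subst lnorm_le_iff) (auto intro: add_nonneg_nonneg)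
    then show ?case by (simp add: F_def S_def)
  qed
qed

text \<open>Let T be the sum in question. The f n are paired with \<Sum> u_j \<psi>_j, where
  \<psi>_j is a multiple of the dual function of \<phi>_j. These pairings tend to T, while Hoelder
  and almost orthogonality eventually keep them below T^(1/t) + e; as t > 1, this forces T <=
  1.\<close>

theorem weak_limits_powr_sum_le:
  fixes f :: "nat \<Rightarrow> 'a \<Rightarrow> complex" and \<phi> :: "'j \<Rightarrow> 'a \<Rightarrow> complex" and u :: "'j \<Rightarrow> nat \<Rightarrow> 'a \<Rightarrow> complex"
  assumes pq: "1 < p" "1 < q" "1 / p + 1 / q = 1" and J: "finite J"
    and f: "\<And>n. f n \<in> lpow M p" "\<And>n. lnorm M p (f n) \<le> 1"
    and \<phi>: "\<And>j. j \<in> J \<Longrightarrow> \<phi> j \<in> lpow M p"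
    and u: "\<And>j n. j \<in> J \<Longrightarrow> u j n \<in> borel_measurable M"
    and un: "\<And>j n x. j \<in> J \<Longrightarrow> x \<in> space M \<Longrightarrow> norm (u j n x) = 1"
    and orth: "\<And>j k h. j \<in> J \<Longrightarrow> k \<in> J \<Longrightarrow> j \<noteq> k \<Longrightarrow> integrable M h \<Longrightarrow>
      (\<lambda>n. \<integral>x. h x * (u j n x * cnj (u k n x)) \<partial>M) \<longlonglongrightarrow> 0"
    and weak: "\<And>j g. j \<in> J \<Longrightarrow> g \<in> lpow M q \<Longrightarrow>
      (\<lambda>n. \<integral>x. u j n x * f n x * g x \<partial>M) \<longlonglongrightarrow> (\<integral>x. \<phi> j x * g x \<partial>M)"
  shows "(\<Sum>j\<in>J. lnorm M p (\<phi> j) powr (max p q)) \<le> 1"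
proof -
  define R where "R = max p q"
  \<comment> \<open>The conjugate of R, and the summation exponent that almost orthogonality
    delivers in L^q: it is p if p <= 2 and q otherwise.\<close>
  define t where "t = min p q"
  have t: "t > 1" "1 / R + 1 / t = 1" "R > 1" using pq by (auto simp: t_def R_def max_def min_def add.commute)
  have Rt: "(R - 1) * t = R" using t by (simp add: field_simps)
  define a where "a = (\<lambda>j. lnorm M p (\<phi> j))"
  define T where "T = (\<Sum>j\<in>J. a j powr R)"
  have T0: "0 \<le> T" unfolding T_def by (intro sum_nonneg) auto
  define g where "g = (\<lambda>j x. cnj (\<phi> j x) * of_real (norm (\<phi> j x) powr (p - 2)))"
  have g: "g j \<in> lpow M q" "(\<integral>x. norm (g j x) powr q \<partial>M) = (\<integral>x. norm (\<phi> j x) powr p \<partial>M)"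
    "(\<integral>x. \<phi> j x * g j x \<partial>M) = of_real (\<integral>x. norm (\<phi> j x) powr p \<partial>M)" if "j \<in> J" for j
    unfolding g_def by (rule lpow_dual[OF pq \<phi>[OF that]])+
  have Ip: "(\<integral>x. norm (\<phi> j x) powr p \<partial>M) = a j powr p" for j
    unfolding a_def using pq by (simp add: lnorm_powr)
  \<comment> \<open>The weight a_j^(R - p) makes both the pairing with \<phi> j and the t-th power
    of the norm equal to a_j^R.\<close>
  define \<psi> where "\<psi> = (\<lambda>j x. of_real (a j powr (R - p)) * g j x)"
  have \<psi>: "\<psi> j \<in> lpow M q" if "j \<in> J" for j
    unfolding \<psi>_def using pq g(1)[OF that] by (intro lpow_scale) auto
  have n\<psi>: "lnorm M q (\<psi> j) powr t = a j powr R" if j: "j \<in> J" for j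
  proof (cases "a j = 0")
    case True
    then have "lnorm M q (g j) = 0" using g(2)[OF j] Ip[of j] by (simp add: lnorm_def)
    then show ?thesis using True pq t unfolding \<psi>_def by (subst lnorm_scale) auto
  next
    case False
    have "p / q = p - 1" using pq by (simp add: field_simps)
    then have "lnorm M q (g j) = a j powr (p - 1)"
      unfolding lnorm_def g(2)[OF j] Ip powr_powr by simp
    then have "lnorm M q (\<psi> j) = a j powr (R - p) * a j powr (p - 1)"
      unfolding \<psi>_def using pq by (subst lnorm_scale) auto
    also have "\<dots> = a j powr (R - 1)" by (simp add: powr_add[symmetric])
    finally show ?thesis by (simp add: powr_powr Rt)
  qed
  have i\<psi>: "(\<integral>x. \<phi> j x * \<psi> j x \<partial>M) = of_real (a j powr R)" if j: "j \<in> J" for j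
  proof -
    have "(\<integral>x. \<phi> j x * \<psi> j x \<partial>M) = (\<integral>x. of_real (a j powr (R - p)) * (\<phi> j x * g j x) \<partial>M)"
      by (simp add: \<psi>_def mult_ac)
    also have "\<dots> = of_real (a j powr (R - p)) * (\<integral>x. \<phi> j x * g j x \<partial>M)" by (rule integral_mult_right_zero)
    also have "\<dots> = of_real (a j powr (R - p) * a j powr p)" by (simp add: g(3)[OF j] Ip)
    also have "a j powr (R - p) * a j powr p = a j powr R"
      by (simp add: powr_add[symmetric])
    finally show ?thesis .
  qed
  define F where "F = (\<lambda>n x. \<Sum>j\<in>J. u j n x * \<psi> j x)"
  have u\<psi>: "(\<lambda>x. u j n x * \<psi> j x) \<in> lpow M q" if "j \<in> J" for j n
    using that pq u un \<psi> by (intro lpow_unimodular_times) auto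
  have Fl: "F n \<in> lpow M q" for n unfolding F_def by (intro lpow_sum u\<psi> pq J)
  have ev: "\<forall>\<^sub>F n in sequentially. lnorm M q (F n) \<le> T powr (1 / t) + e" if "e > 0" for e
  proof -
    have Teq: "(\<Sum>j\<in>J. lnorm M q (\<psi> j) powr t) = T"
      unfolding T_def by (intro sum.cong refl n\<psi>)
    show ?thesis
    proof (cases "p \<le> 2")
      case True
      have "q \<ge> p"
      proof (rule ccontr)
        assume "\<not> q \<ge> p"
        then have "q < 2" "q < p" using True by auto
        then have "1 / q > 1 / 2" "1 / p \<ge> 1 / 2" using pq True by (auto simp: field_simps)
        then show False using pq(3) by linarith
      qed
      then have "t = p" by (simp add: t_def)
      show ?thesis
        unfolding F_def Teq[symmetric] \<open>t = p\<close>
        by (rule lnorm_sum_eventually_le_small[OF pq(1) True pq(2,3) J])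
          (erule \<psi> u | erule (1) un | erule (3) orth | rule that)+
    next
      case False
      have "q \<le> 2"
      proof (rule ccontr)
        assume "\<not> q \<le> 2"
        then have "1 / q < 1 / 2" "1 / p < 1 / 2" using pq False by (auto simp: field_simps)
        then show False using pq(3) by linarith
      qed
      then have "t = q" using False by (simp add: t_def)
      show ?thesis
        unfolding F_def Teq[symmetric] \<open>t = q\<close>
        by (rule lnorm_sum_eventually_le_large[OF pq(2) \<open>q \<le> 2\<close> J])
          (erule \<psi> u | erule (1) un | erule (3) orth | rule that)+
    qed
  qed
  have "(\<lambda>n. \<Sum>j\<in>J. \<integral>x. u j n x * f n x * \<psi> j x \<partial>M) \<longlonglongrightarrow> (\<Sum>j\<in>J. \<integral>x. \<phi> j x * \<psi> j x \<partial>M)"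
    by (intro tendsto_sum weak \<psi>)
  moreover have "(\<Sum>j\<in>J. \<integral>x. \<phi> j x * \<psi> j x \<partial>M) = of_real T"
    unfolding T_def of_real_sum by (intro sum.cong refl i\<psi>)
  moreover have "(\<Sum>j\<in>J. \<integral>x. u j n x * f n x * \<psi> j x \<partial>M) = (\<integral>x. f n x * F n x \<partial>M)" for n
  proof -
    have "(\<integral>x. f n x * F n x \<partial>M) = (\<Sum>j\<in>J. \<integral>x. f n x * (u j n x * \<psi> j x) \<partial>M)"
      unfolding F_def sum_distrib_left
      by (intro Bochner_Integration.integral_sum lpow_mult_integrable[OF pq f(1) u\<psi>])
    moreover have "f n x * (u j n x * \<psi> j x) = u j n x * f n x * \<psi> j x" for j x
      by (simp only: mult_ac)
    ultimately show ?thesis by (simp only:)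
  qed
  ultimately have "(\<lambda>n. \<integral>x. f n x * F n x \<partial>M) \<longlonglongrightarrow> of_real T" by (simp only:)
  then have "(\<lambda>n. norm (\<integral>x. f n x * F n x \<partial>M)) \<longlonglongrightarrow> norm (of_real T :: complex)" by (rule tendsto_norm)
  then have lim: "(\<lambda>n. norm (\<integral>x. f n x * F n x \<partial>M)) \<longlonglongrightarrow> T" using T0 by simp
  have "T \<le> T powr (1 / t) + e" if "e > 0" for e
  proof (rule tendsto_upperbound[OF lim])
    show "\<forall>\<^sub>F n in sequentially. norm (\<integral>x. f n x * F n x \<partial>M) \<le> T powr (1 / t) + e"
      using ev[OF that]
    proof eventually_elim
      case (elim n)
      have "norm (\<integral>x. f n x * F n x \<partial>M) \<le> lnorm M p (f n) * lnorm M q (F n)" by (rule Holder[OF pq f(1) Fl])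
      also have "\<dots> \<le> 1 * lnorm M q (F n)" by (intro mult_right_mono f) auto
      finally show ?case using elim by simp
    qed
  qed simp
  then have TT: "T \<le> T powr (1 / t)" by (rule field_le_epsilon)
  have "T \<le> 1"
  proof (rule ccontr)
    assume "\<not> T \<le> 1"
    then have "T powr (1 / t) < T powr 1" using t by (intro powr_less_mono) auto
    then show False using TT T0 by simp
  qed
  then show ?thesis by (simp add: T_def a_def R_def)
qed

end

section \<open>Concentration\<close>

text \<open>Induction on the number of sequences. A new sequence either diverges from all
  representatives and becomes one itself, or it returns within a fixed distance of them along a
  subsequence.\<close>

lemma divergent_clusters:
  fixes y :: "nat \<Rightarrow> nat \<Rightarrow> 'a::real_normed_vector"
  shows "\<exists>r J \<rho>. strict_mono (r :: nat \<Rightarrow> nat) \<and> J \<subseteq> {..<N} \<and>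
    (\<forall>j\<in>J. \<forall>k\<in>J. j \<noteq> k \<longrightarrow> filterlim (\<lambda>n. y j (r n) - y k (r n)) at_infinity sequentially) \<and>
    (\<forall>i<N. \<forall>n. \<exists>j\<in>J. dist (y i (r n)) (y j (r n)) \<le> \<rho>)"
proof (induction N)
  case 0
  show ?case by (intro exI[of _ id] exI[of _ "{}"]) (auto simp: strict_mono_def)
next
  case (Suc N)
  then obtain r J \<rho> where r': "strict_mono (r :: nat \<Rightarrow> nat)" "J \<subseteq> {..<N}"
    "\<forall>j\<in>J. \<forall>k\<in>J. j \<noteq> k \<longrightarrow> filterlim (\<lambda>n. y j (r n) - y k (r n)) at_infinity sequentially"
    "\<forall>i<N. \<forall>n. \<exists>j\<in>J. dist (y i (r n)) (y j (r n)) \<le> \<rho>" by (elim exE conjE)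
  note r = r'(1,2) r'(3,4)[rule_format]
  show ?case
  proof (cases "\<forall>B. \<forall>\<^sub>F n in sequentially. \<forall>j\<in>J. B \<le> dist (y N (r n)) (y j (r n))")
    case True
    have d: "filterlim (\<lambda>n. y N (r n) - y j (r n)) at_infinity sequentially" if "j \<in> J" for j
      unfolding filterlim_at_infinity[OF order_refl]
    proof (intro allI impI)
      fix B :: real
      show "\<forall>\<^sub>F n in sequentially. B \<le> norm (y N (r n) - y j (r n))"
        using True[rule_format, of B] by eventually_elim (use that in \<open>auto simp: dist_norm\<close>)
    qed
    have d': "filterlim (\<lambda>n. y j (r n) - y N (r n)) at_infinity sequentially" if "j \<in> J" for j
      using d[OF that] unfolding filterlim_at_infinity[OF order_refl] by (simp add: norm_minus_commute)
    show ?thesis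
    \<comment> \<open>The induction hypothesis does not make \<open>\<rho>\<close> nonnegative, and
      the new representative has distance 0 from itself.\<close>
    proof (intro exI[of _ r] exI[of _ "insert N J"] exI[of _ "max \<rho> 0"] conjI ballI impI allI)
      show "\<exists>j\<in>insert N J. dist (y i (r n)) (y j (r n)) \<le> max \<rho> 0" if "i < Suc N" for i n
      proof (cases "i = N")
        case False
        then obtain j where "j \<in> J" "dist (y i (r n)) (y j (r n)) \<le> \<rho>" using r(4)[of i n] \<open>i < Suc N\<close> by auto
        then show ?thesis by (intro bexI[of _ j]) auto
      qed auto
    qed (use r d d' in auto)
  next
    case False
    \<comment> \<open>Infinitely often the new sequence is within B of some representative. Which
      one may vary with n, as the conclusion allows.\<close>
    then obtain B where "\<not> (\<forall>\<^sub>F n in sequentially. \<forall>j\<in>J. B \<le> dist (y N (r n)) (y j (r n)))" by blast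
    from not_eventually_sequentiallyD[OF this]
    obtain s where s: "strict_mono (s :: nat \<Rightarrow> nat)" "\<And>n. \<not> (\<forall>j\<in>J. B \<le> dist (y N (r (s n))) (y j (r (s n))))"
      by blast
    show ?thesis
    proof (intro exI[of _ "r \<circ> s"] exI[of _ J] exI[of _ "max \<rho> B"] conjI ballI impI allI)
      show "strict_mono (r \<circ> s)" using r(1) s(1) by (rule strict_mono_o)
      show "filterlim (\<lambda>n. y j ((r \<circ> s) n) - y k ((r \<circ> s) n)) at_infinity sequentially"
        if "j \<in> J" "k \<in> J" "j \<noteq> k" for j k
        using filterlim_compose[OF r(3)[OF that] filterlim_subseq[OF s(1)]] by (simp add: comp_def)
      show "\<exists>j\<in>J. dist (y i ((r \<circ> s) n)) (y j ((r \<circ> s) n)) \<le> max \<rho> B" if "i < Suc N" for i n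
      proof (cases "i = N")
        case True
        obtain j where "j \<in> J" "dist (y N (r (s n))) (y j (r (s n))) < B" using s(2)[of n] by (auto simp: not_le)
        then show ?thesis using True by (intro bexI[of _ j]) auto
      next
        case False
        then obtain j where "j \<in> J" "dist (y i (r (s n))) (y j (r (s n))) \<le> \<rho>" using r(4)[of i "s n"] \<open>i < Suc N\<close> by auto
        then show ?thesis by (intro bexI[of _ j]) auto
      qed
    qed (use r in auto)
  qed
qed

lemma finite_subset_image_lessThan:
  fixes X :: "'a set"
  assumes "finite X" "card X \<le> N"
  obtains h where "X \<subseteq> h ` {..<N}"
proof -
  obtain h where "bij_betw h {..<card X} X" using assms(1) by (metis bij_betw_from_nat_into_finite)
  then have "X = h ` {..<card X}" by (simp add: bij_betw_imp_surj_on)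
  also have "\<dots> \<subseteq> h ` {..<N}" using assms(2) by (intro image_mono) auto
  finally show ?thesis using that by blast
qed

lemma cis_modulate_measurable:
  fixes f :: "'a::euclidean_space \<Rightarrow> complex"
  assumes "f \<in> lpow sphere_measure p" "0 < p"
  shows "(\<lambda>w. cis (x \<bullet> w) * f w) \<in> lpow sphere_measure p"
    and "lnorm sphere_measure p (\<lambda>w. cis (x \<bullet> w) * f w) = lnorm sphere_measure p f"
proof -
  show "(\<lambda>w. cis (x \<bullet> w) * f w) \<in> lpow sphere_measure p"
    using lpow_measurable[OF assms(1)] assms
    by (intro lpow_cong_norm[OF assms(1,2)]) (auto simp: norm_mult)
  show "lnorm sphere_measure p (\<lambda>w. cis (x \<bullet> w) * f w) = lnorm sphere_measure p f"
    by (intro lnorm_cong_norm) (simp add: norm_mult)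
qed

lemma weakly_convergent_subsequences:
  fixes f :: "'j \<Rightarrow> nat \<Rightarrow> 'a::euclidean_space \<Rightarrow> complex"
  assumes pq: "1 < p" "1 < q" "1 / p + 1 / q = 1" and "finite J"
    and f: "\<And>j n. f j n \<in> lpow sphere_measure p" and K: "\<And>j n. lnorm sphere_measure p (f j n) \<le> K"
  shows "\<exists>r \<phi>. strict_mono (r :: nat \<Rightarrow> nat) \<and> (\<forall>j\<in>J. \<phi> j \<in> lpow sphere_measure p \<and> lnorm sphere_measure p (\<phi> j) \<le> K \<and>
    (\<forall>g\<in>lpow sphere_measure q. (\<lambda>n. \<integral>w. f j (r n) w * g w \<partial>sphere_measure) \<longlonglongrightarrow> (\<integral>w. \<phi> j w * g w \<partial>sphere_measure)))"
  using \<open>finite J\<close>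
proof (induction J)
  case empty
  then show ?case by (intro exI[of _ id]) (auto simp: strict_mono_def)
next
  case (insert i J)
  then obtain r \<phi> where r: "strict_mono (r :: nat \<Rightarrow> nat)"
    "\<forall>j\<in>J. \<phi> j \<in> lpow sphere_measure p \<and> lnorm sphere_measure p (\<phi> j) \<le> K \<and>
    (\<forall>g\<in>lpow sphere_measure q. (\<lambda>n. \<integral>w. f j (r n) w * g w \<partial>sphere_measure) \<longlonglongrightarrow> (\<integral>w. \<phi> j w * g w \<partial>sphere_measure))"
    by (elim exE conjE)
  obtain s \<phi>' where s: "strict_mono s" "\<phi>' \<in> lpow sphere_measure p" "lnorm sphere_measure p \<phi>' \<le> K"
    "\<And>g. g \<in> lpow sphere_measure q \<Longrightarrow>
      (\<lambda>n. \<integral>w. f i (r (s n)) w * g w \<partial>sphere_measure) \<longlonglongrightarrow> (\<integral>w. \<phi>' w * g w \<partial>sphere_measure)"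
    using weakly_convergent_subsequence[OF pq, of "\<lambda>n. f i (r n)" K, OF f K] by blast
  have "(\<lambda>n. \<integral>w. f j (r (s n)) w * g w \<partial>sphere_measure) \<longlonglongrightarrow> (\<integral>w. \<phi> j w * g w \<partial>sphere_measure)"
    if "j \<in> J" "g \<in> lpow sphere_measure q" for j g
  proof -
    have "(\<lambda>n. \<integral>w. f j (r n) w * g w \<partial>sphere_measure) \<longlonglongrightarrow> (\<integral>w. \<phi> j w * g w \<partial>sphere_measure)"
      using r(2) that by blast
    from LIMSEQ_subseq_LIMSEQ[OF this s(1)] show ?thesis by (simp add: comp_def)
  qed
  moreover have "strict_mono (\<lambda>n. r (s n))" using strict_mono_o[OF r(1) s(1)] by (simp add: comp_def)
  ultimately show ?case
    using r(2) s(2-4) insert(2) by (intro exI[of _ "\<lambda>n. r (s n)"] exI[of _ "\<phi>(i := \<phi>')"]) auto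
qed

lemma weak_limit_extension:
  fixes f :: "nat \<Rightarrow> 'a::euclidean_space \<Rightarrow> complex"
  assumes q: "1 < q" and weak: "\<And>g. g \<in> lpow sphere_measure q \<Longrightarrow>
      (\<lambda>n. \<integral>w. f n w * g w \<partial>sphere_measure) \<longlonglongrightarrow> (\<integral>w. \<phi> w * g w \<partial>sphere_measure)"
  shows "(\<lambda>n. extension_op (f n) x) \<longlonglongrightarrow> extension_op \<phi> x"
proof -
  have "(\<lambda>w. cis (x \<bullet> w)) \<in> lpow sphere_measure q"
    using trig_poly_lpow[OF q trig_poly_exp[of 1 x]] by simp
  from weak[OF this] show ?thesis by (simp add: extension_op_def mult.commute)
qed

lemma integral_ball_translate:
  fixes G :: "'a::euclidean_space \<Rightarrow> real"
  assumes [measurable]: "G \<in> borel_measurable borel"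
  shows "(\<integral>x. indicator (ball y \<rho>) x * G x \<partial>lborel) = (\<integral>x. indicator (ball 0 \<rho>) x * G (x + y) \<partial>lborel)"
proof -
  have "(\<integral>x. indicator (ball y \<rho>) x * G x \<partial>lborel) = (\<integral>x. indicator (ball y \<rho>) x * G x \<partial>distr lborel borel ((+) y))"
    by (simp add: lborel_distr_plus)
  also have "\<dots> = (\<integral>x. indicator (ball y \<rho>) (y + x) * G (y + x) \<partial>lborel)"
    by (rule integral_distr) (auto intro!: borel_measurable_times borel_measurable_indicator assms)
  also have "\<dots> = (\<integral>x. indicator (ball 0 \<rho>) x * G (x + y) \<partial>lborel)"
    by (intro Bochner_Integration.integral_cong refl) (auto simp: indicator_def dist_norm add.commute)
  finally show ?thesis .
qed

text \<open>The estimate at the auxiliary exponent \<open>q1\<close> supplies both uniform covers of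
  superlevel sets and decay of extensions at infinity; the target exponent q enters only in the
  individual lemmas.\<close>

locale extension_exponents =
  fixes dummy :: "'a::euclidean_space itself" and p p' q1 :: real
  assumes pp: "1 < p" "1 < p'" "1 / p + 1 / p' = 1"
    and q1: "0 < q1" "extension_norm TYPE('a) (ennreal p) (ennreal q1) < \<infinity>"
begin

sublocale finite_measure "sphere_measure :: 'a measure"
  by (rule finite_sphere_measure)

abbreviation \<sigma> :: "'a measure" where "\<sigma> \<equiv> sphere_measure"

definition S1 :: real where "S1 = enn2real (extension_norm TYPE('a) (ennreal p) (ennreal q1))"

text \<open>The Hoelder constant of the embedding of L^p into L^1. On the unit ball of L^p it bounds
  both the extension and its Lipschitz constant.\<close>

definition C :: real where "C = lnorm \<sigma> p' (\<lambda>w. 1)"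

lemma C_nonneg: "0 \<le> C" by (simp add: C_def)

lemma L1_le:
  assumes "f \<in> lpow \<sigma> p" "lnorm \<sigma> p f \<le> K"
  shows "(\<integral>w. norm (f w) \<partial>\<sigma>) \<le> K * C"
  using L1_le_lnorm[OF pp assms(1)] mult_right_mono[OF assms(2) C_nonneg] unfolding C_def by linarith

lemma extension_le:
  assumes "f \<in> lpow \<sigma> p" "lnorm \<sigma> p f \<le> K"
  shows "norm (extension_op f x) \<le> K * C"
  using extension_op_bound[of f x] L1_le[OF assms] by linarith

text \<open>The added 1 makes the constant positive, as \<open>superlevel_cover\<close>
  demands.\<close>

lemma extension_Lipschitz_unit:
  assumes "f \<in> lpow \<sigma> p" "lnorm \<sigma> p f \<le> 1"
  shows "norm (extension_op f x - extension_op f y) \<le> (C + 1) * dist x y"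
proof -
  have "norm (extension_op f x - extension_op f y) \<le> (\<integral>w. norm (f w) \<partial>\<sigma>) * dist x y"
    by (rule extension_op_Lipschitz[OF lpow_sphere_integrable[OF pp(1) assms(1)]])
  also have "\<dots> \<le> (C + 1) * dist x y" using L1_le[OF assms] by (intro mult_right_mono) auto
  finally show ?thesis .
qed

lemma extension_q1:
  assumes "f \<in> lpow \<sigma> p" "lnorm \<sigma> p f \<le> 1"
  shows "extension_op f \<in> lpow lborel q1" "(\<integral>x. norm (extension_op f x) powr q1 \<partial>lborel) \<le> S1 powr q1"
proof -
  show "extension_op f \<in> lpow lborel q1" by (rule extension_bound_finite(1)[OF pp(1) q1 assms(1)])
  have "lnorm lborel q1 (extension_op f) \<le> S1 * lnorm \<sigma> p f"
    unfolding S1_def by (rule extension_bound_finite(2)[OF pp(1) q1 assms(1)])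
  also have "\<dots> \<le> S1" using assms(2) by (simp add: S1_def mult_left_le)
  finally show "(\<integral>x. norm (extension_op f x) powr q1 \<partial>lborel) \<le> S1 powr q1"
    using q1(1) by (subst (asm) lnorm_le_iff) (auto simp: S1_def)
qed

text \<open>The integral is the extension of h at y n - z n, so asymptotic orthogonality is the
  decay of extensions at infinity.\<close>

lemma modulations_orthogonal:
  fixes h :: "'a \<Rightarrow> complex"
  assumes "integrable \<sigma> h" "filterlim (\<lambda>n. y n - z n) at_infinity sequentially"
  shows "(\<lambda>n. \<integral>w. h w * (cis (y n \<bullet> w) * cnj (cis (z n \<bullet> w))) \<partial>\<sigma>) \<longlonglongrightarrow> 0"
proof -
  have "(\<integral>w. h w * (cis (y n \<bullet> w) * cnj (cis (z n \<bullet> w))) \<partial>\<sigma>) = extension_op h (y n - z n)" for n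
    unfolding extension_op_def by (simp add: cis_cnj cis_mult inner_diff_left mult.commute)
  then show ?thesis using extension_op_tendsto_zero[OF pp(1) q1 assms] by simp
qed

text \<open>Modulation moves the ball about y n to the origin. There the extensions converge
  pointwise by weak convergence and are bounded by \<open>C\<close>, so dominated convergence
  applies.\<close>

lemma local_mass_tendsto:
  assumes f: "\<And>n. f n \<in> lpow \<sigma> p" "\<And>n. lnorm \<sigma> p (f n) \<le> 1" and \<phi>: "\<phi> \<in> lpow \<sigma> p"
    and weak: "\<And>g. g \<in> lpow \<sigma> p' \<Longrightarrow> (\<lambda>n. \<integral>w. cis (y n \<bullet> w) * f n w * g w \<partial>\<sigma>) \<longlonglongrightarrow> (\<integral>w. \<phi> w * g w \<partial>\<sigma>)"
    and q: "0 < q"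
  shows "(\<lambda>n. \<integral>x. indicator (ball (y n) \<rho>) x * norm (extension_op (f n) x) powr q \<partial>lborel) \<longlonglongrightarrow>
    (\<integral>x. indicator (ball 0 \<rho>) x * norm (extension_op \<phi> x) powr q \<partial>lborel)"
proof -
  have meas: "extension_op g \<in> borel_measurable borel" if "g \<in> lpow \<sigma> p" for g :: "'a \<Rightarrow> complex"
    by (rule extension_op_measurable[OF lpow_sphere_integrable[OF pp(1) that]])
  have mod: "(\<lambda>w. cis (y n \<bullet> w) * f n w) \<in> lpow \<sigma> p" "lnorm \<sigma> p (\<lambda>w. cis (y n \<bullet> w) * f n w) \<le> 1" for n
    using cis_modulate_measurable[OF f(1)] f(2) pp by auto
  have "(\<integral>x. indicator (ball (y n) \<rho>) x * norm (extension_op (f n) x) powr q \<partial>lborel) =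
      (\<integral>x. indicator (ball 0 \<rho>) x * norm (extension_op (\<lambda>w. cis (y n \<bullet> w) * f n w) x) powr q \<partial>lborel)" for n
    unfolding extension_op_modulate
  proof (rule integral_ball_translate[where G = "\<lambda>x. norm (extension_op (f n) x) powr q"])
    have [measurable]: "extension_op (f n) \<in> borel_measurable borel" by (rule meas[OF f(1)])
    show "(\<lambda>x. norm (extension_op (f n) x) powr q) \<in> borel_measurable borel" by measurable
  qed
  moreover have "(\<lambda>n. \<integral>x. indicator (ball 0 \<rho>) x * norm (extension_op (\<lambda>w. cis (y n \<bullet> w) * f n w) x) powr q \<partial>lborel) \<longlonglongrightarrow>
    (\<integral>x. indicator (ball 0 \<rho>) x * norm (extension_op \<phi> x) powr q \<partial>lborel)"
  proof (rule integral_dominated_convergence)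
    show "integrable lborel (\<lambda>x. indicator (ball (0::'a) \<rho>) x * (1 * C) powr q)"
      using emeasure_bounded_finite[of "ball (0::'a) \<rho>"] by (intro integrable_mult_left) (auto simp: less_top)
    show "AE x in lborel. (\<lambda>n. indicator (ball 0 \<rho>) x * norm (extension_op (\<lambda>w. cis (y n \<bullet> w) * f n w) x) powr q) \<longlonglongrightarrow>
      indicator (ball 0 \<rho>) x * norm (extension_op \<phi> x) powr q"
    proof (rule AE_I2)
      fix x
      have "(\<lambda>n. extension_op (\<lambda>w. cis (y n \<bullet> w) * f n w) x) \<longlonglongrightarrow> extension_op \<phi> x"
        by (rule weak_limit_extension[OF pp(2) weak])
      then show "(\<lambda>n. indicator (ball 0 \<rho>) x * norm (extension_op (\<lambda>w. cis (y n \<bullet> w) * f n w) x) powr q) \<longlonglongrightarrow>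
        indicator (ball 0 \<rho>) x * norm (extension_op \<phi> x) powr q"
        using q by (intro tendsto_mult tendsto_powr' tendsto_norm tendsto_const) auto
    qed
    show "AE x in lborel. norm (indicator (ball 0 \<rho>) x * norm (extension_op (\<lambda>w. cis (y n \<bullet> w) * f n w) x) powr q) \<le>
      indicator (ball 0 \<rho>) x * (1 * C) powr q" for n
      using extension_le[OF mod] q by (auto simp: indicator_def intro!: powr_mono2)
    show "(\<lambda>x. indicator (ball 0 \<rho>) x * norm (extension_op \<phi> x) powr q) \<in> borel_measurable lborel"
    proof -
      have [measurable]: "extension_op \<phi> \<in> borel_measurable borel" by (rule meas[OF \<phi>])
      have "(\<lambda>x. norm (extension_op \<phi> x) powr q) \<in> borel_measurable lborel" by measurable
      then show ?thesis by (intro borel_measurable_times borel_measurable_indicator) auto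
    qed
    show "(\<lambda>x. indicator (ball 0 \<rho>) x * norm (extension_op (\<lambda>w. cis (y n \<bullet> w) * f n w) x) powr q) \<in> borel_measurable lborel" for n
    proof -
      have [measurable]: "extension_op (\<lambda>w. cis (y n \<bullet> w) * f n w) \<in> borel_measurable borel" by (rule meas[OF mod(1)])
      have "(\<lambda>x. norm (extension_op (\<lambda>w. cis (y n \<bullet> w) * f n w) x) powr q) \<in> borel_measurable lborel" by measurable
      then show ?thesis by (intro borel_measurable_times borel_measurable_indicator) auto
    qed
  qed
  ultimately show ?thesis by simp
qed

text \<open>The level set where \<open>\<bar>\<E> f\<bar> \<ge> \<delta>\<close> is covered by boundedly many unit balls. Grouping their
  centres into mutually divergent clusters leaves finitely many weak limits, which carry almost all of
  the \<open>L\<^sup>q\<close> norm; as \<open>q > max p p'\<close>, one of them must have almost full norm.\<close>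

lemma concentration:
  fixes f :: "nat \<Rightarrow> 'a \<Rightarrow> complex"
  assumes q: "max p p' < q" "q1 < q" "extension_norm TYPE('a) (ennreal p) (ennreal q) < \<infinity>"
    and f: "\<And>n. f n \<in> lpow \<sigma> p" "\<And>n. lnorm \<sigma> p (f n) \<le> 1"
    and ext: "(\<lambda>n. lnorm lborel q (extension_op (f n))) \<longlonglongrightarrow> S"
    and S: "S = enn2real (extension_norm TYPE('a) (ennreal p) (ennreal q))" "0 < S"
    and \<eta>: "0 < \<eta>" "\<eta> < 1"
  obtains r y \<phi> where "strict_mono (r :: nat \<Rightarrow> nat)" "\<phi> \<in> lpow \<sigma> p" "lnorm \<sigma> p \<phi> \<le> 1" "1 - \<eta> \<le> lnorm \<sigma> p \<phi>"
    "\<And>g. g \<in> lpow \<sigma> p' \<Longrightarrow> (\<lambda>n. \<integral>w. cis (y n \<bullet> w) * f (r n) w * g w \<partial>\<sigma>) \<longlonglongrightarrow> (\<integral>w. \<phi> w * g w \<partial>\<sigma>)"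
proof -
  define R where "R = max p p'"
  have R: "0 < R" "R < q" using pp q by (auto simp: R_def)
  have q0: "q > 0" using q1 q by linarith
  \<comment> \<open>If every weak limit had norm at most 1 - \<eta>, giving up q - R powers of the
    norm would leave \<Sum> norm^q <= \<theta> \<Sum> norm^R <= \<theta> < 1.\<close>
  define \<theta> where "\<theta> = (1 - \<eta>) powr (q - R)"
  have \<theta>: "0 \<le> \<theta>" "\<theta> < 1"
    using powr_less_mono2[of "q - R" "1 - \<eta>" 1] \<eta> R by (auto simp: \<theta>_def)
  have gap: "0 < S powr q * (1 - \<theta>)" using S(2) \<theta> by simp
  \<comment> \<open>Below level \<delta> the q-th power is at most \<delta>^(q - q1) times the q1-th
    power; \<delta> is taken so small that this part cannot fill the gap S^q (1 - \<theta>).\<close>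
  have "((\<lambda>\<delta>. \<delta> powr (q - q1) * S1 powr q1) \<longlongrightarrow> 0 powr (q - q1) * S1 powr q1) (at_right 0)"
    using q by (intro tendsto_mult tendsto_powr' tendsto_const tendsto_ident_at) (auto simp: eventually_at_filter)
  then have "\<forall>\<^sub>F \<delta> in at_right 0. \<delta> powr (q - q1) * S1 powr q1 < S powr q * (1 - \<theta>)"
    using gap by (intro order_tendstoD(2)) auto
  moreover have "\<forall>\<^sub>F \<delta>::real in at_right 0. 0 < \<delta>"
    using eventually_at_right_real[of 0 "1::real"] by (auto elim: eventually_mono)
  ultimately have "\<forall>\<^sub>F \<delta> in at_right 0. \<delta> powr (q - q1) * S1 powr q1 < S powr q * (1 - \<theta>) \<and> 0 < \<delta>"
    by eventually_elim auto
  then obtain \<delta> where \<delta>: "\<delta> powr (q - q1) * S1 powr q1 < S powr q * (1 - \<theta>)" "0 < \<delta>"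
    using eventually_happens by fastforce
  have "C + 1 > 0" using C_nonneg by simp
  then obtain N where N: "\<And>F :: 'a \<Rightarrow> complex. (\<And>x y. norm (F x - F y) \<le> (C + 1) * dist x y) \<Longrightarrow>
      F \<in> lpow lborel q1 \<Longrightarrow> (\<integral>x. norm (F x) powr q1 \<partial>lborel) \<le> S1 powr q1 \<Longrightarrow>
      \<exists>X. finite X \<and> card X \<le> N \<and> {x. \<delta> \<le> norm (F x)} \<subseteq> (\<Union>x\<in>X. ball x 1)"
    using superlevel_cover[of "C + 1" q1 \<delta> "S1 powr q1"] q1(1) \<delta>(2) by blast
  have "\<exists>h. {x. \<delta> \<le> norm (extension_op (f n) x)} \<subseteq> (\<Union>j<N. ball (h j) 1)" for n
  proof -
    obtain X where X: "finite X" "card X \<le> N" "{x. \<delta> \<le> norm (extension_op (f n) x)} \<subseteq> (\<Union>x\<in>X. ball x 1)"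
      using N[OF extension_Lipschitz_unit[OF f] extension_q1[OF f]] by blast
    obtain h where "X \<subseteq> h ` {..<N}" using finite_subset_image_lessThan[OF X(1,2)] by blast
    then have "{x. \<delta> \<le> norm (extension_op (f n) x)} \<subseteq> (\<Union>j<N. ball (h j) 1)" using X(3) by blast
    then show ?thesis by blast
  qed
  then obtain Y where Y: "\<And>n. {x. \<delta> \<le> norm (extension_op (f n) x)} \<subseteq> (\<Union>j<N. ball (Y n j) 1)" by metis
  from divergent_clusters[of N "\<lambda>j n. Y n j"] obtain r J \<rho> where
    r': "strict_mono (r :: nat \<Rightarrow> nat)" "J \<subseteq> {..<N}"
    "\<forall>j\<in>J. \<forall>k\<in>J. j \<noteq> k \<longrightarrow> filterlim (\<lambda>n. Y (r n) j - Y (r n) k) at_infinity sequentially"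
    "\<forall>i<N. \<forall>n. \<exists>j\<in>J. dist (Y (r n) i) (Y (r n) j) \<le> \<rho>" by (elim exE conjE)
  note r = r'(1,2) r'(3,4)[rule_format]
  have finJ: "finite J" using r(2) finite_subset by blast
  have "\<exists>s \<phi>. strict_mono (s :: nat \<Rightarrow> nat) \<and> (\<forall>j\<in>J. \<phi> j \<in> lpow \<sigma> p \<and> lnorm \<sigma> p (\<phi> j) \<le> 1 \<and>
    (\<forall>g\<in>lpow \<sigma> p'. (\<lambda>n. \<integral>w. cis (Y (r (s n)) j \<bullet> w) * f (r (s n)) w * g w \<partial>\<sigma>) \<longlonglongrightarrow> (\<integral>w. \<phi> j w * g w \<partial>\<sigma>)))"
    by (rule weakly_convergent_subsequences[OF pp finJ, of "\<lambda>j n w. cis (Y (r n) j \<bullet> w) * f (r n) w" 1])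
      (use cis_modulate_measurable[OF f(1)] f(2) pp in auto)
  then obtain s \<phi> where s': "strict_mono (s :: nat \<Rightarrow> nat)"
    "\<forall>j\<in>J. \<phi> j \<in> lpow \<sigma> p \<and> lnorm \<sigma> p (\<phi> j) \<le> 1 \<and>
    (\<forall>g\<in>lpow \<sigma> p'. (\<lambda>n. \<integral>w. cis (Y (r (s n)) j \<bullet> w) * f (r (s n)) w * g w \<partial>\<sigma>) \<longlonglongrightarrow> (\<integral>w. \<phi> j w * g w \<partial>\<sigma>))"
    by (elim exE conjE)
  have s: "strict_mono s" "\<And>j. j \<in> J \<Longrightarrow> \<phi> j \<in> lpow \<sigma> p" "\<And>j. j \<in> J \<Longrightarrow> lnorm \<sigma> p (\<phi> j) \<le> 1"
    "\<And>j g. j \<in> J \<Longrightarrow> g \<in> lpow \<sigma> p' \<Longrightarrow>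
      (\<lambda>n. \<integral>w. cis (Y (r (s n)) j \<bullet> w) * f (r (s n)) w * g w \<partial>\<sigma>) \<longlonglongrightarrow> (\<integral>w. \<phi> j w * g w \<partial>\<sigma>)"
    using s' by blast+
  define t where "t = (\<lambda>n. r (s n))"
  have t: "strict_mono t" using strict_mono_o[OF r(1) s(1)] by (simp add: t_def comp_def)
  have "(\<Sum>j\<in>J. lnorm \<sigma> p (\<phi> j) powr max p p') \<le> 1"
  proof (rule weak_limits_powr_sum_le[OF pp finJ, where f = "\<lambda>n. f (t n)" and u = "\<lambda>j n w. cis (Y (t n) j \<bullet> w)"])
    show "(\<lambda>n. \<integral>w. h w * (cis (Y (t n) j \<bullet> w) * cnj (cis (Y (t n) k \<bullet> w))) \<partial>\<sigma>) \<longlonglongrightarrow> 0"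
      if "j \<in> J" "k \<in> J" "j \<noteq> k" "integrable \<sigma> h" for j k h
      using filterlim_compose[OF r(3)[OF that(1-3)] filterlim_subseq[OF s(1)]]
      by (intro modulations_orthogonal that) (simp add: t_def)
    show "(\<lambda>n. \<integral>w. cis (Y (t n) j \<bullet> w) * f (t n) w * g w \<partial>\<sigma>) \<longlonglongrightarrow> (\<integral>w. \<phi> j w * g w \<partial>\<sigma>)"
      if "j \<in> J" "g \<in> lpow \<sigma> p'" for j g using s(4)[OF that] by (simp add: t_def)
  qed (use f s in auto)
  then have aR: "(\<Sum>j\<in>J. lnorm \<sigma> p (\<phi> j) powr R) \<le> 1" by (simp add: R_def)
  have E: "extension_op g \<in> lpow lborel q" "(\<integral>x. norm (extension_op g x) powr q \<partial>lborel) \<le> (S * lnorm \<sigma> p g) powr q"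
    if "g \<in> lpow \<sigma> p" for g :: "'a \<Rightarrow> complex"
  proof -
    show "extension_op g \<in> lpow lborel q" by (rule extension_bound_finite(1)[OF pp(1) q0 q(3) that])
    have "lnorm lborel q (extension_op g) \<le> S * lnorm \<sigma> p g"
      unfolding S(1) by (rule extension_bound_finite(2)[OF pp(1) q0 q(3) that])
    then show "(\<integral>x. norm (extension_op g x) powr q \<partial>lborel) \<le> (S * lnorm \<sigma> p g) powr q"
      using q0 S(2) by (subst (asm) lnorm_le_iff) auto
  qed
  \<comment> \<open>The radius \<rho> + 1 lets this ball contain the unit ball about every centre
    whose representative is within \<rho>.\<close>
  define B where "B = (\<lambda>j n. \<integral>x. indicator (ball (Y (t n) j) (\<rho> + 1)) x * norm (extension_op (f (t n)) x) powr q \<partial>lborel)"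
  define B' where "B' = (\<lambda>j. \<integral>x. indicator (ball 0 (\<rho> + 1)) x * norm (extension_op (\<phi> j) x) powr q \<partial>lborel)"
  have mint: "integrable lborel (\<lambda>x. indicator A x * norm (extension_op g x) powr q)"
    if "g \<in> lpow \<sigma> p" "A \<in> sets borel" for g and A :: "'a set"
    using lpow_integrable[OF E(1)[OF that(1)]] that(2) integrable_mult_indicator[of A lborel "\<lambda>x. norm (extension_op g x) powr q"]
    by simp
  have Blim: "B j \<longlonglongrightarrow> B' j" if "j \<in> J" for j
    unfolding B_def B'_def
    by (rule local_mass_tendsto) (use f s(2,4) that q0 in \<open>auto simp: t_def\<close>)
  have B'le: "B' j \<le> S powr q * lnorm \<sigma> p (\<phi> j) powr q" if "j \<in> J" for j
  proof -
    have "B' j \<le> (\<integral>x. norm (extension_op (\<phi> j) x) powr q \<partial>lborel)"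
      unfolding B'_def using s(2)[OF that]
      by (intro integral_mono mint lpow_integrable[OF E(1)]) (auto simp: indicator_def)
    also have "\<dots> \<le> (S * lnorm \<sigma> p (\<phi> j)) powr q" by (rule E(2)[OF s(2)[OF that]])
    finally show ?thesis by (simp add: powr_mult)
  qed
  have main: "(\<integral>x. norm (extension_op (f (t n)) x) powr q \<partial>lborel) \<le> \<delta> powr (q - q1) * S1 powr q1 + (\<Sum>j\<in>J. B j n)" for n
  proof -
    let ?F = "\<lambda>x. norm (extension_op (f (t n)) x)"
    have "(\<integral>x. ?F x powr q \<partial>lborel) \<le>
      (\<integral>x. \<delta> powr (q - q1) * ?F x powr q1 + (\<Sum>j\<in>J. indicator (ball (Y (t n) j) (\<rho> + 1)) x * ?F x powr q) \<partial>lborel)"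
    proof (rule integral_mono)
      show "integrable lborel (\<lambda>x. ?F x powr q)" by (intro lpow_integrable E f)
      show "integrable lborel (\<lambda>x. \<delta> powr (q - q1) * ?F x powr q1 + (\<Sum>j\<in>J. indicator (ball (Y (t n) j) (\<rho> + 1)) x * ?F x powr q))"
        by (intro Bochner_Integration.integrable_add integrable_mult_right lpow_integrable[OF extension_q1(1)]
            Bochner_Integration.integrable_sum mint f) auto
      fix x
      have s0: "0 \<le> (\<Sum>j\<in>J. indicator (ball (Y (t n) j) (\<rho> + 1)) x * ?F x powr q)" by (intro sum_nonneg) auto
      show "?F x powr q \<le> \<delta> powr (q - q1) * ?F x powr q1 + (\<Sum>j\<in>J. indicator (ball (Y (t n) j) (\<rho> + 1)) x * ?F x powr q)"
      proof (cases "\<delta> \<le> ?F x")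
        case True
        then obtain i where i: "i < N" "dist (Y (t n) i) x < 1" using Y[of "t n"] by auto
        obtain j where j: "j \<in> J" "dist (Y (t n) i) (Y (t n) j) \<le> \<rho>" using r(4)[OF i(1), of "s n"] by (auto simp: t_def)
        have "x \<in> ball (Y (t n) j) (\<rho> + 1)"
          using i(2) j(2) dist_triangle[of "Y (t n) j" x "Y (t n) i"] by (simp add: dist_commute)
        then have "?F x powr q = indicator (ball (Y (t n) j) (\<rho> + 1)) x * ?F x powr q" by simp
        also have "\<dots> \<le> (\<Sum>j\<in>J. indicator (ball (Y (t n) j) (\<rho> + 1)) x * ?F x powr q)"
          using finJ j(1) by (intro member_le_sum[of j J "\<lambda>j. indicator (ball (Y (t n) j) (\<rho> + 1)) x * ?F x powr q"]) auto
        also have "\<dots> \<le> \<delta> powr (q - q1) * ?F x powr q1 + (\<Sum>j\<in>J. indicator (ball (Y (t n) j) (\<rho> + 1)) x * ?F x powr q)"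
          by simp
        finally show ?thesis .
      next
        case False
        have "?F x powr q = ?F x powr (q - q1) * ?F x powr q1"
          by (simp add: powr_add[symmetric])
        also have "\<dots> \<le> \<delta> powr (q - q1) * ?F x powr q1"
          using False q by (intro mult_right_mono powr_mono2) auto
        finally show ?thesis using s0 by linarith
      qed
    qed
    also have "\<dots> = \<delta> powr (q - q1) * (\<integral>x. ?F x powr q1 \<partial>lborel) + (\<Sum>j\<in>J. B j n)"
      unfolding B_def
      by (subst Bochner_Integration.integral_add)
         (auto simp: Bochner_Integration.integral_sum mint f intro!: lpow_integrable[OF extension_q1(1)] Bochner_Integration.integrable_sum mint f)
    also have "\<dots> \<le> \<delta> powr (q - q1) * S1 powr q1 + (\<Sum>j\<in>J. B j n)"
      by (intro add_right_mono mult_left_mono extension_q1(2) f) auto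
    finally show ?thesis .
  qed
  have "(\<lambda>n. lnorm lborel q (extension_op (f (t n))) powr q) \<longlonglongrightarrow> S powr q"
    using LIMSEQ_subseq_LIMSEQ[OF ext t] S(2) by (intro tendsto_powr' tendsto_const) (auto simp: comp_def)
  then have "(\<lambda>n. \<integral>x. norm (extension_op (f (t n)) x) powr q \<partial>lborel) \<longlonglongrightarrow> S powr q"
    using q0 by (simp add: lnorm_powr)
  moreover have "(\<lambda>n. \<delta> powr (q - q1) * S1 powr q1 + (\<Sum>j\<in>J. B j n)) \<longlonglongrightarrow> \<delta> powr (q - q1) * S1 powr q1 + (\<Sum>j\<in>J. B' j)"
    by (intro tendsto_intros Blim)
  ultimately have "S powr q \<le> \<delta> powr (q - q1) * S1 powr q1 + (\<Sum>j\<in>J. B' j)"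
    by (rule LIMSEQ_le) (use main in blast)
  also have "(\<Sum>j\<in>J. B' j) \<le> S powr q * (\<Sum>j\<in>J. lnorm \<sigma> p (\<phi> j) powr q)"
    unfolding sum_distrib_left by (intro sum_mono B'le)
  finally have low: "S powr q \<le> \<delta> powr (q - q1) * S1 powr q1 + S powr q * (\<Sum>j\<in>J. lnorm \<sigma> p (\<phi> j) powr q)"
    by simp
  have "\<exists>j\<in>J. 1 - \<eta> \<le> lnorm \<sigma> p (\<phi> j)"
  proof (rule ccontr)
    assume "\<not> ?thesis"
    then have lt: "lnorm \<sigma> p (\<phi> j) \<le> 1 - \<eta>" if "j \<in> J" for j using that by force
    have "(\<Sum>j\<in>J. lnorm \<sigma> p (\<phi> j) powr q) \<le> (\<Sum>j\<in>J. \<theta> * lnorm \<sigma> p (\<phi> j) powr R)"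
    proof (rule sum_mono)
      fix j assume "j \<in> J"
      have "lnorm \<sigma> p (\<phi> j) powr q = lnorm \<sigma> p (\<phi> j) powr (q - R) * lnorm \<sigma> p (\<phi> j) powr R"
        by (simp add: powr_add[symmetric])
      also have "\<dots> \<le> \<theta> * lnorm \<sigma> p (\<phi> j) powr R"
        unfolding \<theta>_def using lt[OF \<open>j \<in> J\<close>] R by (intro mult_right_mono powr_mono2) auto
      finally show "lnorm \<sigma> p (\<phi> j) powr q \<le> \<theta> * lnorm \<sigma> p (\<phi> j) powr R" .
    qed
    also have "\<dots> \<le> \<theta>" unfolding sum_distrib_left[symmetric] using aR \<theta>(1) by (simp add: mult_left_le)
    finally have "S powr q * (\<Sum>j\<in>J. lnorm \<sigma> p (\<phi> j) powr q) \<le> S powr q * \<theta>" by (intro mult_left_mono) auto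
    with low have "S powr q \<le> \<delta> powr (q - q1) * S1 powr q1 + S powr q * \<theta>" by linarith
    with \<delta>(1) show False by (simp add: right_diff_distrib)
  qed
  then obtain j where j: "j \<in> J" "1 - \<eta> \<le> lnorm \<sigma> p (\<phi> j)" by blast
  show ?thesis
  proof (rule that[of t "\<phi> j" "\<lambda>n. Y (t n) j"])
    show "(\<lambda>n. \<integral>w. cis (Y (t n) j \<bullet> w) * f (t n) w * g w \<partial>\<sigma>) \<longlonglongrightarrow> (\<integral>w. \<phi> j w * g w \<partial>\<sigma>)" if "g \<in> lpow \<sigma> p'" for g
      using s(4)[OF j(1) that] by (simp add: t_def)
  qed (use t s j in auto)
qed

end

section \<open>Compactness of extremizing sequences\<close>

lemma lnorm_modulation_diff_le:
  fixes f :: "'a::euclidean_space \<Rightarrow> complex"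
  assumes "0 < p" "f \<in> lpow sphere_measure p"
  shows "lnorm sphere_measure p (\<lambda>w. cis (a \<bullet> w) * f w - cis (b \<bullet> w) * f w) \<le> dist a b * lnorm sphere_measure p f"
proof -
  have [measurable]: "f \<in> borel_measurable sphere_measure" by (rule lpow_measurable[OF assms(2)])
  have le: "norm (cis (a \<bullet> w) * f w - cis (b \<bullet> w) * f w) \<le> dist a b * norm (f w)" if "norm w = 1" for w
  proof -
    have "norm (cis (a \<bullet> w) * f w - cis (b \<bullet> w) * f w) = norm (cis (a \<bullet> w) - cis (b \<bullet> w)) * norm (f w)"
      by (simp add: norm_mult[symmetric] left_diff_distrib)
    also have "\<dots> \<le> dist a b * norm (f w)"
    proof (rule mult_right_mono)
      have "\<bar>a \<bullet> w - b \<bullet> w\<bar> \<le> dist a b"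
        using Cauchy_Schwarz_ineq2[of "a - b" w] that by (simp add: inner_diff_left dist_norm)
      then show "norm (cis (a \<bullet> w) - cis (b \<bullet> w)) \<le> dist a b"
        using norm_cis_diff_le order_trans by blast
    qed simp
    finally show ?thesis .
  qed
  have l: "(\<lambda>w. cis (a \<bullet> w) * f w - cis (b \<bullet> w) * f w) \<in> lpow sphere_measure p"
    by (rule lpow_bound[OF assms(2,1), of _ "dist a b"]) (use le in \<open>auto\<close>)
  have "(\<integral>w. norm (cis (a \<bullet> w) * f w - cis (b \<bullet> w) * f w) powr p \<partial>sphere_measure) \<le>
    (\<integral>w. dist a b powr p * norm (f w) powr p \<partial>sphere_measure)"
  proof (rule integral_mono[OF lpow_integrable[OF l]])
    show "integrable sphere_measure (\<lambda>w. dist a b powr p * norm (f w) powr p)"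
      using lpow_integrable[OF assms(2)] by auto
    fix w :: 'a assume "w \<in> space sphere_measure"
    then show "norm (cis (a \<bullet> w) * f w - cis (b \<bullet> w) * f w) powr p \<le> dist a b powr p * norm (f w) powr p"
      using le[of w] assms(1) by (simp only: powr_mult[symmetric]) (intro powr_mono2, auto)
  qed
  also have "\<dots> = dist a b powr p * lnorm sphere_measure p f powr p"
    using assms(1) by (simp add: lnorm_powr)
  also have "\<dots> = (dist a b * lnorm sphere_measure p f) powr p" by (rule powr_mult[symmetric])
  finally show ?thesis using assms(1) by (subst lnorm_le_iff) auto
qed

context extension_exponents
begin

text \<open>Compares the prescribed points x with the unknown centres y. Once the functions
  modulated by y are close to \<phi>, the extension of \<phi> has modulus at least c/2 at x - y, so
  these offsets stay in a compact set. A limit l of offsets makes the functions modulated by x close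
  to cis (l . w) \<phi>.\<close>

lemma modulated_subsequence_close:
  fixes f :: "nat \<Rightarrow> 'a \<Rightarrow> complex" and x :: "nat \<Rightarrow> 'a"
  defines "G \<equiv> \<lambda>n w. cis (x n \<bullet> w) * f n w"
  assumes f: "\<And>n. f n \<in> lpow \<sigma> p" "\<And>n. lnorm \<sigma> p (f n) \<le> 1"
    and conc: "\<And>\<eta> r. 0 < \<eta> \<Longrightarrow> \<eta> < 1 \<Longrightarrow> strict_mono (r :: nat \<Rightarrow> nat) \<Longrightarrow>
      \<exists>s y \<phi>. strict_mono (s :: nat \<Rightarrow> nat) \<and> \<phi> \<in> lpow \<sigma> p \<and> lnorm \<sigma> p \<phi> \<le> 1 \<and> 1 - \<eta> \<le> lnorm \<sigma> p \<phi> \<and>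
        (\<forall>g\<in>lpow \<sigma> p'. (\<lambda>n. \<integral>w. cis (y n \<bullet> w) * f (r (s n)) w * g w \<partial>\<sigma>) \<longlonglongrightarrow> (\<integral>w. \<phi> w * g w \<partial>\<sigma>))"
    and low: "0 < c" "\<forall>\<^sub>F n in sequentially. c \<le> norm (extension_op (f n) (x n))"
    and r: "strict_mono (r :: nat \<Rightarrow> nat)" and "0 < \<epsilon>"
  obtains s where "strict_mono (s :: nat \<Rightarrow> nat)"
    "\<And>m n. lnorm \<sigma> p (\<lambda>w. G (r (s m)) w - G (r (s n)) w) \<le> \<epsilon>"
proof -
  \<comment> \<open>Two functions within 2 e of a common one are within 4 e <= \<epsilon> of each
    other, and e C <= c/2 keeps the extension of \<phi> above c/2 at the offsets.\<close>
  define e where "e = min (\<epsilon> / 4) (c / (2 * (C + 1)))"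
  have C1: "C + 1 > 0" using C_nonneg by simp
  have e: "0 < e" "4 * e \<le> \<epsilon>" "e * C \<le> c / 2"
  proof -
    show "0 < e" "4 * e \<le> \<epsilon>" using \<open>0 < \<epsilon>\<close> low(1) C1 by (auto simp: e_def)
    have "e * C \<le> c / (2 * (C + 1)) * (C + 1)"
      using C_nonneg low(1) by (intro mult_mono) (auto simp: e_def)
    also have "\<dots> = c / 2" using C1 by (simp add: field_simps)
    finally show "e * C \<le> c / 2" .
  qed
  obtain \<eta> where \<eta>: "0 < \<eta>" "\<And>f \<phi>. (\<And>n. f n \<in> lpow \<sigma> p) \<Longrightarrow> (\<And>n. lnorm \<sigma> p (f n) \<le> 1) \<Longrightarrow>
      \<phi> \<in> lpow \<sigma> p \<Longrightarrow> 1 - \<eta> \<le> lnorm \<sigma> p \<phi> \<Longrightarrow> lnorm \<sigma> p \<phi> \<le> 1 \<Longrightarrow>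
      (\<And>g. g \<in> lpow \<sigma> p' \<Longrightarrow> (\<lambda>n. \<integral>x. f n x * g x \<partial>\<sigma>) \<longlonglongrightarrow> (\<integral>x. \<phi> x * g x \<partial>\<sigma>)) \<Longrightarrow>
      \<forall>\<^sub>F n in sequentially. lnorm \<sigma> p (\<lambda>x. f n x - \<phi> x) < e"
    using weak_limit_close[OF pp e(1), where M = \<sigma>] by blast
  have "\<exists>s y \<phi>. strict_mono (s :: nat \<Rightarrow> nat) \<and> \<phi> \<in> lpow \<sigma> p \<and> lnorm \<sigma> p \<phi> \<le> 1 \<and> 1 - min \<eta> (1/2) \<le> lnorm \<sigma> p \<phi> \<and>
        (\<forall>g\<in>lpow \<sigma> p'. (\<lambda>n. \<integral>w. cis (y n \<bullet> w) * f (r (s n)) w * g w \<partial>\<sigma>) \<longlonglongrightarrow> (\<integral>w. \<phi> w * g w \<partial>\<sigma>))"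
    by (rule conc) (use \<eta>(1) r in auto)
  then obtain s y \<phi> where s: "strict_mono (s :: nat \<Rightarrow> nat)" and \<phi>: "\<phi> \<in> lpow \<sigma> p" "lnorm \<sigma> p \<phi> \<le> 1" "1 - min \<eta> (1/2) \<le> lnorm \<sigma> p \<phi>"
    and weak: "\<forall>g\<in>lpow \<sigma> p'. (\<lambda>n. \<integral>w. cis (y n \<bullet> w) * f (r (s n)) w * g w \<partial>\<sigma>) \<longlonglongrightarrow> (\<integral>w. \<phi> w * g w \<partial>\<sigma>)"
    by (elim exE conjE)
  define h where "h = (\<lambda>n w. cis (y n \<bullet> w) * f (r (s n)) w)"
  have h: "h n \<in> lpow \<sigma> p" "lnorm \<sigma> p (h n) \<le> 1" for n
    unfolding h_def using cis_modulate_measurable[OF f(1)] f(2) pp by auto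
  have close: "\<forall>\<^sub>F n in sequentially. lnorm \<sigma> p (\<lambda>w. h n w - \<phi> w) < e"
    by (rule \<eta>(2)[OF h \<phi>(1)]) (use \<phi> weak in \<open>auto simp: h_def\<close>)
  \<comment> \<open>The extension of \<open>h n\<close> at this offset is the extension of the
    original function at the prescribed point, eventually of modulus at least c.\<close>
  define z where "z = (\<lambda>n. x (r (s n)) - y n)"
  have low': "\<forall>\<^sub>F n in sequentially. c \<le> norm (extension_op (f (r (s n))) (x (r (s n))))"
  proof -
    have "filterlim (\<lambda>n. r (s n)) sequentially sequentially"
      using filterlim_subseq[OF strict_mono_o[OF r s]] by (simp add: comp_def)
    from eventually_compose_filterlim[OF low(2) this] show ?thesis .
  qed
  define Z where "Z = {v. c / 2 \<le> norm (extension_op \<phi> v)}"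
  have "bounded Z"
    unfolding Z_def using low(1) extension_Lipschitz_unit[OF \<phi>(1,2)] extension_q1(1)[OF \<phi>(1,2)] q1(1)
    by (intro Lipschitz_lpow_decay[of _ "C + 1" q1]) auto
  then obtain K where K: "compact K" "Z \<subseteq> K"
    by (metis bounded_subset_cball compact_cball)
  have "\<forall>\<^sub>F n in sequentially. z n \<in> K \<and> lnorm \<sigma> p (\<lambda>w. h n w - \<phi> w) < e"
    using close low'
  proof eventually_elim
    case (elim n)
    have "extension_op (h n) (z n) = extension_op (f (r (s n))) (x (r (s n)))"
      unfolding h_def z_def extension_op_modulate by simp
    then have "c \<le> norm (extension_op (h n) (z n))" using elim(2) by simp
    moreover have "norm (extension_op (h n) (z n) - extension_op \<phi> (z n)) \<le> e * C"
    proof -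
      have "norm (extension_op (\<lambda>w. h n w - \<phi> w) (z n)) \<le> e * C"
        using elim(1) by (intro extension_le lpow_diff pp h \<phi>) auto
      then show ?thesis
        by (simp add: extension_op_diff lpow_sphere_integrable[OF pp(1)] h(1) \<phi>(1))
    qed
    ultimately have "c / 2 \<le> norm (extension_op \<phi> (z n))"
      using e(3) norm_triangle_ineq2[of "extension_op (h n) (z n)" "extension_op \<phi> (z n)"] by simp
    then show ?case using elim(1) K(2) by (auto simp: Z_def)
  qed
  then obtain N where N: "\<And>n. N \<le> n \<Longrightarrow> z n \<in> K" "\<And>n. N \<le> n \<Longrightarrow> lnorm \<sigma> p (\<lambda>w. h n w - \<phi> w) < e"
    unfolding eventually_sequentially by blast
  have "\<forall>n. z (n + N) \<in> K" using N(1) by simp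
  from seq_compactE[OF compact_imp_seq_compact[OF K(1)] this]
  obtain l t where t: "strict_mono (t :: nat \<Rightarrow> nat)" "((\<lambda>n. z (n + N)) \<circ> t) \<longlonglongrightarrow> l"
    by metis
  from t(2) obtain N1 where N1: "\<And>n. N1 \<le> n \<Longrightarrow> dist (z (t n + N)) l < e"
    using metric_LIMSEQ_D[OF t(2) e(1)] by auto
  \<comment> \<open>The shifts by N and N1 discard the early terms, so the closeness holds for all m
    and n.\<close>
  define u where "u = (\<lambda>n. t (n + N1) + N)"
  have u: "strict_mono u"
    using t(1) by (auto simp: u_def strict_mono_def)
  have "strict_mono (\<lambda>n. s (u n))" using strict_mono_o[OF s u] by (simp add: comp_def)
  define L where "L = (\<lambda>w. cis (l \<bullet> w) * \<phi> w)"
  have Ll: "L \<in> lpow \<sigma> p" unfolding L_def using cis_modulate_measurable(1)[OF \<phi>(1)] pp by simp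
  have Gl: "G n \<in> lpow \<sigma> p" for n unfolding G_def using cis_modulate_measurable(1)[OF f(1)] pp by simp
  have near: "lnorm \<sigma> p (\<lambda>w. G (r (s (u n))) w - L w) \<le> 2 * e" for n
  proof -
    let ?k = "u n"
    have k: "N \<le> ?k" by (simp add: u_def)
    have "t (n + N1) + N = ?k" by (simp add: u_def)
    then have zk: "dist (z ?k) l < e" using N1[of "n + N1"] by simp
    let ?P = "\<lambda>w. cis (z ?k \<bullet> w) * \<phi> w"
    have Pl: "?P \<in> lpow \<sigma> p" using cis_modulate_measurable(1)[OF \<phi>(1)] pp by simp
    have "lnorm \<sigma> p (\<lambda>w. G (r (s ?k)) w - ?P w) = lnorm \<sigma> p (\<lambda>w. h ?k w - \<phi> w)"
    proof (rule lnorm_cong_norm)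
      fix w
      have "G (r (s ?k)) w = cis (z ?k \<bullet> w) * h ?k w"
        by (simp add: G_def h_def z_def inner_diff_left mult.assoc[symmetric] cis_mult)
      then have "G (r (s ?k)) w - ?P w = cis (z ?k \<bullet> w) * (h ?k w - \<phi> w)" by (simp add: right_diff_distrib)
      then show "norm (G (r (s ?k)) w - ?P w) = norm (h ?k w - \<phi> w)" by (simp add: norm_mult)
    qed
    moreover have "lnorm \<sigma> p (\<lambda>w. ?P w - L w) \<le> dist (z ?k) l * lnorm \<sigma> p \<phi>"
      unfolding L_def using pp by (intro lnorm_modulation_diff_le \<phi>) auto
    moreover have "dist (z ?k) l * lnorm \<sigma> p \<phi> \<le> e * 1"
      using zk \<phi>(2) e(1) by (intro mult_mono) auto
    ultimately show ?thesis
      using lnorm_triangle3[OF pp(1) Gl Pl Ll, of "r (s ?k)"] N(2)[OF k] by linarith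
  qed
  show ?thesis
  proof (rule that[OF \<open>strict_mono (\<lambda>n. s (u n))\<close>])
    fix m n
    have "lnorm \<sigma> p (\<lambda>w. G (r (s (u m))) w - G (r (s (u n))) w) \<le>
      lnorm \<sigma> p (\<lambda>w. G (r (s (u m))) w - L w) + lnorm \<sigma> p (\<lambda>w. L w - G (r (s (u n))) w)"
      by (rule lnorm_triangle3[OF pp(1) Gl Ll Gl])
    also have "\<dots> \<le> 2 * e + 2 * e"
      using near[of m] near[of n] lnorm_minus_commute[of \<sigma> p L] by simp
    finally show "lnorm \<sigma> p (\<lambda>w. G (r (s (u m))) w - G (r (s (u n))) w) \<le> \<epsilon>" using e(2) by linarith
  qed
qed

end

section \<open>Total boundedness and precompactness in L^p\<close>

lemma subsequence_close_imp_totally_bounded: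
  fixes d :: "'b \<Rightarrow> 'b \<Rightarrow> real" and G :: "nat \<Rightarrow> 'b"
  assumes refl: "\<And>x. d x x = 0"
    and sub: "\<And>r e. strict_mono (r :: nat \<Rightarrow> nat) \<Longrightarrow> 0 < e \<Longrightarrow>
      \<exists>s. strict_mono (s :: nat \<Rightarrow> nat) \<and> (\<forall>m n. d (G (r (s m))) (G (r (s n))) \<le> e)"
    and "0 < e"
  shows "\<exists>k. \<forall>n. \<exists>m\<le>k. d (G m) (G n) < e"
proof (rule ccontr)
  assume "\<not> ?thesis"
  then have "\<exists>n. \<forall>m\<le>k. e \<le> d (G m) (G n)" for k by (auto simp: not_less)
  then obtain N where N: "\<And>k m. m \<le> k \<Longrightarrow> e \<le> d (G m) (G (N k))" by metis
  \<comment> \<open>An index n <= k would have to be at distance e from itself, against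
    \<open>refl\<close>.\<close>
  have "\<exists>n>k. \<forall>m\<le>k. e \<le> d (G m) (G n)" for k
  proof (cases "N k > k")
    case False
    then have "e \<le> d (G (N k)) (G (N k))" using N[of "N k" k] by simp
    then show ?thesis using \<open>0 < e\<close> by (simp add: refl)
  qed (use N in blast)
  \<comment> \<open>As no initial segment is an e-net, a later term at distance at least e from all
    earlier ones can always be chosen; the resulting sequence has no subsequence of diameter
    e/2.\<close>
  then obtain next' where nx: "\<And>k. k < next' k" "\<And>k m. m \<le> k \<Longrightarrow> e \<le> d (G m) (G (next' k))" by metis
  define r where "r = (\<lambda>i. (next' ^^ i) 0)"
  have rS: "r (Suc i) = next' (r i)" for i by (simp add: r_def)
  have r: "strict_mono r" unfolding strict_mono_Suc_iff using nx(1) rS by simp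
  have sep: "e \<le> d (G (r i)) (G (r j))" if "i < j" for i j
  proof -
    obtain j' where j': "j = Suc j'" "i \<le> j'" using \<open>i < j\<close> by (cases j) auto
    then have "r i \<le> r j'" using r by (simp add: strict_mono_less_eq)
    then show ?thesis unfolding j'(1) rS by (rule nx(2))
  qed
  obtain s where s: "strict_mono (s :: nat \<Rightarrow> nat)" "\<forall>m n. d (G (r (s m))) (G (r (s n))) \<le> e / 2"
    using sub[OF r, of "e / 2"] \<open>0 < e\<close> by auto
  have "e \<le> d (G (r (s 0))) (G (r (s 1)))" using s(1) by (intro sep) (simp add: strict_mono_def)
  moreover have "d (G (r (s 0))) (G (r (s 1))) \<le> e / 2" using s(2) by blast
  ultimately show False using \<open>0 < e\<close> by simp
qed

text \<open>The seminorm topology need not be Hausdorff, so the metric theory is applied to a set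
  with one function per class. That set is a complete metric space, where total boundedness gives
  compact closure; open covers are carried back because open sets are unions of classes.\<close>

lemma (in finite_measure) precompactin_Lp:
  assumes p: "1 < p" and A: "A \<subseteq> lpow M p"
    and tb: "\<And>e. 0 < e \<Longrightarrow> \<exists>K. finite K \<and> K \<subseteq> A \<and> (\<forall>f\<in>A. \<exists>g\<in>K. lnorm M p (\<lambda>x. g x - f x) < e)"
  shows "precompactin (Lp_topology M (ennreal p)) A"
proof -
  let ?X = "Lp_topology M (ennreal p) :: ('a \<Rightarrow> complex) topology"
  define d where "d = (\<lambda>f g :: 'a \<Rightarrow> complex. lnorm M p (\<lambda>x. f x - g x))"
  have p0: "0 < p" using p by simp
  have LpM: "Lp M (ennreal p) = lpow M p" by (rule Lp_eq_lpow[OF p0])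
  have eLp: "eLp_norm M (ennreal p) (\<lambda>x. g x - f x) = ennreal (d g f)" if "f \<in> lpow M p" "g \<in> lpow M p" for f g
    unfolding d_def by (rule eLp_norm_eq_lnorm[OF p0 lpow_diff[OF p that(2,1)]])
  have d0: "0 \<le> d f g" "d f f = 0" "d f g = d g f" for f g
    unfolding d_def by (simp_all add: lnorm_minus_commute[of M p f g])
  have tri: "d f h \<le> d f g + d g h" if "f \<in> lpow M p" "g \<in> lpow M p" "h \<in> lpow M p" for f g h
    unfolding d_def by (rule lnorm_triangle3[OF p that])
  \<comment> \<open>The predicate under \<open>SOME\<close> is the same for all members of a class,
    so equivalent functions receive the same representative.\<close>
  define rep where "rep = (\<lambda>f. SOME g. g \<in> lpow M p \<and> d f g = 0)"
  define T where "T = rep ` lpow M p"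
  have rep: "rep f \<in> lpow M p" "d f (rep f) = 0" if "f \<in> lpow M p" for f
    using someI[of "\<lambda>g. g \<in> lpow M p \<and> d f g = 0" f] that d0 by (auto simp: rep_def)
  have TM: "T \<subseteq> lpow M p" using rep by (auto simp: T_def)
  have d_rep: "d (rep f) (rep g) = d f g" if "f \<in> lpow M p" "g \<in> lpow M p" for f g
    using tri[of f "rep f" g] tri[of "rep f" "rep g" g] tri[of "rep f" f "rep g"] tri[of f g "rep g"] rep[OF that(1)] rep[OF that(2)] that
      d0(3)[of "rep f" f] d0(3)[of "rep g" g] by linarith
  have rep_eq: "rep f = rep g" if "f \<in> lpow M p" "g \<in> lpow M p" "d f g = 0" for f g
  proof -
    have "(h \<in> lpow M p \<and> d f h = 0) \<longleftrightarrow> (h \<in> lpow M p \<and> d g h = 0)" for h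
      using tri[of f g h] tri[of g f h] that d0(3)[of g f] d0(1)[of f h] d0(1)[of g h] by fastforce
    then show ?thesis by (simp add: rep_def)
  qed
  interpret T: Metric_space T d
  proof
    fix x y assume "x \<in> T" "y \<in> T"
    then obtain a b where ab: "a \<in> lpow M p" "b \<in> lpow M p" "x = rep a" "y = rep b" by (auto simp: T_def)
    show "d x y = 0 \<longleftrightarrow> x = y"
      using ab d_rep[OF ab(1,2)] rep_eq[OF ab(1,2)] d0(2) by auto
  next
    fix x y z assume "x \<in> T" "y \<in> T" "z \<in> T"
    then show "d x z \<le> d x y + d y z" using TM by (intro tri) auto
  qed (use d0 in auto)
  have complete: "T.mcomplete"
    unfolding T.mcomplete_def
  proof (intro allI impI)
    fix u assume u: "T.MCauchy u"
    then have uT: "\<And>n. u n \<in> T" and ul: "\<And>n. u n \<in> lpow M p"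
      using TM by (auto simp: T.MCauchy_def)
    obtain g where g: "g \<in> lpow M p" "(\<lambda>n. lnorm M p (\<lambda>x. u n x - g x)) \<longlonglongrightarrow> 0"
    proof (rule lpow_complete[OF p ul])
      fix e :: real assume "0 < e"
      then obtain N where "\<forall>n n'. N \<le> n \<longrightarrow> N \<le> n' \<longrightarrow> d (u n) (u n') < e"
        using u unfolding T.MCauchy_def by blast
      then show "\<exists>N. \<forall>m\<ge>N. \<forall>n\<ge>N. lnorm M p (\<lambda>x. u m x - u n x) < e"
        unfolding d_def by blast
    qed blast
    have "d (u n) (rep g) = d (u n) g" for n
      using tri[of "u n" g "rep g"] tri[of "u n" "rep g" g] rep[OF g(1)] ul g(1) d0(3)[of g "rep g"] by fastforce
    then have "(\<lambda>n. d (u n) (rep g)) \<longlonglongrightarrow> 0" using g(2) by (simp add: d_def)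
    moreover have "rep g \<in> T" using g(1) by (simp add: T_def)
    ultimately show "\<exists>x. limitin T.mtopology u x sequentially"
      using uT by (auto simp: T.limitin_metric_dist_null)
  qed
  define S where "S = rep ` A"
  have "T.mtotally_bounded S"
    unfolding T.mtotally_bounded_def
  proof (intro allI impI)
    fix e :: real assume "0 < e"
    from tb[OF this] obtain K where K: "finite K" "K \<subseteq> A" "\<forall>f\<in>A. \<exists>g\<in>K. d g f < e"
      unfolding d_def by blast
    have "S \<subseteq> (\<Union>x\<in>rep ` K. T.mball x e)"
    proof
      fix s assume "s \<in> S"
      then obtain f where f: "f \<in> A" "s = rep f" by (auto simp: S_def)
      then obtain g where g: "g \<in> K" "d g f < e" using K(3) by blast
      then have gf: "g \<in> lpow M p" "f \<in> lpow M p" using A K(2) f(1) by auto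
      then have "rep g \<in> T" "rep f \<in> T" by (auto simp: T_def)
      then have "rep f \<in> T.mball (rep g) e"
        using d_rep[OF gf] g(2) by simp
      then show "s \<in> (\<Union>x\<in>rep ` K. T.mball x e)" using f g by blast
    qed
    then show "\<exists>K. finite K \<and> K \<subseteq> S \<and> S \<subseteq> (\<Union>x\<in>K. T.mball x e)"
      using K by (intro exI[of _ "rep ` K"]) (auto simp: S_def)
  qed
  then have comp: "compactin T.mtopology (T.mtopology closure_of S)"
    using T.mtotally_bounded_eq_compact_closure_of[OF complete] by blast
  have sat: "f \<in> U" if U: "openin ?X U" "g \<in> U" "f \<in> lpow M p" "d f g = 0" for U f g
  proof -
    have g: "g \<in> lpow M p" using openin_subset[OF U(1)] U(2) by (auto simp: LpM)
    obtain \<epsilon> where "\<epsilon> > 0" "\<forall>h\<in>Lp M (ennreal p). eLp_norm M (ennreal p) (\<lambda>x. h x - g x) < \<epsilon> \<longrightarrow> h \<in> U"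
      using U(1,2) unfolding openin_Lp_topology by blast
    then show ?thesis using U(3,4) eLp[OF g U(3)] by (auto simp: LpM)
  qed
  have openT: "openin T.mtopology (U \<inter> T)" if U: "openin ?X U" for U
    unfolding T.openin_mtopology
  proof (intro conjI allI impI)
    fix f assume f: "f \<in> U \<inter> T"
    obtain \<epsilon> where \<epsilon>: "\<epsilon> > 0" "\<forall>h\<in>Lp M (ennreal p). eLp_norm M (ennreal p) (\<lambda>x. h x - f x) < \<epsilon> \<longrightarrow> h \<in> U"
      using U f unfolding openin_Lp_topology by blast
    \<comment> \<open>\<open>\<epsilon>\<close> is an extended real and may be infinite; metric
      balls need a positive real below it.\<close>
    obtain e where e: "0 < e" "ennreal e \<le> \<epsilon>"
      using \<epsilon>(1) by (metis ennreal_cases ennreal_eq_0_iff less_eq_real_def less_irrefl linear top_greatest zero_less_one not_le)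
    have "T.mball f e \<subseteq> U \<inter> T"
    proof
      fix h assume h: "h \<in> T.mball f e"
      then have "h \<in> lpow M p" "f \<in> lpow M p" "d h f < e" using TM f d0(3)[of h f] by auto
      then have "eLp_norm M (ennreal p) (\<lambda>x. h x - f x) < \<epsilon>"
      proof -
        have "ennreal (d h f) < ennreal e" using e(1) \<open>d h f < e\<close> by (intro ennreal_lessI) auto
        also have "\<dots> \<le> \<epsilon>" by (rule e(2))
        finally show ?thesis using eLp[OF \<open>f \<in> lpow M p\<close> \<open>h \<in> lpow M p\<close>] by simp
      qed
      then show "h \<in> U \<inter> T" using \<epsilon>(2) h \<open>h \<in> lpow M p\<close> by (auto simp: LpM)
    qed
    then show "\<exists>r>0. T.mball f r \<subseteq> U \<inter> T" using e(1) by blast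
  qed auto
  have ball_open: "openin ?X {g \<in> lpow M p. d g f < r}" if f: "f \<in> lpow M p" for f r
    unfolding openin_Lp_topology
  proof (intro conjI ballI)
    fix g assume g: "g \<in> {g \<in> lpow M p. d g f < r}"
    show "\<exists>\<epsilon>>0. \<forall>h\<in>Lp M (ennreal p). eLp_norm M (ennreal p) (\<lambda>x. h x - g x) < \<epsilon> \<longrightarrow> h \<in> {g \<in> lpow M p. d g f < r}"
    proof (intro exI[of _ "ennreal (r - d g f)"] conjI ballI impI)
      fix h assume h: "h \<in> Lp M (ennreal p)" "eLp_norm M (ennreal p) (\<lambda>x. h x - g x) < ennreal (r - d g f)"
      then have hl: "h \<in> lpow M p" by (simp add: LpM)
      then have "d h g < r - d g f"
        using h(2) eLp[of g h] g d0(1)[of h g] by (simp add: ennreal_less_iff)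
      then show "h \<in> {g \<in> lpow M p. d g f < r}" using tri[of h g f] hl g f by auto
    qed (use g in auto)
  qed (auto simp: LpM)
  show ?thesis
    unfolding precompactin_def compactin_def
  proof (intro conjI allI impI)
    show "A \<subseteq> topspace ?X" using A by (simp add: LpM)
    show "?X closure_of A \<subseteq> topspace ?X" by (rule closure_of_subset_topspace)
    fix \<U> assume U: "Ball \<U> (openin ?X) \<and> ?X closure_of A \<subseteq> \<Union>\<U>"
    have cl1: "t \<in> ?X closure_of A" if "t \<in> T.mtopology closure_of S" for t
      unfolding in_closure_of
    proof (intro conjI allI impI)
      have "t \<in> T" using that by (simp add: in_closure_of)
      then show "t \<in> topspace ?X" using TM by (auto simp: LpM)
      fix V assume V: "t \<in> V \<and> openin ?X V"
      then have "\<exists>y. y \<in> S \<and> y \<in> V \<inter> T"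
        using that openT[of V] \<open>t \<in> T\<close> unfolding in_closure_of by blast
      then obtain a where a: "a \<in> A" "rep a \<in> V" by (auto simp: S_def)
      have "a \<in> V" by (rule sat[of V "rep a"]) (use V a A rep in auto)
      then show "\<exists>y. y \<in> A \<and> y \<in> V" using a by blast
    qed
    have cov: "T.mtopology closure_of S \<subseteq> \<Union>((\<lambda>V. V \<inter> T) ` \<U>)"
    proof
      fix t assume t: "t \<in> T.mtopology closure_of S"
      then have "t \<in> T" by (simp add: in_closure_of)
      moreover have "t \<in> \<Union>\<U>" using cl1[OF t] U by blast
      ultimately show "t \<in> \<Union>((\<lambda>V. V \<inter> T) ` \<U>)" by blast
    qed
    have "\<exists>\<F>. finite \<F> \<and> \<F> \<subseteq> (\<lambda>V. V \<inter> T) ` \<U> \<and> T.mtopology closure_of S \<subseteq> \<Union>\<F>"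
    proof (rule compactinD[OF comp _ cov])
      fix V assume "V \<in> (\<lambda>V. V \<inter> T) ` \<U>"
      then obtain V' where "V' \<in> \<U>" "V = V' \<inter> T" by (rule imageE)
      then show "openin T.mtopology V" using U openT[of V'] by simp
    qed
    then obtain \<F> where \<F>: "finite \<F>" "\<F> \<subseteq> (\<lambda>V. V \<inter> T) ` \<U>" "T.mtopology closure_of S \<subseteq> \<Union>\<F>"
      by (elim exE conjE)
    from finite_subset_image[OF \<F>(1,2)]
    obtain \<G> where \<G>: "\<G> \<subseteq> \<U>" "finite \<G>" "\<F> = (\<lambda>V. V \<inter> T) ` \<G>"
      by (elim exE conjE)
    have "?X closure_of A \<subseteq> \<Union>\<G>"
    proof
      fix f assume f: "f \<in> ?X closure_of A"
      then have fl: "f \<in> lpow M p" using closure_of_subset_topspace[of ?X A] by (auto simp: LpM)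
      have "rep f \<in> T.mtopology closure_of S"
        unfolding T.metric_closure_of
      proof (intro CollectI conjI allI impI)
        show "rep f \<in> T" using fl by (simp add: T_def)
        fix r :: real assume "0 < r"
        have "f \<in> {g \<in> lpow M p. d g f < r}" using fl \<open>0 < r\<close> d0(2)[of f] by simp
        with f ball_open[OF fl, of r] have "\<exists>y. y \<in> A \<and> y \<in> {g \<in> lpow M p. d g f < r}"
          unfolding in_closure_of by (elim conjE allE[where x = "{g \<in> lpow M p. d g f < r}"]) simp
        then obtain a where a: "a \<in> A" "d a f < r" by blast
        then have al: "a \<in> lpow M p" using A by auto
        then have "rep a \<in> T" "rep f \<in> T" using fl by (auto simp: T_def)
        then have "rep a \<in> T.mball (rep f) r"
          using d_rep[OF fl al] a(2) d0(3)[of a f] by simp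
        then show "\<exists>y\<in>S. y \<in> T.mball (rep f) r" using a by (auto simp: S_def)
      qed
      then obtain V where V: "V \<in> \<G>" "rep f \<in> V" using \<F>(3) \<G>(3) by auto
      have "f \<in> V" by (rule sat[of V "rep f"]) (use V \<G> U fl rep in auto)
      then show "f \<in> \<Union>\<G>" using V by blast
    qed
    then show "\<exists>\<F>. finite \<F> \<and> \<F> \<subseteq> \<U> \<and> ?X closure_of A \<subseteq> \<Union>\<F>" using \<G> by blast
  qed
qed

text \<open>Weak lower semicontinuity: testing with the dual function of \<phi> gives a^p <= K
  a^(p-1) for a the norm of \<phi>.\<close>

lemma weak_limit_lnorm_le:
  assumes pq: "1 < p" "1 < q" "1 / p + 1 / q = 1" and f: "\<And>n. f n \<in> lpow M p" "\<And>n. lnorm M p (f n) \<le> K"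
    and \<phi>: "\<phi> \<in> lpow M p"
    and weak: "\<And>g. g \<in> lpow M q \<Longrightarrow> (\<lambda>n. \<integral>x. f n x * g x \<partial>M) \<longlonglongrightarrow> (\<integral>x. \<phi> x * g x \<partial>M)"
  shows "lnorm M p \<phi> \<le> K"
proof -
  define a where "a = lnorm M p \<phi>"
  define g where "g = (\<lambda>x. cnj (\<phi> x) * of_real (norm (\<phi> x) powr (p - 2)))"
  have g: "g \<in> lpow M q" "(\<integral>x. norm (g x) powr q \<partial>M) = (\<integral>x. norm (\<phi> x) powr p \<partial>M)"
    "(\<integral>x. \<phi> x * g x \<partial>M) = of_real (\<integral>x. norm (\<phi> x) powr p \<partial>M)"
    unfolding g_def by (rule lpow_dual[OF pq \<phi>])+
  have ap: "(\<integral>x. norm (\<phi> x) powr p \<partial>M) = a powr p" unfolding a_def using pq by (simp add: lnorm_powr)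
  have "lnorm M q g = a powr (p / q)" unfolding lnorm_def g(2) ap powr_powr by simp
  also have "p / q = p - 1" using pq by (simp add: field_simps)
  finally have ng: "lnorm M q g = a powr (p - 1)" .
  have "(\<lambda>n. norm (\<integral>x. f n x * g x \<partial>M)) \<longlonglongrightarrow> a powr p"
    using tendsto_norm[OF weak[OF g(1)]] by (simp add: g(3) ap)
  moreover have "norm (\<integral>x. f n x * g x \<partial>M) \<le> K * a powr (p - 1)" for n
    using Holder[OF pq f(1) g(1), of n] mult_right_mono[OF f(2), of "lnorm M q g" n] by (simp add: ng)
  ultimately have *: "a powr p \<le> K * a powr (p - 1)"
    by (intro LIMSEQ_le_const2[of "\<lambda>n. norm (\<integral>x. f n x * g x \<partial>M)"]) auto
  show ?thesis
  proof (cases "a = 0")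
    case True
    then show ?thesis using f(2)[of 0] lnorm_nonneg[of M p "f 0"] unfolding a_def by linarith
  next
    case False
    then have "a > 0" using lnorm_nonneg[of M p \<phi>] unfolding a_def by linarith
    then have "a powr p = a * a powr (p - 1)" by (simp add: powr_diff)
    with * \<open>a > 0\<close> show ?thesis by (simp add: a_def)
  qed
qed

text \<open>Common interface for finite and infinite q: \<open>N f\<close> stands for the L^q norm
  of the extension of f as a real number. \<open>concentrate\<close> and \<open>nonvanish\<close>
  are the facts obtained by different means in the two cases.\<close>

locale extremal_extension = extension_exponents dummy p p' q1
  for dummy :: "'a::euclidean_space itself" and p p' q1 :: real +
  fixes N :: "('a \<Rightarrow> complex) \<Rightarrow> real" and S :: real
  assumes S_pos: "0 < S"
    and N_le: "\<And>f. f \<in> lpow \<sigma> p \<Longrightarrow> N f \<le> S * lnorm \<sigma> p f"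
    and N_diff: "\<And>f g. f \<in> lpow \<sigma> p \<Longrightarrow> g \<in> lpow \<sigma> p \<Longrightarrow> N f \<le> N g + S * lnorm \<sigma> p (\<lambda>w. f w - g w)"
    and N_modulate: "\<And>f x. f \<in> lpow \<sigma> p \<Longrightarrow> N (\<lambda>w. cis (x \<bullet> w) * f w) = N f"
    and concentrate: "\<And>f \<eta>. (\<And>n. f n \<in> lpow \<sigma> p) \<Longrightarrow> (\<And>n. lnorm \<sigma> p (f n) \<le> 1) \<Longrightarrow>
      (\<lambda>n. N (f n)) \<longlonglongrightarrow> S \<Longrightarrow> 0 < \<eta> \<Longrightarrow> \<eta> < 1 \<Longrightarrow>
      \<exists>s y \<phi>. strict_mono (s :: nat \<Rightarrow> nat) \<and> \<phi> \<in> lpow \<sigma> p \<and> lnorm \<sigma> p \<phi> \<le> 1 \<and> 1 - \<eta> \<le> lnorm \<sigma> p \<phi> \<and>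
        (\<forall>g\<in>lpow \<sigma> p'. (\<lambda>n. \<integral>w. cis (y n \<bullet> w) * f (s n) w * g w \<partial>\<sigma>) \<longlonglongrightarrow> (\<integral>w. \<phi> w * g w \<partial>\<sigma>))"
    and nonvanish: "\<And>f. (\<And>n. f n \<in> lpow \<sigma> p) \<Longrightarrow> (\<And>n. lnorm \<sigma> p (f n) \<le> 1) \<Longrightarrow> (\<lambda>n. N (f n)) \<longlonglongrightarrow> S \<Longrightarrow>
      \<exists>c>0. \<forall>\<^sub>F n in sequentially. \<exists>x. c \<le> norm (extension_op (f n) x)"
begin

lemma extremizing_subsequence_close:
  assumes f: "\<And>n. f n \<in> lpow \<sigma> p" "\<And>n. lnorm \<sigma> p (f n) \<le> 1" and ext: "(\<lambda>n. N (f n)) \<longlonglongrightarrow> S"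
  obtains x where "\<And>r e. strict_mono (r :: nat \<Rightarrow> nat) \<Longrightarrow> 0 < e \<Longrightarrow> \<exists>s. strict_mono (s :: nat \<Rightarrow> nat) \<and>
    (\<forall>m n. lnorm \<sigma> p (\<lambda>w. cis (x (r (s m)) \<bullet> w) * f (r (s m)) w - cis (x (r (s n)) \<bullet> w) * f (r (s n)) w) \<le> e)"
proof -
  obtain c where c: "0 < c" "\<forall>\<^sub>F n in sequentially. \<exists>x. c \<le> norm (extension_op (f n) x)"
    using nonvanish[of f, OF f ext] by (elim exE conjE)
  \<comment> \<open>Chosen once for the whole sequence, hence independent of subsequences; for the
    finitely many n without such a point the value is arbitrary.\<close>
  define x where "x = (\<lambda>n. SOME x. c \<le> norm (extension_op (f n) x))"
  have cx: "\<forall>\<^sub>F n in sequentially. c \<le> norm (extension_op (f n) (x n))"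
    using c(2) unfolding x_def by eventually_elim (rule someI_ex)
  show ?thesis
  proof (rule that[of x])
    fix r :: "nat \<Rightarrow> nat" and e :: real assume r: "strict_mono r" and "0 < e"
    have conc: "\<exists>s y \<phi>. strict_mono (s :: nat \<Rightarrow> nat) \<and> \<phi> \<in> lpow \<sigma> p \<and> lnorm \<sigma> p \<phi> \<le> 1 \<and> 1 - \<eta> \<le> lnorm \<sigma> p \<phi> \<and>
        (\<forall>g\<in>lpow \<sigma> p'. (\<lambda>n. \<integral>w. cis (y n \<bullet> w) * f (r (s n)) w * g w \<partial>\<sigma>) \<longlonglongrightarrow> (\<integral>w. \<phi> w * g w \<partial>\<sigma>))"
      if "0 < \<eta>" "\<eta> < 1" "strict_mono r" for \<eta> and r :: "nat \<Rightarrow> nat"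
    proof (rule concentrate[of "\<lambda>n. f (r n)", OF f _ that(1,2)])
      show "(\<lambda>n. N (f (r n))) \<longlonglongrightarrow> S" using LIMSEQ_subseq_LIMSEQ[OF ext that(3)] by (simp add: comp_def)
    qed
    obtain s where s: "strict_mono (s :: nat \<Rightarrow> nat)"
      "\<And>m n. lnorm \<sigma> p (\<lambda>w. cis (x (r (s m)) \<bullet> w) * f (r (s m)) w - cis (x (r (s n)) \<bullet> w) * f (r (s n)) w) \<le> e"
      by (rule modulated_subsequence_close[of f, OF f conc c(1) cx r \<open>0 < e\<close>]) (assumption | rule that)+
    show "\<exists>s. strict_mono (s :: nat \<Rightarrow> nat) \<and>
      (\<forall>m n. lnorm \<sigma> p (\<lambda>w. cis (x (r (s m)) \<bullet> w) * f (r (s m)) w - cis (x (r (s n)) \<bullet> w) * f (r (s n)) w) \<le> e)"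
      by (intro exI[of _ s] conjI allI s)
  qed
qed

lemma extremizing_precompact:
  assumes f: "\<And>n. f n \<in> lpow \<sigma> p" "\<And>n. lnorm \<sigma> p (f n) \<le> 1" and ext: "(\<lambda>n. N (f n)) \<longlonglongrightarrow> S"
  shows "\<exists>x. precompactin (Lp_topology \<sigma> (ennreal p)) (range (\<lambda>n w. cis (x n \<bullet> w) * f n w))"
proof -
  obtain x where x: "\<And>r e. strict_mono (r :: nat \<Rightarrow> nat) \<Longrightarrow> 0 < e \<Longrightarrow> \<exists>s. strict_mono (s :: nat \<Rightarrow> nat) \<and>
    (\<forall>m n. lnorm \<sigma> p (\<lambda>w. cis (x (r (s m)) \<bullet> w) * f (r (s m)) w - cis (x (r (s n)) \<bullet> w) * f (r (s n)) w) \<le> e)"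
    by (rule extremizing_subsequence_close[of f, OF f ext]) (rule that)
  define G where "G = (\<lambda>n w. cis (x n \<bullet> w) * f n w)"
  have Gl: "G n \<in> lpow \<sigma> p" for n unfolding G_def using cis_modulate_measurable(1)[OF f(1)] pp by simp
  have "precompactin (Lp_topology \<sigma> (ennreal p)) (range G)"
  proof (rule precompactin_Lp[OF pp(1)])
    show "range G \<subseteq> lpow \<sigma> p" using Gl by auto
    fix e :: real assume "0 < e"
    have "\<exists>k. \<forall>n. \<exists>m\<le>k. lnorm \<sigma> p (\<lambda>w. G m w - G n w) < e"
      by (rule subsequence_close_imp_totally_bounded[of "\<lambda>g h. lnorm \<sigma> p (\<lambda>w. g w - h w)" G])
        (use x \<open>0 < e\<close> in \<open>auto simp: G_def\<close>)
    then obtain k where k: "\<forall>n. \<exists>m\<le>k. lnorm \<sigma> p (\<lambda>w. G m w - G n w) < e" ..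
    then show "\<exists>K. finite K \<and> K \<subseteq> range G \<and> (\<forall>g\<in>range G. \<exists>h\<in>K. lnorm \<sigma> p (\<lambda>w. h w - g w) < e)"
      by (intro exI[of _ "G ` {..k}"]) auto
  qed
  then show ?thesis unfolding G_def by blast
qed

text \<open>Lower semicontinuity, applied to differences, puts the weak limit within e/S of all
  terms of a suitable subsequence. As \<open>N\<close> is Lipschitz with constant S, this gives N
  \<phi> >= S - e for every e, and \<open>N_le\<close> then forces norm 1.\<close>

lemma extremizer_exists:
  assumes f: "\<And>n. f n \<in> lpow \<sigma> p" "\<And>n. lnorm \<sigma> p (f n) \<le> 1" and ext: "(\<lambda>n. N (f n)) \<longlonglongrightarrow> S"
  shows "\<exists>\<phi>\<in>lpow \<sigma> p. lnorm \<sigma> p \<phi> = 1 \<and> N \<phi> = S"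
proof -
  obtain x where x: "\<And>r e. strict_mono (r :: nat \<Rightarrow> nat) \<Longrightarrow> 0 < e \<Longrightarrow> \<exists>s. strict_mono (s :: nat \<Rightarrow> nat) \<and>
    (\<forall>m n. lnorm \<sigma> p (\<lambda>w. cis (x (r (s m)) \<bullet> w) * f (r (s m)) w - cis (x (r (s n)) \<bullet> w) * f (r (s n)) w) \<le> e)"
    by (rule extremizing_subsequence_close[of f, OF f ext]) (rule that)
  define G where "G = (\<lambda>n w. cis (x n \<bullet> w) * f n w)"
  have Gl: "G n \<in> lpow \<sigma> p" "lnorm \<sigma> p (G n) \<le> 1" for n
    unfolding G_def using cis_modulate_measurable[OF f(1)] f(2) pp by auto
  have NG: "N (G n) = N (f n)" for n unfolding G_def by (rule N_modulate[OF f(1)])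
  obtain r \<phi> where r: "strict_mono (r :: nat \<Rightarrow> nat)" and \<phi>: "\<phi> \<in> lpow \<sigma> p" "lnorm \<sigma> p \<phi> \<le> 1"
    and weak: "\<And>g. g \<in> lpow \<sigma> p' \<Longrightarrow> (\<lambda>n. \<integral>w. G (r n) w * g w \<partial>\<sigma>) \<longlonglongrightarrow> (\<integral>w. \<phi> w * g w \<partial>\<sigma>)"
    by (rule weakly_convergent_subsequence[OF pp Gl]) (rule that)
  have "S \<le> N \<phi> + e" if "0 < e" for e
  proof -
    have "0 < e / S" using that S_pos by simp
    from x[OF r this] obtain s where s: "strict_mono (s :: nat \<Rightarrow> nat)"
      "\<forall>m n. lnorm \<sigma> p (\<lambda>w. cis (x (r (s m)) \<bullet> w) * f (r (s m)) w - cis (x (r (s n)) \<bullet> w) * f (r (s n)) w) \<le> e / S"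
      by (elim exE conjE)
    have cl: "lnorm \<sigma> p (\<lambda>w. G (r (s m)) w - G (r (s n)) w) \<le> e / S" for m n
      using s(2) by (simp add: G_def)
    have lim: "lnorm \<sigma> p (\<lambda>w. G (r (s m)) w - \<phi> w) \<le> e / S" for m
    proof (rule weak_limit_lnorm_le[OF pp])
      show "(\<lambda>w. G (r (s m)) w - G (r (s n)) w) \<in> lpow \<sigma> p" for n by (intro lpow_diff pp Gl)
      show "lnorm \<sigma> p (\<lambda>w. G (r (s m)) w - G (r (s n)) w) \<le> e / S" for n by (rule cl)
      show "(\<lambda>w. G (r (s m)) w - \<phi> w) \<in> lpow \<sigma> p" by (intro lpow_diff pp Gl \<phi>)
      fix g assume g: "g \<in> lpow \<sigma> p'"
      have "(\<lambda>n. (\<integral>w. G (r (s m)) w * g w \<partial>\<sigma>) - (\<integral>w. G (r (s n)) w * g w \<partial>\<sigma>)) \<longlonglongrightarrow>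
        (\<integral>w. G (r (s m)) w * g w \<partial>\<sigma>) - (\<integral>w. \<phi> w * g w \<partial>\<sigma>)"
        using LIMSEQ_subseq_LIMSEQ[OF weak[OF g] s(1)] by (intro tendsto_intros) (simp add: comp_def)
      then show "(\<lambda>n. \<integral>w. (G (r (s m)) w - G (r (s n)) w) * g w \<partial>\<sigma>) \<longlonglongrightarrow> (\<integral>w. (G (r (s m)) w - \<phi> w) * g w \<partial>\<sigma>)"
        using lpow_mult_integrable[OF pp Gl(1) g] lpow_mult_integrable[OF pp \<phi>(1) g]
        by (simp add: left_diff_distrib)
    qed
    have "N (f (r (s n))) \<le> N \<phi> + e" for n
    proof -
      have "N (G (r (s n))) \<le> N \<phi> + S * lnorm \<sigma> p (\<lambda>w. G (r (s n)) w - \<phi> w)" by (rule N_diff[OF Gl(1) \<phi>(1)])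
      also have "\<dots> \<le> N \<phi> + S * (e / S)" using lim S_pos by (intro add_left_mono mult_left_mono) auto
      finally show ?thesis using S_pos by (simp add: NG)
    qed
    moreover have "(\<lambda>n. N (f (r (s n)))) \<longlonglongrightarrow> S"
      using LIMSEQ_subseq_LIMSEQ[OF ext strict_mono_o[OF r s(1)]] by (simp add: comp_def)
    ultimately show ?thesis by (intro LIMSEQ_le_const2[of "\<lambda>n. N (f (r (s n)))"]) auto
  qed
  then have "S \<le> N \<phi>" by (rule field_le_epsilon)
  moreover have "N \<phi> \<le> S * lnorm \<sigma> p \<phi>" by (rule N_le[OF \<phi>(1)])
  moreover have "S * lnorm \<sigma> p \<phi> \<le> S * 1" using \<phi>(2) S_pos by (intro mult_left_mono) auto
  ultimately have "N \<phi> = S" "S * lnorm \<sigma> p \<phi> = S * 1" by linarith+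
  then show ?thesis using \<phi>(1) S_pos by auto
qed

end

section \<open>The cases of finite and infinite q\<close>

context extension_exponents
begin

lemma extremal_extension_finite:
  assumes q: "max p p' < q" "q1 < q" and fin: "extension_norm TYPE('a) (ennreal p) (ennreal q) < \<infinity>"
    and S: "S = enn2real (extension_norm TYPE('a) (ennreal p) (ennreal q))" "0 < S"
  shows "extremal_extension p p' q1 (\<lambda>f :: 'a \<Rightarrow> complex. lnorm lborel q (extension_op f)) S"
proof
  have q0: "0 < q" "1 < q" using q pp by auto
  have El: "extension_op f \<in> lpow lborel q" if "f \<in> lpow \<sigma> p" for f :: "'a \<Rightarrow> complex"
    by (rule extension_bound_finite(1)[OF pp(1) q0(1) fin that])
  show bound: "lnorm lborel q (extension_op f) \<le> S * lnorm \<sigma> p f" if "f \<in> lpow \<sigma> p" for f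
    unfolding S(1) by (rule extension_bound_finite(2)[OF pp(1) q0(1) fin that])
  show "lnorm lborel q (extension_op f) \<le> lnorm lborel q (extension_op g) + S * lnorm \<sigma> p (\<lambda>w. f w - g w)"
    if fg: "f \<in> lpow \<sigma> p" "g \<in> lpow \<sigma> p" for f g
  proof -
    have "extension_op (\<lambda>w. f w - g w) = (\<lambda>x. extension_op f x - extension_op g x)"
      using fg by (auto simp: extension_op_diff lpow_sphere_integrable[OF pp(1)])
    then show ?thesis
      using lnorm_diff_triangle[OF q0(2) El[OF fg(1)] El[OF fg(2)]] bound[OF lpow_diff[OF pp(1) fg]] by simp
  qed
  show "lnorm lborel q (extension_op (\<lambda>w. cis (y \<bullet> w) * f w)) = lnorm lborel q (extension_op f)"
    if "f \<in> lpow \<sigma> p" for f and y :: 'a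
  proof -
    have [measurable]: "extension_op f \<in> borel_measurable borel"
      by (rule extension_op_measurable[OF lpow_sphere_integrable[OF pp(1) that]])
    have "(\<integral>x. norm (extension_op f x) powr q \<partial>lborel) = (\<integral>x. norm (extension_op f x) powr q \<partial>distr lborel borel ((+) y))"
      by (simp add: lborel_distr_plus)
    also have "\<dots> = (\<integral>x. norm (extension_op f (y + x)) powr q \<partial>lborel)"
      by (rule integral_distr) auto
    finally show ?thesis by (simp add: lnorm_def extension_op_modulate add.commute)
  qed
  show "0 < S" by (rule S(2))
  fix f :: "nat \<Rightarrow> 'a \<Rightarrow> complex"
  assume f: "\<And>n. f n \<in> lpow \<sigma> p" "\<And>n. lnorm \<sigma> p (f n) \<le> 1" and ext: "(\<lambda>n. lnorm lborel q (extension_op (f n))) \<longlonglongrightarrow> S"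
  show "\<exists>s y \<phi>. strict_mono (s :: nat \<Rightarrow> nat) \<and> \<phi> \<in> lpow \<sigma> p \<and> lnorm \<sigma> p \<phi> \<le> 1 \<and> 1 - \<eta> \<le> lnorm \<sigma> p \<phi> \<and>
        (\<forall>g\<in>lpow \<sigma> p'. (\<lambda>n. \<integral>w. cis (y n \<bullet> w) * f (s n) w * g w \<partial>\<sigma>) \<longlonglongrightarrow> (\<integral>w. \<phi> w * g w \<partial>\<sigma>))"
    if "0 < \<eta>" "\<eta> < 1" for \<eta>
    by (rule concentration[OF q fin f ext S that]) blast
  show "\<exists>c>0. \<forall>\<^sub>F n in sequentially. \<exists>x. c \<le> norm (extension_op (f n) x)"
  proof -
    have gap: "0 < (S / 2) powr q" using S(2) by simp
    \<comment> \<open>An extension bounded by c everywhere has q-th power integral at most c^(q -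
      q1) S1^q1. For small c this excludes an L^q norm above S/2, so the supremum cannot tend to
      0.\<close>
    have "((\<lambda>c. c powr (q - q1) * S1 powr q1) \<longlongrightarrow> 0 powr (q - q1) * S1 powr q1) (at_right 0)"
      using q by (intro tendsto_mult tendsto_powr' tendsto_const tendsto_ident_at) (auto simp: eventually_at_filter)
    then have "\<forall>\<^sub>F c in at_right 0. c powr (q - q1) * S1 powr q1 < (S / 2) powr q"
      using gap by (intro order_tendstoD(2)) auto
    moreover have "\<forall>\<^sub>F c::real in at_right 0. 0 < c"
      using eventually_at_right_real[of 0 "1::real"] by (auto elim: eventually_mono)
    ultimately have "\<forall>\<^sub>F c in at_right 0. c powr (q - q1) * S1 powr q1 < (S / 2) powr q \<and> 0 < c"
      by eventually_elim auto
    then obtain c where c: "c powr (q - q1) * S1 powr q1 < (S / 2) powr q" "0 < c"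
      using eventually_happens by fastforce
    have "\<forall>\<^sub>F n in sequentially. S / 2 < lnorm lborel q (extension_op (f n))"
      using ext S(2) by (intro order_tendstoD(1)) auto
    then have "\<forall>\<^sub>F n in sequentially. \<exists>x. c \<le> norm (extension_op (f n) x)"
    proof eventually_elim
      case (elim n)
      show ?case
      proof (rule ccontr)
        assume "\<not> ?thesis"
        then have lt: "norm (extension_op (f n) x) \<le> c" for x by (meson less_imp_le not_le)
        have "(\<integral>x. norm (extension_op (f n) x) powr q \<partial>lborel) \<le>
          (\<integral>x. c powr (q - q1) * norm (extension_op (f n) x) powr q1 \<partial>lborel)"
        proof (rule integral_mono)
          show "integrable lborel (\<lambda>x. norm (extension_op (f n) x) powr q)" by (rule lpow_integrable[OF El[OF f(1)]])
          show "integrable lborel (\<lambda>x. c powr (q - q1) * norm (extension_op (f n) x) powr q1)"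
            using lpow_integrable[OF extension_q1(1)[OF f]] by auto
          fix x
          have "norm (extension_op (f n) x) powr q =
            norm (extension_op (f n) x) powr (q - q1) * norm (extension_op (f n) x) powr q1"
            by (simp add: powr_add[symmetric])
          also have "\<dots> \<le> c powr (q - q1) * norm (extension_op (f n) x) powr q1"
            using lt q by (intro mult_right_mono powr_mono2) auto
          finally show "norm (extension_op (f n) x) powr q \<le> c powr (q - q1) * norm (extension_op (f n) x) powr q1" .
        qed
        also have "\<dots> = c powr (q - q1) * (\<integral>x. norm (extension_op (f n) x) powr q1 \<partial>lborel)" by simp
        also have "\<dots> \<le> c powr (q - q1) * S1 powr q1" by (intro mult_left_mono extension_q1(2) f) auto
        finally have "(\<integral>x. norm (extension_op (f n) x) powr q \<partial>lborel) \<le> (S / 2) powr q" using c(1) by linarith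
        then have "lnorm lborel q (extension_op (f n)) \<le> S / 2"
          using q0 S(2) by (subst lnorm_le_iff) auto
        with elim show False by simp
      qed
    qed
    with c(2) show ?thesis by blast
  qed
qed

lemma extremal_extension_infinite:
  assumes fin: "extension_norm TYPE('a) (ennreal p) \<infinity> < \<infinity>"
    and S: "S = enn2real (extension_norm TYPE('a) (ennreal p) \<infinity>)" "0 < S"
  shows "extremal_extension p p' q1 (\<lambda>f :: 'a \<Rightarrow> complex. enn2real (eLp_norm lborel \<infinity> (extension_op f))) S"
proof
  let ?N = "\<lambda>f :: 'a \<Rightarrow> complex. enn2real (eLp_norm lborel \<infinity> (extension_op f))"
  have bound: "norm (extension_op f x) \<le> S * lnorm \<sigma> p f" if "f \<in> lpow \<sigma> p" for f x
    unfolding S(1) by (rule extension_bound_infinite[OF pp(1) fin that])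
  have meas: "extension_op f \<in> borel_measurable borel" if "f \<in> lpow \<sigma> p" for f :: "'a \<Rightarrow> complex"
    by (rule extension_op_measurable[OF lpow_sphere_integrable[OF pp(1) that]])
  have le: "eLp_norm lborel \<infinity> (extension_op f) \<le> ennreal (S * lnorm \<sigma> p f)" if "f \<in> lpow \<sigma> p" for f
    by (rule esssup_le_bound[OF meas[OF that] bound[OF that]])
  have eN: "eLp_norm lborel \<infinity> (extension_op f) = ennreal (?N f)" if "f \<in> lpow \<sigma> p" for f
    using le[OF that] by (metis ennreal_enn2real ennreal_less_top le_less_trans)
  have Nge: "norm (extension_op f x) \<le> ?N f" if "f \<in> lpow \<sigma> p" for f x
    using le_esssup_continuous[OF extension_op_continuous[OF lpow_sphere_integrable[OF pp(1) that]], of x] eN[OF that]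
    by (metis ennreal_le_iff enn2real_nonneg)
  have Nle: "?N f \<le> c" if "f \<in> lpow \<sigma> p" "\<And>x. norm (extension_op f x) \<le> c" for f c
  proof -
    have "0 \<le> c" using that(2)[of 0] norm_ge_zero order_trans by blast
    moreover have "ennreal (?N f) \<le> ennreal c"
      using esssup_le_bound[OF meas[OF that(1)] that(2)] eN[OF that(1)] by metis
    ultimately show ?thesis by simp
  qed
  show Nb: "?N f \<le> S * lnorm \<sigma> p f" if "f \<in> lpow \<sigma> p" for f by (rule Nle[OF that bound[OF that]])
  show "?N f \<le> ?N g + S * lnorm \<sigma> p (\<lambda>w. f w - g w)" if fg: "f \<in> lpow \<sigma> p" "g \<in> lpow \<sigma> p" for f g
  proof (rule Nle[OF fg(1)])
    fix x
    have split: "extension_op f x = extension_op g x + extension_op (\<lambda>w. f w - g w) x"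
      using fg by (simp add: extension_op_diff lpow_sphere_integrable[OF pp(1)])
    show "norm (extension_op f x) \<le> ?N g + S * lnorm \<sigma> p (\<lambda>w. f w - g w)"
      unfolding split
      using norm_triangle_ineq[of "extension_op g x" "extension_op (\<lambda>w. f w - g w) x"]
        Nge[OF fg(2), of x] bound[OF lpow_diff[OF pp(1) fg], of x] by linarith
  qed
  show "?N (\<lambda>w. cis (y \<bullet> w) * f w) = ?N f" if f: "f \<in> lpow \<sigma> p" for f and y :: 'a
  proof (rule antisym)
    have fy: "(\<lambda>w. cis (y \<bullet> w) * f w) \<in> lpow \<sigma> p" using cis_modulate_measurable(1)[OF f] pp by simp
    show "?N (\<lambda>w. cis (y \<bullet> w) * f w) \<le> ?N f"
      by (rule Nle[OF fy]) (simp only: extension_op_modulate Nge[OF f])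
    show "?N f \<le> ?N (\<lambda>w. cis (y \<bullet> w) * f w)"
    proof (rule Nle[OF f])
      fix x show "norm (extension_op f x) \<le> ?N (\<lambda>w. cis (y \<bullet> w) * f w)"
        using Nge[OF fy, of "x - y"] by (simp add: extension_op_modulate)
    qed
  qed
  show "0 < S" by (rule S(2))
  fix f :: "nat \<Rightarrow> 'a \<Rightarrow> complex"
  assume f: "\<And>n. f n \<in> lpow \<sigma> p" "\<And>n. lnorm \<sigma> p (f n) \<le> 1" and ext: "(\<lambda>n. ?N (f n)) \<longlonglongrightarrow> S"
  have "\<exists>y. ?N (f n) - inverse (real (Suc n)) < norm (extension_op (f n) y)" for n
  proof (rule ccontr)
    assume "\<not> ?thesis"
    then have "?N (f n) \<le> ?N (f n) - inverse (real (Suc n))" by (intro Nle[OF f(1)]) (auto simp: not_less)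
    then show False by simp
  qed
  then obtain y where y: "\<And>n. ?N (f n) - inverse (real (Suc n)) < norm (extension_op (f n) (y n))" by metis
  show "\<exists>c>0. \<forall>\<^sub>F n in sequentially. \<exists>x. c \<le> norm (extension_op (f n) x)"
  proof (intro exI[of _ "S / 2"] conjI)
    have "(\<lambda>n. ?N (f n) - inverse (real (Suc n))) \<longlonglongrightarrow> S - 0"
      by (intro tendsto_intros ext LIMSEQ_inverse_real_of_nat)
    then have "\<forall>\<^sub>F n in sequentially. S / 2 < ?N (f n) - inverse (real (Suc n))"
      using S(2) by (intro order_tendstoD(1)) auto
    then show "\<forall>\<^sub>F n in sequentially. \<exists>x. S / 2 \<le> norm (extension_op (f n) x)"
    proof eventually_elim
      case (elim n)
      then show ?case using y[of n] by (intro exI[of _ "y n"]) linarith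
    qed
  qed (use S(2) in simp)
  show "\<exists>s y \<phi>. strict_mono (s :: nat \<Rightarrow> nat) \<and> \<phi> \<in> lpow \<sigma> p \<and> lnorm \<sigma> p \<phi> \<le> 1 \<and> 1 - \<eta> \<le> lnorm \<sigma> p \<phi> \<and>
        (\<forall>g\<in>lpow \<sigma> p'. (\<lambda>n. \<integral>w. cis (y n \<bullet> w) * f (s n) w * g w \<partial>\<sigma>) \<longlonglongrightarrow> (\<integral>w. \<phi> w * g w \<partial>\<sigma>))"
    if "0 < \<eta>" "\<eta> < 1" for \<eta>
  proof -
    define h where "h = (\<lambda>n w. cis (y n \<bullet> w) * f n w)"
    have h: "h n \<in> lpow \<sigma> p" "lnorm \<sigma> p (h n) \<le> 1" for n
      unfolding h_def using cis_modulate_measurable[OF f(1)] f(2) pp by auto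
    obtain s \<phi> where s: "strict_mono (s :: nat \<Rightarrow> nat)" and \<phi>: "\<phi> \<in> lpow \<sigma> p" "lnorm \<sigma> p \<phi> \<le> 1"
      and weak: "\<And>g. g \<in> lpow \<sigma> p' \<Longrightarrow> (\<lambda>n. \<integral>w. h (s n) w * g w \<partial>\<sigma>) \<longlonglongrightarrow> (\<integral>w. \<phi> w * g w \<partial>\<sigma>)"
      by (rule weakly_convergent_subsequence[OF pp h]) (rule that)
    \<comment> \<open>The value of an extension at 0 is a pairing with the constant 1, hence passes
      to the weak limit.\<close>
    have "(\<lambda>n. norm (extension_op (h (s n)) 0)) \<longlonglongrightarrow> norm (extension_op \<phi> 0)"
      by (intro tendsto_norm weak_limit_extension[OF pp(2) weak])
    moreover have "(\<lambda>n. ?N (f (s n)) - inverse (real (Suc (s n)))) \<longlonglongrightarrow> S - 0"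
      using LIMSEQ_subseq_LIMSEQ[OF ext s] LIMSEQ_subseq_LIMSEQ[OF LIMSEQ_inverse_real_of_nat s]
      by (intro tendsto_diff) (simp_all add: comp_def)
    moreover have "?N (f (s n)) - inverse (real (Suc (s n))) \<le> norm (extension_op (h (s n)) 0)" for n
      using y[of "s n"] unfolding h_def extension_op_modulate by simp
    ultimately have "S - 0 \<le> norm (extension_op \<phi> 0)" by (intro LIMSEQ_le) auto
    then have "S * 1 \<le> S * lnorm \<sigma> p \<phi>" using bound[OF \<phi>(1), of 0] by linarith
    then have "1 \<le> lnorm \<sigma> p \<phi>" using S(2) by simp
    then show ?thesis
      using s \<phi> weak \<open>0 < \<eta>\<close> unfolding h_def
      by (intro exI[of _ s] exI[of _ "\<lambda>n. y (s n)"] exI[of _ \<phi>]) auto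
  qed
qed

end

section \<open>Extremizing sequences for the extension inequality\<close>

lemma conj_exponent_ennreal:
  assumes "1 < P"
  shows "conj_exponent (ennreal P) = ennreal (P / (P - 1))"
proof -
  have "1 - inverse (ennreal P) = ennreal (1 - inverse P)"
    using assms by (simp add: inverse_ennreal ennreal_minus flip: ennreal_1)
  moreover have "0 < 1 - inverse P" using assms by (simp add: field_simps)
  moreover have "inverse (1 - inverse P) = P / (P - 1)" using assms by (simp add: field_simps)
  ultimately show ?thesis by (simp add: conj_exponent_def inverse_ennreal)
qed

text \<open>The conjugate exponent decreases: P < Q gives Q/(Q - 1) <= P/(P - 1), so (d + 2)/d *
  Q/(Q - 1) < Q, that is Q - 1 > (d + 2)/d.\<close>

lemma exponent_gt_endpoint:
  fixes P Q d :: real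
  assumes "1 < P" "P < Q" "0 < d" "(d + 2) / d * (P / (P - 1)) < Q"
  shows "2 * (d + 1) / d < Q"
proof -
  have "Q / (Q - 1) \<le> P / (P - 1)" using assms by (simp add: field_simps)
  then have "(d + 2) / d * (Q / (Q - 1)) \<le> (d + 2) / d * (P / (P - 1))"
    using assms by (intro mult_left_mono) auto
  also have "\<dots> < Q" by (rule assms(4))
  finally have "Q * ((d + 2) / d) < Q * (Q - 1)" using assms by (simp add: field_simps)
  then have "(d + 2) / d < Q - 1" by (rule mult_left_less_imp_less) (use assms in auto)
  moreover have "(d + 2) / d + 1 = 2 * (d + 1) / d" using assms by (simp add: field_simps)
  ultimately show ?thesis by linarith
qed

text \<open>The conjecture holds by convention up to the endpoint 2 (d + 1)/d and below the line (d
  + 2)/d p'. The assumptions on \<open>s\<close> exclude both alternatives and leave the estimate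
  itself.\<close>

lemma extension_norm_finite_near:
  fixes d :: nat and P :: real and s :: ennreal
  assumes dim: "DIM('a::euclidean_space) = d + 1" "d \<ge> 1" and "1 < P"
    and s: "ennreal P < s" "ennreal ((real d + 2) / real d * (P / (P - 1))) < s"
    and conj: "extension_conjecture_at TYPE('a) (ennreal P) s"
  shows "extension_norm TYPE('a) (ennreal P) s < \<infinity>"
proof -
  have d: "real DIM('a) - 1 = real d" "0 < real d" using dim by auto
  have "\<not> s \<le> ennreal (2 * (real d + 1) / real d)"
  proof
    assume le: "s \<le> ennreal (2 * (real d + 1) / real d)"
    then obtain Q where Q: "s = ennreal Q" "0 \<le> Q"
      by (metis ennreal_cases ennreal_neq_top top_unique)
    have "P < Q" "(real d + 2) / real d * (P / (P - 1)) < Q"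
      using s Q \<open>1 < P\<close> by (auto simp: ennreal_less_iff)
    from exponent_gt_endpoint[OF \<open>1 < P\<close> this(1) d(2) this(2)]
    have "2 * (real d + 1) / real d < Q" .
    moreover have "0 \<le> 2 * (real d + 1) / real d" using d by simp
    then have "Q \<le> 2 * (real d + 1) / real d" using le ennreal_le_iff[of _ Q] unfolding Q(1) by blast
    ultimately show False by linarith
  qed
  moreover have "\<not> s < ennreal ((real d + 2) / real d) * conj_exponent (ennreal P)"
    using s(2) \<open>1 < P\<close> by (simp add: conj_exponent_ennreal ennreal_mult[symmetric] not_less less_imp_le)
  ultimately show ?thesis
    using conj unfolding extension_conjecture_at_def Let_def d by blast
qed

text \<open>The constant 1 is a witness: at the origin its extension is the total mass of the
  sphere, which is positive, and continuity prevents the extension from being null in any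
  L^q.\<close>

lemma extension_norm_pos:
  assumes "DIM('a::euclidean_space) \<ge> 2" "1 < p" and q: "q = \<infinity> \<or> (\<exists>Q>0. q = ennreal Q)"
    and fin: "extension_norm TYPE('a) (ennreal p) q < \<infinity>"
  shows "0 < extension_norm TYPE('a) (ennreal p) q"
proof (rule ccontr)
  interpret finite_measure "sphere_measure :: 'a measure" by (rule finite_sphere_measure)
  assume "\<not> ?thesis"
  then have zero: "extension_norm TYPE('a) (ennreal p) q = 0" by simp
  define g where "g = (\<lambda>w::'a. 1 :: complex)"
  have g: "g \<in> lpow sphere_measure p" by (simp add: g_def)
  have "extension_op g 0 = of_real (measure (sphere_measure :: 'a measure) (sphere 0 1))"
    by (simp add: extension_op_def g_def scaleR_conv_of_real)
  then have pos: "0 < norm (extension_op g 0)" using measure_sphere_measure_pos[OF assms(1)] by simp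
  from q show False
  proof
    assume "q = \<infinity>"
    then show False using extension_bound_infinite[OF assms(2) _ g, of 0] zero pos fin by simp
  next
    assume "\<exists>Q>0. q = ennreal Q"
    then obtain Q where Q: "0 < Q" "q = ennreal Q" by blast
    have E: "extension_op g \<in> lpow lborel Q" "lnorm lborel Q (extension_op g) \<le> 0"
      using extension_bound_finite[OF assms(2) Q(1) _ g] zero fin Q by auto
    define L where "L = (\<integral>w. norm (g w) \<partial>sphere_measure) + 1"
    have L: "0 < L" unfolding L_def by (simp add: add_nonneg_pos)
    have lip: "norm (extension_op g x - extension_op g y) \<le> L * dist x y" for x y
      by (rule order_trans[OF extension_op_Lipschitz[OF lpow_sphere_integrable[OF assms(2) g]]])
        (intro mult_right_mono, auto simp: L_def)
    define \<delta> where "\<delta> = norm (extension_op g 0)"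
    \<comment> \<open>Packing with the single point 0 bounds the L^Q norm from below, since the
      extension is Lipschitz.\<close>
    have "real (card {0::'a}) * (unit_ball_vol (real DIM('a)) * (min (1/2) (\<delta> / (2 * L))) ^ DIM('a) * (\<delta> / 2) powr Q)
      \<le> (\<integral>x. norm (extension_op g x) powr Q \<partial>lborel)"
      using pos by (intro superlevel_packing[OF L lip Q(1) E(1)]) (auto simp: \<delta>_def)
    also have "\<dots> \<le> 0" using E(2) Q(1) by (subst (asm) lnorm_le_iff) auto
    finally have "unit_ball_vol (real DIM('a)) * (min (1/2) (\<delta> / (2 * L))) ^ DIM('a) * (\<delta> / 2) powr Q \<le> 0" by simp
    moreover have "0 < unit_ball_vol (real DIM('a)) * (min (1/2) (\<delta> / (2 * L))) ^ DIM('a) * (\<delta> / 2) powr Q"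
      using pos L by (intro mult_pos_pos zero_less_power) (auto simp: \<delta>_def)
    ultimately show False by linarith
  qed
qed

lemma smooth_on_sphere_measurable:
  assumes "smooth_on_sphere f"
  shows "f \<in> borel_measurable sphere_measure"
proof -
  obtain U g where g: "sphere 0 1 \<subseteq> U" "\<forall>k. Ck_on k U g" "\<forall>w\<in>sphere 0 1. f w = g w"
    using assms unfolding smooth_on_sphere_def by blast
  have "Ck_on 0 U g" using g(2) by blast
  then have "continuous_on (sphere 0 1) g" using g(1) continuous_on_subset by auto
  then have "continuous_on (sphere 0 1) f" using g(3) by (subst continuous_on_cong[OF refl]) auto
  then show ?thesis by (rule continuous_on_sphere_measurable)
qed

text \<open>Provides the sequence from which the extremizer is extracted, by picking near maximisers
  among the smooth functions over which \<open>extension_norm\<close> is taken.\<close>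

lemma smooth_extremizing_sequence:
  fixes N :: "('a::euclidean_space \<Rightarrow> complex) \<Rightarrow> real"
  assumes S: "extension_norm TYPE('a) (ennreal p) q = ennreal S" "0 < S" and p: "1 < p"
    and le: "\<And>f :: 'a \<Rightarrow> complex. f \<in> lpow sphere_measure p \<Longrightarrow> lnorm sphere_measure p f = 1 \<Longrightarrow>
      eLp_norm lborel q (extension_op f) = ennreal (N f)"
    and N0: "\<And>f. 0 \<le> N f"
  obtains f :: "nat \<Rightarrow> 'a \<Rightarrow> complex" where "\<And>n. f n \<in> lpow sphere_measure p"
    "\<And>n. lnorm sphere_measure p (f n) = 1" "(\<lambda>n. N (f n)) \<longlonglongrightarrow> S"
proof -
  define T where "T = {f :: 'a \<Rightarrow> complex. smooth_on_sphere f \<and> eLp_norm sphere_measure (ennreal p) f = 1}"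
  have TS: "extension_norm TYPE('a) (ennreal p) q = (SUP f\<in>T. eLp_norm lborel q (extension_op f))"
    by (simp add: extension_norm_def T_def)
  have Tl: "f \<in> lpow sphere_measure p \<and> lnorm sphere_measure p f = 1" if "f \<in> T" for f
  proof -
    have "f \<in> Lp sphere_measure (ennreal p)"
      using that smooth_on_sphere_measurable by (auto simp: Lp_def T_def)
    then have "f \<in> lpow sphere_measure p" using Lp_eq_lpow[of p "sphere_measure :: 'a measure"] p by simp
    then show ?thesis using eLp_norm_eq_lnorm[of p f sphere_measure] that p by (simp add: T_def)
  qed
  have "\<exists>f\<in>T. S - inverse (real (Suc n)) < N f" for n
  proof (rule ccontr)
    assume "\<not> ?thesis"
    then have le': "N f \<le> S - inverse (real (Suc n))" if "f \<in> T" for f using that by (auto simp: not_less)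
    have "(SUP f\<in>T. eLp_norm lborel q (extension_op f)) \<le> ennreal (S - inverse (real (Suc n)))"
      using le' le Tl by (intro SUP_least) (simp add: ennreal_leI)
    then have "ennreal S \<le> ennreal (S - inverse (real (Suc n)))" using TS S(1) by simp
    moreover have "ennreal (S - inverse (real (Suc n))) < ennreal S" using S(2) by (intro ennreal_lessI) auto
    ultimately show False by simp
  qed
  then obtain f where f: "\<And>n. f n \<in> T" "\<And>n. S - inverse (real (Suc n)) < N (f n)" by metis
  have up: "N (f n) \<le> S" for n
  proof -
    have "eLp_norm lborel q (extension_op (f n)) \<le> ennreal S"
      unfolding S(1)[symmetric] TS by (rule SUP_upper[OF f(1)])
    then show ?thesis using le[of "f n"] Tl[OF f(1)] S(2) N0[of "f n"] by (simp add: ennreal_le_iff)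
  qed
  have "(\<lambda>n. N (f n)) \<longlonglongrightarrow> S"
  proof (rule tendsto_sandwich[OF _ _ _ tendsto_const])
    have "(\<lambda>n. S - inverse (real (Suc n))) \<longlonglongrightarrow> S - 0"
      by (intro tendsto_intros LIMSEQ_inverse_real_of_nat)
    then show "(\<lambda>n. S - inverse (real (Suc n))) \<longlonglongrightarrow> S" by simp
  qed (use f(2) up in \<open>auto intro!: always_eventually less_imp_le\<close>)
  then show ?thesis using that[of f] Tl[OF f(1)] by blast
qed

text \<open>Passage from the real-valued norms back to \<open>ennreal\<close>. The extremizer is not
  almost everywhere zero because its norm is 1.\<close>

lemma extremal_extension_conclusion:
  fixes q :: ennreal
  assumes ext: "extremal_extension p p' q1 (N :: ('a::euclidean_space \<Rightarrow> complex) \<Rightarrow> real) S"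
    and S: "extension_norm TYPE('a) (ennreal p) q = ennreal S" "0 < S"
    and eN: "\<And>f. f \<in> lpow sphere_measure p \<Longrightarrow> eLp_norm lborel q (extension_op f) = ennreal (N f)"
    and N0: "\<And>f. 0 \<le> N f"
  shows "(\<forall>f :: nat \<Rightarrow> 'a \<Rightarrow> complex.
            (\<forall>n. f n \<in> Lp sphere_measure (ennreal p) \<and> eLp_norm sphere_measure (ennreal p) (f n) = 1) \<and>
            extremizing_sequence (ennreal p) q f \<longrightarrow>
            (\<exists>x :: nat \<Rightarrow> 'a.
               precompactin (Lp_topology sphere_measure (ennreal p))
                 (range (\<lambda>n \<omega>. cis (x n \<bullet> \<omega>) * f n \<omega>)))) \<and>
         (\<exists>f :: 'a \<Rightarrow> complex. f \<in> Lp sphere_measure (ennreal p) \<and>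
            \<not> (AE \<omega> in sphere_measure. f \<omega> = 0) \<and>
            eLp_norm lborel q (extension_op f) =
              extension_norm TYPE('a) (ennreal p) q * eLp_norm sphere_measure (ennreal p) f)"
proof -
  interpret extremal_extension "TYPE('a)" p p' q1 N S
    by (rule ext)
  have p0: "0 < p" using pp by simp
  have Lp: "Lp (sphere_measure :: 'a measure) (ennreal p) = lpow sphere_measure p" by (rule Lp_eq_lpow[OF p0])
  show ?thesis
  proof (intro conjI allI impI)
    fix f :: "nat \<Rightarrow> 'a \<Rightarrow> complex"
    assume A: "(\<forall>n. f n \<in> Lp sphere_measure (ennreal p) \<and> eLp_norm sphere_measure (ennreal p) (f n) = 1) \<and>
      extremizing_sequence (ennreal p) q f"
    then have fl: "f n \<in> lpow sphere_measure p" for n using Lp by auto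
    have fn: "lnorm sphere_measure p (f n) \<le> 1" for n
      using A eLp_norm_eq_lnorm[OF p0 fl, of n] by simp
    have "(\<lambda>n. eLp_norm lborel q (extension_op (f n))) \<longlonglongrightarrow> ennreal S"
      using conjunct2[OF A] conjunct1[OF A] unfolding extremizing_sequence_def S(1) by (simp add: divide_ennreal_def)
    then have "(\<lambda>n. N (f n)) \<longlonglongrightarrow> S"
      using tendsto_enn2real[of "\<lambda>n. ennreal (N (f n))" S sequentially] S(2) N0 by (simp add: eN[OF fl])
    from extremizing_precompact[OF fl fn this]
    show "\<exists>x. precompactin (Lp_topology sphere_measure (ennreal p)) (range (\<lambda>n \<omega>. cis (x n \<bullet> \<omega>) * f n \<omega>))" .
  next
    obtain f :: "nat \<Rightarrow> 'a \<Rightarrow> complex" where f: "\<And>n. f n \<in> lpow sphere_measure p"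
      "\<And>n. lnorm sphere_measure p (f n) = 1" "(\<lambda>n. N (f n)) \<longlonglongrightarrow> S"
      by (rule smooth_extremizing_sequence[of p q S N, OF S pp(1) eN N0]) (assumption | rule that)+
    obtain \<phi> where \<phi>: "\<phi> \<in> lpow sphere_measure p" "lnorm sphere_measure p \<phi> = 1"
      "N \<phi> = S"
      using extremizer_exists[of f, OF f(1) eq_refl[OF f(2)] f(3)] by (elim bexE conjE)
    show "\<exists>f :: 'a \<Rightarrow> complex. f \<in> Lp sphere_measure (ennreal p) \<and> \<not> (AE \<omega> in sphere_measure. f \<omega> = 0) \<and>
      eLp_norm lborel q (extension_op f) = extension_norm TYPE('a) (ennreal p) q * eLp_norm sphere_measure (ennreal p) f"
    proof (intro exI[of _ \<phi>] conjI notI)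
      show "\<phi> \<in> Lp sphere_measure (ennreal p)" using \<phi>(1) Lp by simp
      show "eLp_norm lborel q (extension_op \<phi>) = extension_norm TYPE('a) (ennreal p) q * eLp_norm sphere_measure (ennreal p) \<phi>"
        using eN[OF \<phi>(1)] \<phi>(3) eLp_norm_eq_lnorm[OF p0 \<phi>(1)] \<phi>(2) S(1) by simp
      assume ae: "AE \<omega> in sphere_measure. \<phi> \<omega> = 0"
      have "(\<integral>\<omega>. norm (\<phi> \<omega>) powr p \<partial>sphere_measure) = 0"
        by (rule integral_eq_zero_AE) (use ae in \<open>auto elim!: eventually_mono\<close>)
      then show False using \<phi>(2) by (simp add: lnorm_def)
    qed
  qed
qed

theorem theorem1p1:
  fixes d :: nat and p q :: ennreal
  assumes "DIM('a::euclidean_space) = d + 1" and "d \<ge> 1"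
    and "1 \<le> p" and "1 \<le> q"
    and "q > max p (ennreal ((real d + 2) / real d) * conj_exponent p)"
    and "extension_conjecture_near TYPE('a) p q"
  shows "(\<forall>f :: nat \<Rightarrow> 'a \<Rightarrow> complex.
            (\<forall>n. f n \<in> Lp sphere_measure p \<and> eLp_norm sphere_measure p (f n) = 1) \<and>
            extremizing_sequence p q f \<longrightarrow>
            (\<exists>x :: nat \<Rightarrow> 'a.
               precompactin (Lp_topology sphere_measure p)
                 (range (\<lambda>n \<omega>. cis (x n \<bullet> \<omega>) * f n \<omega>)))) \<and>
         (\<exists>f :: 'a \<Rightarrow> complex. f \<in> Lp sphere_measure p \<and>
            \<not> (AE \<omega> in sphere_measure. f \<omega> = 0) \<and>
            eLp_norm lborel q (extension_op f) =
              extension_norm TYPE('a) p q * eLp_norm sphere_measure p f)"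
proof -
  define c where "c = (real d + 2) / real d"
  have c: "1 < c" using assms(2) by (simp add: c_def field_simps)
  have qp: "p < q" and qc: "ennreal c * conj_exponent p < q" using assms(5) by (auto simp: c_def)
  obtain P where P: "p = ennreal P" "1 \<le> P"
  proof -
    have "p < \<infinity>" using qp by (rule less_le_trans) simp
    then obtain P where "p = ennreal P" "0 \<le> P" by (metis ennreal_cases infinity_ennreal_def less_irrefl)
    then show ?thesis using that assms(3) by (simp flip: ennreal_1)
  qed
  have P1: "1 < P"
  proof (rule ccontr)
    assume "\<not> 1 < P"
    then have "p = 1" using P by simp
    then have "conj_exponent p = \<infinity>" by (simp add: conj_exponent_def)
    then show False using qc c by (simp add: ennreal_mult_top)
  qed
  define P' where "P' = P / (P - 1)"
  have P': "1 < P'" "1 / P + 1 / P' = 1" using P1 by (auto simp: P'_def field_simps)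
  have qc': "ennreal (c * P') < q"
    using qc P1 c P'(1) unfolding P(1) conj_exponent_ennreal[OF P1] P'_def[symmetric]
    by (simp add: ennreal_mult)
  \<comment> \<open>Above m both strict inequalities of the hypothesis hold with s in place of q, so
    the estimate holds at every such s with (p, s) in the neighbourhood.\<close>
  define m where "m = max P (c * P')"
  have m: "ennreal m < q" "0 \<le> m" using qp qc' P P1 by (auto simp: m_def max_def)
  have dim2: "DIM('a) \<ge> 2" using assms(1,2) by simp
  obtain U where U: "open U" "(p, q) \<in> U"
    "\<And>r s. (r, s) \<in> U \<Longrightarrow> 1 \<le> r \<Longrightarrow> 1 \<le> s \<Longrightarrow> extension_conjecture_at TYPE('a) r s"
    using assms(6) unfolding extension_conjecture_near_def by blast
  have good: "extension_norm TYPE('a) (ennreal P) s < \<infinity>" if s: "(p, s) \<in> U" "ennreal m < s" for s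
  proof (rule extension_norm_finite_near[OF assms(1,2) P1])
    have "ennreal P \<le> ennreal m" "ennreal (c * P') \<le> ennreal m"
      by (auto simp: m_def intro!: ennreal_leI)
    then show "ennreal P < s" "ennreal ((real d + 2) / real d * (P / (P - 1))) < s"
      using s(2) by (auto simp: c_def P'_def intro: le_less_trans)
    then have "1 \<le> s" using assms(3) P(1) by (metis less_imp_le order_trans)
    then show "extension_conjecture_at TYPE('a) (ennreal P) s"
      using U(3)[OF s(1) assms(3)] by (simp add: P(1))
  qed
  have "open ((\<lambda>s. (p, s)) -` U)"
    by (intro open_vimage U(1) continuous_intros)
  moreover have "q \<in> (\<lambda>s. (p, s)) -` U" using U(2) by simp
  ultimately obtain b where b: "b < q" "{b<..q} \<subseteq> (\<lambda>s. (p, s)) -` U"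
    using open_left m(1) by blast
  \<comment> \<open>Such an s stays in the neighbourhood at the same p and above m; it becomes the
    auxiliary exponent \<open>q1\<close> of the locale.\<close>
  obtain s where s: "max b (ennreal m) < s" "s < q" using dense[of "max b (ennreal m)" q] b(1) m(1) by auto
  then have "s < \<infinity>" using less_le_trans[of s q \<infinity>] by simp
  then obtain Q1 where Q1: "s = ennreal Q1" "0 \<le> Q1" by (metis ennreal_cases infinity_ennreal_def less_irrefl)
  have "s \<in> {b<..q}" using s by auto
  then have sU: "(p, s) \<in> U" using b(2) by blast
  have Q1m: "m < Q1" using s(1) Q1 m(2) by (simp add: ennreal_less_iff)
  interpret extension_exponents "TYPE('a)" P P' Q1
    using P1 P' Q1m m(2) good[OF sU] s(1) by unfold_locales (auto simp: Q1)
  have qfin: "extension_norm TYPE('a) (ennreal P) q < \<infinity>" by (rule good[OF U(2) m(1)])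
  define S where "S = enn2real (extension_norm TYPE('a) (ennreal P) q)"
  have S: "extension_norm TYPE('a) (ennreal P) q = ennreal S" using qfin by (simp add: S_def)
  have q_cases: "q = \<infinity> \<or> (\<exists>Q>0. q = ennreal Q)"
    using m by (cases q rule: ennreal_cases) (auto simp: ennreal_less_iff intro: le_less_trans)
  have S0: "0 < S"
    using extension_norm_pos[OF dim2 P1 q_cases qfin] S by simp
  from q_cases show ?thesis
  proof
    assume q: "q = \<infinity>"
    show ?thesis
      unfolding P(1)
    proof (rule extremal_extension_conclusion[OF _ S S0])
      show "extremal_extension P P' Q1 (\<lambda>f :: 'a \<Rightarrow> complex. enn2real (eLp_norm lborel q (extension_op f))) S"
        using extremal_extension_infinite qfin S_def S0 unfolding q by blast
      fix f :: "'a \<Rightarrow> complex"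
      assume f: "f \<in> lpow sphere_measure P"
      have "eLp_norm lborel q (extension_op f) \<le> ennreal (S * lnorm sphere_measure P f)"
        unfolding q
      proof (rule esssup_le_bound)
        show "extension_op f \<in> borel_measurable borel"
          by (rule extension_op_measurable[OF lpow_sphere_integrable[OF P1 f]])
        show "norm (extension_op f x) \<le> S * lnorm sphere_measure P f" for x
          using extension_bound_infinite[OF P1 _ f] qfin unfolding S_def q by blast
      qed
      then have "eLp_norm lborel q (extension_op f) < \<infinity>" by (rule le_less_trans) simp
      then show "eLp_norm lborel q (extension_op f) = ennreal (enn2real (eLp_norm lborel q (extension_op f)))" by simp
    qed simp
  next
    assume "\<exists>Q>0. q = ennreal Q"
    then obtain Q where Q: "0 < Q" "q = ennreal Q" by blast
    \<comment> \<open>With c > 1 this gives P' <= c P' <= m < Q, half of the gap over max p p' on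
      which concentration relies.\<close>
    have "1 * P' \<le> c * P'" using c P' by (intro mult_right_mono) auto
    moreover have "m < Q" using m Q by (simp add: ennreal_less_iff)
    ultimately have PQ: "max P P' < Q" by (simp add: m_def)
    have "Q1 < Q" using s(2) Q Q1 by (simp add: ennreal_less_iff)
    then have ext: "extremal_extension P P' Q1 (\<lambda>f :: 'a \<Rightarrow> complex. lnorm lborel Q (extension_op f)) S"
      by (rule extremal_extension_finite[OF PQ _ qfin[unfolded Q(2)] S_def[unfolded Q(2)] S0])
    show ?thesis
      unfolding P(1)
      by (rule extremal_extension_conclusion[OF ext S S0])
        (use Q eLp_norm_eq_lnorm[OF Q(1) extension_bound_finite(1)[OF P1 Q(1) qfin[unfolded Q(2)]]] in auto)
  qed
qed

end
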